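(* Let $\mathrm{Syn}_{ps,\infty}$ be the full subcategory of the syntactic category $\mathrm{Syn}(\mathsf{CaTT})$ whose objects are the ps-contexts. Then there is an equivalence of categories $\mathrm{Syn}_{ps,\infty}\simeq\Theta_\infty^{op}$, where $\Theta_\infty$ is the Batanin–Leinster cat-coherator.
   Context: The theory $\mathsf{CaTT}$: raw terms are variables or $\mathrm{coh}^{op}_{\Gamma,A}[\gamma]$, $\mathrm{coh}_{\Gamma,A}[\gamma]$; raw types are $\star$ or $t\to_A u$; contexts are lists $(x_i:A_i)$, substitutions lists $\langle x_i\mapsto t_i\rangle$; $\mathrm{Var}$ denotes free variables ($\mathrm{Var}(\mathrm{coh}^{(op)}_{\Gamma,A}[\gamma])=\mathrm{Var}(\gamma)$) and $\mathrm{Var}(t:A)=\mathrm{Var}t\cup\mathrm{Var}A$. Rules: standard rules for empty context, context extension (fresh variable), $\star$, $t\to_Au$ (from $\Gamma\vdash A$, $\Gamma\vdash t:A$, $\Gamma\vdash u:A$), variables, empty substitution, substitution extension ($\Delta\vdash\gamma:\Gamma$, $(\Gamma,x:A)\vdash$, $\Delta\vdash t:A[\gamma]$ give $\Delta\vdash\langle\gamma,x\mapsto t\rangle:(\Gamma,x:A)$); (op): if $\Gamma\vdash_{ps}$, $\partial^-\Gamma\vdash t:A$, $\partial^+\Gamma\vdash u:A$, $\Delta\vdash\gamma:\Gamma$, $\mathrm{Var}(t:A)=\mathrm{Var}\partial^-\Gamma$, $\mathrm{Var}(u:A)=\mathrm{Var}\partial^+\Gamma$ then $\Delta\vdash\mathrm{coh}^{op}_{\Gamma,t\to_Au}[\gamma]:t[\gamma]\to_{A[\gamma]}u[\gamma]$;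 (coh): if $\Gamma\vdash_{ps}$, $\Gamma\vdash t:A$, $\Gamma\vdash u:A$, $\Delta\vdash\gamma:\Gamma$, $\mathrm{Var}(t:A)=\mathrm{Var}(u:A)=\mathrm{Var}\Gamma$, then $\Delta\vdash\mathrm{coh}_{\Gamma,t\to_Au}[\gamma]:t[\gamma]\to_{A[\gamma]}u[\gamma]$. Ps-contexts are derived by: $(x:\star)\vdash_{ps}x:\star$; $\Gamma\vdash_{ps}f:x\to_Ay$ gives $\Gamma\vdash_{ps}y:A$; $\Gamma\vdash_{ps}x:A$ gives $(\Gamma,y:A,f:x\to_Ay)\vdash_{ps}f:x\to_Ay$ for fresh $y,f$; $\Gamma\vdash_{ps}x:\star$ gives $\Gamma\vdash_{ps}$. For a ps-context with maximal variable dimension $n$ (dimension of $x:A$ is $\dim A+1$, $\dim\star=-1$, $\dim(t\to_Au)=\dim A+1$): if $n=0$ then $\partial^\pm\Gamma=\Gamma$, else $\partial^-\Gamma$ (resp. $\partial^+\Gamma$) removes all variables of dimension $n$ and the variables of dimension $n-1$ that are targets (resp. sources) of variables of dimension $n$. $\mathrm{Syn}(\mathsf{CaTT})$: derivable contexts up to renaming, derivable substitutions as morphisms. $\Theta_\infty$: let $\mathbb G$ be the category of globes ($\sigma_i,\tau_i:i\to i+1$, $\sigma_{i+1}\sigma_i=\tau_{i+1}\sigma_i$, $\sigma_{i+1}\tau_i=\tau_{i+1}\tau_i$). $\Theta_0$ is the full subcategory of globular sets on the pasting schemes, the globular sums $D^{i_1}\amalg_{D^{j_1}}D^{i_2}\amalg\cdots\amalg_{D^{j_{k-1}}}D^{i_k}$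 of representables along iterated $\tau$ and $\sigma$. Globular extensions, globular theories, globular (= in $\Theta_0$) and algebraic arrows (every factorization $f=gf'$ with $g$ globular has $g=\mathrm{id}$), boundary $\sigma_X,\tau_X:\partial X\to X$ of a pasting scheme, admissible pairs (parallel $f,g:D^i\to X$ both algebraic, or $f=\sigma_Xf'$, $g=\tau_Xg'$ with $f',g'$ algebraic) and lifts ($h:D^{i+1}\to X$ with $h\sigma=f$, $h\tau=g$) are as in Grothendieck–Maltsiniotis; $\Theta_{n+1}$ is the universal globular extension of $\Theta_n$ adding lifts for the admissible pairs of $\Theta_n$ not in earlier stages, and $\Theta_\infty=\mathrm{colim}_n\Theta_n$.
   Formalization: Rule (op) is restricted to ps-contexts of dimension > 0, since over (x:⋆) it would duplicate (coh) and give two lifts of (id,id) where Θ_∞ has one; contexts bound in coherences are taken up to renaming; Θ_∞ is any category, in a fixed large enough universe, with its defining universal properties. *)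

theory Defs
  imports Main "HOL-Library.FuncSet"
begin

section \<open>Categories\<close>

record ('o, 'a) cat =
  Obj :: "'o set"
  Arr :: "'a set"
  Dom :: "'a \<Rightarrow> 'o"
  Cod :: "'a \<Rightarrow> 'o"
  Id :: "'o \<Rightarrow> 'a"
  Comp :: "'a \<Rightarrow> 'a \<Rightarrow> 'a"  \<comment> \<open>\<open>Comp C g f\<close> is \<open>g\<close> after \<open>f\<close>\<close>

definition hom :: "('o, 'a) cat \<Rightarrow> 'o \<Rightarrow> 'o \<Rightarrow> 'a set" where
  "hom C X Y = {f \<in> Arr C. Dom C f = X \<and> Cod C f = Y}"

definition category :: "('o, 'a) cat \<Rightarrow> bool" where
  "category C \<longleftrightarrow>
     (\<forall>f\<in>Arr C. Dom C f \<in> Obj C \<and> Cod C f \<in> Obj C) \<and>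
     (\<forall>X\<in>Obj C. Id C X \<in> hom C X X) \<and>
     (\<forall>f\<in>Arr C. \<forall>g\<in>Arr C. Dom C g = Cod C f \<longrightarrow> Comp C g f \<in> hom C (Dom C f) (Cod C g)) \<and>
     (\<forall>f\<in>Arr C. Comp C f (Id C (Dom C f)) = f \<and> Comp C (Id C (Cod C f)) f = f) \<and>
     (\<forall>f\<in>Arr C. \<forall>g\<in>Arr C. \<forall>h\<in>Arr C. Dom C g = Cod C f \<longrightarrow> Dom C h = Cod C g \<longrightarrow>
        Comp C h (Comp C g f) = Comp C (Comp C h g) f)"

definition opposite :: "('o, 'a) cat \<Rightarrow> ('o, 'a) cat" where
  "opposite C = \<lparr>Obj = Obj C, Arr = Arr C, Dom = Cod C, Cod = Dom C, Id = Id C,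
     Comp = (\<lambda>g f. Comp C f g)\<rparr>"

definition full_subcategory :: "('o, 'a) cat \<Rightarrow> 'o set \<Rightarrow> ('o, 'a) cat" where
  "full_subcategory C S = C\<lparr>Obj := Obj C \<inter> S, Arr := {f \<in> Arr C. Dom C f \<in> S \<and> Cod C f \<in> S}\<rparr>"

text \<open>A functor is a pair of total maps; only their values on objects and arrows of the
  source category are relevant, so functors are compared with \<open>functor_eq\<close>.\<close>

type_synonym ('o, 'a, 'p, 'b) func = "('o \<Rightarrow> 'p) \<times> ('a \<Rightarrow> 'b)"

definition is_functor :: "('o, 'a) cat \<Rightarrow> ('p, 'b) cat \<Rightarrow> ('o, 'a, 'p, 'b) func \<Rightarrow> bool" where
  "is_functor C D F \<longleftrightarrow> category C \<and> category D \<and>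
     (\<forall>X\<in>Obj C. fst F X \<in> Obj D \<and> snd F (Id C X) = Id D (fst F X)) \<and>
     (\<forall>f\<in>Arr C. snd F f \<in> hom D (fst F (Dom C f)) (fst F (Cod C f))) \<and>
     (\<forall>f\<in>Arr C. \<forall>g\<in>Arr C. Dom C g = Cod C f \<longrightarrow>
        snd F (Comp C g f) = Comp D (snd F g) (snd F f))"

definition id_functor :: "('o, 'a, 'o, 'a) func" where
  "id_functor = (id, id)"

definition comp_functor ::
    "('p, 'b, 'q, 'c) func \<Rightarrow> ('o, 'a, 'p, 'b) func \<Rightarrow> ('o, 'a, 'q, 'c) func" where
  "comp_functor G F = (fst G \<circ> fst F, snd G \<circ> snd F)"

definition functor_eq ::
    "('o, 'a) cat \<Rightarrow> ('o, 'a, 'p, 'b) func \<Rightarrow> ('o, 'a, 'p, 'b) func \<Rightarrow> bool" where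
  "functor_eq C F G \<longleftrightarrow>
     (\<forall>X\<in>Obj C. fst F X = fst G X) \<and> (\<forall>f\<in>Arr C. snd F f = snd G f)"

definition is_iso :: "('o, 'a) cat \<Rightarrow> 'a \<Rightarrow> bool" where
  "is_iso C f \<longleftrightarrow> f \<in> Arr C \<and>
     (\<exists>g \<in> hom C (Cod C f) (Dom C f).
        Comp C g f = Id C (Dom C f) \<and> Comp C f g = Id C (Cod C f))"

definition naturally_isomorphic ::
    "('o, 'a) cat \<Rightarrow> ('p, 'b) cat \<Rightarrow> ('o, 'a, 'p, 'b) func \<Rightarrow> ('o, 'a, 'p, 'b) func \<Rightarrow> bool" where
  "naturally_isomorphic C D F G \<longleftrightarrow>
     (\<exists>\<eta>. (\<forall>X\<in>Obj C. \<eta> X \<in> hom D (fst F X) (fst G X) \<and> is_iso D (\<eta> X)) \<and>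
          (\<forall>f\<in>Arr C. Comp D (\<eta> (Cod C f)) (snd F f) = Comp D (snd G f) (\<eta> (Dom C f))))"

definition equivalent_categories :: "('o, 'a) cat \<Rightarrow> ('p, 'b) cat \<Rightarrow> bool" where
  "equivalent_categories C D \<longleftrightarrow> category C \<and> category D \<and>
     (\<exists>F G. is_functor C D F \<and> is_functor D C G \<and>
        naturally_isomorphic C C (comp_functor G F) id_functor \<and>
        naturally_isomorphic D D (comp_functor F G) id_functor)"

text \<open>Colimit, in the category of categories, of the sequence of functors \<open>P n\<close> from \<open>C n\<close> to
  \<open>C (Suc n)\<close>. The test categories live in the same types as the colimit.\<close>

definition is_sequential_cocone ::
    "(nat \<Rightarrow> ('o, 'a) cat) \<Rightarrow> (nat \<Rightarrow> ('o, 'a, 'o, 'a) func) \<Rightarrow> ('o, 'a) cat \<Rightarrow>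
     (nat \<Rightarrow> ('o, 'a, 'o, 'a) func) \<Rightarrow> bool" where
  "is_sequential_cocone C P D \<Phi> \<longleftrightarrow>
     (\<forall>n. is_functor (C n) D (\<Phi> n)) \<and>
     (\<forall>n. functor_eq (C n) (comp_functor (\<Phi> (Suc n)) (P n)) (\<Phi> n))"

definition is_sequential_colimit ::
    "(nat \<Rightarrow> ('o, 'a) cat) \<Rightarrow> (nat \<Rightarrow> ('o, 'a, 'o, 'a) func) \<Rightarrow> ('o, 'a) cat \<Rightarrow>
     (nat \<Rightarrow> ('o, 'a, 'o, 'a) func) \<Rightarrow> bool" where
  "is_sequential_colimit C P L \<Phi> \<longleftrightarrow> is_sequential_cocone C P L \<Phi> \<and>
     (\<forall>D \<Psi>. is_sequential_cocone C P D \<Psi> \<longrightarrow>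
        (\<exists>K. is_functor L D K \<and> (\<forall>n. functor_eq (C n) (comp_functor K (\<Phi> n)) (\<Psi> n)) \<and>
           (\<forall>K'. is_functor L D K' \<and> (\<forall>n. functor_eq (C n) (comp_functor K' (\<Phi> n)) (\<Psi> n))
              \<longrightarrow> functor_eq L K' K)))"


section \<open>The type theory CaTT\<close>

datatype ty = Star | Arrow tm ty tm
  \<comment> \<open>\<open>Arrow t A u\<close> is the type of arrows from \<open>t\<close> to \<open>u\<close> over \<open>A\<close>\<close>
and tm = Var nat
  | CohOp "(nat \<times> ty) list" ty "(nat \<times> tm) list"
  | Coh "(nat \<times> ty) list" ty "(nat \<times> tm) list"

text \<open>Contexts and substitutions grow at the right end of the list.\<close>

type_synonym ctx = "(nat \<times> ty) list"
type_synonym sub = "(nat \<times> tm) list"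

fun vars_ty :: "ty \<Rightarrow> nat set" and vars_tm :: "tm \<Rightarrow> nat set" where
  "vars_ty Star = {}"
| "vars_ty (Arrow t A u) = vars_tm t \<union> vars_ty A \<union> vars_tm u"
| "vars_tm (Var x) = {x}"
| "vars_tm (CohOp \<Gamma> A \<gamma>) = (\<Union>(x, t)\<in>set \<gamma>. vars_tm t)"
| "vars_tm (Coh \<Gamma> A \<gamma>) = (\<Union>(x, t)\<in>set \<gamma>. vars_tm t)"

definition vars_typed :: "tm \<Rightarrow> ty \<Rightarrow> nat set" where
  "vars_typed t A = vars_tm t \<union> vars_ty A"

definition vars_ctx :: "ctx \<Rightarrow> nat set" where
  "vars_ctx \<Gamma> = fst ` set \<Gamma>"

fun subst_ty :: "sub \<Rightarrow> ty \<Rightarrow> ty" and subst_tm :: "sub \<Rightarrow> tm \<Rightarrow> tm" where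
  "subst_ty \<delta> Star = Star"
| "subst_ty \<delta> (Arrow t A u) = Arrow (subst_tm \<delta> t) (subst_ty \<delta> A) (subst_tm \<delta> u)"
| "subst_tm \<delta> (Var x) = (case map_of \<delta> x of None \<Rightarrow> Var x | Some t \<Rightarrow> t)"
| "subst_tm \<delta> (CohOp \<Gamma> A \<gamma>) = CohOp \<Gamma> A (map (\<lambda>(x, t). (x, subst_tm \<delta> t)) \<gamma>)"
| "subst_tm \<delta> (Coh \<Gamma> A \<gamma>) = Coh \<Gamma> A (map (\<lambda>(x, t). (x, subst_tm \<delta> t)) \<gamma>)"

definition comp_sub :: "sub \<Rightarrow> sub \<Rightarrow> sub" where
  "comp_sub \<gamma> \<delta> = map (\<lambda>(x, t). (x, subst_tm \<delta> t)) \<gamma>"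

definition id_sub :: "ctx \<Rightarrow> sub" where
  "id_sub \<Gamma> = map (\<lambda>(x, A). (x, Var x)) \<Gamma>"

fun dim_ty :: "ty \<Rightarrow> int" where
  "dim_ty Star = -1"
| "dim_ty (Arrow t A u) = dim_ty A + 1"

definition dim_ctx :: "ctx \<Rightarrow> int" where
  "dim_ctx \<Gamma> = Max ((\<lambda>(x, A). dim_ty A + 1) ` set \<Gamma>)"

inductive ps_at :: "ctx \<Rightarrow> nat \<Rightarrow> ty \<Rightarrow> bool" where
  ps_point: "ps_at [(x, Star)] x Star"
| ps_drop: "ps_at \<Gamma> f (Arrow (Var x) A (Var y)) \<Longrightarrow> ps_at \<Gamma> y A"
| ps_extend: "ps_at \<Gamma> x A \<Longrightarrow> y \<notin> vars_ctx \<Gamma> \<Longrightarrow> f \<notin> vars_ctx \<Gamma> \<Longrightarrow> f \<noteq> y \<Longrightarrow>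
    ps_at (\<Gamma> @ [(y, A), (f, Arrow (Var x) A (Var y))]) f (Arrow (Var x) A (Var y))"

definition ps_ctx :: "ctx \<Rightarrow> bool" where
  "ps_ctx \<Gamma> \<longleftrightarrow> (\<exists>x. ps_at \<Gamma> x Star)"

definition is_target_in :: "ctx \<Rightarrow> int \<Rightarrow> nat \<Rightarrow> bool" where
  "is_target_in \<Gamma> n y \<longleftrightarrow> (\<exists>f t A. (f, Arrow t A (Var y)) \<in> set \<Gamma> \<and> dim_ty (Arrow t A (Var y)) + 1 = n)"

definition is_source_in :: "ctx \<Rightarrow> int \<Rightarrow> nat \<Rightarrow> bool" where
  "is_source_in \<Gamma> n x \<longleftrightarrow> (\<exists>f A u. (f, Arrow (Var x) A u) \<in> set \<Gamma> \<and> dim_ty (Arrow (Var x) A u) + 1 = n)"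

definition src_ctx :: "ctx \<Rightarrow> ctx" where
  "src_ctx \<Gamma> = (let n = dim_ctx \<Gamma> in if n = 0 then \<Gamma> else
     filter (\<lambda>(x, A). dim_ty A + 1 \<noteq> n \<and> \<not> (dim_ty A + 1 = n - 1 \<and> is_target_in \<Gamma> n x)) \<Gamma>)"

definition tgt_ctx :: "ctx \<Rightarrow> ctx" where
  "tgt_ctx \<Gamma> = (let n = dim_ctx \<Gamma> in if n = 0 then \<Gamma> else
     filter (\<lambda>(x, A). dim_ty A + 1 \<noteq> n \<and> \<not> (dim_ty A + 1 = n - 1 \<and> is_source_in \<Gamma> n x)) \<Gamma>)"

text \<open>Contexts are considered up to renaming, both as objects of the syntactic category and when
  they are bound in a coherence term. Since contexts are ordered, every renaming class has exactly
  one member whose variables are numbered \<open>0, 1, 2, \<dots>\<close> from left to right, and this member is used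
  to represent the class.\<close>

definition canonical :: "ctx \<Rightarrow> bool" where
  "canonical \<Gamma> \<longleftrightarrow> map fst \<Gamma> = [0..<length \<Gamma>]"

text \<open>The boundary of the point \<open>(x : Star)\<close> is the point itself, so without the premise
  \<open>dim_ctx \<Gamma> \<noteq> 0\<close> the rule \<open>tm_op\<close> would duplicate every instance of \<open>tm_coh\<close> over the point:
  there would be, for example, two distinct generating terms of type \<open>x \<rightarrow> x\<close>, whereas a coherator
  has a single lift of the pair \<open>(id, id)\<close>. In all other dimensions the two rules exclude each
  other.\<close>

inductive wf_ctx :: "ctx \<Rightarrow> bool"
  and wf_ty :: "ctx \<Rightarrow> ty \<Rightarrow> bool"
  and wf_tm :: "ctx \<Rightarrow> tm \<Rightarrow> ty \<Rightarrow> bool"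
  and wf_sub :: "ctx \<Rightarrow> sub \<Rightarrow> ctx \<Rightarrow> bool"
where
  ctx_empty: "wf_ctx []"
| ctx_extend: "wf_ctx \<Gamma> \<Longrightarrow> wf_ty \<Gamma> A \<Longrightarrow> x \<notin> vars_ctx \<Gamma> \<Longrightarrow> wf_ctx (\<Gamma> @ [(x, A)])"
| ty_star: "wf_ctx \<Gamma> \<Longrightarrow> wf_ty \<Gamma> Star"
| ty_arrow: "wf_ty \<Gamma> A \<Longrightarrow> wf_tm \<Gamma> t A \<Longrightarrow> wf_tm \<Gamma> u A \<Longrightarrow> wf_ty \<Gamma> (Arrow t A u)"
| tm_var: "wf_ctx \<Gamma> \<Longrightarrow> (x, A) \<in> set \<Gamma> \<Longrightarrow> wf_tm \<Gamma> (Var x) A"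
| tm_op: "ps_ctx \<Gamma> \<Longrightarrow> canonical \<Gamma> \<Longrightarrow> dim_ctx \<Gamma> \<noteq> 0 \<Longrightarrow>
    wf_tm (src_ctx \<Gamma>) t A \<Longrightarrow> wf_tm (tgt_ctx \<Gamma>) u A \<Longrightarrow> wf_sub \<Delta> \<gamma> \<Gamma> \<Longrightarrow>
    vars_typed t A = vars_ctx (src_ctx \<Gamma>) \<Longrightarrow> vars_typed u A = vars_ctx (tgt_ctx \<Gamma>) \<Longrightarrow>
    wf_tm \<Delta> (CohOp \<Gamma> (Arrow t A u) \<gamma>) (Arrow (subst_tm \<gamma> t) (subst_ty \<gamma> A) (subst_tm \<gamma> u))"
| tm_coh: "ps_ctx \<Gamma> \<Longrightarrow> canonical \<Gamma> \<Longrightarrow>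
    wf_tm \<Gamma> t A \<Longrightarrow> wf_tm \<Gamma> u A \<Longrightarrow> wf_sub \<Delta> \<gamma> \<Gamma> \<Longrightarrow>
    vars_typed t A = vars_ctx \<Gamma> \<Longrightarrow> vars_typed u A = vars_ctx \<Gamma> \<Longrightarrow>
    wf_tm \<Delta> (Coh \<Gamma> (Arrow t A u) \<gamma>) (Arrow (subst_tm \<gamma> t) (subst_ty \<gamma> A) (subst_tm \<gamma> u))"
| sub_empty: "wf_ctx \<Delta> \<Longrightarrow> wf_sub \<Delta> [] []"
| sub_extend: "wf_sub \<Delta> \<gamma> \<Gamma> \<Longrightarrow> wf_ctx (\<Gamma> @ [(x, A)]) \<Longrightarrow> wf_tm \<Delta> t (subst_ty \<gamma> A) \<Longrightarrow>
    wf_sub \<Delta> (\<gamma> @ [(x, t)]) (\<Gamma> @ [(x, A)])"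

definition Syn :: "(ctx, ctx \<times> sub \<times> ctx) cat" where
  "Syn = \<lparr>Obj = {\<Gamma>. wf_ctx \<Gamma> \<and> canonical \<Gamma>},
     Arr = {(\<Delta>, \<gamma>, \<Gamma>). wf_ctx \<Delta> \<and> canonical \<Delta> \<and> wf_ctx \<Gamma> \<and> canonical \<Gamma> \<and> wf_sub \<Delta> \<gamma> \<Gamma>},
     Dom = (\<lambda>(\<Delta>, \<gamma>, \<Gamma>). \<Delta>),
     Cod = (\<lambda>(\<Delta>, \<gamma>, \<Gamma>). \<Gamma>),
     Id = (\<lambda>\<Gamma>. (\<Gamma>, id_sub \<Gamma>, \<Gamma>)),
     Comp = (\<lambda>(\<Delta>, \<gamma>, \<Gamma>) (\<Xi>, \<delta>, \<Delta>'). (\<Xi>, comp_sub \<gamma> \<delta>, \<Gamma>))\<rparr>"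

definition Syn_ps :: "(ctx, ctx \<times> sub \<times> ctx) cat" where
  "Syn_ps = full_subcategory Syn {\<Gamma>. ps_ctx \<Gamma>}"


section \<open>Globes, globular sets and pasting schemes\<close>

text \<open>By the relations between the generators, a composite of globe maps from \<open>j\<close> to \<open>i\<close>, with
  \<open>j < i\<close>, only depends on whether the innermost generator is a source or a target map. An arrow
  of the category of globes is therefore a triple \<open>(j, l, i)\<close>, where \<open>l\<close> is this innermost
  generator, or \<open>Idn\<close> for the identity if \<open>j = i\<close>.\<close>

datatype side = Src | Tgt | Idn

definition globe_hom :: "nat \<Rightarrow> nat \<Rightarrow> side set" where
  "globe_hom j i = (if j < i then {Src, Tgt} else if j = i then {Idn} else {})"

definition Globe :: "(nat, nat \<times> side \<times> nat) cat" where
  "Globe = \<lparr>Obj = UNIV,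
     Arr = {(j, l, i). l \<in> globe_hom j i},
     Dom = (\<lambda>(j, l, i). j),
     Cod = (\<lambda>(j, l, i). i),
     Id = (\<lambda>i. (i, Idn, i)),
     Comp = (\<lambda>(j', l', i) (k, l, j). (k, (if l = Idn then l' else l), i))\<rparr>"

text \<open>The iterated source (\<open>e = Src\<close>) or target (\<open>e = Tgt\<close>) map from \<open>j\<close> to \<open>i\<close>, for \<open>j \<le> i\<close>.\<close>

definition globe_map :: "side \<Rightarrow> nat \<Rightarrow> nat \<Rightarrow> nat \<times> side \<times> nat" where
  "globe_map e j i = (j, (if j = i then Idn else e), i)"

record 'x gset =
  cells :: "nat \<Rightarrow> 'x set"
  gsrc :: "nat \<Rightarrow> 'x \<Rightarrow> 'x"  \<comment> \<open>\<open>gsrc X n\<close> goes from dimension \<open>Suc n\<close> to dimension \<open>n\<close>\<close>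
  gtgt :: "nat \<Rightarrow> 'x \<Rightarrow> 'x"

definition is_gset :: "'x gset \<Rightarrow> bool" where
  "is_gset X \<longleftrightarrow>
     (\<forall>n. \<forall>x\<in>cells X (Suc n). gsrc X n x \<in> cells X n \<and> gtgt X n x \<in> cells X n) \<and>
     (\<forall>n. \<forall>x\<in>cells X (Suc (Suc n)).
        gsrc X n (gsrc X (Suc n) x) = gsrc X n (gtgt X (Suc n) x) \<and>
        gtgt X n (gsrc X (Suc n) x) = gtgt X n (gtgt X (Suc n) x))"

definition gset_homs :: "'x gset \<Rightarrow> 'x gset \<Rightarrow> (nat \<Rightarrow> 'x \<Rightarrow> 'x) set" where
  "gset_homs X Y = {f.
     (\<forall>n. f n \<in> cells X n \<rightarrow>\<^sub>E cells Y n) \<and>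
     (\<forall>n. \<forall>x\<in>cells X (Suc n).
        f n (gsrc X n x) = gsrc Y n (f (Suc n) x) \<and> f n (gtgt X n x) = gtgt Y n (f (Suc n) x))}"

type_synonym 'x gset_arr = "'x gset \<times> (nat \<Rightarrow> 'x \<Rightarrow> 'x) \<times> 'x gset"

definition GSet :: "('x gset, 'x gset_arr) cat" where
  "GSet = \<lparr>Obj = {X. is_gset X},
     Arr = {(X, f, Y). is_gset X \<and> is_gset Y \<and> f \<in> gset_homs X Y},
     Dom = (\<lambda>(X, f, Y). X),
     Cod = (\<lambda>(X, f, Y). Y),
     Id = (\<lambda>X. (X, (\<lambda>n. restrict id (cells X n)), X)),
     Comp = (\<lambda>(Y', g, Z) (X, f, Y). (X, (\<lambda>n. compose (cells X n) (g n) (f n)), Z))\<rparr>"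

text \<open>The table of dimensions \<open>(i0, [(j0, i1), (j1, i2), \<dots>])\<close> describes the globular sum of the
  globes of dimension \<open>i0, i1, i2, \<dots>\<close>, where the \<open>m\<close>-th and the \<open>Suc m\<close>-th globe are glued along
  a globe of dimension \<open>jm\<close>.\<close>

type_synonym table = "nat \<times> (nat \<times> nat) list"

definition last_index :: "table \<Rightarrow> nat" where
  "last_index T = length (snd T)"

definition summand :: "table \<Rightarrow> nat \<Rightarrow> nat" where
  "summand T m = (case m of 0 \<Rightarrow> fst T | Suc m' \<Rightarrow> snd (snd T ! m'))"

definition glue :: "table \<Rightarrow> nat \<Rightarrow> nat" where
  "glue T m = fst (snd T ! m)"

definition is_table :: "table \<Rightarrow> bool" where
  "is_table T \<longleftrightarrow> (\<forall>m<last_index T. glue T m < summand T m \<and> glue T m < summand T (Suc m))"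

definition dim_table :: "table \<Rightarrow> nat" where
  "dim_table T = Max (summand T ` {..last_index T})"

text \<open>A \<open>k\<close>-cell of the representable globular set on \<open>i\<close> is an element of \<open>globe_hom k i\<close>; all
  its (\<open>Suc k\<close>)-cells have source \<open>Src\<close> and target \<open>Tgt\<close>. The function \<open>push e j i\<close> is
  postcomposition with \<open>globe_map e j i\<close>.\<close>

definition push :: "side \<Rightarrow> nat \<Rightarrow> nat \<Rightarrow> side \<Rightarrow> side" where
  "push e j i l = (if l = Idn \<and> j \<noteq> i then e else l)"

text \<open>The globular sum is computed dimensionwise as a quotient of the disjoint union of the globes:
  the target of each globe is identified with the source of the next one.\<close>

definition sum_cells :: "table \<Rightarrow> nat \<Rightarrow> (nat \<times> side) set" where
  "sum_cells T k = {(m, l). m \<le> last_index T \<and> l \<in> globe_hom k (summand T m)}"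

definition sum_glue :: "table \<Rightarrow> nat \<Rightarrow> ((nat \<times> side) \<times> (nat \<times> side)) set" where
  "sum_glue T k =
     {((m, push Tgt (glue T m) (summand T m) l), (Suc m, push Src (glue T m) (summand T (Suc m)) l))
       | m l. m < last_index T \<and> l \<in> globe_hom k (glue T m)}"

definition sum_rel :: "table \<Rightarrow> nat \<Rightarrow> ((nat \<times> side) \<times> (nat \<times> side)) set" where
  "sum_rel T k = (sum_glue T k \<union> (sum_glue T k)\<inverse>)\<^sup>*"

type_synonym scheme = "(nat \<times> side) set gset"
type_synonym scheme_arr = "(nat \<times> side) set gset_arr"

definition gsum :: "table \<Rightarrow> scheme" where
  "gsum T = \<lparr>cells = (\<lambda>k. sum_cells T k // sum_rel T k),
     gsrc = (\<lambda>k c. sum_rel T k `` ((\<lambda>(m, l). (m, Src)) ` c)),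
     gtgt = (\<lambda>k c. sum_rel T k `` ((\<lambda>(m, l). (m, Tgt)) ` c))\<rparr>"

definition Theta0 :: "(scheme, scheme_arr) cat" where
  "Theta0 = full_subcategory GSet {gsum T | T. is_table T}"

text \<open>The map of globular sums which sends the \<open>m\<close>-th globe of \<open>T\<close> to the \<open>\<phi> m\<close>-th globe of \<open>T'\<close>
  by an iterated source or target map, according to \<open>e\<close>.\<close>

definition sum_map :: "side \<Rightarrow> (nat \<Rightarrow> nat) \<Rightarrow> table \<Rightarrow> table \<Rightarrow> scheme_arr" where
  "sum_map e \<phi> T T' = (gsum T,
     (\<lambda>k. restrict (\<lambda>c. sum_rel T' k ``
        ((\<lambda>(m, l). (\<phi> m, push e (summand T m) (summand T' (\<phi> m)) l)) ` c)) (cells (gsum T) k)),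
     gsum T')"

definition globes0 :: "(nat, nat \<times> side \<times> nat, scheme, scheme_arr) func" where
  "globes0 = ((\<lambda>i. gsum (i, [])), (\<lambda>(j, l, i). sum_map l (\<lambda>m. m) (j, []) (i, [])))"

text \<open>Boundary of a pasting scheme of dimension \<open>n > 0\<close>: the globes of dimension \<open>n\<close> are replaced by
  globes of dimension \<open>n - 1\<close>, and consecutive globes which were glued in dimension \<open>n - 1\<close> are
  thereby merged to a single one. The source inclusion sends a merged globe to the source of the
  first globe of its block, the target inclusion sends it to the target of the last one; globes of
  dimension less than \<open>n\<close> are mapped identically.\<close>

definition bd_table :: "table \<Rightarrow> table" where
  "bd_table T = (let n = dim_table T in
     (min (fst T) (n - 1),
      map (\<lambda>(j, i). (j, min i (n - 1))) (filter (\<lambda>(j, i). j < n - 1) (snd T))))"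

definition block :: "table \<Rightarrow> nat \<Rightarrow> nat" where
  "block T m = card {m'. m' < m \<and> glue T m' < dim_table T - 1}"

definition bd_src :: "table \<Rightarrow> scheme_arr" where
  "bd_src T = sum_map Src (\<lambda>b. LEAST m. m \<le> last_index T \<and> block T m = b) (bd_table T) T"

definition bd_tgt :: "table \<Rightarrow> scheme_arr" where
  "bd_tgt T = sum_map Tgt (\<lambda>b. GREATEST m. m \<le> last_index T \<and> block T m = b) (bd_table T) T"


section \<open>Globular extensions\<close>

type_synonym ('o, 'a) globes = "(nat, nat \<times> side \<times> nat, 'o, 'a) func"

definition is_sum_cocone ::
    "('o, 'a) cat \<Rightarrow> ('o, 'a) globes \<Rightarrow> table \<Rightarrow> 'o \<Rightarrow> (nat \<Rightarrow> 'a) \<Rightarrow> bool" where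
  "is_sum_cocone C G T X \<iota> \<longleftrightarrow> X \<in> Obj C \<and>
     (\<forall>m\<le>last_index T. \<iota> m \<in> hom C (fst G (summand T m)) X) \<and>
     (\<forall>m<last_index T.
        Comp C (\<iota> m) (snd G (globe_map Tgt (glue T m) (summand T m))) =
        Comp C (\<iota> (Suc m)) (snd G (globe_map Src (glue T m) (summand T (Suc m)))))"

definition is_globular_sum ::
    "('o, 'a) cat \<Rightarrow> ('o, 'a) globes \<Rightarrow> table \<Rightarrow> 'o \<Rightarrow> (nat \<Rightarrow> 'a) \<Rightarrow> bool" where
  "is_globular_sum C G T X \<iota> \<longleftrightarrow> is_sum_cocone C G T X \<iota> \<and>
     (\<forall>Y \<kappa>. is_sum_cocone C G T Y \<kappa> \<longrightarrow>
        (\<exists>!h. h \<in> hom C X Y \<and> (\<forall>m\<le>last_index T. Comp C h (\<iota> m) = \<kappa> m)))"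

definition globular_extension :: "('o, 'a) cat \<Rightarrow> ('o, 'a) globes \<Rightarrow> bool" where
  "globular_extension C G \<longleftrightarrow> category C \<and> is_functor Globe C G \<and>
     (\<forall>T. is_table T \<longrightarrow> (\<exists>X \<iota>. is_globular_sum C G T X \<iota>))"

definition globular_functor ::
    "('o, 'a) cat \<Rightarrow> ('o, 'a) globes \<Rightarrow> ('p, 'b) cat \<Rightarrow> ('p, 'b) globes \<Rightarrow>
     ('o, 'a, 'p, 'b) func \<Rightarrow> bool" where
  "globular_functor C G D H F \<longleftrightarrow> is_functor C D F \<and>
     functor_eq Globe (comp_functor F G) H \<and>
     (\<forall>T X \<iota>. is_table T \<longrightarrow> is_globular_sum C G T X \<iota> \<longrightarrow>
        is_globular_sum D H T (fst F X) (\<lambda>m. snd F (\<iota> m)))"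

definition is_lift ::
    "('o, 'a) cat \<Rightarrow> ('o, 'a) globes \<Rightarrow> nat \<Rightarrow> 'a \<Rightarrow> 'a \<Rightarrow> 'a \<Rightarrow> bool" where
  "is_lift C G i f g h \<longleftrightarrow>
     h \<in> hom C (fst G (Suc i)) (Cod C f) \<and>
     Comp C h (snd G (globe_map Src i (Suc i))) = f \<and>
     Comp C h (snd G (globe_map Tgt i (Suc i))) = g"

text \<open>\<open>E\<close> is a set of triples \<open>(i, f, g)\<close> where \<open>f\<close> and \<open>g\<close> are parallel arrows out of the globe of
  dimension \<open>i\<close>, and \<open>L\<close> assigns to each of them the lift that is added in \<open>C'\<close>. The
  test categories live in the same types as \<open>C\<close> and \<open>C'\<close>.\<close>

definition universal_extension ::
    "('o, 'a) cat \<Rightarrow> ('o, 'a) globes \<Rightarrow> (nat \<times> 'a \<times> 'a) set \<Rightarrow>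
     ('o, 'a) cat \<Rightarrow> ('o, 'a) globes \<Rightarrow> ('o, 'a, 'o, 'a) func \<Rightarrow> (nat \<times> 'a \<times> 'a \<Rightarrow> 'a) \<Rightarrow> bool"
where
  "universal_extension C G E C' G' P L \<longleftrightarrow>
     globular_extension C' G' \<and> globular_functor C G C' G' P \<and>
     (\<forall>(i, f, g)\<in>E. is_lift C' G' i (snd P f) (snd P g) (L (i, f, g))) \<and>
     (\<forall>(D :: ('o, 'a) cat) H F M. globular_extension D H \<and> globular_functor C G D H F \<and>
        (\<forall>(i, f, g)\<in>E. is_lift D H i (snd F f) (snd F g) (M (i, f, g))) \<longrightarrow>
        (\<exists>K. globular_functor C' G' D H K \<and> functor_eq C (comp_functor K P) F \<and>
             (\<forall>e\<in>E. snd K (L e) = M e) \<and>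
           (\<forall>K'. globular_functor C' G' D H K' \<and> functor_eq C (comp_functor K' P) F \<and>
             (\<forall>e\<in>E. snd K' (L e) = M e) \<longrightarrow> functor_eq C' K' K)))"


section \<open>The Batanin--Leinster cat-coherator\<close>

text \<open>In the following definitions, \<open>J\<close> is the structure functor from \<open>Theta0\<close> to \<open>C\<close>.\<close>

definition globular_arrow :: "(scheme, scheme_arr, 'o, 'a) func \<Rightarrow> 'a \<Rightarrow> bool" where
  "globular_arrow J g \<longleftrightarrow> g \<in> snd J ` Arr Theta0"

definition algebraic_arrow ::
    "('o, 'a) cat \<Rightarrow> (scheme, scheme_arr, 'o, 'a) func \<Rightarrow> 'a \<Rightarrow> bool" where
  "algebraic_arrow C J f \<longleftrightarrow> f \<in> Arr C \<and>
     (\<forall>g f'. globular_arrow J g \<and> f' \<in> Arr C \<and> Dom C g = Cod C f' \<and> f = Comp C g f' \<longrightarrow>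
        g = Id C (Cod C f))"

definition parallel_arrows ::
    "('o, 'a) cat \<Rightarrow> ('o, 'a) globes \<Rightarrow> nat \<Rightarrow> 'o \<Rightarrow> 'a \<Rightarrow> 'a \<Rightarrow> bool" where
  "parallel_arrows C G i X f g \<longleftrightarrow> f \<in> hom C (fst G i) X \<and> g \<in> hom C (fst G i) X \<and>
     (\<forall>i'. i = Suc i' \<longrightarrow>
        (\<forall>e\<in>{Src, Tgt}. Comp C f (snd G (globe_map e i' i)) = Comp C g (snd G (globe_map e i' i))))"

definition admissible_pairs ::
    "('o, 'a) cat \<Rightarrow> ('o, 'a) globes \<Rightarrow> (scheme, scheme_arr, 'o, 'a) func \<Rightarrow> (nat \<times> 'a \<times> 'a) set"
where
  "admissible_pairs C G J = {(i, f, g). \<exists>T. is_table T \<and> parallel_arrows C G i (fst J (gsum T)) f g \<and>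
     (algebraic_arrow C J f \<and> algebraic_arrow C J g \<or>
      dim_table T > 0 \<and>
      (\<exists>f'\<in>hom C (fst G i) (fst J (gsum (bd_table T))).
       \<exists>g'\<in>hom C (fst G i) (fst J (gsum (bd_table T))).
         algebraic_arrow C J f' \<and> algebraic_arrow C J g' \<and>
         f = Comp C (snd J (bd_src T)) f' \<and> g = Comp C (snd J (bd_tgt T)) g'))}"

text \<open>The composite of \<open>P m, \<dots>, P (m + k - 1)\<close>.\<close>

fun tower_map :: "(nat \<Rightarrow> ('o, 'a, 'o, 'a) func) \<Rightarrow> nat \<Rightarrow> nat \<Rightarrow> ('o, 'a, 'o, 'a) func" where
  "tower_map P m 0 = id_functor"
| "tower_map P m (Suc k) = comp_functor (P (m + k)) (tower_map P m k)"

definition admissible_stage ::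
    "(nat \<Rightarrow> (scheme, scheme_arr) cat) \<Rightarrow> (nat \<Rightarrow> (scheme, scheme_arr) globes) \<Rightarrow>
     (nat \<Rightarrow> (scheme, scheme_arr, scheme, scheme_arr) func) \<Rightarrow> nat \<Rightarrow>
     (nat \<times> scheme_arr \<times> scheme_arr) set" where
  "admissible_stage \<Theta> G P n = admissible_pairs (\<Theta> n) (G n) (tower_map P 0 n)"

definition new_admissible_pairs ::
    "(nat \<Rightarrow> (scheme, scheme_arr) cat) \<Rightarrow> (nat \<Rightarrow> (scheme, scheme_arr) globes) \<Rightarrow>
     (nat \<Rightarrow> (scheme, scheme_arr, scheme, scheme_arr) func) \<Rightarrow> nat \<Rightarrow>
     (nat \<times> scheme_arr \<times> scheme_arr) set" where
  "new_admissible_pairs \<Theta> G P n = admissible_stage \<Theta> G P n -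
     (\<Union>m<n. (\<lambda>(i, f, g). (i, snd (tower_map P m (n - m)) f, snd (tower_map P m (n - m)) g)) `
              admissible_stage \<Theta> G P m)"

text \<open>The coherator is determined by universal properties, hence up to isomorphism. All its stages
  are taken in the types of \<open>Theta0\<close>, which also provide the test categories. This is no
  restriction: the universal extensions and their colimit do not add objects and have countably
  many arrows, whereas \<open>scheme_arr\<close> is uncountable.\<close>

definition batanin_leinster_coherator :: "(scheme, scheme_arr) cat \<Rightarrow> bool" where
  "batanin_leinster_coherator \<Theta>inf \<longleftrightarrow>
     (\<exists>\<Theta> G P L \<Phi>. \<Theta> 0 = Theta0 \<and> G 0 = globes0 \<and>
        (\<forall>n. universal_extension (\<Theta> n) (G n) (new_admissible_pairs \<Theta> G P n)
               (\<Theta> (Suc n)) (G (Suc n)) (P n) (L n)) \<and>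
        is_sequential_colimit \<Theta> P \<Theta>inf \<Phi>)"

end

theory Submission imports Defs "HOL-Library.Countable" begin

text \<open>Tables of dimensions correspond to ps-contexts up to renaming, and maps of pasting schemes to substitutions
 of variables. Say that a substitution has level \<open>n\<close> if the types of coherences are nested in it at most
 \<open>n\<close> deep, and let \<open>S n\<close> be the opposite of the category of ps-contexts and substitutions of level \<open>n\<close>. Arrows
 of \<open>S n\<close> out of the \<open>k\<close>-globe are terms of dimension \<open>k\<close>, and arrows out of a globular sum are families of terms
 which fit together; so \<open>S n\<close> is a globular extension, and \<open>S 0\<close> is isomorphic to \<open>Theta0\<close>.

 An arrow out of a globe is algebraic if and only if the corresponding term, with its type, contains all variables.
 For this one has to see that the support of a term is contained in a proper sub-ps-context as soon as it is not
 everything. Every degenerate map from a pasting scheme to a globe sends the support of a term to cells of which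
 one has greater dimension than all others, as if the term were a composite in a strict \<open>\<omega>\<close>-category.
 If a variable is missing, a suitable map of this kind shows that a variable \<open>z\<close> which is not a face
 is missing together with its source or its target, and these two can be removed from the ps-context.

 Hence the admissible pairs of \<open>S n\<close> are the pairs \<open>(t, u)\<close> for which there is a coherence of type \<open>t \<rightarrow> u\<close>, and
 since the terms of level \<open>Suc n\<close> are freely generated by these coherences, \<open>S (Suc n)\<close> is the universal extension
 of \<open>S n\<close>. By the uniqueness of universal extensions, the stages of the coherator are the \<open>S n\<close>, and the
 coherator is isomorphic to their union, the opposite of the category of ps-contexts.\<close>

text \<open>The obstacle is that the coherence rules speak of free variables, whereas admissibility
  speaks of factorizations. A missing variable does not by itself give a factorization: only the
  removal of a suitable pair of variables, both missing, leaves a ps-context. A degenerate map onto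
  a globe exhibits such a pair, because two different cells of the same greatest dimension cannot
  both occur in the image of a support. The level counts the nesting of types of coherences and not
  that of the terms substituted into them. So each level is closed under substitution and forms a
  category, while a generic coherence has level \<open>Suc n\<close> exactly if its two ends have
  level \<open>n\<close>. Maps of ps-contexts preserve the order of the variables. This rigidity
  makes globular surjections identities, which is what the definition of an algebraic arrow asks
  for. Contexts are numbered canonically, so pasting schemes and ps-contexts correspond one to one.
  All stages are therefore compared by isomorphisms of categories, and no natural transformations
  have to be carried through the tower.\<close>

instance ty :: countable by countable_datatype
instance tm :: countable by countable_datatype

section \<open>Substitution and typing in CaTT\<close>

text \<open>The datatype recurses through lists of pairs. This form of the induction rule treats
  both coherence constructors as one case with a variable constructor \<open>c\<close>, and gives
  the hypothesis for the entries of the substitution as well as for the type.\<close>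

lemma ty_tm_induct [case_names Star Arrow Var Coh]:
 assumes "P Star"
  and "\<And>t A u. Q t \<Longrightarrow> P A \<Longrightarrow> Q u \<Longrightarrow> P (Arrow t A u)"
  and "\<And>x. Q (Var x)"
  and "\<And>c \<Gamma> A \<gamma>. c = Coh \<or> c = CohOp \<Longrightarrow> P A \<Longrightarrow> (\<And>x t. (x, t) \<in> set \<gamma> \<Longrightarrow> Q t) \<Longrightarrow> Q (c \<Gamma> A \<gamma>)"
 shows "P A" and "Q t"
proof (induction A and t rule: ty.induct tm.induct)
 case (CohOp \<Gamma> A \<gamma>)
 thus ?case using assms(4)[of CohOp] by (metis snds.intros snd_conv)
next
 case (Coh \<Gamma> A \<gamma>)
 thus ?case using assms(4)[of Coh] by (metis snds.intros snd_conv)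
qed (use assms in auto)

lemma tm_cases_induct [case_names Var Coh]:
 assumes "\<And>x. Q (Var x)"
  and "\<And>c \<Gamma> A \<gamma>. c = Coh \<or> c = CohOp \<Longrightarrow> (\<And>x t. (x, t) \<in> set \<gamma> \<Longrightarrow> Q t) \<Longrightarrow> Q (c \<Gamma> A \<gamma>)"
 shows "Q t"
 by (rule ty_tm_induct(2)[where P = "\<lambda>_. True"]) (use assms in auto)

text \<open>The value of a substitution at a variable, continued by the identity outside its domain,
  so that substitutions can be compared pointwise.\<close>

definition sv :: "sub \<Rightarrow> nat \<Rightarrow> tm" where
 "sv \<gamma> x = (case map_of \<gamma> x of None \<Rightarrow> Var x | Some t \<Rightarrow> t)"

lemma subst_Var [simp]: "subst_tm \<gamma> (Var x) = sv \<gamma> x"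
 by (simp add: sv_def)

declare subst_tm.simps(1) [simp del]

lemma vars_subst:
 shows "vars_ty (subst_ty \<gamma> A) = (\<Union>x\<in>vars_ty A. vars_tm (sv \<gamma> x))"
  and "vars_tm (subst_tm \<gamma> t) = (\<Union>x\<in>vars_tm t. vars_tm (sv \<gamma> x))"
proof (induction A and t rule: ty_tm_induct)
 case (Coh c \<Gamma> A \<delta>)
 have "vars_tm (subst_tm \<gamma> (c \<Gamma> A \<delta>)) = (\<Union>(x, t)\<in>set \<delta>. vars_tm (subst_tm \<gamma> t))"
  using Coh(1) by (elim disjE) (auto simp: case_prod_beta)
 also have "\<dots> = (\<Union>(x, t)\<in>set \<delta>. \<Union>x\<in>vars_tm t. vars_tm (sv \<gamma> x))"
  using Coh(3) by (intro SUP_cong) auto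
 finally show ?case using Coh(1) by (elim disjE) auto
qed auto

lemma subst_cong:
 shows "(\<And>x. x \<in> vars_ty A \<Longrightarrow> sv \<gamma> x = sv \<delta> x) \<Longrightarrow> subst_ty \<gamma> A = subst_ty \<delta> A"
  and "(\<And>x. x \<in> vars_tm t \<Longrightarrow> sv \<gamma> x = sv \<delta> x) \<Longrightarrow> subst_tm \<gamma> t = subst_tm \<delta> t"
proof (induction A and t rule: ty_tm_induct)
 case (Coh c \<Gamma> A \<theta>)
 have "\<And>x t. (x, t) \<in> set \<theta> \<Longrightarrow> subst_tm \<gamma> t = subst_tm \<delta> t"
  by (rule Coh(3), assumption, rule Coh(4)) (use Coh(1) in \<open>elim disjE; force\<close>)
 thus ?case using Coh(1) by (elim disjE) auto
qed auto

lemma map_of_comp_sub: "map_of (comp_sub \<gamma> \<delta>) x = map_option (subst_tm \<delta>) (map_of \<gamma> x)"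
 unfolding comp_sub_def by (induction \<gamma>) auto

lemma sv_comp_sub: "x \<in> fst ` set \<gamma> \<Longrightarrow> sv (comp_sub \<gamma> \<delta>) x = subst_tm \<delta> (sv \<gamma> x)"
 by (auto simp: sv_def map_of_comp_sub split: option.splits simp: map_of_eq_None_iff)

text \<open>The inclusion of the variables matters: outside the domain of \<open>\<gamma>\<close>
  the left-hand side still applies \<open>\<delta>\<close>, whereas the composite has no entry and
  acts as the identity.\<close>

lemma comp_sub_assoc_subst:
 shows "vars_ty A \<subseteq> fst ` set \<gamma> \<Longrightarrow> subst_ty \<delta> (subst_ty \<gamma> A) = subst_ty (comp_sub \<gamma> \<delta>) A"
  and "vars_tm t \<subseteq> fst ` set \<gamma> \<Longrightarrow> subst_tm \<delta> (subst_tm \<gamma> t) = subst_tm (comp_sub \<gamma> \<delta>) t"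
proof (induction A and t rule: ty_tm_induct)
 case (Coh c \<Gamma> A \<theta>)
 have "\<And>x t. (x, t) \<in> set \<theta> \<Longrightarrow> subst_tm \<delta> (subst_tm \<gamma> t) = subst_tm (comp_sub \<gamma> \<delta>) t"
  by (rule Coh(3), assumption) (use Coh(1,4) in \<open>elim disjE; force\<close>)
 thus ?case using Coh(1) by (elim disjE) auto
qed (auto simp: sv_comp_sub)

lemma comp_sub_assoc:
 assumes "\<And>x t. (x, t) \<in> set \<gamma> \<Longrightarrow> vars_tm t \<subseteq> fst ` set \<delta>"
 shows "comp_sub (comp_sub \<gamma> \<delta>) \<theta> = comp_sub \<gamma> (comp_sub \<delta> \<theta>)"
 using assms comp_sub_assoc_subst(2) by (auto simp: comp_sub_def[of \<gamma>] comp_sub_def[of "map _ _"])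

lemma sv_id_sub [simp]: "sv (id_sub \<Gamma>) x = Var x"
proof -
 have "map_of (id_sub \<Gamma>) x = None \<or> map_of (id_sub \<Gamma>) x = Some (Var x)"
  unfolding id_sub_def by (induction \<Gamma>) auto
 thus ?thesis by (auto simp: sv_def)
qed

lemma subst_id_sub [simp]:
 shows "subst_ty (id_sub \<Gamma>) A = A" and "subst_tm (id_sub \<Gamma>) t = t"
proof (induction A and t rule: ty_tm_induct)
 case (Coh c \<Gamma> A \<theta>) thus ?case by (auto intro!: map_idI)
qed auto

lemma comp_sub_id [simp]: "comp_sub \<gamma> (id_sub \<Delta>) = \<gamma>"
 by (auto simp: comp_sub_def intro!: map_idI)

lemma sv_in: "distinct (map fst \<gamma>) \<Longrightarrow> (x, t) \<in> set \<gamma> \<Longrightarrow> sv \<gamma> x = t"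
 by (simp add: sv_def)

lemma id_comp_sub:
 assumes "distinct (map fst \<gamma>)" "map fst \<gamma> = map fst \<Gamma>"
 shows "comp_sub (id_sub \<Gamma>) \<gamma> = \<gamma>"
proof (rule nth_equalityI)
 have l: "length \<gamma> = length \<Gamma>" using assms(2) map_eq_imp_length_eq by blast
 thus "length (comp_sub (id_sub \<Gamma>) \<gamma>) = length \<gamma>" by (simp add: comp_sub_def id_sub_def)
 fix i assume "i < length (comp_sub (id_sub \<Gamma>) \<gamma>)"
 hence i: "i < length \<gamma>" "i < length \<Gamma>" using l by (auto simp: comp_sub_def id_sub_def)
 have "sv \<gamma> (fst (\<gamma> ! i)) = snd (\<gamma> ! i)" using assms(1) i by (intro sv_in) auto
 moreover have "fst (\<gamma> ! i) = fst (\<Gamma> ! i)" using assms(2) i by (metis nth_map)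
 ultimately show "comp_sub (id_sub \<Gamma>) \<gamma> ! i = \<gamma> ! i"
  using i by (auto simp: comp_sub_def id_sub_def case_prod_beta prod_eq_iff)
qed

lemma sub_eqI:
 assumes "map fst \<gamma> = map fst \<delta>" "distinct (map fst \<gamma>)" "\<And>x. x \<in> fst ` set \<gamma> \<Longrightarrow> sv \<gamma> x = sv \<delta> x"
 shows "\<gamma> = \<delta>"
proof (rule nth_equalityI)
 show l: "length \<gamma> = length \<delta>" using assms(1) map_eq_imp_length_eq by blast
 fix i assume i: "i < length \<gamma>"
 have f: "fst (\<gamma> ! i) = fst (\<delta> ! i)" using assms(1) i l by (metis nth_map)
 have "sv \<gamma> (fst (\<gamma> ! i)) = snd (\<gamma> ! i)" using assms(2) i by (intro sv_in) auto
 moreover have "sv \<delta> (fst (\<delta> ! i)) = snd (\<delta> ! i)" using assms(1,2) i l by (intro sv_in) auto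
 moreover have "fst (\<gamma> ! i) \<in> fst ` set \<gamma>" using i by simp
 ultimately show "\<gamma> ! i = \<delta> ! i" using assms(3) f by (metis prod_eqI)
qed

section \<open>Metatheory of the typing rules: weakening, substitution, strengthening\<close>

lemma wf_ctx_of:
 shows "wf_ctx \<Gamma> \<Longrightarrow> True" and "wf_ty \<Gamma> A \<Longrightarrow> wf_ctx \<Gamma>" and "wf_tm \<Gamma> t A \<Longrightarrow> wf_ctx \<Gamma>"
  and "wf_sub \<Delta> \<gamma> \<Gamma> \<Longrightarrow> wf_ctx \<Delta> \<and> wf_ctx \<Gamma> \<and> map fst \<gamma> = map fst \<Gamma>"
 by (induction rule: wf_ctx_wf_ty_wf_tm_wf_sub.inducts) (auto intro: ctx_empty)

lemma wf_ctx_distinct: "wf_ctx \<Gamma> \<Longrightarrow> distinct (map fst \<Gamma>)"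
proof (induction \<Gamma> rule: rev_induct)
 case (snoc p \<Gamma>)
 from snoc.prems have "wf_ctx \<Gamma> \<and> fst p \<notin> vars_ctx \<Gamma>" by (cases rule: wf_ctx.cases) auto
 with snoc.IH show ?case by (auto simp: vars_ctx_def)
qed auto

lemma wf_sub_dom: "wf_sub \<Delta> \<gamma> \<Gamma> \<Longrightarrow> map fst \<gamma> = map fst \<Gamma>"
 and wf_sub_dom_set: "wf_sub \<Delta> \<gamma> \<Gamma> \<Longrightarrow> fst ` set \<gamma> = vars_ctx \<Gamma>"
 and wf_sub_distinct: "wf_sub \<Delta> \<gamma> \<Gamma> \<Longrightarrow> distinct (map fst \<gamma>)"
proof -
 assume "wf_sub \<Delta> \<gamma> \<Gamma>"
 thus 1: "map fst \<gamma> = map fst \<Gamma>" by (simp add: wf_ctx_of)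
 thus "fst ` set \<gamma> = vars_ctx \<Gamma>" by (metis list.set_map vars_ctx_def)
 show "distinct (map fst \<gamma>)" using \<open>wf_sub \<Delta> \<gamma> \<Gamma>\<close> 1 wf_ctx_distinct wf_ctx_of(4) by simp
qed

lemma src_ctx_subset: "set (src_ctx \<Gamma>) \<subseteq> set \<Gamma>"
 and tgt_ctx_subset: "set (tgt_ctx \<Gamma>) \<subseteq> set \<Gamma>"
 by (auto simp: src_ctx_def tgt_ctx_def Let_def)

lemma vars_ctx_mono: "set \<Gamma> \<subseteq> set \<Delta> \<Longrightarrow> vars_ctx \<Gamma> \<subseteq> vars_ctx \<Delta>"
 by (auto simp: vars_ctx_def)

lemma wf_vars:
 shows "wf_ctx \<Gamma> \<Longrightarrow> True"
  and "wf_ty \<Gamma> A \<Longrightarrow> vars_ty A \<subseteq> vars_ctx \<Gamma>" and "wf_tm \<Gamma> t A \<Longrightarrow> vars_tm t \<subseteq> vars_ctx \<Gamma>"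
  and "wf_sub \<Delta> \<gamma> \<Gamma> \<Longrightarrow> \<forall>(x, t)\<in>set \<gamma>. vars_tm t \<subseteq> vars_ctx \<Delta>"
proof (induction rule: wf_ctx_wf_ty_wf_tm_wf_sub.inducts)
 case (tm_var \<Gamma> x A) thus ?case by (force simp: vars_ctx_def)
qed (auto simp: vars_ctx_def)

text \<open>A judgement uses its context only through membership of entries, so inclusion of sets is
  enough. In this form it applies to the boundaries of a ps-context, which are not initial
  segments.\<close>

lemma weakening:
 shows "wf_ctx \<Gamma> \<Longrightarrow> True"
  and "wf_ty \<Gamma> A \<Longrightarrow> wf_ctx \<Gamma>' \<Longrightarrow> set \<Gamma> \<subseteq> set \<Gamma>' \<Longrightarrow> wf_ty \<Gamma>' A"
  and "wf_tm \<Gamma> t A \<Longrightarrow> wf_ctx \<Gamma>' \<Longrightarrow> set \<Gamma> \<subseteq> set \<Gamma>' \<Longrightarrow> wf_tm \<Gamma>' t A"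
  and "wf_sub \<Gamma> \<gamma> \<Delta> \<Longrightarrow> wf_ctx \<Gamma>' \<Longrightarrow> set \<Gamma> \<subseteq> set \<Gamma>' \<Longrightarrow> wf_sub \<Gamma>' \<gamma> \<Delta>"
 by (induction arbitrary: and \<Gamma>' and \<Gamma>' and \<Gamma>' rule: wf_ctx_wf_ty_wf_tm_wf_sub.inducts)
  (auto intro: wf_ctx_wf_ty_wf_tm_wf_sub.intros)

lemma wf_ctx_ty: "wf_ctx \<Gamma> \<Longrightarrow> (x, A) \<in> set \<Gamma> \<Longrightarrow> wf_ty \<Gamma> A"
proof (induction \<Gamma> rule: rev_induct)
 case (snoc p \<Gamma>)
 from snoc.prems(1) have *: "wf_ctx \<Gamma>" "wf_ty \<Gamma> (snd p)" by (cases rule: wf_ctx.cases; auto)+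
 show ?case
 proof (cases "(x, A) \<in> set \<Gamma>")
  case True
  thus ?thesis using snoc * weakening(2)[of \<Gamma> A "\<Gamma> @ [p]"] by auto
 next
  case False
  hence "A = snd p" using snoc.prems by auto
  thus ?thesis using snoc * weakening(2)[of \<Gamma> A "\<Gamma> @ [p]"] by auto
 qed
qed auto

lemma sv_append: "x \<in> fst ` set \<gamma> \<Longrightarrow> sv (\<gamma> @ \<delta>) x = sv \<gamma> x"
 unfolding sv_def
 by (auto simp: map_add_def map_of_eq_None_iff split: option.splits)

lemma wf_sub_sv:
 "wf_sub \<Delta> \<gamma> \<Gamma> \<Longrightarrow> (x, A) \<in> set \<Gamma> \<Longrightarrow> wf_tm \<Delta> (sv \<gamma> x) (subst_ty \<gamma> A)"
proof (induction \<Gamma> arbitrary: \<gamma> rule: rev_induct)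
 case (snoc p \<Gamma>)
 from snoc.prems(1) obtain \<gamma>' y B t where *: "\<gamma> = \<gamma>' @ [(y, t)]" "p = (y, B)" "wf_sub \<Delta> \<gamma>' \<Gamma>"
  "wf_ctx (\<Gamma> @ [(y, B)])" "wf_tm \<Delta> t (subst_ty \<gamma>' B)" by (cases rule: wf_sub.cases) auto
 have w: "wf_ctx \<Gamma>" "wf_ty \<Gamma> B" "y \<notin> vars_ctx \<Gamma>" using *(4) by (cases rule: wf_ctx.cases; auto)+
 have ext: "subst_ty \<gamma> C = subst_ty \<gamma>' C" if "vars_ty C \<subseteq> vars_ctx \<Gamma>" for C
  using that wf_sub_dom_set[OF *(3)] *(1) by (intro subst_cong(1)) (auto simp: sv_append)
 show ?case
 proof (cases "(x, A) \<in> set \<Gamma>")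
  case True
  hence "x \<in> fst ` set \<gamma>'" using wf_sub_dom_set[OF *(3)] by (force simp: vars_ctx_def)
  hence "sv \<gamma> x = sv \<gamma>' x" using *(1) sv_append by simp
  thus ?thesis using snoc.IH[OF *(3) True] ext wf_vars(2) wf_ctx_ty[OF w(1) True] by simp
 next
  case False
  hence p: "x = y" "A = B" using snoc.prems *(2) by auto
  have "sv \<gamma> x = t" using wf_sub_distinct[OF snoc.prems(1)] *(1) p by (intro sv_in) auto
  thus ?thesis using p *(5) ext wf_vars(2) w(2) by simp
 qed
qed auto

lemma wf_sub_in: "wf_sub \<Delta> \<gamma> \<Gamma> \<Longrightarrow> x \<in> vars_ctx \<Gamma> \<Longrightarrow> (x, sv \<gamma> x) \<in> set \<gamma>"
 using wf_sub_dom_set[of \<Delta> \<gamma> \<Gamma>] wf_sub_distinct[of \<Delta> \<gamma> \<Gamma>] by (metis (no_types, lifting) imageE prod.collapse sv_in)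

lemma subst_comp_wf:
 assumes "wf_sub \<Delta> \<gamma> \<Gamma>"
 shows "wf_ty \<Gamma> A \<Longrightarrow> subst_ty \<delta> (subst_ty \<gamma> A) = subst_ty (comp_sub \<gamma> \<delta>) A"
  and "wf_tm \<Gamma> t B \<Longrightarrow> subst_tm \<delta> (subst_tm \<gamma> t) = subst_tm (comp_sub \<gamma> \<delta>) t"
 using comp_sub_assoc_subst wf_sub_dom_set[OF assms] wf_vars(2,3) by auto

lemma wf_coh_body:
 assumes "wf_sub \<Delta> \<gamma> \<Gamma>" "wf_tm (src_ctx \<Gamma>) t A \<or> wf_tm (tgt_ctx \<Gamma>) t A \<or> wf_tm \<Gamma> t A"
 shows "wf_tm \<Gamma> t A"
 using assms weakening(3) src_ctx_subset tgt_ctx_subset wf_ctx_of(4) by blast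

text \<open>In the two coherence cases the body lives in its own context and stays untouched; only
  the attached substitution is composed. The resulting types agree because the variables of the body
  lie in the domain of that substitution.\<close>

lemma substitution:
 shows "wf_ctx \<Gamma> \<Longrightarrow> True"
  and "wf_ty \<Gamma> A \<Longrightarrow> wf_sub \<Delta> \<delta> \<Gamma> \<Longrightarrow> wf_ty \<Delta> (subst_ty \<delta> A)"
  and "wf_tm \<Gamma> t A \<Longrightarrow> wf_sub \<Delta> \<delta> \<Gamma> \<Longrightarrow> wf_tm \<Delta> (subst_tm \<delta> t) (subst_ty \<delta> A)"
  and "wf_sub \<Gamma> \<gamma> \<Xi> \<Longrightarrow> wf_sub \<Delta> \<delta> \<Gamma> \<Longrightarrow> wf_sub \<Delta> (comp_sub \<gamma> \<delta>) \<Xi>"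
proof (induction arbitrary: and \<Delta> \<delta> and \<Delta> \<delta> and \<Delta> \<delta> rule: wf_ctx_wf_ty_wf_tm_wf_sub.inducts)
 case (ty_star \<Gamma>)
 thus ?case using wf_ctx_of(4) by (auto intro: wf_ctx_wf_ty_wf_tm_wf_sub.ty_star)
next
 case (tm_var \<Gamma> x A)
 thus ?case using wf_sub_sv by auto
next
 case (tm_op \<Gamma> t A u \<Xi> \<gamma>)
 note wf = wf_coh_body[OF tm_op.hyps(6)]
 have t: "wf_tm \<Gamma> t A" "wf_tm \<Gamma> u A" using wf tm_op.hyps by auto
 have v: "vars_ty A \<subseteq> vars_ctx \<Gamma>"
  using tm_op.hyps vars_ctx_mono[OF src_ctx_subset] by (auto simp: vars_typed_def)
 have s: "subst_ty \<delta> (subst_ty \<gamma> A) = subst_ty (comp_sub \<gamma> \<delta>) A"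
  using comp_sub_assoc_subst(1) wf_sub_dom_set[OF tm_op.hyps(6)] v by auto
 have "wf_sub \<Delta> (comp_sub \<gamma> \<delta>) \<Gamma>" using tm_op by auto
 from wf_ctx_wf_ty_wf_tm_wf_sub.tm_op[OF tm_op.hyps(1-5) this tm_op.hyps(7,8)]
 show ?case using s subst_comp_wf(2)[OF tm_op.hyps(6)] t by (simp add: comp_sub_def)
next
 case (tm_coh \<Gamma> t A u \<Xi> \<gamma>)
 have v: "vars_ty A \<subseteq> vars_ctx \<Gamma>" using tm_coh.hyps by (auto simp: vars_typed_def)
 have s: "subst_ty \<delta> (subst_ty \<gamma> A) = subst_ty (comp_sub \<gamma> \<delta>) A"
  using comp_sub_assoc_subst(1) wf_sub_dom_set[OF tm_coh.hyps(5)] v by auto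
 have "wf_sub \<Delta> (comp_sub \<gamma> \<delta>) \<Gamma>" using tm_coh by auto
 from wf_ctx_wf_ty_wf_tm_wf_sub.tm_coh[OF tm_coh.hyps(1-4) this tm_coh.hyps(6,7)]
 show ?case using s subst_comp_wf(2)[OF tm_coh.hyps(5)] tm_coh.hyps(3,4) by (simp add: comp_sub_def)
next
 case (sub_empty \<Gamma>)
 thus ?case using wf_ctx_of(4) by (auto simp: comp_sub_def intro: wf_ctx_wf_ty_wf_tm_wf_sub.sub_empty)
next
 case (sub_extend \<Gamma> \<gamma> \<Xi> x A t)
 have "wf_ty \<Xi> A" using sub_extend.hyps(2) by (cases rule: wf_ctx.cases) auto
 hence "wf_tm \<Delta> (subst_tm \<delta> t) (subst_ty (comp_sub \<gamma> \<delta>) A)"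
  using sub_extend.IH(3)[OF sub_extend.prems] subst_comp_wf(1)[OF sub_extend.hyps(1)] by simp
 from wf_ctx_wf_ty_wf_tm_wf_sub.sub_extend[OF sub_extend.IH(1)[OF sub_extend.prems] sub_extend.hyps(2) this]
 show ?case by (simp add: comp_sub_def)
qed (auto intro: wf_ctx_wf_ty_wf_tm_wf_sub.intros)

lemma wf_tm_ty:
 shows "wf_ctx \<Gamma> \<Longrightarrow> True" and "wf_ty \<Gamma> A \<Longrightarrow> True" and "wf_tm \<Gamma> t A \<Longrightarrow> wf_ty \<Gamma> A"
  and "wf_sub \<Delta> \<gamma> \<Gamma> \<Longrightarrow> True"
proof (induction rule: wf_ctx_wf_ty_wf_tm_wf_sub.inducts)
 case (tm_var \<Gamma> x A) thus ?case using wf_ctx_ty by blast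
next
 case (tm_op \<Gamma> t A u \<Delta> \<gamma>)
 note wf = wf_coh_body[OF tm_op.hyps(6)]
 have "wf_ty \<Gamma> A" using tm_op weakening(2) src_ctx_subset wf_ctx_of(4) by blast
 hence "wf_ty \<Gamma> (Arrow t A u)" using wf tm_op.hyps by (auto intro: ty_arrow)
 from substitution(2)[OF this tm_op.hyps(6)] show ?case by simp
next
 case (tm_coh \<Gamma> t A u \<Delta> \<gamma>)
 hence "wf_ty \<Gamma> (Arrow t A u)" by (auto intro: ty_arrow)
 from substitution(2)[OF this tm_coh.hyps(5)] show ?case by simp
qed auto

text \<open>A coherence carries its own type, so its type is the instance of this stored type and no
  induction is required.\<close>

lemma wf_tm_unique: "wf_tm \<Gamma> t A \<Longrightarrow> wf_tm \<Gamma> t B \<Longrightarrow> A = B"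
proof (cases t)
 case (Var x)
 assume "wf_tm \<Gamma> t A" "wf_tm \<Gamma> t B"
 hence "(x, A) \<in> set \<Gamma>" "(x, B) \<in> set \<Gamma>" "wf_ctx \<Gamma>" using Var by (auto elim: wf_tm.cases)
 thus ?thesis using wf_ctx_distinct eq_key_imp_eq_value by metis
next
 case (CohOp \<Delta> C \<gamma>)
 assume "wf_tm \<Gamma> t A" "wf_tm \<Gamma> t B"
 hence "A = subst_ty \<gamma> C" "B = subst_ty \<gamma> C" using CohOp by (auto elim: wf_tm.cases)
 thus ?thesis by simp
next
 case (Coh \<Delta> C \<gamma>)
 assume "wf_tm \<Gamma> t A" "wf_tm \<Gamma> t B"
 hence "A = subst_ty \<gamma> C" "B = subst_ty \<gamma> C" using Coh by (auto elim: wf_tm.cases)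
 thus ?thesis by simp
qed

lemma wf_ty_Arrow: "wf_ty \<Gamma> (Arrow t A u) \<longleftrightarrow> wf_ty \<Gamma> A \<and> wf_tm \<Gamma> t A \<and> wf_tm \<Gamma> u A"
 by (auto elim: wf_ty.cases intro: ty_arrow)

lemma wf_tm_Var: "wf_tm \<Gamma> (Var x) A \<longleftrightarrow> wf_ctx \<Gamma> \<and> (x, A) \<in> set \<Gamma>"
 by (auto elim: wf_tm.cases intro: tm_var)

lemma wf_ctx_snocD: "wf_ctx (\<Gamma> @ [(x, A)]) \<Longrightarrow> wf_ctx \<Gamma> \<and> wf_ty \<Gamma> A \<and> x \<notin> vars_ctx \<Gamma>"
 by (cases rule: wf_ctx.cases) auto

text \<open>The typing of each entry is checked against the complete substitution. This agrees with
  the initial segment that the rule asks for, since a type only mentions earlier variables.\<close>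

lemma wf_sub_mapI:
 assumes "wf_ctx \<Delta>" "wf_ctx \<Gamma>"
  and "\<And>x A. (x, A) \<in> set \<Gamma> \<Longrightarrow> wf_tm \<Delta> (g x) (subst_ty (map (\<lambda>(x, A). (x, g x)) \<Gamma>) A)"
 shows "wf_sub \<Delta> (map (\<lambda>(x, A). (x, g x)) \<Gamma>) \<Gamma>"
 using assms(2,3)
proof (induction \<Gamma> rule: rev_induct)
 case Nil thus ?case using assms(1) by (auto intro: sub_empty)
next
 case (snoc p \<Gamma>)
 obtain x A where p: "p = (x, A)" by (cases p)
 have w: "wf_ctx \<Gamma>" "wf_ty \<Gamma> A" "x \<notin> vars_ctx \<Gamma>" using snoc.prems(1) p wf_ctx_snocD by auto
 let ?m = "map (\<lambda>(x, A). (x, g x))"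
 have ext: "subst_ty (?m (\<Gamma> @ [p])) C = subst_ty (?m \<Gamma>) C" if "vars_ty C \<subseteq> vars_ctx \<Gamma>" for C
 proof (rule subst_cong(1))
  fix y assume "y \<in> vars_ty C"
  hence "y \<in> fst ` set (?m \<Gamma>)" using that by (force simp: vars_ctx_def)
  thus "sv (?m (\<Gamma> @ [p])) y = sv (?m \<Gamma>) y" by (simp add: sv_append)
 qed
 have "wf_sub \<Delta> (?m \<Gamma>) \<Gamma>"
 proof (rule snoc.IH[OF w(1)])
  fix y B assume y: "(y, B) \<in> set \<Gamma>"
  thus "wf_tm \<Delta> (g y) (subst_ty (?m \<Gamma>) B)"
   using snoc.prems(2)[of y B] ext wf_vars(2)[OF wf_ctx_ty[OF w(1) y]] by simp
 qed
 moreover have "wf_tm \<Delta> (g x) (subst_ty (?m \<Gamma>) A)"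
  using snoc.prems(2)[of x A] ext wf_vars(2)[OF w(2)] p by simp
 ultimately show ?case using sub_extend snoc.prems(1) p by simp
qed

lemma sv_map:
 assumes "x \<in> vars_ctx \<Gamma>"
 shows "sv (map (\<lambda>(x, A). (x, g x)) \<Gamma>) x = g x"
proof -
 have "map_of (map (\<lambda>(x, A). (x, g x)) \<Gamma>) x = Some (g x)" using assms
  by (induction \<Gamma>) (auto simp: vars_ctx_def)
 thus ?thesis by (simp add: sv_def)
qed

lemma wf_id_sub: "wf_ctx \<Gamma> \<Longrightarrow> wf_sub \<Gamma> (id_sub \<Gamma>) \<Gamma>"
 using wf_sub_mapI[of \<Gamma> \<Gamma> Var] by (auto simp flip: id_sub_def intro: tm_var)

text \<open>Supports are closed under faces. For a term, the faces of a variable may occur only in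
  the type of the term; for a substitution they reappear in earlier entries, so the last clause gets
  by with the entries alone.\<close>

lemma vars_closed:
 shows "wf_ctx \<Gamma> \<Longrightarrow> True"
  and "wf_ty \<Gamma> A \<Longrightarrow> (x, B) \<in> set \<Gamma> \<Longrightarrow> x \<in> vars_ty A \<Longrightarrow> vars_ty B \<subseteq> vars_ty A"
  and "wf_tm \<Gamma> t A \<Longrightarrow> (x, B) \<in> set \<Gamma> \<Longrightarrow> x \<in> vars_tm t \<Longrightarrow> vars_ty B \<subseteq> vars_typed t A"
  and "wf_sub \<Gamma> \<gamma> \<Delta> \<Longrightarrow> (x, B) \<in> set \<Gamma> \<Longrightarrow> x \<in> (\<Union>(y, t)\<in>set \<gamma>. vars_tm t) \<Longrightarrow>
    vars_ty B \<subseteq> (\<Union>(y, t)\<in>set \<gamma>. vars_tm t)"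
proof (induction rule: wf_ctx_wf_ty_wf_tm_wf_sub.inducts)
 case (ty_arrow \<Gamma> A t u) thus ?case by (auto simp: vars_typed_def)
next
 case (tm_var \<Gamma> x' A)
 hence "B = A" using wf_ctx_distinct eq_key_imp_eq_value by (metis singletonD vars_tm.simps(1))
 thus ?case by (auto simp: vars_typed_def)
next
 case (sub_extend \<Delta> \<gamma> \<Gamma> y A t)
 have "vars_ty A \<subseteq> fst ` set \<gamma>"
  using wf_ctx_snocD[OF sub_extend.hyps(2)] wf_vars(2) wf_sub_dom_set[OF sub_extend.hyps(1)] by auto
 hence "vars_ty (subst_ty \<gamma> A) \<subseteq> (\<Union>(y, t)\<in>set \<gamma>. vars_tm t)"
  unfolding vars_subst using wf_sub_in[OF sub_extend.hyps(1)] wf_sub_dom_set[OF sub_extend.hyps(1)] by fastforce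
 thus ?case using sub_extend by (fastforce simp: vars_typed_def)
qed (auto simp: vars_typed_def)

lemma vars_typed_closed:
 assumes "wf_tm \<Gamma> t A" "x \<in> vars_typed t A" "(x, B) \<in> set \<Gamma>"
 shows "vars_ty B \<subseteq> vars_typed t A"
 using assms vars_closed(2,3) wf_tm_ty(3)[OF assms(1)] by (fastforce simp: vars_typed_def)

lemma strengthening:
 shows "wf_ctx \<Gamma> \<Longrightarrow> True"
  and "wf_ty \<Gamma> A \<Longrightarrow> wf_ctx \<Gamma>' \<Longrightarrow> (\<And>x B. (x, B) \<in> set \<Gamma> \<Longrightarrow> x \<in> vars_ty A \<Longrightarrow> (x, B) \<in> set \<Gamma>') \<Longrightarrow> wf_ty \<Gamma>' A"
  and "wf_tm \<Gamma> t A \<Longrightarrow> wf_ctx \<Gamma>' \<Longrightarrow> (\<And>x B. (x, B) \<in> set \<Gamma> \<Longrightarrow> x \<in> vars_tm t \<Longrightarrow> (x, B) \<in> set \<Gamma>') \<Longrightarrow> wf_tm \<Gamma>' t A"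
  and "wf_sub \<Gamma> \<gamma> \<Delta> \<Longrightarrow> wf_ctx \<Gamma>' \<Longrightarrow>
   (\<And>x B. (x, B) \<in> set \<Gamma> \<Longrightarrow> x \<in> (\<Union>(y, t)\<in>set \<gamma>. vars_tm t) \<Longrightarrow> (x, B) \<in> set \<Gamma>') \<Longrightarrow> wf_sub \<Gamma>' \<gamma> \<Delta>"
proof (induction arbitrary: and \<Gamma>' and \<Gamma>' and \<Gamma>' rule: wf_ctx_wf_ty_wf_tm_wf_sub.inducts)
 case (tm_op \<Gamma> t A u \<Delta> \<gamma>)
 hence "wf_sub \<Gamma>' \<gamma> \<Gamma>" by auto
 thus ?case using tm_op.hyps by (intro wf_ctx_wf_ty_wf_tm_wf_sub.tm_op)
next
 case (tm_coh \<Gamma> t A u \<Delta> \<gamma>)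
 hence "wf_sub \<Gamma>' \<gamma> \<Gamma>" by auto
 thus ?case using tm_coh.hyps by (intro wf_ctx_wf_ty_wf_tm_wf_sub.tm_coh)
next
 case (sub_extend \<Delta> \<gamma> \<Gamma> y A t)
 hence "wf_sub \<Gamma>' \<gamma> \<Gamma>" "wf_tm \<Gamma>' t (subst_ty \<gamma> A)" by auto
 thus ?case using sub_extend.hyps by (intro wf_ctx_wf_ty_wf_tm_wf_sub.sub_extend)
qed (auto intro: wf_ctx_wf_ty_wf_tm_wf_sub.intros)

lemma wf_ctx_filter:
 assumes "wf_ctx \<Gamma>" "\<And>x A y. (x, A) \<in> set \<Gamma> \<Longrightarrow> P x \<Longrightarrow> y \<in> vars_ty A \<Longrightarrow> P y"
 shows "wf_ctx (filter (\<lambda>p. P (fst p)) \<Gamma>)"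
 using assms
proof (induction \<Gamma> rule: rev_induct)
 case Nil thus ?case by (simp add: ctx_empty)
next
 case (snoc p \<Gamma>)
 obtain x A where p: "p = (x, A)" by (cases p)
 have w: "wf_ctx \<Gamma>" "wf_ty \<Gamma> A" "x \<notin> vars_ctx \<Gamma>" using snoc.prems(1) p wf_ctx_snocD by auto
 have f: "wf_ctx (filter (\<lambda>p. P (fst p)) \<Gamma>)" using snoc w(1) by auto
 show ?case
 proof (cases "P x")
  case True
  hence "wf_ty (filter (\<lambda>p. P (fst p)) \<Gamma>) A"
   using snoc.prems(2) p by (intro strengthening(2)[OF w(2) f]) auto
  thus ?thesis using f w(3) True p by (auto simp: vars_ctx_def intro!: ctx_extend)
 qed (use f p in auto)
qed

section \<open>Levels\<close>

text \<open>\<open>lev_tm n t\<close> says that \<open>t\<close> lives in the \<open>n\<close>-th stage of the coherator: types of coherences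
 are nested at most \<open>n\<close> deep.\<close>

fun lev_ty :: "nat \<Rightarrow> ty \<Rightarrow> bool" and lev_tm :: "nat \<Rightarrow> tm \<Rightarrow> bool" where
 "lev_ty n Star = True"
| "lev_ty n (Arrow t A u) = (lev_tm n t \<and> lev_ty n A \<and> lev_tm n u)"
| "lev_tm n (Var x) = True"
| "lev_tm n (CohOp \<Gamma> A \<gamma>) = ((case n of 0 \<Rightarrow> False | Suc m \<Rightarrow> lev_ty m A) \<and> (\<forall>(x, t)\<in>set \<gamma>. lev_tm n t))"
| "lev_tm n (Coh \<Gamma> A \<gamma>) = ((case n of 0 \<Rightarrow> False | Suc m \<Rightarrow> lev_ty m A) \<and> (\<forall>(x, t)\<in>set \<gamma>. lev_tm n t))"

definition lev_sub :: "nat \<Rightarrow> sub \<Rightarrow> bool" where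
 "lev_sub n \<gamma> \<longleftrightarrow> (\<forall>(x, t)\<in>set \<gamma>. lev_tm n t)"

lemma lev_mono:
 shows "lev_ty m A \<Longrightarrow> m \<le> n \<Longrightarrow> lev_ty n A" and "lev_tm m t \<Longrightarrow> m \<le> n \<Longrightarrow> lev_tm n t"
proof (induction A and t arbitrary: m n and m n rule: ty_tm_induct)
 case (Coh c \<Gamma> A \<gamma>) thus ?case by (elim disjE) (fastforce split: nat.splits)+
qed auto

lemma lev_ex:
 shows "\<exists>n. lev_ty n A" and "\<exists>n. lev_tm n t"
proof (induction A and t rule: ty_tm_induct)
 case (Arrow t A u)
 then obtain a b c where "lev_tm a t" "lev_ty b A" "lev_tm c u" by auto
 hence "lev_ty (a + b + c) (Arrow t A u)" using lev_mono by (auto elim!: lev_mono)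
 thus ?case by blast
next
 case (Coh c \<Gamma> A \<gamma>)
 then obtain N where N: "lev_ty N A" by blast
 have "\<forall>t. \<exists>n. (\<exists>x. (x, t) \<in> set \<gamma>) \<longrightarrow> lev_tm n t" using Coh(3) by blast
 then obtain f where f: "\<And>x t. (x, t) \<in> set \<gamma> \<Longrightarrow> lev_tm (f t) t" by metis
 \<comment> \<open>The sum bounds the levels of all entries at once; \<open>Suc N\<close> accounts
   for the type, which is measured one level lower.\<close>
 let ?M = "Suc N + (\<Sum>p\<in>set \<gamma>. f (snd p))"
 have "f t \<le> ?M" if "(x, t) \<in> set \<gamma>" for x t
  using member_le_sum[of "(x, t)" "set \<gamma>" "\<lambda>p. f (snd p)"] that by simp
 hence "lev_tm ?M (c \<Gamma> A \<gamma>)" using Coh(1) f N lev_mono by (elim disjE) (fastforce split: nat.splits)+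
 thus ?case by blast
qed auto

lemma lev_sub_ex: "\<exists>n. lev_sub n \<gamma>"
proof (induction \<gamma>)
 case (Cons p \<gamma>)
 then obtain a b where "lev_sub a \<gamma>" "lev_tm b (snd p)" using lev_ex(2) by blast
 hence "lev_sub (a + b) (p # \<gamma>)" using lev_mono(2) by (fastforce simp: lev_sub_def)
 thus ?case by blast
qed (simp add: lev_sub_def)

lemma lev_sv: "lev_sub n \<gamma> \<Longrightarrow> lev_tm n (sv \<gamma> x)"
 by (auto simp: lev_sub_def sv_def split: option.splits dest: map_of_SomeD)

lemma lev_subst:
 assumes "lev_sub n \<gamma>"
 shows "lev_ty n A \<Longrightarrow> lev_ty n (subst_ty \<gamma> A)" and "lev_tm n t \<Longrightarrow> lev_tm n (subst_tm \<gamma> t)"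
proof (induction A and t rule: ty_tm_induct)
 case (Var x) thus ?case using lev_sv[OF assms] by simp
next
 case (Coh c \<Gamma> A \<theta>) thus ?case by (elim disjE) force+
qed auto

lemma lev_comp_sub: "lev_sub n \<gamma> \<Longrightarrow> lev_sub n \<delta> \<Longrightarrow> lev_sub n (comp_sub \<gamma> \<delta>)"
 using lev_subst(2) by (fastforce simp: lev_sub_def comp_sub_def)

lemma lev_sub_mono: "lev_sub m \<gamma> \<Longrightarrow> m \<le> n \<Longrightarrow> lev_sub n \<gamma>"
 using lev_mono(2) by (fastforce simp: lev_sub_def)

lemma lev_id_sub: "lev_sub n (id_sub \<Gamma>)"
 by (auto simp: lev_sub_def id_sub_def)

text \<open>The type of a coherence is the instance of its stored type, whose level is even smaller;
  for variables the bound comes from the context.\<close>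

lemma lev_tm_ty:
 assumes "wf_tm \<Gamma> t A" "lev_tm n t" "\<And>x B. (x, B) \<in> set \<Gamma> \<Longrightarrow> lev_ty n B"
 shows "lev_ty n A"
 using assms(1)
proof cases
 case (tm_op \<Delta> a B u \<gamma>)
 hence "lev_sub n \<gamma>" "lev_ty n (Arrow a B u)" using assms(2)
  by (auto simp: lev_sub_def split: nat.splits intro: lev_mono)
 thus ?thesis using lev_subst(1)[of n \<gamma> "Arrow a B u"] tm_op by simp
next
 case (tm_coh \<Delta> a B u \<gamma>)
 hence "lev_sub n \<gamma>" "lev_ty n (Arrow a B u)" using assms(2)
  by (auto simp: lev_sub_def split: nat.splits intro: lev_mono)
 thus ?thesis using lev_subst(1)[of n \<gamma> "Arrow a B u"] tm_coh by simp
qed (use assms in auto)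

section \<open>Combinatorics of ps-contexts\<close>

text \<open>Dimensions as natural numbers, shifted by one against \<open>dim_ty\<close>:
  \<open>tdim A\<close> is the dimension of a variable of type \<open>A\<close>.\<close>

fun tdim :: "ty \<Rightarrow> nat" where
 "tdim Star = 0"
| "tdim (Arrow t A u) = Suc (tdim A)"

lemma dim_ty_tdim: "dim_ty A = int (tdim A) - 1"
 by (induction A rule: tdim.induct) auto

lemma tdim_subst [simp]: "tdim (subst_ty \<gamma> A) = tdim A"
 by (induction A rule: tdim.induct) auto

definition var_types :: "ctx \<Rightarrow> bool" where
 "var_types \<Gamma> \<longleftrightarrow> (\<forall>(f, B)\<in>set \<Gamma>. B = Star \<or>
   (\<exists>a C b. B = Arrow (Var a) C (Var b) \<and> (a, C) \<in> set \<Gamma> \<and> (b, C) \<in> set \<Gamma>))"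

lemma var_typesE:
 assumes "var_types \<Gamma>" "(f, Arrow t C u) \<in> set \<Gamma>"
 obtains a b where "t = Var a" "u = Var b" "(a, C) \<in> set \<Gamma>" "(b, C) \<in> set \<Gamma>"
 using assms unfolding var_types_def by fastforce

lemma ps_at_wf: "ps_at \<Gamma> x A \<Longrightarrow> wf_ctx \<Gamma> \<and> (x, A) \<in> set \<Gamma> \<and> var_types \<Gamma>"
proof (induction rule: ps_at.induct)
 case (ps_point x)
 have "wf_ctx ([] @ [(x, Star)])"
  by (intro ctx_extend ctx_empty ty_star) (simp add: vars_ctx_def)
 thus ?case by (simp add: var_types_def)
next
 case (ps_drop \<Gamma> f x A y)
 thus ?case by (auto elim: var_typesE)
next
 case (ps_extend \<Gamma> x A y f)
 have A: "wf_ty \<Gamma> A" using ps_extend wf_ctx_ty by blast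
 have w1: "wf_ctx (\<Gamma> @ [(y, A)])" using ps_extend A by (auto intro: ctx_extend)
 have "wf_ty (\<Gamma> @ [(y, A)]) (Arrow (Var x) A (Var y))"
  using A weakening(2)[OF A w1] w1 ps_extend by (auto intro!: ty_arrow tm_var)
 hence "wf_ctx ((\<Gamma> @ [(y, A)]) @ [(f, Arrow (Var x) A (Var y))])"
  using ps_extend.hyps by (intro ctx_extend[OF w1]) (auto simp: vars_ctx_def)
 moreover have "var_types (\<Gamma> @ [(y, A), (f, Arrow (Var x) A (Var y))])"
  using ps_extend unfolding var_types_def by fastforce
 ultimately show ?case by simp
qed

lemma ps_ctx_wf: "ps_ctx \<Gamma> \<Longrightarrow> wf_ctx \<Gamma>" and ps_ctx_var_types: "ps_ctx \<Gamma> \<Longrightarrow> var_types \<Gamma>"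
 using ps_at_wf by (auto simp: ps_ctx_def)

lemma ctx_fun: "wf_ctx \<Gamma> \<Longrightarrow> (x, A) \<in> set \<Gamma> \<Longrightarrow> (x, B) \<in> set \<Gamma> \<Longrightarrow> A = B"
 using wf_ctx_distinct eq_key_imp_eq_value by metis

lemma vars_ctxI: "(x, A) \<in> set \<Gamma> \<Longrightarrow> x \<in> vars_ctx \<Gamma>"
 by (force simp: vars_ctx_def)

lemma vars_ctxE: "x \<in> vars_ctx \<Gamma> \<Longrightarrow> (\<And>A. (x, A) \<in> set \<Gamma> \<Longrightarrow> P) \<Longrightarrow> P"
 by (force simp: vars_ctx_def)

lemma var_types_vars:
 assumes "var_types \<Gamma>" "(x, A) \<in> set \<Gamma>" "y \<in> vars_ty A"
 shows "y \<in> vars_ctx \<Gamma>"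
 using assms(2,3)
proof (induction A arbitrary: x rule: tdim.induct)
 case (2 t A u)
 from assms(1) 2(2) obtain a b where "t = Var a" "u = Var b" "(a, A) \<in> set \<Gamma>" "(b, A) \<in> set \<Gamma>"
  by (rule var_typesE)
 thus ?case using 2 by (auto intro: vars_ctxI)
qed auto

subsection \<open>Degenerate maps to a globe\<close>

text \<open>The pair \<open>(j, l)\<close> stands for the \<open>j\<close>-dimensional cell \<open>l\<close> of a globe, seen as a cell of any
 dimension \<open>k \<ge> j\<close> of the free strict \<open>\<omega>\<close>-category on the globe; \<open>sk k\<close> and \<open>tk k\<close> are its source and
 target in dimension \<open>k\<close>. An assignment \<open>asg r \<Gamma>\<close> is a functor from the pasting scheme \<open>\<Gamma>\<close> to such
 a globe.\<close>

definition sk :: "nat \<Rightarrow> nat \<times> side \<Rightarrow> nat \<times> side" where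
 "sk k c = (if fst c \<le> k then c else (k, Src))"

definition tk :: "nat \<Rightarrow> nat \<times> side \<Rightarrow> nat \<times> side" where
 "tk k c = (if fst c \<le> k then c else (k, Tgt))"

definition asg :: "(nat \<Rightarrow> nat \<times> side) \<Rightarrow> ctx \<Rightarrow> bool" where
 "asg r \<Gamma> \<longleftrightarrow> var_types \<Gamma> \<and> (\<forall>(f, B)\<in>set \<Gamma>. fst (r f) \<le> tdim B) \<and>
   (\<forall>f a C b. (f, Arrow (Var a) C (Var b)) \<in> set \<Gamma> \<longrightarrow>
    r a = sk (tdim C) (r f) \<and> r b = tk (tdim C) (r f))"

text \<open>The principal value: it is attained, and it is the only value of its dimension or above.
  The other values are proper faces and never carry the mark \<open>Idn\<close> of the top cell of a
  globe.\<close>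

definition prin :: "(nat \<Rightarrow> nat \<times> side) \<Rightarrow> nat set \<Rightarrow> nat \<times> side \<Rightarrow> bool" where
 "prin r U c \<longleftrightarrow> c \<in> r ` U \<and> (\<forall>w\<in>U. r w = c \<or> fst (r w) < fst c \<and> snd (r w) \<noteq> Idn)"

lemma prin_unique: "prin r U c \<Longrightarrow> prin r U d \<Longrightarrow> c = d"
 unfolding prin_def by (metis imageE less_asym')

text \<open>Starting from the current variable of a derivation, the reflexive transitive closure
  reaches exactly the variables to which \<open>ps_drop\<close> can descend.\<close>

definition tgtrel :: "ctx \<Rightarrow> (nat \<times> nat) set" where
 "tgtrel \<Gamma> = {(f, y). \<exists>t A. (f, Arrow t A (Var y)) \<in> set \<Gamma>}"

lemma tgtrel_mono: "set \<Gamma> \<subseteq> set \<Delta> \<Longrightarrow> (tgtrel \<Gamma>)\<^sup>* \<subseteq> (tgtrel \<Delta>)\<^sup>*"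
 by (rule rtrancl_mono) (auto simp: tgtrel_def)

lemma tgtrel_dim:
 assumes "(x, w) \<in> (tgtrel \<Gamma>)\<^sup>*" "wf_ctx \<Gamma>" "var_types \<Gamma>" "(x, A) \<in> set \<Gamma>"
 shows "\<exists>B. (w, B) \<in> set \<Gamma> \<and> (w = x \<or> tdim B < tdim A)"
 using assms(1)
proof (induction rule: rtrancl_induct)
 case (step y z)
 then obtain B t C where "(y, B) \<in> set \<Gamma>" "y = x \<or> tdim B < tdim A" "(y, Arrow t C (Var z)) \<in> set \<Gamma>"
  by (auto simp: tgtrel_def)
 moreover from this(1,3) have "B = Arrow t C (Var z)" using ctx_fun assms(2) by blast
 moreover have "(z, C) \<in> set \<Gamma>" using calculation(3) by (rule var_typesE[OF assms(3)]) simp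
 moreover have "y = x \<Longrightarrow> B = A" using calculation(1) ctx_fun assms(2,4) by blast
 ultimately show ?case by (intro exI[of _ C]) auto
qed (use assms in auto)

lemma tgtrel_step:
 assumes "(x, w) \<in> (tgtrel \<Gamma>)\<^sup>*" "w \<noteq> x" "wf_ctx \<Gamma>" "(x, Arrow t A (Var y)) \<in> set \<Gamma>"
 shows "(y, w) \<in> (tgtrel \<Gamma>)\<^sup>*"
 using assms(1)
proof (cases rule: converse_rtranclE)
 case (step y')
 hence "y' = y" using assms(3,4) ctx_fun[of \<Gamma> x] by (fastforce simp: tgtrel_def)
 thus ?thesis using step by simp
qed (use assms in auto)

lemma asg_sub:
 assumes "asg r \<Delta>" "set \<Gamma> \<subseteq> set \<Delta>" "var_types \<Gamma>"
 shows "asg r \<Gamma>"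
 using assms unfolding asg_def by fast

text \<open>An invariant of the derivation of a ps-context. If the current variable lies over a
  source, then this source is already the principal value. The next two clauses say that a variable
  of full dimension over the target (source) of the principal cell really is a target (source) of
  some variable. The last clause supports the one for sources when the principal cell is raised: the
  variables over the source that are not yet sources are iterated targets of the current
  variable.\<close>

lemma ps_shadow_aux:
 assumes "ps_at \<Gamma> x A" "asg r \<Gamma>"
 shows "\<exists>c. prin r (vars_ctx \<Gamma>) c \<and>
  (\<forall>j. r x = (j, Src) \<longrightarrow> c = (j, Src)) \<and>
  (\<forall>w B. (w, B) \<in> set \<Gamma> \<longrightarrow> Suc (tdim B) = fst c \<longrightarrow> r w = (tdim B, Tgt) \<longrightarrow>
    (\<exists>f t. (f, Arrow t B (Var w)) \<in> set \<Gamma>)) \<and>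
  (\<forall>w B. (w, B) \<in> set \<Gamma> \<longrightarrow> Suc (tdim B) = fst c \<longrightarrow> r w = (tdim B, Src) \<longrightarrow>
    (\<exists>f u. (f, Arrow (Var w) B u) \<in> set \<Gamma>)) \<and>
  (\<forall>w B. (w, B) \<in> set \<Gamma> \<longrightarrow> r x = (tdim B, Src) \<longrightarrow> r w = (tdim B, Src) \<longrightarrow>
    (x, w) \<in> (tgtrel \<Gamma>)\<^sup>* \<or> (\<exists>f u. (f, Arrow (Var w) B u) \<in> set \<Gamma>))"
  (is "\<exists>c. ?P \<Gamma> x c")
 using assms
proof (induction rule: ps_at.induct)
 case (ps_point x)
 have "fst (r x) = 0" using ps_point by (auto simp: asg_def)
 thus ?case by (intro exI[of _ "r x"]) (auto simp: prin_def vars_ctx_def)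
next
 case (ps_drop \<Gamma> f x A y)
 then obtain c where c: "?P \<Gamma> f c" by blast
 note w = ps_at_wf[OF ps_drop.hyps]
 have f: "(f, Arrow (Var x) A (Var y)) \<in> set \<Gamma>" using w by simp
 hence y: "r y = tk (tdim A) (r f)" using ps_drop.prems by (auto simp: asg_def)
 \<comment> \<open>The target of \<open>f\<close> lies over a source only if \<open>f\<close> itself
   is collapsed to this source.\<close>
 have rf: "r f = (j, Src)" "j \<le> tdim A" if "r y = (j, Src)" for j
  using that y by (auto simp: tk_def split: if_splits)
 have "(y, w) \<in> (tgtrel \<Gamma>)\<^sup>* \<or> (\<exists>g u. (g, Arrow (Var w) B u) \<in> set \<Gamma>)"
  if a: "(w, B) \<in> set \<Gamma>" "r y = (tdim B, Src)" "r w = (tdim B, Src)" for w B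
 proof -
  have "(f, w) \<in> (tgtrel \<Gamma>)\<^sup>* \<or> (\<exists>g u. (g, Arrow (Var w) B u) \<in> set \<Gamma>)"
   using c a rf[OF a(2)] by blast
  moreover have "w \<noteq> f" using ctx_fun[of \<Gamma> f B] a(1) f w rf(2)[OF a(2)] by fastforce
  ultimately show ?thesis using tgtrel_step[of f w \<Gamma>] f w by blast
 qed
 hence "?P \<Gamma> y c" using c rf by blast
 thus ?case by blast
next
 case (ps_extend \<Gamma> x A y f)
 let ?F = "Arrow (Var x) A (Var y)"
 let ?G = "\<Gamma> @ [(y, A), (f, ?F)]"
 note w = ps_at_wf[OF ps_extend.hyps(1)]
 have old: "asg r \<Gamma>" using asg_sub[OF ps_extend.prems] w by auto
 from ps_extend.IH[OF old] obtain c where c: "?P \<Gamma> x c" by blast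
 have vG: "vars_ctx ?G = insert y (insert f (vars_ctx \<Gamma>))" by (auto simp: vars_ctx_def)
 have rx: "r x = sk (tdim A) (r f)" "r y = tk (tdim A) (r f)" "fst (r f) \<le> Suc (tdim A)"
  using ps_extend.prems unfolding asg_def by auto
 have p: "prin r (vars_ctx \<Gamma>) c" using c by blast
 have fb: "fst (r v) \<le> tdim B" if "(v, B) \<in> set ?G" for v B
  using ps_extend.prems that unfolding asg_def by fast
 have xin: "x \<in> vars_ctx \<Gamma>" using w vars_ctxI by blast
 show ?case
 proof (cases "fst (r f) \<le> tdim A")
  \<comment> \<open>Here \<open>f\<close> is collapsed, both new variables take the value of
    \<open>x\<close>, and the principal value stays as it is.\<close>
  case True
  hence e: "r x = r f" "r y = r f" using rx by (auto simp: sk_def tk_def)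
  have "prin r (vars_ctx ?G) c" using p e xin unfolding vG by (auto simp: prin_def)
  moreover have "\<forall>j. r f = (j, Src) \<longrightarrow> c = (j, Src)" using c e by metis
  moreover have "\<exists>g t. (g, Arrow t B (Var v)) \<in> set ?G"
   if "(v, B) \<in> set ?G" "Suc (tdim B) = fst c" "r v = (tdim B, Tgt)" for v B
  proof -
   consider "(v, B) \<in> set \<Gamma>" | "(v, B) = (y, A)" | "(v, B) = (f, ?F)" using \<open>(v, B) \<in> set ?G\<close> by auto
   thus ?thesis
   proof cases
    case 1 thus ?thesis using c that by (metis (no_types, lifting) Un_iff set_append)
   next
    case 2 thus ?thesis by auto
   next
    case 3 thus ?thesis using that True by auto
   qed
  qed
  moreover have "\<exists>g u. (g, Arrow (Var v) B u) \<in> set ?G"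
   if "(v, B) \<in> set ?G" "Suc (tdim B) = fst c" "r v = (tdim B, Src)" for v B
  proof -
   consider "(v, B) \<in> set \<Gamma>" | "(v, B) = (y, A)" | "(v, B) = (f, ?F)" using \<open>(v, B) \<in> set ?G\<close> by auto
   thus ?thesis
   proof cases
    case 1 thus ?thesis using c that by (metis (no_types, lifting) Un_iff set_append)
   next
    case 2
    hence "c = (tdim B, Src)" using c e that by auto
    thus ?thesis using that by simp
   next
    case 3 thus ?thesis using that True by auto
   qed
  qed
  moreover have "(f, v) \<in> (tgtrel ?G)\<^sup>* \<or> (\<exists>g u. (g, Arrow (Var v) B u) \<in> set ?G)"
   if a: "(v, B) \<in> set ?G" "r f = (tdim B, Src)" "r v = (tdim B, Src)" for v B
  proof -
   have fy: "(f, y) \<in> tgtrel ?G" by (auto simp: tgtrel_def)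
   consider "(v, B) \<in> set \<Gamma>" | "(v, B) = (y, A)" | "(v, B) = (f, ?F)" using a(1) by auto
   thus ?thesis
   proof cases
    case 1
    hence "(x, v) \<in> (tgtrel \<Gamma>)\<^sup>* \<or> (\<exists>g u. (g, Arrow (Var v) B u) \<in> set \<Gamma>)" using c a e by metis
    moreover {
     assume xv: "(x, v) \<in> (tgtrel \<Gamma>)\<^sup>*"
     have ?thesis
     proof (cases "v = x")
      case True
      hence "B = A" using 1 w ctx_fun by blast
      thus ?thesis using True by auto
     next
      case False
      then obtain b where b: "(x, b) \<in> tgtrel \<Gamma>" "(b, v) \<in> (tgtrel \<Gamma>)\<^sup>*"
       using xv by (metis converse_rtranclE)
      \<comment> \<open>The variables \<open>x\<close> and \<open>y\<close> have the same type and
        hence the same target, so a chain of targets that leaves \<open>x\<close> can also be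
        entered from \<open>y\<close>.\<close>
      hence "(y, b) \<in> tgtrel ?G" using w ctx_fun by (fastforce simp: tgtrel_def)
      moreover have "(b, v) \<in> (tgtrel ?G)\<^sup>*" using b(2) tgtrel_mono[of \<Gamma> ?G] by auto
      ultimately show ?thesis using fy by (meson converse_rtrancl_into_rtrancl)
     qed }
    ultimately show ?thesis by auto
   next
    case 2 thus ?thesis using fy by auto
   next
    case 3 thus ?thesis by auto
   qed
  qed
  ultimately show ?thesis by blast
 next
  \<comment> \<open>Now \<open>x\<close> lies over the source of the cell \<open>r f\<close>, so by
    the invariant everything so far lies below this source, and \<open>r f\<close> becomes the
    principal value.\<close>
  case False
  hence k: "fst (r f) = Suc (tdim A)" using rx by simp
  have e: "r x = (tdim A, Src)" "r y = (tdim A, Tgt)" using rx k by (auto simp: sk_def tk_def)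
  hence cc: "c = (tdim A, Src)" using c by blast
  have lo: "r v = (tdim A, Src) \<or> fst (r v) < tdim A \<and> snd (r v) \<noteq> Idn" if "v \<in> vars_ctx \<Gamma>" for v
   using p that cc by (auto simp: prin_def)
  have "prin r (vars_ctx ?G) (r f)"
   using lo e k unfolding vG prin_def by (force simp: less_Suc_eq)
  moreover have "\<forall>j. r f = (j, Src) \<longrightarrow> r f = (j, Src)" by simp
  moreover have "\<exists>g t. (g, Arrow t B (Var v)) \<in> set ?G"
   if "(v, B) \<in> set ?G" "Suc (tdim B) = fst (r f)" "r v = (tdim B, Tgt)" for v B
  proof -
   have "v \<notin> vars_ctx \<Gamma>" using lo[of v] that k by auto
   hence "(v, B) = (y, A)" using that k vars_ctxI by fastforce
   thus ?thesis by auto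
  qed
  moreover have "\<exists>g u. (g, Arrow (Var v) B u) \<in> set ?G"
   if a: "(v, B) \<in> set ?G" "Suc (tdim B) = fst (r f)" "r v = (tdim B, Src)" for v B
  proof -
   have "(v, B) \<in> set \<Gamma>" using a k e(2) by auto
   \<comment> \<open>An iterated target of \<open>x\<close> of the same dimension as
     \<open>x\<close> can only be \<open>x\<close>, and \<open>x\<close> is the source of the new
     arrow.\<close>
   moreover from this have "(x, v) \<in> (tgtrel \<Gamma>)\<^sup>* \<or> (\<exists>g u. (g, Arrow (Var v) B u) \<in> set \<Gamma>)"
    using c a k e(1) by auto
   ultimately show ?thesis using tgtrel_dim[of x v \<Gamma> A] w a(2) k ctx_fun by fastforce
  qed
  moreover have "(f, v) \<in> (tgtrel ?G)\<^sup>* \<or> (\<exists>g u. (g, Arrow (Var v) B u) \<in> set ?G)"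
   if a: "(v, B) \<in> set ?G" "r f = (tdim B, Src)" "r v = (tdim B, Src)" for v B
  proof -
   have "v \<notin> vars_ctx \<Gamma>" using lo[of v] a k by auto
   moreover have "v \<noteq> y" using a e k by auto
   ultimately have "v = f" using a vars_ctxI by fastforce
   thus ?thesis by simp
  qed
  ultimately show ?thesis by blast
 qed
qed

text \<open>A value \<open>q\<close> of the new arrow \<open>f\<close> forces the value of
  \<open>y\<close>. It is admissible as soon as its source is the value of \<open>x\<close>; the
  last hypothesis supplies the faces of \<open>y\<close>, which are those of
  \<open>x\<close>.\<close>

lemma asg_extend:
 assumes "asg r \<Gamma>" "wf_ctx \<Gamma>" "(x, A) \<in> set \<Gamma>" "y \<notin> vars_ctx \<Gamma>" "f \<notin> vars_ctx \<Gamma>" "f \<noteq> y"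
  and "var_types (\<Gamma> @ [(y, A), (f, Arrow (Var x) A (Var y))])"
  and "fst q \<le> Suc (tdim A)" "r x = sk (tdim A) q"
  and "\<And>a C b. A = Arrow (Var a) C (Var b) \<Longrightarrow> r a = sk (tdim C) (tk (tdim A) q) \<and> r b = tk (tdim C) (tk (tdim A) q)"
 shows "asg (r(y := tk (tdim A) q, f := q)) (\<Gamma> @ [(y, A), (f, Arrow (Var x) A (Var y))])"
  (is "asg ?r ?G")
 unfolding asg_def
proof (intro conjI allI impI)
 note vt = assms(1)[unfolded asg_def]
 have eq: "?r v = r v" if "v \<in> vars_ctx \<Gamma>" for v using that assms by auto
 have xin: "x \<in> vars_ctx \<Gamma>" using assms vars_ctxI by blast
 show "var_types ?G" by fact
 have "fst (?r g) \<le> tdim B" if "(g, B) \<in> set \<Gamma>" for g B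
  using vt that eq vars_ctxI by auto
 moreover have "fst (tk (tdim A) q) \<le> tdim A" by (simp add: tk_def)
 ultimately show "\<forall>(g, B)\<in>set ?G. fst (?r g) \<le> tdim B" using assms by auto
 fix g a C b assume g: "(g, Arrow (Var a) C (Var b)) \<in> set ?G"
 have "?r a = sk (tdim C) (?r g) \<and> ?r b = tk (tdim C) (?r g)"
 proof (cases "(g, Arrow (Var a) C (Var b)) \<in> set \<Gamma> \<or> (y, A) = (g, Arrow (Var a) C (Var b))")
  case True
  hence ab: "a \<in> vars_ctx \<Gamma>" "b \<in> vars_ctx \<Gamma>"
   using assms vt var_types_vars[of \<Gamma>] by fastforce+
  show ?thesis
  proof (cases "(g, Arrow (Var a) C (Var b)) \<in> set \<Gamma>")
   case True
   hence "?r g = r g" using eq vars_ctxI by metis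
   thus ?thesis using vt True ab eq by auto
  next
   case False
   with True have g: "g = y" "A = Arrow (Var a) C (Var b)" by auto
   thus ?thesis using assms(6,10) eq ab by auto
  qed
 next
  case False
  hence "g = f" "a = x" "b = y" "C = A" using g by auto
  thus ?thesis using eq[OF xin] assms by auto
 qed
 thus "?r a = sk (tdim C) (?r g)" "?r b = tk (tdim C) (?r g)" by auto
qed

text \<open>Prepares \<open>asg_peak\<close>: before a peak is added over \<open>x\<close>, the
  variable \<open>x\<close> has to lie over the source of a globe and everything else must not
  exceed its dimension.\<close>

lemma asg_start:
 assumes "ps_at \<Gamma> x A"
 shows "\<exists>r. asg r \<Gamma> \<and> r x = (tdim A, Src) \<and> (\<forall>w\<in>vars_ctx \<Gamma>. fst (r w) \<le> tdim A)"
 using assms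
proof (induction rule: ps_at.induct)
 case (ps_point x)
 show ?case by (rule exI[of _ "\<lambda>_. (0, Src)"]) (auto simp: asg_def var_types_def)
next
 case (ps_drop \<Gamma> f x A y)
 then obtain r where r: "asg r \<Gamma>" "r f = (Suc (tdim A), Src)"
  "\<forall>w\<in>vars_ctx \<Gamma>. fst (r w) \<le> Suc (tdim A)" by auto
 let ?k = "tdim A"
 \<comment> \<open>This map identifies all cells of dimension at least \<open>?k\<close> and
   commutes with the remaining faces. It turns the target \<open>y\<close> of \<open>f\<close>,
   which lies over \<open>Tgt\<close>, into a variable over \<open>Src\<close>.\<close>
 define col where "col = (\<lambda>c :: nat \<times> side. if fst c < ?k then c else (?k, Src))"
 have f: "(f, Arrow (Var x) A (Var y)) \<in> set \<Gamma>" using ps_at_wf[OF ps_drop.hyps] by simp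
 have 1: "col (sk j c) = sk j (col c)" "col (tk j c) = tk j (col c)"
  if "fst c \<le> Suc j" "fst c \<le> Suc ?k" for j c
  using that by (auto simp: col_def sk_def tk_def split: if_splits)
 have "asg (col \<circ> r) \<Gamma>"
  unfolding asg_def
 proof (intro conjI allI impI)
  show "var_types \<Gamma>" using r by (simp add: asg_def)
  have "fst (col (r g)) \<le> tdim B" if "(g, B) \<in> set \<Gamma>" for g B
  proof -
   have "fst (r g) \<le> tdim B" using r(1) that by (auto simp: asg_def)
   thus ?thesis by (auto simp: col_def)
  qed
  thus "\<forall>(g, B)\<in>set \<Gamma>. fst ((col \<circ> r) g) \<le> tdim B" by auto
  fix g a C b assume g: "(g, Arrow (Var a) C (Var b)) \<in> set \<Gamma>"
  hence "fst (r g) \<le> Suc (tdim C)" "fst (r g) \<le> Suc ?k" using r vars_ctxI by (auto simp: asg_def)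
  thus "(col \<circ> r) a = sk (tdim C) ((col \<circ> r) g)" "(col \<circ> r) b = tk (tdim C) ((col \<circ> r) g)"
   using 1 g r(1) by (auto simp: asg_def)
 qed
 moreover have "(col \<circ> r) y = (?k, Src)"
 proof -
  have "r y = tk ?k (r f)" using r(1) f by (auto simp: asg_def)
  thus ?thesis using r(2) by (simp add: col_def tk_def)
 qed
 moreover have "\<forall>w\<in>vars_ctx \<Gamma>. fst ((col \<circ> r) w) \<le> ?k" by (auto simp: col_def)
 ultimately show ?case by blast
next
 case (ps_extend \<Gamma> x A y f)
 then obtain r where r: "asg r \<Gamma>" "r x = (tdim A, Src)" "\<forall>w\<in>vars_ctx \<Gamma>. fst (r w) \<le> tdim A" by auto
 note w = ps_at_wf[OF ps_extend.hyps(1)] ps_at_wf[OF ps_at.ps_extend[OF ps_extend.hyps]]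
 let ?q = "(Suc (tdim A), Src)"
 let ?r = "r(y := tk (tdim A) ?q, f := ?q)"
 have "r a = sk (tdim C) (r x) \<and> r b = tk (tdim C) (r x)" if "A = Arrow (Var a) C (Var b)" for a C b
  using r(1) w that by (auto simp: asg_def)
 hence "asg ?r (\<Gamma> @ [(y, A), (f, Arrow (Var x) A (Var y))])"
  using w r by (intro asg_extend[OF _ _ _ ps_extend.hyps(2-4)]) (auto simp: sk_def tk_def)
 moreover have "\<forall>v\<in>vars_ctx (\<Gamma> @ [(y, A), (f, Arrow (Var x) A (Var y))]). fst (?r v) \<le> Suc (tdim A)"
  using r(3) by (auto simp: vars_ctx_def tk_def le_SucI)
 moreover have "?r f = (tdim (Arrow (Var x) A (Var y)), Src)" by simp
 ultimately show ?case by (metis tdim.simps(2))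
qed

definition is_face :: "ctx \<Rightarrow> nat \<Rightarrow> bool" where
 "is_face \<Gamma> z \<longleftrightarrow> (\<exists>f t A u. (f, Arrow t A u) \<in> set \<Gamma> \<and> (t = Var z \<or> u = Var z))"

text \<open>When \<open>z\<close> is added, \<open>asg_start\<close> has put everything before it on
  the source side. Every later pair of variables is collapsed to the value of the variable to which
  it is attached. So \<open>z\<close> alone reaches the top cell of the globe.\<close>

lemma asg_peak:
 assumes "ps_at \<Gamma> x A" "(z, Arrow t B u) \<in> set \<Gamma>" "\<not> is_face \<Gamma> z"
 shows "\<exists>r. asg r \<Gamma> \<and> r z = (Suc (tdim B), Idn) \<and> (\<forall>w\<in>vars_ctx \<Gamma>. w \<noteq> z \<longrightarrow> fst (r w) \<le> tdim B)"
 using assms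
proof (induction rule: ps_at.induct)
 case (ps_extend \<Gamma> x A y f)
 note w = ps_at_wf[OF ps_extend.hyps(1)] ps_at_wf[OF ps_at.ps_extend[OF ps_extend.hyps]]
 note sm = asg_extend[OF _ _ _ ps_extend.hyps(2-4)]
 have zy: "z \<noteq> y" "z \<noteq> x" using ps_extend.prems(2) by (auto simp: is_face_def)
 show ?case
 proof (cases "z = f")
  case True
  hence z: "B = A" using ps_extend.prems ps_extend.hyps vars_ctxI by fastforce
  from asg_start[OF ps_extend.hyps(1)] obtain r where
   r: "asg r \<Gamma>" "r x = (tdim A, Src)" "\<forall>w\<in>vars_ctx \<Gamma>. fst (r w) \<le> tdim A" by auto
  have "r a = sk (tdim C) (r x) \<and> r b = tk (tdim C) (r x)" if "A = Arrow (Var a) C (Var b)" for a C b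
   using r(1) w that by (auto simp: asg_def)
  hence "asg (r(y := tk (tdim A) (Suc (tdim A), Idn), f := (Suc (tdim A), Idn))) (\<Gamma> @ [(y, A), (f, Arrow (Var x) A (Var y))])"
   using w r by (intro sm) (auto simp: sk_def tk_def)
  moreover have "\<forall>w\<in>vars_ctx (\<Gamma> @ [(y, A), (f, Arrow (Var x) A (Var y))]). w \<noteq> z \<longrightarrow>
    fst ((r(y := tk (tdim A) (Suc (tdim A), Idn), f := (Suc (tdim A), Idn))) w) \<le> tdim B"
   using r(3) True z by (auto simp: vars_ctx_def tk_def)
  ultimately show ?thesis using True z by fastforce
 next
  case False
  hence z: "(z, Arrow t B u) \<in> set \<Gamma>" using ps_extend.prems zy by auto
  moreover have "\<not> is_face \<Gamma> z" using ps_extend.prems by (auto simp: is_face_def)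
  ultimately obtain r where r: "asg r \<Gamma>" "r z = (Suc (tdim B), Idn)"
   "\<forall>w\<in>vars_ctx \<Gamma>. w \<noteq> z \<longrightarrow> fst (r w) \<le> tdim B" using ps_extend.IH by auto
  have rx: "fst (r x) \<le> tdim A" using r(1) w by (auto simp: asg_def)
  hence tx: "tk (tdim A) (r x) = r x" "sk (tdim A) (r x) = r x" by (auto simp: tk_def sk_def)
  have "r a = sk (tdim C) (r x) \<and> r b = tk (tdim C) (r x)" if "A = Arrow (Var a) C (Var b)" for a C b
   using r(1) w that by (auto simp: asg_def)
  hence "asg (r(y := tk (tdim A) (r x), f := r x)) (\<Gamma> @ [(y, A), (f, Arrow (Var x) A (Var y))])"
   using w r rx tx by (intro sm) auto
  moreover have "fst (r x) \<le> tdim B" using r(3) w(1) zy vars_ctxI by auto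
  moreover from this have "\<forall>w\<in>vars_ctx (\<Gamma> @ [(y, A), (f, Arrow (Var x) A (Var y))]). w \<noteq> z \<longrightarrow>
    fst ((r(y := tk (tdim A) (r x), f := r x)) w) \<le> tdim B" using r(3) tx by (auto simp: vars_ctx_def)
  moreover have "(r(y := tk (tdim A) (r x), f := r x)) z = (Suc (tdim B), Idn)" using r(2) zy False by simp
  ultimately show ?thesis by blast
 qed
qed auto

subsection \<open>Removing a peak\<close>

text \<open>As \<open>z\<close> is no face, it entered as the arrow of an extension step, together
  with \<open>y\<close>. By the hypotheses nothing is attached to either of them later, so this step
  can be skipped, with \<open>w\<close> as the current variable in the place of both.\<close>

lemma ps_remove_right:
 assumes "ps_at \<Gamma> d D" "(z, Arrow (Var w) C (Var y)) \<in> set \<Gamma>" "\<not> is_face \<Gamma> z"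
  and "\<And>g t B. (g, Arrow t B (Var y)) \<in> set \<Gamma> \<Longrightarrow> g = z"
  and "\<And>g u B. (g, Arrow (Var y) B u) \<notin> set \<Gamma>"
 shows "(d \<notin> {y, z} \<longrightarrow> ps_at (filter (\<lambda>p. fst p \<notin> {y, z}) \<Gamma>) d D) \<and>
  (d \<in> {y, z} \<longrightarrow> ps_at (filter (\<lambda>p. fst p \<notin> {y, z}) \<Gamma>) w C)"
 using assms
proof (induction rule: ps_at.induct)
 case (ps_drop \<Gamma> f x A b)
 note wf = ps_at_wf[OF ps_drop.hyps]
 let ?H = "filter (\<lambda>p. fst p \<notin> {y, z}) \<Gamma>"
 have IH: "(f \<notin> {y, z} \<longrightarrow> ps_at ?H f (Arrow (Var x) A (Var b))) \<and> (f \<in> {y, z} \<longrightarrow> ps_at ?H w C)"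
  using ps_drop.IH[OF ps_drop.prems] .
 have bz: "b \<noteq> z" using wf ps_drop.prems(2) by (force simp: is_face_def)
 show ?case
 proof (cases "f = z")
  case True
  hence "b = y" using ctx_fun[of \<Gamma> z] wf ps_drop.prems(1) by blast
  thus ?thesis using IH True by simp
 next
  case fz: False
  show ?thesis
  proof (cases "f = y")
   case True
   have "(y, C) \<in> set \<Gamma>" using wf ps_drop.prems(1) by (auto elim!: var_typesE)
   hence C: "C = Arrow (Var x) A (Var b)" using wf True ctx_fun by blast
   hence "(b, A) \<in> set \<Gamma>" using wf True by (auto elim!: var_typesE)
   hence "b \<noteq> y" using ctx_fun[of \<Gamma> y A C] \<open>(y, C) \<in> set \<Gamma>\<close> wf C
    by (metis n_not_Suc_n tdim.simps(2))
   thus ?thesis using IH True C bz ps_at.ps_drop by blast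
  next
   case False
   hence "b \<noteq> y" using fz wf ps_drop.prems(3) by blast
   thus ?thesis using IH False fz bz ps_at.ps_drop by blast
  qed
 qed
next
 case (ps_extend \<Gamma> x A b f)
 note wf = ps_at_wf[OF ps_extend.hyps(1)]
 let ?F = "Arrow (Var x) A (Var b)"
 let ?H = "filter (\<lambda>p. fst p \<notin> {y, z}) \<Gamma>"
 show ?case
 proof (cases "z = f")
  case True
  hence "(z, Arrow (Var w) C (Var y)) = (f, ?F)" using ps_extend.prems(1) ps_extend.hyps vars_ctxI by auto
  hence e: "w = x" "C = A" "y = b" by auto
  have "?H = \<Gamma>" using True e ps_extend.hyps by (auto simp: filter_id_conv vars_ctx_def)
  thus ?thesis using e True ps_extend.hyps by simp
 next
  case False
  have zb: "z \<noteq> b" using ps_extend.prems(2) by (auto simp: is_face_def)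
  have z: "(z, Arrow (Var w) C (Var y)) \<in> set \<Gamma>" using ps_extend.prems False zb by auto
  hence yin: "y \<in> vars_ctx \<Gamma>" "z \<in> vars_ctx \<Gamma>" using wf var_types_vars[of \<Gamma> z] vars_ctxI by auto
  have "x \<noteq> y" using ps_extend.prems(4)[of f A "Var b"] by auto
  hence x: "x \<notin> {y, z}" using ps_extend.prems(2) by (auto simp: is_face_def)
  have "\<not> is_face \<Gamma> z" using ps_extend.prems(2) unfolding is_face_def by fastforce
  from ps_extend.IH[OF z this] have "ps_at ?H x A"
   using ps_extend.prems(3,4) x by (metis (no_types, lifting) Un_iff set_append)
  moreover have "b \<notin> {y, z}" "f \<notin> {y, z}" using yin ps_extend.hyps by auto
  ultimately show ?thesis
   using ps_at.ps_extend[of ?H x A b f] ps_extend.hyps by (auto simp: vars_ctx_def)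
 qed
qed auto

text \<open>The iterated targets of the current variable form the far end of the diagram in each
  dimension; an arrow can start there only after a further extension.\<close>

lemma tgtrel_not_source:
 assumes "ps_at \<Gamma> x A" "(x, w) \<in> (tgtrel \<Gamma>)\<^sup>*"
 shows "(g, Arrow (Var w) B u) \<notin> set \<Gamma>"
 using assms
proof (induction arbitrary: w g B u rule: ps_at.induct)
 case (ps_drop \<Gamma> f x A y)
 hence "(f, w) \<in> (tgtrel \<Gamma>)\<^sup>*" using ps_at_wf[OF ps_drop.hyps]
  by (intro converse_rtrancl_into_rtrancl[of f y]) (auto simp: tgtrel_def)
 thus ?case using ps_drop.IH by blast
next
 case (ps_extend \<Gamma> x A y f)
 note wf = ps_at_wf[OF ps_extend.hyps(1)]
 let ?F = "Arrow (Var x) A (Var y)"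
 let ?G = "\<Gamma> @ [(y, A), (f, ?F)]"
 note wf' = ps_at_wf[OF ps_at.ps_extend[OF ps_extend.hyps]]
 have xin: "x \<in> vars_ctx \<Gamma>" using wf vars_ctxI by blast
 show ?case
 proof
  assume g: "(g, Arrow (Var w) B u) \<in> set ?G"
  have gw: "w \<in> vars_ctx \<Gamma>"
   using g wf var_types_vars[of \<Gamma>] xin by fastforce
  hence "w \<noteq> f" "w \<noteq> y" using ps_extend.hyps by auto
  hence yw: "(y, w) \<in> (tgtrel ?G)\<^sup>*" using tgtrel_step[OF ps_extend.prems] wf' by auto
  then obtain b where b: "(y, b) \<in> tgtrel ?G" "(b, w) \<in> (tgtrel ?G)\<^sup>*"
   using \<open>w \<noteq> y\<close> by (metis converse_rtranclE)
  then obtain t C where A: "A = Arrow t C (Var b)"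
   using ps_extend.hyps vars_ctxI by (fastforce simp: tgtrel_def)
  have "(b, w) \<in> (tgtrel \<Gamma>)\<^sup>* \<and> b \<in> vars_ctx \<Gamma>" using b(2)
  proof (induction rule: rtrancl_induct)
   case base
   show ?case using A wf var_types_vars[of \<Gamma> x A b] by auto
  next
   case (step c d)
   hence "c \<in> vars_ctx \<Gamma>"
    by (metis (no_types, opaque_lifting) tgtrel_dim vars_ctxE vars_ctxI wf)
   hence "(c, d) \<in> tgtrel \<Gamma>" using step(2) ps_extend.hyps by (auto simp: tgtrel_def)
   thus ?case using step by auto
  qed
  \<comment> \<open>The variables \<open>x\<close> and \<open>y\<close> have the same target
    \<open>b\<close>, so the chain from \<open>y\<close> down to \<open>w\<close> can be started at
    \<open>x\<close>, where the induction hypothesis applies.\<close>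
  hence xw: "(x, w) \<in> (tgtrel \<Gamma>)\<^sup>*" and bw: "(b, w) \<in> (tgtrel \<Gamma>)\<^sup>*"
   using A wf by (auto intro!: converse_rtrancl_into_rtrancl[of x b] simp: tgtrel_def)
  have bC: "(b, C) \<in> set \<Gamma>" using A wf by (auto elim!: var_typesE)
  have "w \<noteq> x"
  proof
   assume "w = x"
   then obtain B where "(x, B) \<in> set \<Gamma>" "x = b \<or> tdim B < tdim C"
    using tgtrel_dim[OF bw _ _ bC] wf by auto
   moreover from this have "B = A" using wf ctx_fun by blast
   ultimately have "tdim A \<le> tdim C" using bC wf ctx_fun[of \<Gamma> x A C] by auto
   thus False using A by simp
  qed
  moreover have "(g, Arrow (Var w) B u) \<notin> set \<Gamma>" using ps_extend.IH[OF xw] .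
  moreover have "(g, Arrow (Var w) B u) \<noteq> (y, A)"
   using ps_extend.IH[OF xw, of x] wf by auto
  ultimately show False using g by auto
 qed
qed auto

text \<open>Since \<open>w\<close> is no target, the derivation cannot have descended to it, so
  \<open>z\<close> was attached immediately after \<open>w\<close> had been introduced. The variable
  \<open>y\<close> has the same type and can be introduced in the place of \<open>w\<close>.\<close>

lemma ps_remove_left:
 assumes "ps_at \<Gamma> d D" "(z, Arrow (Var w) C (Var y)) \<in> set \<Gamma>" "\<not> is_face \<Gamma> z"
  and "\<And>g t B. (g, Arrow t B (Var w)) \<notin> set \<Gamma>"
  and "\<And>g u B. (g, Arrow (Var w) B u) \<in> set \<Gamma> \<Longrightarrow> g = z"
 shows "(d \<noteq> z \<longrightarrow> ps_at (filter (\<lambda>p. fst p \<notin> {w, z}) \<Gamma>) d D) \<and>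
  (d = z \<longrightarrow> ps_at (filter (\<lambda>p. fst p \<notin> {w, z}) \<Gamma>) y C)"
 using assms
proof (induction rule: ps_at.induct)
 case (ps_drop \<Gamma> f x A b)
 note wf = ps_at_wf[OF ps_drop.hyps]
 let ?H = "filter (\<lambda>p. fst p \<notin> {w, z}) \<Gamma>"
 have IH: "(f \<noteq> z \<longrightarrow> ps_at ?H f (Arrow (Var x) A (Var b))) \<and> (f = z \<longrightarrow> ps_at ?H y C)"
  using ps_drop.IH[OF ps_drop.prems] .
 have bz: "b \<noteq> z" using wf ps_drop.prems(2) by (force simp: is_face_def)
 show ?case
 proof (cases "f = z")
  case True
  hence "b = y" "A = C" using ctx_fun[of \<Gamma> z] wf ps_drop.prems(1) by blast+
  thus ?thesis using IH True bz by simp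
 next
  case False
  thus ?thesis using IH bz ps_at.ps_drop by blast
 qed
next
 case (ps_extend \<Gamma> x A b f)
 note wf = ps_at_wf[OF ps_extend.hyps(1)]
 let ?F = "Arrow (Var x) A (Var b)"
 let ?H = "filter (\<lambda>p. fst p \<notin> {w, z}) \<Gamma>"
 show ?case
 proof (cases "z = f")
  case True
  hence "(z, Arrow (Var w) C (Var y)) = (f, ?F)" using ps_extend.prems(1) ps_extend.hyps vars_ctxI by auto
  hence e: "w = x" "C = A" "y = b" by auto
  have xb: "x \<noteq> b" "x \<noteq> f" using wf ps_extend.hyps vars_ctxI by blast+
  have "ps_at (?H @ [(b, A)]) b A" using ps_extend.hyps(1)
  proof (cases rule: ps_at.cases)
   case ps_point
   hence "?H @ [(b, A)] = [(b, Star)]" "A = Star" using e by auto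
   thus ?thesis using ps_at.ps_point by simp
  next
   case (ps_drop g a)
   thus ?thesis using ps_at_wf[OF ps_drop] ps_extend.prems(3)[of g] e by auto
  next
   case (ps_extend \<Gamma>0 x1 A1 y1)
   have n: "x \<notin> vars_ctx \<Gamma>0" "z \<notin> vars_ctx \<Gamma>0" "z \<noteq> y1" "z \<noteq> x" "x \<noteq> y1"
    using ps_extend True \<open>f \<notin> vars_ctx \<Gamma>\<close> by (auto simp: vars_ctx_def)
   hence "?H @ [(b, A)] = \<Gamma>0 @ [(y1, A1), (b, A)]"
    using ps_extend e by (auto simp: vars_ctx_def filter_id_conv)
   moreover have "b \<notin> vars_ctx \<Gamma>0" "b \<noteq> y1" using \<open>b \<notin> vars_ctx \<Gamma>\<close> ps_extend by (auto simp: vars_ctx_def)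
   ultimately show ?thesis using ps_at.ps_extend[of \<Gamma>0 x1 A1 y1 b] ps_extend by auto
  qed
  thus ?thesis using e True ps_extend.hyps xb by (auto simp: is_face_def)
 next
  case False
  have zb: "z \<noteq> b" "x \<noteq> z" using ps_extend.prems(2) by (auto simp: is_face_def)
  have z: "(z, Arrow (Var w) C (Var y)) \<in> set \<Gamma>" using ps_extend.prems False zb by auto
  hence yin: "w \<in> vars_ctx \<Gamma>" "z \<in> vars_ctx \<Gamma>" using wf var_types_vars[of \<Gamma> z] vars_ctxI by auto
  have "\<not> is_face \<Gamma> z" using ps_extend.prems(2) unfolding is_face_def by fastforce
  from ps_extend.IH[OF z this] have "ps_at ?H x A"
   using ps_extend.prems(3,4) zb by (metis (no_types, lifting) Un_iff set_append)
  moreover have "b \<notin> {w, z}" "f \<notin> {w, z}" using yin ps_extend.hyps by auto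
  ultimately show ?thesis
   using ps_at.ps_extend[of ?H x A b f] ps_extend.hyps by (auto simp: vars_ctx_def)
 qed
qed auto

subsection \<open>Canonical ps-contexts\<close>

lemma canonical_snoc2:
 "canonical (\<Gamma> @ [(y, A), (f, B)]) \<longleftrightarrow> canonical \<Gamma> \<and> y = length \<Gamma> \<and> f = Suc (length \<Gamma>)"
 by (auto simp: canonical_def)

lemma canonical_vars: "canonical \<Gamma> \<Longrightarrow> vars_ctx \<Gamma> = {..<length \<Gamma>}"
 unfolding canonical_def vars_ctx_def by (metis atLeast_upt list.set_map)

text \<open>A variable that enters as an arrow directly follows its target. A variable that enters
  as the new target of another arrow is a face.\<close>

lemma canonical_arrow:
 assumes "ps_at \<Gamma> x A" "canonical \<Gamma>" "(f, Arrow (Var a) C (Var b)) \<in> set \<Gamma>"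
 shows "a < b \<and> b < f \<and> (is_face \<Gamma> f \<or> f = Suc b)"
 using assms
proof (induction arbitrary: f a C b rule: ps_at.induct)
 case (ps_extend \<Gamma> x A y g)
 note wf = ps_at_wf[OF ps_extend.hyps(1)]
 have cn: "canonical \<Gamma>" "y = length \<Gamma>" "g = Suc (length \<Gamma>)" using ps_extend.prems by (auto simp: canonical_snoc2)
 have lt: "x < length \<Gamma>" using wf cn canonical_vars vars_ctxI by blast
 consider "(f, Arrow (Var a) C (Var b)) \<in> set \<Gamma>" | "f = y" "A = Arrow (Var a) C (Var b)"
  | "f = g" "a = x" "b = y" using ps_extend.prems by auto
 thus ?case
 proof cases
  case 1 thus ?thesis using ps_extend.IH[OF cn(1) 1] by (auto simp: is_face_def)
 next
  case 2
  hence "a < b" "b < x" using ps_extend.IH[OF cn(1), of x] wf by auto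
  thus ?thesis using 2 cn lt by (auto simp: is_face_def)
 next
  case 3 thus ?thesis using cn lt by simp
 qed
qed auto

text \<open>As long as a new \<open>w\<close> can end in \<open>x\<close>, the variable
  \<open>x\<close> is an iterated target of the current one, hence not yet a source. So
  \<open>w\<close> precedes whatever is attached at \<open>x\<close>.\<close>

lemma tgtrel_source_less:
 assumes "ps_at \<Gamma> d D" "canonical \<Gamma>" "(w, x) \<in> (tgtrel \<Gamma>)\<^sup>*" "(f, Arrow (Var x) A (Var y)) \<in> set \<Gamma>" "w \<in> vars_ctx \<Gamma>"
 shows "w < y"
 using assms
proof (induction arbitrary: w x A y f rule: ps_at.induct)
 case (ps_extend \<Gamma> d D b g)
 note wf = ps_at_wf[OF ps_extend.hyps(1)]
 let ?G = "\<Gamma> @ [(b, D), (g, Arrow (Var d) D (Var b))]"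
 have cn: "canonical \<Gamma>" "b = length \<Gamma>" "g = Suc (length \<Gamma>)" using ps_extend.prems by (auto simp: canonical_snoc2)
 have ns: "(g, x) \<notin> (tgtrel ?G)\<^sup>*"
  using tgtrel_not_source[OF ps_at.ps_extend[OF ps_extend.hyps]] ps_extend.prems(3) by blast
 have "(g, b) \<in> tgtrel ?G" by (auto simp: tgtrel_def)
 hence "w \<noteq> b" "w \<noteq> g" using ns ps_extend.prems(2) by (auto intro: converse_rtrancl_into_rtrancl)
 hence w: "w \<in> vars_ctx \<Gamma>" using ps_extend.prems(4) by (auto simp: vars_ctx_def)
 have wx: "(w, x) \<in> (tgtrel \<Gamma>)\<^sup>* \<and> x \<in> vars_ctx \<Gamma>" using ps_extend.prems(2)
 proof (induction rule: rtrancl_induct)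
  case (step c e)
  hence "(c, e) \<in> tgtrel \<Gamma>" using ps_extend.hyps by (auto simp: tgtrel_def vars_ctx_def)
  moreover from this have "e \<in> vars_ctx \<Gamma>" using wf by (auto simp: tgtrel_def intro: var_types_vars)
  ultimately show ?case using step by auto
 qed (use w in simp)
 consider "(f, Arrow (Var x) A (Var y)) \<in> set \<Gamma>" | "D = Arrow (Var x) A (Var y)"
  | "x = d" "y = b" using ps_extend.prems by auto
 thus ?case
 proof cases
  case 1 thus ?thesis using ps_extend.IH[OF cn(1) _ 1] wx w by blast
 next
  case 2
  thus ?thesis using ps_extend.IH[OF cn(1), of w x d A y] wf wx w by auto
 next
  case 3 thus ?thesis using cn w canonical_vars by auto
 qed
qed auto

lemma ps_last:
 assumes "ps_at \<Gamma> x A"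
 shows "\<Gamma> \<noteq> [] \<and> (fst (last \<Gamma>), x) \<in> (tgtrel \<Gamma>)\<^sup>*"
 using assms
proof (induction rule: ps_at.induct)
 case (ps_drop \<Gamma> f x A y)
 hence "(f, y) \<in> tgtrel \<Gamma>" using ps_at_wf[OF ps_drop.hyps] by (auto simp: tgtrel_def)
 thus ?case using ps_drop by auto
qed auto

lemma ps_map_mono:
 assumes "ps_at \<Gamma> x A" "canonical \<Gamma>" "ps_ctx \<Delta>" "canonical \<Delta>"
  and "\<And>v B. (v, B) \<in> set \<Gamma> \<Longrightarrow> g v \<in> vars_ctx \<Delta>"
  and "\<And>f a C b. (f, Arrow (Var a) C (Var b)) \<in> set \<Gamma> \<Longrightarrow> \<exists>C'. (g f, Arrow (Var (g a)) C' (Var (g b))) \<in> set \<Delta>"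
  and "Suc i < length \<Gamma>"
 shows "g i < g (Suc i)"
proof -
 obtain d D where D: "ps_at \<Delta> d D" using assms(3) by (auto simp: ps_ctx_def)
 show ?thesis using assms(1,2,5-)
 proof (induction rule: ps_at.induct)
  case (ps_extend \<Gamma> x A y f)
  let ?G = "\<Gamma> @ [(y, A), (f, Arrow (Var x) A (Var y))]"
  note wf = ps_at_wf[OF ps_extend.hyps(1)]
  have cn: "canonical \<Gamma>" "y = length \<Gamma>" "f = Suc (length \<Gamma>)"
   using ps_extend.prems(1) by (auto simp: canonical_snoc2)
  obtain C where C: "(g f, Arrow (Var (g x)) C (Var (g y))) \<in> set \<Delta>" using ps_extend.prems(3)[of f x A y] by auto
  have G: "\<exists>C'. (g h, Arrow (Var (g a)) C' (Var (g b))) \<in> set \<Delta>"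
   if "(h, Arrow (Var a) C (Var b)) \<in> set \<Gamma>" for h a C b
   using ps_extend.prems(3)[of h a C b] that by auto
  consider "Suc i < length \<Gamma>" | "Suc i = length \<Gamma>" | "i = length \<Gamma>" using ps_extend.prems(4) by fastforce
  thus ?case
  proof cases
   case 1
   thus ?thesis using ps_extend.IH[OF cn(1)] ps_extend.prems(2) G by (metis Un_iff set_append)
  next
   case 2
   have "fst (last \<Gamma>) = last (map fst \<Gamma>)" using ps_last[OF ps_extend.hyps(1)] by (simp add: last_map)
   also have "\<dots> = last [0..<Suc i]" using cn(1) unfolding canonical_def 2 by simp
   also have "\<dots> = i" by simp
   finally have "(i, x) \<in> (tgtrel \<Gamma>)\<^sup>*" using ps_last[OF ps_extend.hyps(1)] by simp
   hence "(g i, g x) \<in> (tgtrel \<Delta>)\<^sup>*"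
   proof (induction rule: rtrancl_induct)
    case (step a b)
    then obtain t B where "(a, Arrow t B (Var b)) \<in> set \<Gamma>" by (auto simp: tgtrel_def)
    moreover from this obtain a' where "t = Var a'" using wf by (auto elim: var_typesE)
    ultimately have "(g a, g b) \<in> tgtrel \<Delta>" using G by (fastforce simp: tgtrel_def)
    thus ?case using step by auto
   qed simp
   moreover have "i \<in> vars_ctx \<Gamma>" using cn(1) canonical_vars 2 by auto
   hence "g i \<in> vars_ctx \<Delta>" using ps_extend.prems(2) by (auto elim!: vars_ctxE)
   ultimately show ?thesis using tgtrel_source_less[OF D assms(4) _ C] cn 2 by auto
  next
   case 3
   thus ?thesis using canonical_arrow[OF D assms(4) C] cn by auto
  qed
 qed auto
qed

lemma ps_map_less:
 assumes "ps_ctx \<Gamma>" "canonical \<Gamma>" "ps_ctx \<Delta>" "canonical \<Delta>"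
  and "\<And>v B. (v, B) \<in> set \<Gamma> \<Longrightarrow> g v \<in> vars_ctx \<Delta>"
  and "\<And>f a C b. (f, Arrow (Var a) C (Var b)) \<in> set \<Gamma> \<Longrightarrow> \<exists>C'. (g f, Arrow (Var (g a)) C' (Var (g b))) \<in> set \<Delta>"
  and "i < j" "j < length \<Gamma>"
 shows "g i < g j"
proof -
 obtain x where x: "ps_at \<Gamma> x Star" using assms(1) by (auto simp: ps_ctx_def)
 have s: "g i < g (Suc i)" if "Suc i < length \<Gamma>" for i
  using that by (intro ps_map_mono[OF x assms(2-4)] assms(5,6))
 show ?thesis using assms(7,8)
 proof (induction rule: strict_inc_induct)
  case (base i)
  thus ?case using s by simp
 next
  case (step i)
  hence "Suc i < length \<Gamma>" by auto
  thus ?case using s[of i] step by simp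
 qed
qed

text \<open>An increasing surjection between initial segments of the natural numbers is the
  identity. In particular pasting schemes have no nontrivial automorphisms.\<close>

lemma ps_map_surj_id:
 assumes "ps_ctx \<Gamma>" "canonical \<Gamma>" "ps_ctx \<Delta>" "canonical \<Delta>"
  and "\<And>f a C b. (f, Arrow (Var a) C (Var b)) \<in> set \<Gamma> \<Longrightarrow> \<exists>C'. (g f, Arrow (Var (g a)) C' (Var (g b))) \<in> set \<Delta>"
  and "g ` vars_ctx \<Gamma> = vars_ctx \<Delta>"
 shows "length \<Gamma> = length \<Delta> \<and> (\<forall>i<length \<Gamma>. g i = i)"
proof -
 have less: "g i < g j" if "i < j" "j < length \<Gamma>" for i j
 proof (rule ps_map_less[OF assms(1-4) _ assms(5) that])
  show "g v \<in> vars_ctx \<Delta>" if "(v, B) \<in> set \<Gamma>" for v B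
   using that assms(6) vars_ctxI by blast
 qed
 hence inj: "inj_on g {..<length \<Gamma>}" unfolding inj_on_def by (metis lessThan_iff linorder_neqE_nat nat_neq_iff)
 have im: "g ` {..<length \<Gamma>} = {..<length \<Delta>}" using assms canonical_vars by metis
 hence len: "length \<Gamma> = length \<Delta>" using card_image[OF inj] by simp
 have le: "i \<le> g i" if "i < length \<Gamma>" for i using that
 proof (induction i)
  case (Suc i) thus ?case using less[of i "Suc i"] by auto
 qed simp
 have "g i = i" if "i < length \<Gamma>" for i
  using that
 proof (induction i rule: measure_induct_rule[where f = "\<lambda>i. length \<Gamma> - i"])
  case (less i)
  have "g i < length \<Gamma>" using less.prems im len by auto
  show ?case
  proof (rule ccontr)
   assume "g i \<noteq> i"
   hence lt: "i < g i" using le less.prems by (simp add: order_neq_le_trans)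
   hence "g (g i) = g i" using less.IH[of "g i"] \<open>g i < length \<Gamma>\<close> less.prems by simp
   thus False using inj_onD[OF inj, of "g i" i] lt \<open>g i < length \<Gamma>\<close> less.prems by auto
  qed
 qed
 thus ?thesis using len by blast
qed

text \<open>Several arrows may share a target, but then they are parallel: an extension either
  creates a fresh target or repeats a type that is already present.\<close>

lemma tgt_determines:
 assumes "ps_at \<Gamma> x A" "(f, Arrow t C (Var b)) \<in> set \<Gamma>" "(g, Arrow t' C' (Var b)) \<in> set \<Gamma>"
 shows "Arrow t C (Var b) = Arrow t' C' (Var b)"
 using assms
proof (induction arbitrary: f t C g t' C' b rule: ps_at.induct)
 case (ps_extend \<Gamma> x A y h)
 note wf = ps_at_wf[OF ps_extend.hyps(1)]
 have nb: "(k, Arrow s B (Var y)) \<notin> set \<Gamma>" for k s B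
  using wf ps_extend.hyps var_types_vars[of \<Gamma> k "Arrow s B (Var y)" y] by auto
 have nA: "A \<noteq> Arrow s B (Var y)" for s B using nb wf by blast
 have key: "\<exists>k. (k, Arrow s B (Var b)) \<in> set \<Gamma>"
  if "(l, Arrow s B (Var b)) \<in> set (\<Gamma> @ [(y, A), (h, Arrow (Var x) A (Var y))])" "b \<noteq> y" for l s B b
  using that wf by auto
 show ?case
 proof (cases "b = y")
  case True
  thus ?thesis using ps_extend.prems nb nA[of t C] nA[of t' C'] by auto
 next
  case False
  then obtain k l where "(k, Arrow t C (Var b)) \<in> set \<Gamma>" "(l, Arrow t' C' (Var b)) \<in> set \<Gamma>"
   using key ps_extend.prems by meson
  thus ?thesis using ps_extend.IH by blast
 qed
qed auto

lemma src_determines: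
 assumes "ps_at \<Gamma> x A" "(f, Arrow (Var a) C u) \<in> set \<Gamma>" "(g, Arrow (Var a) C' u') \<in> set \<Gamma>"
 shows "Arrow (Var a) C u = Arrow (Var a) C' u'"
 using assms
proof (induction arbitrary: f u C g u' C' a rule: ps_at.induct)
 case (ps_extend \<Gamma> x A y h)
 note wf = ps_at_wf[OF ps_extend.hyps(1)]
 have nb: "(k, Arrow (Var x) B s) \<notin> set \<Gamma>" for k s B
  using tgtrel_not_source[OF ps_extend.hyps(1)] by blast
 have nA: "A \<noteq> Arrow (Var x) B s" for s B using nb wf by blast
 have key: "\<exists>k. (k, Arrow (Var a) B s) \<in> set \<Gamma>"
  if "(l, Arrow (Var a) B s) \<in> set (\<Gamma> @ [(y, A), (h, Arrow (Var x) A (Var y))])" "a \<noteq> x" for l s B a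
  using that wf by auto
 show ?case
 proof (cases "a = x")
  case True
  thus ?thesis using ps_extend.prems nb nA[of C u] nA[of C' u'] by auto
 next
  case False
  then obtain k l where "(k, Arrow (Var a) C u) \<in> set \<Gamma>" "(l, Arrow (Var a) C' u') \<in> set \<Gamma>"
   using key ps_extend.prems by meson
  thus ?thesis using ps_extend.IH by blast
 qed
qed auto

text \<open>A second variable of a given type only arises when an extension puts a new target beside
  its source, and both are faces of the new arrow.\<close>

lemma parallel_face:
 assumes "ps_at \<Gamma> x A" "(f, B) \<in> set \<Gamma>" "(g, B) \<in> set \<Gamma>" "f \<noteq> g"
 shows "is_face \<Gamma> f"
 using assms
proof (induction arbitrary: f g B rule: ps_at.induct)
 case (ps_extend \<Gamma> x A y h)
 note wf = ps_at_wf[OF ps_extend.hyps(1)]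
 let ?F = "Arrow (Var x) A (Var y)"
 let ?G = "\<Gamma> @ [(y, A), (h, ?F)]"
 have F: "is_face ?G x" "is_face ?G y" by (auto simp: is_face_def)
 have old: "is_face \<Gamma> k \<Longrightarrow> is_face ?G k" for k by (auto simp: is_face_def)
 have nF: "(k, ?F) \<notin> set \<Gamma>" for k
  using wf ps_extend.hyps var_types_vars[of \<Gamma> k ?F y] by auto
 have nA: "A \<noteq> ?F" by (metis n_not_Suc_n tdim.simps(2))
 show ?case
 proof (cases "f = x \<or> f = y")
  case False
  hence fB: "(f, B) \<in> set \<Gamma> \<or> (f, B) = (h, ?F)" using ps_extend.prems by auto
  hence f: "(f, B) \<in> set \<Gamma>" using ps_extend.prems nF nA by auto
  hence "(g, B) \<in> set \<Gamma> \<or> B = A" using ps_extend.prems nF by auto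
  hence "\<exists>g'. (g', B) \<in> set \<Gamma> \<and> f \<noteq> g'" using wf False ps_extend.prems by auto
  thus ?thesis using ps_extend.IH f old by blast
 qed (use F in auto)
qed auto

lemma point_face:
 assumes "ps_at \<Gamma> x A" "(p, Star) \<in> set \<Gamma>"
 shows "\<Gamma> = [(p, Star)] \<or> is_face \<Gamma> p"
 using assms
proof (induction rule: ps_at.induct)
 case (ps_extend \<Gamma> x A y h)
 note wf = ps_at_wf[OF ps_extend.hyps(1)]
 show ?case
 proof (cases "p = y")
  case False
  hence "\<Gamma> = [(p, Star)] \<or> is_face \<Gamma> p" using ps_extend by auto
  moreover have "p = x" if "\<Gamma> = [(p, Star)]" using wf that by auto
  ultimately show ?thesis by (auto simp: is_face_def)
 qed (auto simp: is_face_def)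
qed auto

subsection \<open>Boundaries and supports\<close>

lemma var_types_face:
 assumes "var_types \<Gamma>" "(f, Arrow t C u) \<in> set \<Gamma>" "t = Var z \<or> u = Var z"
 shows "(z, C) \<in> set \<Gamma>"
 by (rule var_typesE[OF assms(1,2)]) (use assms(3) in auto)

definition cdim :: "ctx \<Rightarrow> nat" where
 "cdim \<Gamma> = Max ((\<lambda>p. tdim (snd p)) ` set \<Gamma>)"

lemma dim_ctx_cdim: "\<Gamma> \<noteq> [] \<Longrightarrow> dim_ctx \<Gamma> = int (cdim \<Gamma>)"
proof -
 assume ne: "\<Gamma> \<noteq> []"
 have "(\<lambda>(x, A). dim_ty A + 1) ` set \<Gamma> = int ` (\<lambda>p. tdim (snd p)) ` set \<Gamma>"
  by (auto simp: dim_ty_tdim image_image case_prod_beta)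
 thus ?thesis unfolding dim_ctx_def cdim_def
  using mono_Max_commute[of int "(\<lambda>p. tdim (snd p)) ` set \<Gamma>"] ne by (simp add: mono_def)
qed

lemma cdim_ge: "(x, A) \<in> set \<Gamma> \<Longrightarrow> tdim A \<le> cdim \<Gamma>"
 unfolding cdim_def by (rule Max_ge) force+

lemma cdim_attained: "\<Gamma> \<noteq> [] \<Longrightarrow> \<exists>x A. (x, A) \<in> set \<Gamma> \<and> tdim A = cdim \<Gamma>"
proof -
 assume "\<Gamma> \<noteq> []"
 hence "cdim \<Gamma> \<in> (\<lambda>p. tdim (snd p)) ` set \<Gamma>" unfolding cdim_def by (intro Max_in) auto
 thus ?thesis by force
qed

lemma mem_src_ctx:
 assumes "\<Gamma> \<noteq> []" "cdim \<Gamma> = Suc m"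
 shows "(x, A) \<in> set (src_ctx \<Gamma>) \<longleftrightarrow> (x, A) \<in> set \<Gamma> \<and> tdim A \<noteq> Suc m \<and>
  \<not> (tdim A = m \<and> (\<exists>f t B. (f, Arrow t B (Var x)) \<in> set \<Gamma> \<and> tdim B = m))"
 using assms dim_ctx_cdim[OF assms(1)] by (auto simp: src_ctx_def is_target_in_def dim_ty_tdim Let_def)

lemma mem_tgt_ctx:
 assumes "\<Gamma> \<noteq> []" "cdim \<Gamma> = Suc m"
 shows "(x, A) \<in> set (tgt_ctx \<Gamma>) \<longleftrightarrow> (x, A) \<in> set \<Gamma> \<and> tdim A \<noteq> Suc m \<and>
  \<not> (tdim A = m \<and> (\<exists>f B u. (f, Arrow (Var x) B u) \<in> set \<Gamma> \<and> tdim B = m))"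
 using assms dim_ctx_cdim[OF assms(1)] by (auto simp: tgt_ctx_def is_source_in_def dim_ty_tdim Let_def)

text \<open>If a variable over the source of \<open>c\<close> has been removed because it is the
  target of some \<open>f\<close>, then \<open>f\<close> is collapsed and the source of
  \<open>f\<close> has the same value and a smaller number; the descent ends at a variable which is
  kept. For targets the numbers increase instead.\<close>

lemma bd_prin:
 assumes ps: "ps_ctx \<Gamma>" "canonical \<Gamma>" and r: "asg r \<Gamma>" and c: "prin r (vars_ctx \<Gamma>) c"
  and m: "cdim \<Gamma> = Suc m"
 shows "prin r (vars_ctx (src_ctx \<Gamma>)) (sk m c)" and "prin r (vars_ctx (tgt_ctx \<Gamma>)) (tk m c)"
proof -
 obtain x where x: "ps_at \<Gamma> x Star" using ps(1) by (auto simp: ps_ctx_def)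
 note wf = ps_at_wf[OF x]
 have ne: "\<Gamma> \<noteq> []" using wf by auto
 note ms = mem_src_ctx[OF ne m] and mt = mem_tgt_ctx[OF ne m]
 have fb: "fst (r v) \<le> tdim B" if "(v, B) \<in> set \<Gamma>" for v B
  using r that unfolding asg_def by fast
 have ar: "r a = sk (tdim C) (r f) \<and> r b = tk (tdim C) (r f)" if "(f, Arrow (Var a) C (Var b)) \<in> set \<Gamma>" for f a C b
  using r that unfolding asg_def by blast
 obtain w0 B0 where w0: "(w0, B0) \<in> set \<Gamma>" "c = r w0" using c by (auto simp: prin_def elim!: vars_ctxE)
 have c1: "fst c \<le> Suc m" using fb[OF w0(1)] cdim_ge[OF w0(1)] m w0 by simp
 have up: "r v = c \<or> fst (r v) < fst c \<and> snd (r v) \<noteq> Idn" if "(v, B) \<in> set \<Gamma>" for v B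
  using c that vars_ctxI unfolding prin_def by blast
 from ps_shadow_aux[OF x r] obtain c' where c': "prin r (vars_ctx \<Gamma>) c'"
  and T: "\<And>w B. (w, B) \<in> set \<Gamma> \<Longrightarrow> Suc (tdim B) = fst c' \<Longrightarrow> r w = (tdim B, Tgt) \<Longrightarrow>
    (\<exists>f t. (f, Arrow t B (Var w)) \<in> set \<Gamma>)"
  and S: "\<And>w B. (w, B) \<in> set \<Gamma> \<Longrightarrow> Suc (tdim B) = fst c' \<Longrightarrow> r w = (tdim B, Src) \<Longrightarrow>
    (\<exists>f u. (f, Arrow (Var w) B u) \<in> set \<Gamma>)" by blast
 have cc: "c' = c" using prin_unique c c' by blast
 have len: "v < length \<Gamma>" if "(v, B) \<in> set \<Gamma>" for v B
  using that vars_ctxI canonical_vars[OF ps(2)] by blast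
 have below: "\<exists>w B. (w, B) \<in> set \<Gamma> \<and> tdim B \<le> m \<and> r w = sk m c" "\<exists>w B. (w, B) \<in> set \<Gamma> \<and> tdim B \<le> m \<and> r w = tk m c"
 proof -
  have "tdim B0 \<le> Suc m" using cdim_ge[OF w0(1)] m by simp
  then consider "tdim B0 \<le> m" | t C u where "B0 = Arrow t C u" "tdim C = m" by (cases B0) force+
  hence "(\<exists>w B. (w, B) \<in> set \<Gamma> \<and> tdim B \<le> m \<and> r w = sk m c) \<and> (\<exists>w B. (w, B) \<in> set \<Gamma> \<and> tdim B \<le> m \<and> r w = tk m c)"
  proof cases
   case 1
   hence "sk m c = c" "tk m c = c" using fb[OF w0(1)] w0 by (auto simp: sk_def tk_def)
   thus ?thesis using w0 1 by metis
  next
   case 2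
   then obtain a b where "t = Var a" "u = Var b" "(a, C) \<in> set \<Gamma>" "(b, C) \<in> set \<Gamma>"
    using w0 wf by (auto elim: var_typesE)
   thus ?thesis using ar 2 w0 by blast
  qed
  thus "\<exists>w B. (w, B) \<in> set \<Gamma> \<and> tdim B \<le> m \<and> r w = sk m c" "\<exists>w B. (w, B) \<in> set \<Gamma> \<and> tdim B \<le> m \<and> r w = tk m c"
   by auto
 qed
 have "\<exists>w'\<in>vars_ctx (src_ctx \<Gamma>). r w' = sk m c" if "(w, B) \<in> set \<Gamma>" "tdim B \<le> m" "r w = sk m c" for w B
  using that
 proof (induction w arbitrary: B rule: less_induct)
  case (less w)
  show ?case
  proof (cases "(w, B) \<in> set (src_ctx \<Gamma>)")
   case True
   thus ?thesis using vars_ctxI less.prems by blast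
  next
   case False
   then obtain f t C where f: "tdim B = m" "(f, Arrow t C (Var w)) \<in> set \<Gamma>" "tdim C = m"
    using ms less.prems by auto
   then obtain a where a: "t = Var a" "(a, C) \<in> set \<Gamma>" using wf by (auto elim: var_typesE)
   have "r w = tk m (r f)" "r a = sk m (r f)" using ar f a by auto
   moreover have "fst (r f) \<le> m"
   proof (rule ccontr)
    assume "\<not> fst (r f) \<le> m"
    hence "tk m (r f) = (m, Tgt)" "\<not> fst c \<le> m" using up[OF f(2)] by (auto simp: tk_def)
    thus False using less.prems(3) calculation by (simp add: sk_def)
   qed
   ultimately have "r a = sk m c" using less.prems(3) by (simp add: sk_def tk_def)
   moreover have "a < w" using canonical_arrow[OF x ps(2)] f a by blast
   ultimately show ?thesis using less.IH a f by (metis order_refl)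
  qed
 qed
 hence "sk m c \<in> r ` vars_ctx (src_ctx \<Gamma>)" using below(1) by (metis imageI)
 moreover have "r v = sk m c \<or> fst (r v) < fst (sk m c) \<and> snd (r v) \<noteq> Idn" if vin: "v \<in> vars_ctx (src_ctx \<Gamma>)" for v
 proof -
  obtain B where B: "(v, B) \<in> set (src_ctx \<Gamma>)" using vin by (rule vars_ctxE)
  hence v: "(v, B) \<in> set \<Gamma>" "tdim B \<le> m" using ms cdim_ge[of v B \<Gamma>] m by fastforce+
  show ?thesis
  proof (cases "fst c \<le> m")
   case True thus ?thesis using up[OF v(1)] by (simp add: sk_def)
  next
   case False
   hence s: "sk m c = (m, Src)" "fst c = Suc m" using c1 by (auto simp: sk_def)
   have lt: "fst (r v) \<le> m" "snd (r v) \<noteq> Idn" using fb[OF v(1)] v(2) up[OF v(1)] False by fastforce+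
   \<comment> \<open>By the invariant of the derivation, a variable of dimension \<open>m\<close>
     over the target is the target of a variable of maximal dimension, and so it is not in the
     source boundary.\<close>
   have "r v \<noteq> (m, Tgt)"
   proof
    assume a: "r v = (m, Tgt)"
    hence "tdim B = m" using fb[OF v(1)] v(2) by simp
    then obtain f t where "(f, Arrow t B (Var v)) \<in> set \<Gamma>" using T[OF v(1)] a s cc by auto
    thus False using B ms \<open>tdim B = m\<close> by blast
   qed
   thus ?thesis using lt s by (cases "r v"; cases "snd (r v)") auto
  qed
 qed
 ultimately show "prin r (vars_ctx (src_ctx \<Gamma>)) (sk m c)" by (simp add: prin_def)
 have "\<exists>w'\<in>vars_ctx (tgt_ctx \<Gamma>). r w' = tk m c" if "(w, B) \<in> set \<Gamma>" "tdim B \<le> m" "r w = tk m c" for w B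
  using that
 proof (induction "length \<Gamma> - w" arbitrary: w B rule: less_induct)
  case (less w)
  show ?case
  proof (cases "(w, B) \<in> set (tgt_ctx \<Gamma>)")
   case True
   thus ?thesis using vars_ctxI less.prems by blast
  next
   case False
   then obtain f u C where f: "tdim B = m" "(f, Arrow (Var w) C u) \<in> set \<Gamma>" "tdim C = m"
    using mt less.prems by auto
   then obtain b where b: "u = Var b" "(b, C) \<in> set \<Gamma>" using wf by (auto elim: var_typesE)
   have "r w = sk m (r f)" "r b = tk m (r f)" using ar f b by auto
   moreover have "fst (r f) \<le> m"
   proof (rule ccontr)
    assume "\<not> fst (r f) \<le> m"
    hence "sk m (r f) = (m, Src)" "\<not> fst c \<le> m" using up[OF f(2)] by (auto simp: sk_def)
    thus False using less.prems(3) calculation by (simp add: tk_def)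
   qed
   ultimately have "r b = tk m c" using less.prems(3) by (simp add: sk_def tk_def)
   moreover have "length \<Gamma> - b < length \<Gamma> - w"
    using canonical_arrow[OF x ps(2), of f w C b] f b len[OF b(2)] by auto
   ultimately show ?thesis using less.hyps b f by (metis order_refl)
  qed
 qed
 hence "tk m c \<in> r ` vars_ctx (tgt_ctx \<Gamma>)" using below(2) by (metis imageI)
 moreover have "r v = tk m c \<or> fst (r v) < fst (tk m c) \<and> snd (r v) \<noteq> Idn" if vin: "v \<in> vars_ctx (tgt_ctx \<Gamma>)" for v
 proof -
  obtain B where B: "(v, B) \<in> set (tgt_ctx \<Gamma>)" using vin by (rule vars_ctxE)
  hence v: "(v, B) \<in> set \<Gamma>" "tdim B \<le> m" using mt cdim_ge[of v B \<Gamma>] m by fastforce+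
  show ?thesis
  proof (cases "fst c \<le> m")
   case True thus ?thesis using up[OF v(1)] by (simp add: tk_def)
  next
   case False
   hence s: "tk m c = (m, Tgt)" "fst c = Suc m" using c1 by (auto simp: tk_def)
   have lt: "fst (r v) \<le> m" "snd (r v) \<noteq> Idn" using fb[OF v(1)] v(2) up[OF v(1)] False by fastforce+
   have "r v \<noteq> (m, Src)"
   proof
    assume a: "r v = (m, Src)"
    hence "tdim B = m" using fb[OF v(1)] v(2) by simp
    then obtain f u where "(f, Arrow (Var v) B u) \<in> set \<Gamma>" using S[OF v(1)] a s cc by auto
    thus False using B mt \<open>tdim B = m\<close> by blast
   qed
   thus ?thesis using lt s by (cases "r v"; cases "snd (r v)") auto
  qed
 qed
 ultimately show "prin r (vars_ctx (tgt_ctx \<Gamma>)) (tk m c)" by (simp add: prin_def)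
qed

lemma ps_prin:
 assumes "ps_ctx \<Gamma>" "asg r \<Gamma>"
 obtains c where "prin r (vars_ctx \<Gamma>) c"
 using assms ps_shadow_aux by (metis ps_ctx_def)

text \<open>A variable of maximal dimension cannot be a face, so there is a projection onto its
  globe.\<close>

lemma asg_top:
 assumes "ps_ctx \<Gamma>" "cdim \<Gamma> = Suc m"
 shows "\<exists>r. asg r \<Gamma> \<and> prin r (vars_ctx \<Gamma>) (Suc m, Idn)"
proof -
 obtain x where x: "ps_at \<Gamma> x Star" using assms(1) by (auto simp: ps_ctx_def)
 note wf = ps_at_wf[OF x]
 hence "\<Gamma> \<noteq> []" by auto
 then obtain z A where z: "(z, A) \<in> set \<Gamma>" "tdim A = Suc m" using cdim_attained[of \<Gamma>] assms(2) by auto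
 then obtain t B u where A: "A = Arrow t B u" "tdim B = m" by (cases A) auto
 have "\<not> is_face \<Gamma> z"
 proof
  assume "is_face \<Gamma> z"
  then obtain f t C u where f: "(f, Arrow t C u) \<in> set \<Gamma>" "t = Var z \<or> u = Var z" by (auto simp: is_face_def)
  hence "(z, C) \<in> set \<Gamma>" using wf var_types_face by blast
  hence "C = A" using z wf ctx_fun by blast
  thus False using cdim_ge[OF f(1)] z assms(2) by simp
 qed
 then obtain r where r: "asg r \<Gamma>" "r z = (Suc m, Idn)" "\<forall>w\<in>vars_ctx \<Gamma>. w \<noteq> z \<longrightarrow> fst (r w) \<le> m"
  using asg_peak[OF x] z A by blast
 obtain c where c: "prin r (vars_ctx \<Gamma>) c" using ps_prin assms(1) r(1) by blast
 have "z \<in> vars_ctx \<Gamma>" using z vars_ctxI by blast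
 hence "c = r z \<or> fst (r z) < fst c" using c by (auto simp: prin_def)
 moreover have "fst c \<le> Suc m" using c r unfolding prin_def by (metis imageE fst_conv le_SucI order_refl)
 ultimately have "c = (Suc m, Idn)" using r(2) by auto
 thus ?thesis using c r by blast
qed

section \<open>Images of terms under degenerate maps to a globe\<close>

lemma asg_faces:
 assumes "asg r \<Gamma>" "(x, A) \<in> set \<Gamma>" "y \<in> vars_ty A"
 shows "r y = r x \<or> fst (r y) < fst (r x) \<and> snd (r y) \<noteq> Idn"
 using assms(2,3)
proof (induction A arbitrary: x rule: tdim.induct)
 case (2 t A u)
 obtain a b where ab: "t = Var a" "u = Var b" "(a, A) \<in> set \<Gamma>" "(b, A) \<in> set \<Gamma>"
  using assms(1) 2(2) by (auto simp: asg_def elim: var_typesE)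
 hence r: "r a = sk (tdim A) (r x)" "r b = tk (tdim A) (r x)" using assms(1) 2(2) by (auto simp: asg_def)
 have a: "r a = r x \<or> fst (r a) < fst (r x) \<and> snd (r a) \<noteq> Idn" and b: "r b = r x \<or> fst (r b) < fst (r x) \<and> snd (r b) \<noteq> Idn"
  using r by (auto simp: sk_def tk_def)
 consider "y = a" | "y = b" | "y \<in> vars_ty A" using 2(3) ab by auto
 thus ?case
 proof cases
  case 3
  from 2(1)[OF ab(3) this] a show ?thesis by auto
 qed (use a b in auto)
qed auto

text \<open>The support of \<open>t\<close> has principal value \<open>c\<close>, and the supports
  of the two ends of its type have the source and target of \<open>c\<close>. So supports alone
  behave like values of a strict functor, although terms are not interpreted in any strict
  category.\<close>

definition shad :: "(nat \<Rightarrow> nat \<times> side) \<Rightarrow> tm \<Rightarrow> ty \<Rightarrow> nat \<times> side \<Rightarrow> bool" where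
 "shad r t A c \<longleftrightarrow> prin r (vars_typed t A) c \<and> fst c \<le> tdim A \<and>
   (\<forall>a B b. A = Arrow a B b \<longrightarrow>
    prin r (vars_typed a B) (sk (tdim B) c) \<and> prin r (vars_typed b B) (tk (tdim B) c))"

lemma shad_Var:
 assumes "asg r \<Gamma>" "(x, A) \<in> set \<Gamma>"
 shows "shad r (Var x) A (r x)"
proof -
 have p: "prin r (vars_typed (Var y) B) (r y)" if "(y, B) \<in> set \<Gamma>" for y B
  using asg_faces[OF assms(1) that] by (auto simp: prin_def vars_typed_def)
 have "prin r (vars_typed a B) (sk (tdim B) (r x)) \<and> prin r (vars_typed b B) (tk (tdim B) (r x))"
  if A: "A = Arrow a B b" for a B b
 proof -
  have "var_types \<Gamma>" using assms by (simp add: asg_def)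
  then obtain a' b' where ab: "a = Var a'" "b = Var b'" "(a', B) \<in> set \<Gamma>" "(b', B) \<in> set \<Gamma>"
   using assms(2) unfolding A by (rule var_typesE)
  moreover have "r a' = sk (tdim B) (r x)" "r b' = tk (tdim B) (r x)"
   using assms A ab by (auto simp: asg_def)
  ultimately show ?thesis using p by metis
 qed
 thus ?thesis using p[OF assms(2)] assms by (auto simp: shad_def asg_def)
qed

lemma vars_typed_subst:
 "vars_typed (subst_tm \<gamma> t) (subst_ty \<gamma> A) = (\<Union>x\<in>vars_typed t A. vars_tm (sv \<gamma> x))"
 by (auto simp: vars_typed_def vars_subst)

text \<open>Pulls an assignment back along a substitution. Principal values are unique, so the
  boundary clauses of \<open>shad\<close> make the values of the entries an assignment on
  \<open>\<Gamma>\<close> again, and principal values of closed sets of variables carry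
  over.\<close>

lemma shad_coh:
 assumes ps: "ps_ctx \<Gamma>" and g: "wf_sub \<Delta> \<gamma> \<Gamma>"
  and IH: "\<And>x A. (x, A) \<in> set \<Gamma> \<Longrightarrow> \<exists>c. shad r (sv \<gamma> x) (subst_ty \<gamma> A) c"
 shows "\<exists>r'. asg r' \<Gamma> \<and> (\<forall>U c. U \<subseteq> vars_ctx \<Gamma> \<longrightarrow> (\<forall>(x, A)\<in>set \<Gamma>. x \<in> U \<longrightarrow> vars_ty A \<subseteq> U) \<longrightarrow>
   prin r' U c \<longrightarrow> prin r (\<Union>x\<in>U. vars_tm (sv \<gamma> x)) c)"
proof -
 note wf = ps_ctx_wf[OF ps] and vt = ps_ctx_var_types[OF ps]
 define ty where "ty x = (THE A. (x, A) \<in> set \<Gamma>)" for x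
 have ty: "ty x = A" if "(x, A) \<in> set \<Gamma>" for x A
  using that ctx_fun[OF wf] unfolding ty_def by blast
 define r' where "r' x = (SOME c. shad r (sv \<gamma> x) (subst_ty \<gamma> (ty x)) c)" for x
 have r': "shad r (sv \<gamma> x) (subst_ty \<gamma> A) (r' x)" if "(x, A) \<in> set \<Gamma>" for x A
  unfolding r'_def using someI_ex[OF IH[OF that]] ty[OF that] by simp
 have "asg r' \<Gamma>"
  unfolding asg_def
 proof (intro conjI allI impI)
  show "\<forall>(f, B)\<in>set \<Gamma>. fst (r' f) \<le> tdim B" using r' by (fastforce simp: shad_def)
  fix f a C b assume f: "(f, Arrow (Var a) C (Var b)) \<in> set \<Gamma>"
  hence ab: "(a, C) \<in> set \<Gamma>" "(b, C) \<in> set \<Gamma>" using vt by (auto elim!: var_typesE)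
  have "prin r (vars_typed (sv \<gamma> a) (subst_ty \<gamma> C)) (sk (tdim C) (r' f))"
   "prin r (vars_typed (sv \<gamma> b) (subst_ty \<gamma> C)) (tk (tdim C) (r' f))"
   using r'[OF f] by (auto simp: shad_def)
  thus "r' a = sk (tdim C) (r' f)" "r' b = tk (tdim C) (r' f)"
   using r'[OF ab(1)] r'[OF ab(2)] prin_unique unfolding shad_def by blast+
 qed (rule vt)
 moreover have "prin r (\<Union>x\<in>U. vars_tm (sv \<gamma> x)) c"
  if U: "U \<subseteq> vars_ctx \<Gamma>" "\<forall>(x, A)\<in>set \<Gamma>. x \<in> U \<longrightarrow> vars_ty A \<subseteq> U" and c: "prin r' U c" for U c
 proof -
  \<comment> \<open>Since \<open>U\<close> is closed under faces, the types of the entries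
    contribute no variables beyond those of the entries themselves.\<close>
  have eq: "(\<Union>x\<in>U. vars_tm (sv \<gamma> x)) = (\<Union>x\<in>U. vars_typed (sv \<gamma> x) (subst_ty \<gamma> (ty x)))"
  proof
   show "(\<Union>x\<in>U. vars_tm (sv \<gamma> x)) \<subseteq> (\<Union>x\<in>U. vars_typed (sv \<gamma> x) (subst_ty \<gamma> (ty x)))"
    by (auto simp: vars_typed_def)
   show "(\<Union>x\<in>U. vars_typed (sv \<gamma> x) (subst_ty \<gamma> (ty x))) \<subseteq> (\<Union>x\<in>U. vars_tm (sv \<gamma> x))"
   proof (rule UN_least)
    fix x assume x: "x \<in> U"
    then obtain A where A: "(x, A) \<in> set \<Gamma>" using U(1) by (auto elim: vars_ctxE)
    hence "vars_ty (ty x) \<subseteq> U" using U(2) x ty by fastforce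
    thus "vars_typed (sv \<gamma> x) (subst_ty \<gamma> (ty x)) \<subseteq> (\<Union>x\<in>U. vars_tm (sv \<gamma> x))"
     using x by (auto simp: vars_typed_def vars_subst)
   qed
  qed
  have p: "prin r (vars_typed (sv \<gamma> x) (subst_ty \<gamma> (ty x))) (r' x)" if xU: "x \<in> U" for x
  proof -
   obtain A where A: "(x, A) \<in> set \<Gamma>" using U(1) xU by (auto elim: vars_ctxE)
   thus ?thesis using r'[OF A] ty[OF A] by (simp add: shad_def)
  qed
  show ?thesis unfolding eq prin_def
  proof (intro conjI ballI)
   obtain x where "x \<in> U" "c = r' x" using c by (auto simp: prin_def)
   thus "c \<in> r ` (\<Union>x\<in>U. vars_typed (sv \<gamma> x) (subst_ty \<gamma> (ty x)))"
    using p[of x] by (auto simp: prin_def)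
   fix w assume "w \<in> (\<Union>x\<in>U. vars_typed (sv \<gamma> x) (subst_ty \<gamma> (ty x)))"
   then obtain x where x: "x \<in> U" "w \<in> vars_typed (sv \<gamma> x) (subst_ty \<gamma> (ty x))" by blast
   hence "r w = r' x \<or> fst (r w) < fst (r' x) \<and> snd (r w) \<noteq> Idn" using p by (auto simp: prin_def)
   moreover have "r' x = c \<or> fst (r' x) < fst c \<and> snd (r' x) \<noteq> Idn" using c x by (auto simp: prin_def)
   ultimately show "r w = c \<or> fst (r w) < fst c \<and> snd (r w) \<noteq> Idn" by auto
  qed
 qed
 ultimately show ?thesis by blast
qed

lemma vars_sub_image:
 assumes "wf_sub \<Delta> \<gamma> \<Gamma>"
 shows "(\<Union>(x, t)\<in>set \<gamma>. vars_tm t) = (\<Union>x\<in>vars_ctx \<Gamma>. vars_tm (sv \<gamma> x))"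
proof -
 have "(x, t) \<in> set \<gamma> \<longleftrightarrow> x \<in> vars_ctx \<Gamma> \<and> t = sv \<gamma> x" for x t
  using wf_sub_in[OF assms] wf_sub_dom_set[OF assms] sv_in[OF wf_sub_distinct[OF assms]] by force
 thus ?thesis by fastforce
qed

text \<open>The cell \<open>c\<close> is the image of \<open>t\<close>, interpreted in the strict \<open>\<omega>\<close>-category on the globe.\<close>

lemma shadow:
 assumes "wf_tm \<Gamma> t A" "asg r \<Gamma>"
 shows "\<exists>c. shad r t A c"
proof -
 define Q where "Q t \<longleftrightarrow> (\<forall>\<Gamma> A r. wf_tm \<Gamma> t A \<longrightarrow> asg r \<Gamma> \<longrightarrow> (\<exists>c. shad r t A c))" for t
 have "Q t"
 \<comment> \<open>The predicate quantifies over contexts and assignments because the two ends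
   stored in the type of a coherence are interpreted over the context of the coherence, with the
   pulled-back assignment.\<close>
 proof (rule ty_tm_induct(2)[where P = "\<lambda>T. \<forall>a B b. T = Arrow a B b \<longrightarrow> Q a \<and> Q b"])
  show "Q (Var x)" for x using shad_Var unfolding wf_tm_Var Q_def by blast
 next
  fix k \<Gamma>' T and \<gamma> :: sub
  assume k: "k = Coh \<or> k = CohOp" and T: "\<forall>a B b. T = Arrow a B b \<longrightarrow> Q a \<and> Q b" and IH: "\<And>x t. (x, t) \<in> set \<gamma> \<Longrightarrow> Q t"
  show "Q (k \<Gamma>' T \<gamma>)" unfolding Q_def
  proof (intro allI impI)
   fix \<Gamma> A0 r assume w: "wf_tm \<Gamma> (k \<Gamma>' T \<gamma>) A0" and r: "asg r \<Gamma>"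
   have "\<exists>a A u. T = Arrow a A u \<and> A0 = Arrow (subst_tm \<gamma> a) (subst_ty \<gamma> A) (subst_tm \<gamma> u) \<and> ps_ctx \<Gamma>' \<and> canonical \<Gamma>' \<and> wf_sub \<Gamma> \<gamma> \<Gamma>' \<and>
    (wf_tm \<Gamma>' a A \<and> wf_tm \<Gamma>' u A \<and> vars_typed a A = vars_ctx \<Gamma>' \<and> vars_typed u A = vars_ctx \<Gamma>' \<or>
     dim_ctx \<Gamma>' \<noteq> 0 \<and> wf_tm (src_ctx \<Gamma>') a A \<and> wf_tm (tgt_ctx \<Gamma>') u A \<and>
     vars_typed a A = vars_ctx (src_ctx \<Gamma>') \<and> vars_typed u A = vars_ctx (tgt_ctx \<Gamma>'))"
    using w by (cases rule: wf_tm.cases) (use k in auto)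
   then obtain a A u where h: "T = Arrow a A u" "A0 = Arrow (subst_tm \<gamma> a) (subst_ty \<gamma> A) (subst_tm \<gamma> u)"
    "ps_ctx \<Gamma>'" "canonical \<Gamma>'" "wf_sub \<Gamma> \<gamma> \<Gamma>'"
    and d: "wf_tm \<Gamma>' a A \<and> wf_tm \<Gamma>' u A \<and> vars_typed a A = vars_ctx \<Gamma>' \<and> vars_typed u A = vars_ctx \<Gamma>' \<or>
     dim_ctx \<Gamma>' \<noteq> 0 \<and> wf_tm (src_ctx \<Gamma>') a A \<and> wf_tm (tgt_ctx \<Gamma>') u A \<and>
     vars_typed a A = vars_ctx (src_ctx \<Gamma>') \<and> vars_typed u A = vars_ctx (tgt_ctx \<Gamma>')" by blast
   have wa: "wf_tm \<Gamma>' a A" "wf_tm \<Gamma>' u A" using wf_coh_body[OF h(5)] d by auto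
   have sh: "\<exists>c. shad \<rho> a A c" "\<exists>c. shad \<rho> u A c" if "asg \<rho> \<Gamma>'" for \<rho> using T h(1) wa that unfolding Q_def by blast+
   have closed: "\<forall>(x, B)\<in>set \<Gamma>'. x \<in> vars_typed b A \<longrightarrow> vars_ty B \<subseteq> vars_typed b A" if "wf_tm \<Gamma>' b A" for b
    using vars_typed_closed[OF that] by blast
   have sub: "vars_typed b A \<subseteq> vars_ctx \<Gamma>'" if "wf_tm \<Gamma>' b A" for b
    using wf_vars(3)[OF that] wf_vars(2)[OF wf_tm_ty(3)[OF that]] by (auto simp: vars_typed_def)
   have "\<exists>c. shad r (sv \<gamma> x) (subst_ty \<gamma> B) c" if "(x, B) \<in> set \<Gamma>'" for x B
    using IH[OF wf_sub_in[OF h(5) vars_ctxI[OF that]]] wf_sub_sv[OF h(5) that] r unfolding Q_def by blast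
   from shad_coh[OF h(3,5) this] obtain r' where r': "asg r' \<Gamma>'"
    and tr: "\<And>U c. U \<subseteq> vars_ctx \<Gamma>' \<Longrightarrow> (\<forall>(x, A)\<in>set \<Gamma>'. x \<in> U \<longrightarrow> vars_ty A \<subseteq> U) \<Longrightarrow>
     prin r' U c \<Longrightarrow> prin r (\<Union>x\<in>U. vars_tm (sv \<gamma> x)) c" by blast
   have "\<exists>c. prin r' (vars_ctx \<Gamma>') c \<and> fst c \<le> Suc (tdim A) \<and>
    prin r' (vars_typed a A) (sk (tdim A) c) \<and> prin r' (vars_typed u A) (tk (tdim A) c)"
    using d
   proof (elim disjE conjE)
    \<comment> \<open>For \<open>tm_coh\<close> both ends have the principal value of the whole
      context. Its dimension is at most that of the ends, so it is its own source and target: the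
      coherence is sent to an identity.\<close>
    assume "vars_typed a A = vars_ctx \<Gamma>'" "vars_typed u A = vars_ctx \<Gamma>'"
    thus ?thesis using sh(1)[OF r'] by (auto simp: shad_def sk_def tk_def)
   next
    assume dm: "dim_ctx \<Gamma>' \<noteq> 0" and v: "vars_typed a A = vars_ctx (src_ctx \<Gamma>')" "vars_typed u A = vars_ctx (tgt_ctx \<Gamma>')"
    obtain m where m: "cdim \<Gamma>' = Suc m"
    proof -
     have "\<Gamma>' \<noteq> []" using h(3) ps_last by (auto simp: ps_ctx_def)
     hence "cdim \<Gamma>' \<noteq> 0" using dm dim_ctx_cdim by auto
     thus thesis using that not0_implies_Suc by blast
    qed
    have bd: "shad \<rho> a A (sk m c) \<and> shad \<rho> u A (tk m c)"
     if rc: "asg \<rho> \<Gamma>'" "prin \<rho> (vars_ctx \<Gamma>') c" for \<rho> c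
    proof -
     note b = bd_prin[OF h(3,4) rc m]
     obtain x y where "shad \<rho> a A x" "shad \<rho> u A y" using sh[OF rc(1)] by blast
     moreover from this have "x = sk m c" "y = tk m c" using b v prin_unique unfolding shad_def by metis+
     ultimately show ?thesis by blast
    qed
    \<comment> \<open>The rule \<open>tm_op\<close> does not record the dimension of its ends. A
      test assignment that reaches the top cell shows that it is \<open>m\<close>: in a higher
      dimension the common source of both ends would have two different principal values.\<close>
    obtain \<rho> where \<rho>: "asg \<rho> \<Gamma>'" "prin \<rho> (vars_ctx \<Gamma>') (Suc m, Idn)" using asg_top[OF h(3) m] by blast
    have top: "shad \<rho> a A (m, Src)" "shad \<rho> u A (m, Tgt)" using bd[OF \<rho>] by (auto simp: sk_def tk_def)
    have mA: "m = tdim A"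
    proof (rule ccontr)
     assume "m \<noteq> tdim A"
     moreover have "m \<le> tdim A" using top(1) by (auto simp: shad_def)
     ultimately have lt: "m < tdim A" by simp
     then obtain p B q where A: "A = Arrow p B q" by (cases A) auto
     hence "prin \<rho> (vars_typed p B) (m, Src)" "prin \<rho> (vars_typed p B) (m, Tgt)"
      using top lt by (auto simp: shad_def sk_def)
     thus False using prin_unique by blast
    qed
    obtain c where c: "prin r' (vars_ctx \<Gamma>') c" using ps_prin[OF h(3) r'] by blast
    obtain x B where "(x, B) \<in> set \<Gamma>'" "c = r' x" using c by (auto simp: prin_def elim!: vars_ctxE)
    hence "fst c \<le> tdim B" "tdim B \<le> cdim \<Gamma>'" using r' cdim_ge by (auto simp: asg_def)
    thus ?thesis using c m mA bd[OF r' c] by (intro exI[of _ c]) (simp add: shad_def)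
   qed
   then obtain c where c: "prin r' (vars_ctx \<Gamma>') c" "fst c \<le> Suc (tdim A)"
    "prin r' (vars_typed a A) (sk (tdim A) c)" "prin r' (vars_typed u A) (tk (tdim A) c)" by blast
   have "\<forall>(x, B)\<in>set \<Gamma>'. x \<in> vars_ctx \<Gamma>' \<longrightarrow> vars_ty B \<subseteq> vars_ctx \<Gamma>'"
    using var_types_vars[OF ps_ctx_var_types[OF h(3)]] by blast
   hence "prin r (\<Union>x\<in>vars_ctx \<Gamma>'. vars_tm (sv \<gamma> x)) c" using tr[OF _ _ c(1)] by simp
   moreover have "vars_typed (k \<Gamma>' T \<gamma>) A0 = (\<Union>x\<in>vars_ctx \<Gamma>'. vars_tm (sv \<gamma> x))"
   proof -
    have "vars_ty A0 \<subseteq> (\<Union>x\<in>vars_ctx \<Gamma>'. vars_tm (sv \<gamma> x))"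
     using sub[OF wa(1)] sub[OF wa(2)] unfolding h(2) by (auto simp: vars_typed_def vars_subst)
    thus ?thesis using k vars_sub_image[OF h(5)] by (auto simp: vars_typed_def)
   qed
   ultimately have "shad r (k \<Gamma>' T \<gamma>) A0 c"
    using c(2) tr[OF sub[OF wa(1)] closed[OF wa(1)] c(3)] tr[OF sub[OF wa(2)] closed[OF wa(2)] c(4)] h(2)
     vars_typed_subst[of \<gamma> a A] vars_typed_subst[of \<gamma> u A] by (simp add: shad_def)
   thus "\<exists>c. shad r (k \<Gamma>' T \<gamma>) A0 c" by blast
  qed
 qed auto
 thus ?thesis using assms unfolding Q_def by blast
qed

text \<open>A missing variable \<open>z\<close> of greatest dimension is no face. The projection
  onto its globe sends the support below the top cell, hence misses one side of the boundary of the
  globe. Among \<open>z\<close> and the variables of its dimension collapsed to that side, an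
  extremal one has a missing face to which nothing else is attached, and this pair can be
  removed.\<close>

lemma proper_support:
 assumes ps: "ps_ctx \<Gamma>" "canonical \<Gamma>" and t: "wf_tm \<Gamma> t A" "vars_typed t A \<noteq> vars_ctx \<Gamma>"
 shows "\<exists>U. vars_typed t A \<subseteq> U \<and> \<not> vars_ctx \<Gamma> \<subseteq> U \<and> ps_ctx (filter (\<lambda>p. fst p \<in> U) \<Gamma>)"
proof -
 obtain d where d: "ps_at \<Gamma> d Star" using ps(1) by (auto simp: ps_ctx_def)
 note wf = ps_at_wf[OF d]
 define S where "S = vars_typed t A"
 have Ssub: "S \<subseteq> vars_ctx \<Gamma>"
  using wf_vars(3)[OF t(1)] wf_vars(2)[OF wf_tm_ty(3)[OF t(1)]] by (auto simp: S_def vars_typed_def)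
 have face: "f \<notin> S" if "(f, Arrow t B u) \<in> set \<Gamma>" "t = Var z \<or> u = Var z" "z \<notin> S" for f t B u z
  using vars_typed_closed[OF t(1) _ that(1)] that unfolding S_def by auto
 have "vars_ctx \<Gamma> - S \<noteq> {}" "finite (vars_ctx \<Gamma> - S)" using t(2) Ssub S_def by (auto simp: vars_ctx_def)
 hence "\<exists>p. p \<in> set \<Gamma> \<and> fst p \<notin> S" by (auto simp: vars_ctx_def)
 from ex_has_greatest_nat[of "\<lambda>p. p \<in> set \<Gamma> \<and> fst p \<notin> S" _ "\<lambda>p. tdim (snd p)" "cdim \<Gamma>"] this
 obtain z B where z: "(z, B) \<in> set \<Gamma>" "z \<notin> S"
  and mx: "\<And>v C. (v, C) \<in> set \<Gamma> \<Longrightarrow> v \<notin> S \<Longrightarrow> tdim C \<le> tdim B"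
  using cdim_ge[of _ _ \<Gamma>] by (auto simp: le_eq_less_or_eq) (metis le_eq_less_or_eq surj_pair fst_conv snd_conv)
 have nf: "\<not> is_face \<Gamma> v" if "(v, C) \<in> set \<Gamma>" "v \<notin> S" "tdim C = tdim B" for v C
 proof
  assume "is_face \<Gamma> v"
  then obtain f t D u where f: "(f, Arrow t D u) \<in> set \<Gamma>" "t = Var v \<or> u = Var v" by (auto simp: is_face_def)
  hence "(v, D) \<in> set \<Gamma>" using wf var_types_face by blast
  hence "D = C" using that wf ctx_fun by blast
  thus False using mx[OF f(1) face[OF f that(2)]] that by simp
 qed
 \<comment> \<open>A missing point that is no face would be the whole context, but the image of a
   support has a principal value, so supports are never empty.\<close>
 have "B \<noteq> Star"
 proof
  assume "B = Star"
  hence "\<Gamma> = [(z, Star)]" using point_face[OF d, of z] z nf by auto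
  hence "S = {}" using Ssub z(2) by (auto simp: vars_ctx_def)
  moreover obtain r where "asg r \<Gamma>" using asg_start[OF d] by blast
  hence "S \<noteq> {}" using shadow[OF t(1)] by (auto simp: shad_def prin_def S_def)
  ultimately show False by blast
 qed
 then obtain t0 C u0 where B: "B = Arrow t0 C u0" by (cases B) auto
 let ?i = "tdim C"
 obtain r where r: "asg r \<Gamma>" "r z = (Suc ?i, Idn)" "\<forall>w\<in>vars_ctx \<Gamma>. w \<noteq> z \<longrightarrow> fst (r w) \<le> ?i"
  using asg_peak[OF d] z(1) nf[OF z] B by blast
 obtain c where c: "prin r S c" using shadow[OF t(1) r(1)] by (auto simp: shad_def S_def)
 have ci: "fst c \<le> ?i" using c r(3) z(2) Ssub unfolding prin_def by (metis imageE subsetD)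
 have ar: "r a = sk (tdim D) (r f) \<and> r b = tk (tdim D) (r f)" if "(f, Arrow (Var a) D (Var b)) \<in> set \<Gamma>" for f a D b
  using r that unfolding asg_def by blast
 have topz: "v = z" if "v \<in> vars_ctx \<Gamma>" "\<not> fst (r v) \<le> ?i" for v using r(3) that by blast
 let ?Z = "\<lambda>l. {v. \<exists>D. (v, D) \<in> set \<Gamma> \<and> tdim D = Suc ?i \<and> (v = z \<or> r v = (?i, l))}"
 have fin: "finite (?Z l)" for l by (rule finite_subset[of _ "fst ` set \<Gamma>"]) force+
 have zin: "z \<in> ?Z l" for l using z B by auto
 \<comment> \<open>The top cell is reached by \<open>z\<close> only, so the principal value of the
   support has dimension at most \<open>?i\<close>. It is the only value of its dimension, so not
   both sides in dimension \<open>?i\<close> occur.\<close>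
 consider "\<And>v. v \<in> S \<Longrightarrow> r v \<noteq> (?i, Tgt)" | "\<And>v. v \<in> S \<Longrightarrow> r v \<noteq> (?i, Src)"
  using c ci unfolding prin_def by (metis fst_conv not_le old.prod.inject side.distinct(1))
 thus ?thesis
 proof cases
  case 1
  \<comment> \<open>An arrow that starts at the target of \<open>z'\<close> and has its dimension
    would be collapsed to the same side and be numbered higher; the maximum excludes it.\<close>
  define z' where "z' = Max (?Z Tgt)"
  have "z' \<in> ?Z Tgt" unfolding z'_def using fin zin by (intro Max_in) auto
  then obtain D where D: "(z', D) \<in> set \<Gamma>" "tdim D = Suc ?i" "z' = z \<or> r z' = (?i, Tgt)" by auto
  have max: "v \<le> z'" if "v \<in> ?Z Tgt" for v unfolding z'_def using fin that by (intro Max_ge)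
  obtain ta E ub where "D = Arrow ta E ub" "tdim E = ?i" using D(2) by (cases D) auto
  moreover from this obtain a b where "ta = Var a" "ub = Var b" using wf D(1) by (auto elim!: var_typesE)
  ultimately have z': "(z', Arrow (Var a) E (Var b)) \<in> set \<Gamma>" "tdim E = ?i" using D by auto
  have miss: "z' \<notin> S" using D(3) z(2) 1 by auto
  have nfz: "\<not> is_face \<Gamma> z'" using nf[OF D(1) miss] D(2) B by simp
  have rb: "r b = (?i, Tgt)" using ar[OF z'(1)] D(3) r(2) z'(2) by (auto simp: tk_def)
  hence bS: "b \<notin> S" using 1 by blast
  have zb: "z' = Suc b" "a < b" using canonical_arrow[OF d ps(2) z'(1)] nfz by auto
  have onlyt: "g = z'" if g: "(g, Arrow t F (Var b)) \<in> set \<Gamma>" for g t F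
   using tgt_determines[OF d g z'(1)] parallel_face[OF d z'(1), of g] g nfz by metis
  have nosrc: "(g, Arrow (Var b) F u) \<notin> set \<Gamma>" for g F u
  proof
   assume g: "(g, Arrow (Var b) F u) \<in> set \<Gamma>"
   then obtain e where e: "u = Var e" using wf by (auto elim!: var_typesE)
   have "(b, F) \<in> set \<Gamma>" "(b, E) \<in> set \<Gamma>" using g z' wf var_types_face by blast+
   hence F: "F = E" using wf ctx_fun by blast
   have "r b = sk ?i (r g)" using ar g e F z'(2) by auto
   hence "r g = (?i, Tgt)" using rb by (auto simp: sk_def split: if_splits)
   hence "g \<le> z'" using g F z'(2) by (intro max) auto
   moreover have "b < e" "e < g" using canonical_arrow[OF d ps(2)] g e by auto
   ultimately show False using zb by simp
  qed
  have "d \<noteq> z'" using wf z'(1) ctx_fun by blast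
  have rem: "(d \<notin> {b, z'} \<longrightarrow> ps_at (filter (\<lambda>p. fst p \<notin> {b, z'}) \<Gamma>) d Star) \<and>
   (d \<in> {b, z'} \<longrightarrow> ps_at (filter (\<lambda>p. fst p \<notin> {b, z'}) \<Gamma>) a E)"
   by (rule ps_remove_right[OF d z'(1) nfz]) (use onlyt nosrc in blast)+
  have bE: "(b, E) \<in> set \<Gamma>" using z' wf var_types_face by blast
  have "\<exists>x. ps_at (filter (\<lambda>p. fst p \<notin> {b, z'}) \<Gamma>) x Star"
  proof (cases "d = b")
   case True
   hence "E = Star" using bE wf ctx_fun by blast
   thus ?thesis using rem True by blast
  next
   case False
   thus ?thesis using rem \<open>d \<noteq> z'\<close> by blast
  qed
  hence "ps_ctx (filter (\<lambda>p. fst p \<in> - {b, z'}) \<Gamma>)" by (simp add: ps_ctx_def)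
  moreover have "S \<subseteq> - {b, z'}" using bS miss by auto
  moreover have "\<not> vars_ctx \<Gamma> \<subseteq> - {b, z'}" using vars_ctxI[OF z'(1)] by auto
  ultimately show ?thesis unfolding S_def by blast
 next
  case 2
  \<comment> \<open>An arrow of this dimension that ends in the source \<open>a\<close> of
    \<open>z'\<close> would be collapsed to the same side. It would be no face, hence equal to
    \<open>Suc a\<close>, and come before \<open>z'\<close>; the minimum excludes it.\<close>
  define z' where "z' = Min (?Z Src)"
  have "z' \<in> ?Z Src" unfolding z'_def using fin zin by (intro Min_in) auto
  then obtain D where D: "(z', D) \<in> set \<Gamma>" "tdim D = Suc ?i" "z' = z \<or> r z' = (?i, Src)" by auto
  have min: "z' \<le> v" if "v \<in> ?Z Src" for v unfolding z'_def using fin that by (intro Min_le)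
  obtain ta E ub where "D = Arrow ta E ub" "tdim E = ?i" using D(2) by (cases D) auto
  moreover from this obtain a b where "ta = Var a" "ub = Var b" using wf D(1) by (auto elim!: var_typesE)
  ultimately have z': "(z', Arrow (Var a) E (Var b)) \<in> set \<Gamma>" "tdim E = ?i" using D by auto
  have miss: "v \<notin> S" if "v \<in> ?Z Src" for v using that z(2) 2 by auto
  have zm: "z' \<notin> S" using \<open>z' \<in> ?Z Src\<close> miss by blast
  have nfz: "\<not> is_face \<Gamma> z'" using nf[OF D(1) zm] D(2) B by simp
  have ra: "r a = (?i, Src)" using ar[OF z'(1)] D(3) r(2) z'(2) by (auto simp: sk_def)
  hence aS: "a \<notin> S" using 2 by blast
  have zb: "z' = Suc b" "a < b" using canonical_arrow[OF d ps(2) z'(1)] nfz by auto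
  have onlys: "g = z'" if g: "(g, Arrow (Var a) F u) \<in> set \<Gamma>" for g u F
   using src_determines[OF d g z'(1)] parallel_face[OF d z'(1), of g] g nfz by metis
  have notgt: "(g, Arrow t F (Var a)) \<notin> set \<Gamma>" for g F t
  proof
   assume g: "(g, Arrow t F (Var a)) \<in> set \<Gamma>"
   then obtain e where e: "t = Var e" using wf by (auto elim!: var_typesE)
   have "(a, F) \<in> set \<Gamma>" "(a, E) \<in> set \<Gamma>" using g z' wf var_types_face by blast+
   hence F: "F = E" using wf ctx_fun by blast
   have "r a = tk ?i (r g)" using ar g e F z'(2) by auto
   hence "r g = (?i, Src)" using ra by (auto simp: tk_def split: if_splits)
   hence gZ: "g \<in> ?Z Src" using g F z'(2) by auto
   hence "z' \<le> g" using min by blast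
   moreover have "\<not> is_face \<Gamma> g" using nf[OF g miss[OF gZ]] F z'(2) B by simp
   hence "g = Suc a" using canonical_arrow[OF d ps(2)] g e by auto
   ultimately show False using zb by simp
  qed
  have "d \<noteq> z'" using wf z'(1) ctx_fun by blast
  moreover have "(d \<noteq> z' \<longrightarrow> ps_at (filter (\<lambda>p. fst p \<notin> {a, z'}) \<Gamma>) d Star) \<and>
   (d = z' \<longrightarrow> ps_at (filter (\<lambda>p. fst p \<notin> {a, z'}) \<Gamma>) b E)"
   by (rule ps_remove_left[OF d z'(1) nfz]) (use onlys notgt in blast)+
  ultimately have "ps_at (filter (\<lambda>p. fst p \<notin> {a, z'}) \<Gamma>) d Star" by blast
  hence "ps_ctx (filter (\<lambda>p. fst p \<in> - {a, z'}) \<Gamma>)" by (auto simp: ps_ctx_def)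
  moreover have "S \<subseteq> - {a, z'}" using aS zm by auto
  moreover have "\<not> vars_ctx \<Gamma> \<subseteq> - {a, z'}" using vars_ctxI[OF z'(1)] by auto
  ultimately show ?thesis unfolding S_def by blast
 qed
qed

section \<open>The ps-context of a table of dimensions\<close>

text \<open>The first summand is treated as if it were glued in dimension 0 to the initial variable,
  so that all summands contribute new variables in the same way.\<close>

definition gl0 :: "table \<Rightarrow> nat \<Rightarrow> nat" where
 "gl0 T m = (case m of 0 \<Rightarrow> 0 | Suc m' \<Rightarrow> glue T m')"

lemma gl0_simps [simp]: "gl0 T 0 = 0" "gl0 T (Suc m) = glue T m"
 by (auto simp: gl0_def)

fun off :: "table \<Rightarrow> nat \<Rightarrow> nat" where
 "off T 0 = 1"
| "off T (Suc m) = off T m + 2 * (summand T m - gl0 T m)"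

text \<open>\<open>cvar T k m l\<close> is the name of the variable which corresponds to the \<open>k\<close>-cell \<open>(m, l)\<close> of the
 globular sum, and \<open>vty T k m\<close> is its type. The first \<open>off T m\<close> variables belong to the summands
 before the \<open>m\<close>-th one.\<close>

fun cvar :: "table \<Rightarrow> nat \<Rightarrow> nat \<Rightarrow> side \<Rightarrow> nat" where
 "cvar T k 0 l = (if l = Tgt then Suc (2 * k) else 2 * k)"
| "cvar T k (Suc m) l =
  (if k < glue T m then cvar T k m l
   else if k = glue T m \<and> l = Src then cvar T k m Tgt
   else if l = Tgt then off T (Suc m) + 2 * (k - glue T m)
   else off T (Suc m) + 2 * (k - glue T m) - 1)"

fun vty :: "table \<Rightarrow> nat \<Rightarrow> nat \<Rightarrow> ty" where
 "vty T 0 m = Star"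
| "vty T (Suc k) m = Arrow (Var (cvar T k m Src)) (vty T k m) (Var (cvar T k m Tgt))"

text \<open>The order is that of \<open>ps_extend\<close>: a target of dimension \<open>k\<close>,
  followed by the arrow of dimension \<open>Suc k\<close> over it, which becomes the source for the
  next pair.\<close>

definition seg :: "table \<Rightarrow> nat \<Rightarrow> ctx" where
 "seg T m = concat (map (\<lambda>k. [(cvar T k m Tgt, vty T k m), (cvar T (Suc k) m Src, vty T (Suc k) m)])
   [gl0 T m..<summand T m])"

definition ctxT :: "table \<Rightarrow> ctx" where
 "ctxT T = (0, Star) # concat (map (seg T) [0..<Suc (last_index T)])"

lemma tdim_vty [simp]: "tdim (vty T k m) = k"
 by (induction k) auto

lemma off_cong: "(\<And>m'. m' < m \<Longrightarrow> summand T m' = summand T' m' \<and> glue T m' = glue T' m') \<Longrightarrow> off T m = off T' m"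
proof (induction m)
 case (Suc m)
 hence "gl0 T m = gl0 T' m" by (cases m) auto
 thus ?case using Suc by auto
qed auto

lemma cvar_cong:
 "(\<And>m'. m' < m \<Longrightarrow> summand T m' = summand T' m' \<and> glue T m' = glue T' m') \<Longrightarrow> cvar T k m l = cvar T' k m l"
proof (induction m arbitrary: k l)
 case (Suc m)
 have "off T (Suc m) = off T' (Suc m)" by (rule off_cong) (use Suc.prems in auto)
 moreover have "cvar T k' m l' = cvar T' k' m l'" for k' l' by (rule Suc.IH) (use Suc.prems in auto)
 moreover have "glue T m = glue T' m" using Suc.prems by blast
 ultimately show ?case by (simp del: off.simps)
qed auto

lemma vty_cong:
 "(\<And>m'. m' < m \<Longrightarrow> summand T m' = summand T' m' \<and> glue T m' = glue T' m') \<Longrightarrow> vty T k m = vty T' k m"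
proof (induction k)
 case (Suc k)
 thus ?case using cvar_cong[of m T T'] by simp
qed auto

lemma vty_glue: "k \<le> glue T m \<Longrightarrow> vty T k (Suc m) = vty T k m"
 by (induction k) auto

text \<open>The variables that a summand adds come in pairs, the target in dimension
  \<open>k\<close> and the variable of dimension \<open>Suc k\<close> right after it.\<close>

lemma cvar_new:
 assumes "gl0 T m \<le> k"
 shows "cvar T k m Tgt = off T m + 2 * (k - gl0 T m)"
  and "cvar T (Suc k) m l = (if l = Tgt then off T m + 2 * (Suc k - gl0 T m) else Suc (off T m + 2 * (k - gl0 T m)))"
 using assms by (cases m; auto simp: Suc_diff_le simp del: off.simps(2))+

text \<open>The top cell of a globe occupies the number that a source of its dimension would
  have.\<close>

lemma cvar_Idn: "gl0 T m < k \<or> m = 0 \<Longrightarrow> cvar T k m Idn = cvar T k m Src"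
 by (cases m) auto

definition inc_last :: "table \<Rightarrow> table" where
 "inc_last T = (if snd T = [] then (Suc (fst T), [])
   else (fst T, butlast (snd T) @ [(fst (last (snd T)), Suc (snd (last (snd T))))]))"

text \<open>The effect of \<open>ps_extend\<close> at a current variable of dimension
  \<open>k\<close>: the last globe is raised if this variable is its top cell; otherwise a globe of
  dimension \<open>Suc k\<close> is glued on along an iterated target.\<close>

definition grow :: "table \<Rightarrow> nat \<Rightarrow> table" where
 "grow T k = (if k = summand T (last_index T) then inc_last T else (fst T, snd T @ [(k, Suc k)]))"

lemma summand_append:
 "m \<le> length es \<Longrightarrow> summand (i, es @ fs) m = summand (i, es) m"
 "summand (i, es @ [(j, k)]) (Suc (length es)) = k"
 by (auto simp: summand_def nth_append split: nat.splits)

lemma glue_append: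
 "m < length es \<Longrightarrow> glue (i, es @ fs) m = glue (i, es) m" "glue (i, es @ [(j, k)]) (length es) = j"
 by (auto simp: glue_def nth_append)

lemma table_cases:
 obtains (one) i where "T = (i, [])" | (snoc) i es j k where "T = (i, es @ [(j, k)])"
 by (metis prod.collapse rev_exhaust)

lemma inc_last:
 "last_index (inc_last T) = last_index T"
 "m < last_index T \<Longrightarrow> summand (inc_last T) m = summand T m"
 "m < last_index T \<Longrightarrow> glue (inc_last T) m = glue T m"
 "summand (inc_last T) (last_index T) = Suc (summand T (last_index T))"
 by (cases T rule: table_cases; auto simp: inc_last_def last_index_def summand_append glue_append less_Suc_eq;
   simp add: summand_def)+

lemma snoc_table:
 "last_index (fst T, snd T @ [(j, k)]) = Suc (last_index T)"
 "m \<le> last_index T \<Longrightarrow> summand (fst T, snd T @ [(j, k)]) m = summand T m"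
 "m < last_index T \<Longrightarrow> glue (fst T, snd T @ [(j, k)]) m = glue T m"
 "summand (fst T, snd T @ [(j, k)]) (Suc (last_index T)) = k"
 "glue (fst T, snd T @ [(j, k)]) (last_index T) = j"
 by (auto simp: last_index_def summand_append glue_append)

lemma is_tableD:
 "is_table T \<Longrightarrow> m < last_index T \<Longrightarrow> glue T m < summand T m \<and> glue T m < summand T (Suc m)"
 by (simp add: is_table_def)

lemma gl0_less: "is_table T \<Longrightarrow> m \<le> last_index T \<Longrightarrow> m \<noteq> 0 \<Longrightarrow> gl0 T m < summand T m"
 using is_tableD[of T "m - 1"] by (cases m) auto

lemma gl0_le: "is_table T \<Longrightarrow> m \<le> last_index T \<Longrightarrow> gl0 T m \<le> summand T m"
 using is_tableD[of T "m - 1"] by (cases m) auto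

lemma length_pre: "length (concat (map (seg T) [0..<m])) + 1 = off T m"
proof (induction m)
 case (Suc m)
 have "length (seg T m) = 2 * (summand T m - gl0 T m)"
  by (simp add: seg_def length_concat comp_def sum_list_triv)
 thus ?case using Suc by simp
qed simp

lemma length_ctxT: "length (ctxT T) = off T (Suc (last_index T))"
 using length_pre[of T "Suc (last_index T)"] by (simp add: ctxT_def)

lemma seg_cong:
 assumes "\<And>m'. m' < m \<Longrightarrow> summand T m' = summand T' m' \<and> glue T m' = glue T' m'" "summand T m = summand T' m"
 shows "seg T m = seg T' m"
proof -
 have "cvar T k m l = cvar T' k m l" "vty T k m = vty T' k m" for k l
  using cvar_cong vty_cong assms(1) by metis+
 moreover have "gl0 T m = gl0 T' m" using assms(1) by (cases m) auto
 ultimately show ?thesis using assms(2) unfolding seg_def by (simp del: vty.simps)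
qed

text \<open>The current variable of the derivation after descending to dimension \<open>k\<close>:
  the top cell of the last globe or one of its iterated targets.\<close>

definition cur :: "table \<Rightarrow> nat \<Rightarrow> nat" where
 "cur T k = cvar T k (last_index T) (if k = summand T (last_index T) then Src else Tgt)"

lemma grow_facts:
 assumes T: "is_table T" and k: "k \<le> summand T (last_index T)"
 defines "N \<equiv> length (ctxT T)" and "A \<equiv> vty T k (last_index T)"
 shows "is_table (grow T k)"
  and "ctxT (grow T k) = ctxT T @ [(N, A), (Suc N, Arrow (Var (cur T k)) A (Var N))]"
  and "summand (grow T k) (last_index (grow T k)) = Suc k"
  and "cur (grow T k) (Suc k) = Suc N" and "vty (grow T k) (Suc k) (last_index (grow T k)) = Arrow (Var (cur T k)) A (Var N)"
proof -
 let ?L = "last_index T"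
 have "is_table (grow T k) \<and> ctxT (grow T k) = ctxT T @ [(N, A), (Suc N, Arrow (Var (cur T k)) A (Var N))] \<and>
  summand (grow T k) (last_index (grow T k)) = Suc k \<and> cur (grow T k) (Suc k) = Suc N \<and>
  vty (grow T k) (Suc k) (last_index (grow T k)) = Arrow (Var (cur T k)) A (Var N)"
 proof (cases "k = summand T ?L")
  case True
  let ?T = "inc_last T"
  have g: "grow T k = ?T" using True by (simp add: grow_def)
  note inc = inc_last[where T = T]
  have same: "summand ?T m = summand T m \<and> glue ?T m = glue T m" if "m < ?L" for m
   using inc that by simp
  have "is_table ?T" unfolding is_table_def
  proof (intro allI impI)
   fix m assume "m < last_index ?T"
   hence m: "m < ?L" using inc by simp
   thus "glue ?T m < summand ?T m \<and> glue ?T m < summand ?T (Suc m)"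
    using is_tableD[OF T m] same[OF m] same[of "Suc m"] inc by (cases "Suc m = ?L") auto
  qed
  moreover have cv: "cvar ?T k' m l = cvar T k' m l" "vty ?T k' m = vty T k' m" "off ?T m = off T m" "gl0 ?T m = gl0 T m"
   if "m \<le> ?L" for k' m l
  proof -
   have "\<And>m'. m' < m \<Longrightarrow> summand ?T m' = summand T m' \<and> glue ?T m' = glue T m'" using same that by auto
   thus "cvar ?T k' m l = cvar T k' m l" "vty ?T k' m = vty T k' m" "off ?T m = off T m" "gl0 ?T m = gl0 T m"
    using cvar_cong[of m ?T T] vty_cong[of m ?T T] off_cong[of m ?T T] by (blast, blast, blast, cases m, auto)
  qed
  have sg: "seg ?T m = seg T m" if "m < ?L" for m using same that by (intro seg_cong) auto
  have N: "N = cvar T k ?L Tgt" "Suc N = cvar T (Suc k) ?L Src"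
  proof -
   have "N = off T ?L + 2 * (k - gl0 T ?L)" using True by (simp add: N_def length_ctxT)
   thus "N = cvar T k ?L Tgt" "Suc N = cvar T (Suc k) ?L Src"
    using cvar_new[of T ?L k] gl0_le[OF T] True by auto
  qed
  have "seg ?T ?L = seg T ?L @ [(N, A), (Suc N, Arrow (Var (cur T k)) A (Var N))]"
   unfolding seg_def using cv[of ?L] inc True gl0_le[OF T, of ?L] N by (simp add: A_def cur_def)
  hence "ctxT ?T = ctxT T @ [(N, A), (Suc N, Arrow (Var (cur T k)) A (Var N))]"
  proof -
   have "map (seg ?T) [0..<?L] = map (seg T) [0..<?L]" using sg by (intro map_cong) auto
   hence "concat (map (seg ?T) [0..<?L]) = concat (map (seg T) [0..<?L])" by (rule arg_cong)
   thus ?thesis using \<open>seg ?T ?L = _\<close> inc by (simp add: ctxT_def)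
  qed
  moreover have "cur ?T (Suc k) = Suc N" using inc True cv[of ?L] N by (simp add: cur_def)
  moreover have "vty ?T (Suc k) ?L = Arrow (Var (cur T k)) A (Var N)"
   using cv[of ?L] True N by (simp add: cur_def A_def)
  ultimately show ?thesis using g inc True by simp
 next
  case False
  let ?T = "(fst T, snd T @ [(k, Suc k)])"
  have g: "grow T k = ?T" using False by (simp add: grow_def)
  note sn = snoc_table[where T = T and j = k and k = "Suc k"]
  have kl: "k < summand T ?L" using False k by simp
  have same: "summand ?T m = summand T m \<and> (m < ?L \<longrightarrow> glue ?T m = glue T m)" if "m \<le> ?L" for m
   using sn that by simp
  have tab: "is_table ?T" unfolding is_table_def
  proof (intro allI impI)
   fix m assume "m < last_index ?T"
   then consider "m < ?L" | "m = ?L" using sn by fastforce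
   thus "glue ?T m < summand ?T m \<and> glue ?T m < summand ?T (Suc m)"
   proof cases
    case 1
    thus ?thesis using is_tableD[OF T 1] same[of m] same[of "Suc m"] by simp
   next
    case 2
    thus ?thesis using sn kl by simp
   qed
  qed
  have cv: "cvar ?T k' m l = cvar T k' m l" "vty ?T k' m = vty T k' m" "off ?T m = off T m"
   if "m \<le> ?L" for k' m l
  proof -
   have "\<And>m'. m' < m \<Longrightarrow> summand ?T m' = summand T m' \<and> glue ?T m' = glue T m'" using same that by auto
   thus "cvar ?T k' m l = cvar T k' m l" "vty ?T k' m = vty T k' m" "off ?T m = off T m"
    using cvar_cong[of m ?T T] vty_cong[of m ?T T] off_cong[of m ?T T] by blast+
  qed
  have sg: "seg ?T m = seg T m" if "m < Suc ?L" for m using same that by (intro seg_cong) auto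
  have o: "off ?T (Suc ?L) = N"
  proof -
   have "gl0 ?T ?L = gl0 T ?L" using same by (cases ?L) auto
   thus ?thesis using cv(3)[of ?L] same[of ?L] by (simp add: N_def length_ctxT)
  qed
  have vt: "vty ?T k (Suc ?L) = A" using vty_glue[of k ?T ?L] cv(2)[of ?L] sn by (simp add: A_def)
  have N: "cvar ?T k (Suc ?L) Tgt = N" "cvar ?T (Suc k) (Suc ?L) Src = Suc N" "cvar ?T k (Suc ?L) Src = cur T k"
   using cvar_new[of ?T "Suc ?L" k] sn o cv(1)[of ?L] False by (auto simp: cur_def simp del: off.simps)
  have "seg ?T (Suc ?L) = [(N, A), (Suc N, Arrow (Var (cur T k)) A (Var N))]"
   unfolding seg_def using sn vt N by (simp del: cvar.simps off.simps)
  moreover have "map (seg ?T) [0..<Suc ?L] = map (seg T) [0..<Suc ?L]" using sg by (intro map_cong) auto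
  moreover from this have "concat (map (seg ?T) [0..<Suc ?L]) = concat (map (seg T) [0..<Suc ?L])" by (rule arg_cong)
  ultimately have "ctxT ?T = ctxT T @ [(N, A), (Suc N, Arrow (Var (cur T k)) A (Var N))]"
   using sn(1) upt_Suc_append[of 0 "Suc ?L"] by (simp only: ctxT_def map_append concat_append) simp
  moreover have "cur ?T (Suc k) = Suc N" using sn N by (simp add: cur_def del: cvar.simps off.simps)
  moreover have "vty ?T (Suc k) (Suc ?L) = Arrow (Var (cur T k)) A (Var N)"
   using vt N by (simp del: cvar.simps off.simps)
  ultimately show ?thesis using g sn tab by (simp del: cvar.simps off.simps vty.simps)
 qed
 thus "is_table (grow T k)"
  and "ctxT (grow T k) = ctxT T @ [(N, A), (Suc N, Arrow (Var (cur T k)) A (Var N))]"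
  and "summand (grow T k) (last_index (grow T k)) = Suc k"
  and "cur (grow T k) (Suc k) = Suc N" and "vty (grow T k) (Suc k) (last_index (grow T k)) = Arrow (Var (cur T k)) A (Var N)"
  by auto
qed

text \<open>The last extension is undone by lowering the last globe, or by dropping it when this
  would bring it down to the dimension of its gluing.\<close>

lemma table_grow:
 assumes "is_table T"
 shows "T = (0, []) \<or> (\<exists>T0 k. is_table T0 \<and> k \<le> summand T0 (last_index T0) \<and> T = grow T0 k)"
proof (cases T rule: table_cases)
 case (one i)
 show ?thesis
 proof (cases i)
  case (Suc j)
  hence "T = grow (j, []) j" "is_table (j, [])" "j \<le> summand (j, []) (last_index (j, []))"
   using one by (auto simp: grow_def inc_last_def is_table_def last_index_def summand_def)
  thus ?thesis by blast
 qed (use one in simp)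
next
 case (snoc i es j k)
 note tb = is_tableD[OF assms]
 have L: "last_index T = Suc (length es)" using snoc by (simp add: last_index_def)
 have jk: "j < k" "j < summand (i, es) (length es)" using tb[of "length es"] snoc L
  by (auto simp: summand_append glue_append)
 have old: "glue (i, es) m < summand (i, es) m \<and> glue (i, es) m < summand (i, es) (Suc m)" if "m < length es" for m
  using tb[of m] that snoc L by (auto simp: summand_append glue_append)
 show ?thesis
 proof (cases "k = Suc j")
  case True
  have "is_table (i, es)" using old by (simp add: is_table_def last_index_def)
  moreover have "T = grow (i, es) j" using snoc True jk by (simp add: grow_def last_index_def)
  ultimately show ?thesis using jk by (intro disjI2 exI[of _ "(i, es)"] exI[of _ j]) (simp add: last_index_def)
 next
  case False
  then obtain k' where k': "k = Suc k'" "j < k'" using jk by (cases k) auto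
  let ?T = "(i, es @ [(j, k')])"
  have "is_table ?T" unfolding is_table_def
  proof (intro allI impI)
   fix m assume "m < last_index ?T"
   then consider "m < length es" | "m = length es" by (fastforce simp: last_index_def)
   thus "glue ?T m < summand ?T m \<and> glue ?T m < summand ?T (Suc m)"
    by cases (use old jk k' in \<open>auto simp: summand_append glue_append\<close>)
  qed
  moreover have "summand ?T (last_index ?T) = k'" by (simp add: last_index_def summand_append)
  moreover from this have "T = grow ?T k'" using snoc k' by (simp add: grow_def inc_last_def)
  ultimately show ?thesis by (metis order_refl)
 qed
qed

lemma table_induct [consumes 1, case_names point grow]:
 assumes "is_table T" "P (0, [])"
  and "\<And>T k. is_table T \<Longrightarrow> k \<le> summand T (last_index T) \<Longrightarrow> P T \<Longrightarrow> P (grow T k)"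
 shows "P T"
 using assms(1)
proof (induction "length (ctxT T)" arbitrary: T rule: less_induct)
 case less
 from table_grow[OF less.prems] show ?case
 proof (elim disjE exE conjE)
  fix T0 k assume T0: "is_table T0" "k \<le> summand T0 (last_index T0)" "T = grow T0 k"
  hence "length (ctxT T0) < length (ctxT T)" using grow_facts(2)[OF T0(1,2)] by simp
  thus "P T" using less.hyps T0 assms(3) by blast
 qed (use assms in simp)
qed

lemma ctxT_point [simp]: "ctxT (0, []) = [(0, Star)]"
 by (simp add: ctxT_def last_index_def seg_def summand_def)

lemma ctxT_ne [simp]: "ctxT T \<noteq> []"
 by (simp add: ctxT_def)

text \<open>Claimed for every dimension up to that of the last globe, because the next extension may
  take place at any of them; the lower ones follow by \<open>ps_drop\<close>.\<close>

lemma ps_ctxT: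
 assumes "is_table T"
 shows "canonical (ctxT T) \<and> (\<forall>k\<le>summand T (last_index T). ps_at (ctxT T) (cur T k) (vty T k (last_index T)))"
 using assms
proof (induction rule: table_induct)
 case point
 show ?case by (auto simp: canonical_def summand_def last_index_def cur_def intro: ps_point)
next
 case (grow T k)
 note g = grow_facts[OF grow.hyps]
 let ?T = "grow T k"
 have cn: "canonical (ctxT ?T)" using grow.IH g(2) by (simp add: canonical_snoc2)
 have vs: "vars_ctx (ctxT T) = {..<length (ctxT T)}" using grow.IH canonical_vars by blast
 have top: "ps_at (ctxT ?T) (cur ?T (Suc k)) (vty ?T (Suc k) (last_index ?T))"
  unfolding g(2,4,5) using grow vs by (intro ps_extend) auto
 have "ps_at (ctxT ?T) (cur ?T j) (vty ?T j (last_index ?T))" if "j \<le> Suc k" for j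
  using that
 proof (induction rule: inc_induct)
  case base show ?case by (rule top)
 next
  case (step n)
  hence "cur ?T n = cvar ?T n (last_index ?T) Tgt" using g(3) by (simp add: cur_def)
  thus ?case using step.IH by (auto intro: ps_drop)
 qed
 thus ?case using cn g(3) by simp
qed

lemma ctxT_canonical: "is_table T \<Longrightarrow> canonical (ctxT T)"
 and ctxT_ps: "is_table T \<Longrightarrow> ps_ctx (ctxT T)"
 using ps_ctxT[of T] by (auto simp: ps_ctx_def) (metis le0 vty.simps(1))

text \<open>Derivations and tables are built in step: \<open>ps_extend\<close> is
  \<open>grow\<close>, and \<open>ps_drop\<close> leaves the table alone and lowers the dimension of
  the current variable.\<close>

lemma ctxT_surj_aux:
 assumes "ps_at \<Gamma> x A" "canonical \<Gamma>"
 shows "\<exists>T. is_table T \<and> \<Gamma> = ctxT T \<and> tdim A \<le> summand T (last_index T) \<and>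
  A = vty T (tdim A) (last_index T) \<and> x = cur T (tdim A)"
 using assms
proof (induction rule: ps_at.induct)
 case (ps_point x)
 hence "x = 0" by (simp add: canonical_def)
 thus ?case by (intro exI[of _ "(0, [])"]) (simp add: is_table_def last_index_def summand_def cur_def)
next
 case (ps_drop \<Gamma> f x A y)
 then obtain T where T: "is_table T" "\<Gamma> = ctxT T" "Suc (tdim A) \<le> summand T (last_index T)"
  "Arrow (Var x) A (Var y) = vty T (Suc (tdim A)) (last_index T)" by auto
 thus ?case by (intro exI[of _ T]) (auto simp: cur_def)
next
 case (ps_extend \<Gamma> x A y f)
 hence cn: "canonical \<Gamma>" "y = length \<Gamma>" "f = Suc (length \<Gamma>)" by (auto simp: canonical_snoc2)
 then obtain T where T: "is_table T" "\<Gamma> = ctxT T" "tdim A \<le> summand T (last_index T)"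
  "A = vty T (tdim A) (last_index T)" "x = cur T (tdim A)" using ps_extend.IH by blast
 note g = grow_facts[OF T(1,3)]
 show ?case using g T cn by (intro exI[of _ "grow T (tdim A)"]) auto
qed

lemma ctxT_surj: "ps_ctx \<Gamma> \<Longrightarrow> canonical \<Gamma> \<Longrightarrow> \<exists>T. is_table T \<and> \<Gamma> = ctxT T"
 using ctxT_surj_aux by (metis ps_ctx_def)

text \<open>The last two entries of the context show the dimension of the last extension, so both
  tables can be taken apart together.\<close>

lemma ctxT_inj:
 assumes "is_table T" "is_table T'" "ctxT T = ctxT T'"
 shows "T = T'"
 using assms
proof (induction arbitrary: T' rule: table_induct)
 case point
 from table_grow[OF point(1)] show ?case
 proof (elim disjE exE conjE)
  fix T0 k assume T0: "is_table T0" "k \<le> summand T0 (last_index T0)" "T' = grow T0 k"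
  thus ?thesis using grow_facts(2)[OF T0(1,2)] point(2) by simp
 qed simp
next
 case (grow T k)
 note g = grow_facts(2)[OF grow.hyps]
 from table_grow[OF grow.prems(1)] show ?case
 proof (elim disjE exE conjE)
  assume "T' = (0, [])"
  thus ?thesis using g grow.prems by simp
 next
  fix T0 j assume T0: "is_table T0" "j \<le> summand T0 (last_index T0)" "T' = grow T0 j"
  note g0 = grow_facts(2)[OF T0(1,2)]
  have e: "ctxT T = ctxT T0" "vty T k (last_index T) = vty T0 j (last_index T0)"
   using g g0 grow.prems T0(3) by auto
  hence "T = T0" using grow.IH T0 by blast
  moreover have "k = j" using arg_cong[OF e(2), of tdim] by simp
  ultimately show ?thesis using T0 by simp
 qed
qed

subsection \<open>Cells of globular sums are variables\<close>

lemma globe_hom_iff: "l \<in> globe_hom k i \<longleftrightarrow> (k < i \<and> (l = Src \<or> l = Tgt)) \<or> (k = i \<and> l = Idn)"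
 by (auto simp: globe_hom_def)

lemma mem_sum_cells: "(m, l) \<in> sum_cells T k \<longleftrightarrow> m \<le> last_index T \<and> l \<in> globe_hom k (summand T m)"
 by (simp add: sum_cells_def)

lemma mem_ctxT_list:
 "p \<in> set (ctxT T) \<longleftrightarrow> p = (0, Star) \<or> (\<exists>m k. m \<le> last_index T \<and> gl0 T m \<le> k \<and> k < summand T m \<and>
   (p = (cvar T k m Tgt, vty T k m) \<or> p = (cvar T (Suc k) m Src, vty T (Suc k) m)))"
proof -
 have "p \<in> set (seg T m) \<longleftrightarrow> (\<exists>k. gl0 T m \<le> k \<and> k < summand T m \<and>
   (p = (cvar T k m Tgt, vty T k m) \<or> p = (cvar T (Suc k) m Src, vty T (Suc k) m)))" for m
  unfolding seg_def by (auto simp del: vty.simps cvar.simps)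
 moreover have "p \<in> set (ctxT T) \<longleftrightarrow> p = (0, Star) \<or> (\<exists>m\<le>last_index T. p \<in> set (seg T m))"
  unfolding ctxT_def by (auto simp del: upt_Suc simp: less_Suc_eq_le)
 ultimately show ?thesis by blast
qed

lemma cvar_in_ctxT:
 assumes T: "is_table T" and c: "(m, l) \<in> sum_cells T k"
 shows "(cvar T k m l, vty T k m) \<in> set (ctxT T)"
 using c
proof (induction m arbitrary: l)
 have seg: "(cvar T k m Tgt, vty T k m) \<in> set (ctxT T)" "(cvar T (Suc k) m Src, vty T (Suc k) m) \<in> set (ctxT T)"
  if "m \<le> last_index T" "gl0 T m \<le> k" "k < summand T m" for m k
  using that unfolding mem_ctxT_list by blast+
 have new: "(cvar T k m l, vty T k m) \<in> set (ctxT T)"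
  if c: "(m, l) \<in> sum_cells T k" and n: "l = Tgt \<and> gl0 T m \<le> k \<or> gl0 T m < k" for m l
 proof -
  have m: "m \<le> last_index T" using c by (simp add: mem_sum_cells)
  show ?thesis
  proof (cases "l = Tgt")
   case True
   thus ?thesis using seg[OF m] c n by (auto simp: mem_sum_cells globe_hom_iff)
  next
   case False
   then obtain k' where k': "k = Suc k'" "gl0 T m \<le> k'" using n by (cases k) auto
   hence "cvar T k m l = cvar T k m Src" using False cvar_Idn[of T m k] n by (cases l) auto
   thus ?thesis using seg(2)[OF m k'(2)] k' c by (auto simp: mem_sum_cells globe_hom_iff simp del: vty.simps)
  qed
 qed
 {
  case 0
  show ?case
  proof (cases "l = Tgt \<or> 0 < k")
   case True thus ?thesis using new[OF 0] by auto
  next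
   case False thus ?thesis by (simp add: ctxT_def)
  qed
 next
  case (Suc m)
  hence g: "glue T m < summand T m" "glue T m < summand T (Suc m)" "m \<le> last_index T"
   using is_tableD[OF T, of m] by (auto simp: mem_sum_cells)
  show ?case
  proof (cases "k < glue T m \<or> k = glue T m \<and> l = Src")
   case True
   hence "(m, if k < glue T m then l else Tgt) \<in> sum_cells T k"
    using g Suc.prems by (auto simp: mem_sum_cells globe_hom_iff)
   from Suc.IH[OF this] show ?thesis using True vty_glue[of k T m] by (auto split: if_splits)
  next
   case False
   hence "l = Tgt \<and> gl0 T (Suc m) \<le> k \<or> gl0 T (Suc m) < k"
    using Suc.prems g by (auto simp: mem_sum_cells globe_hom_iff)
   thus ?thesis using new[OF Suc.prems] by blast
  qed
 }
qed

lemma ctxT_mem: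
 assumes T: "is_table T"
 shows "(x, A) \<in> set (ctxT T) \<longleftrightarrow>
  (\<exists>k m l. (m, l) \<in> sum_cells T k \<and> x = cvar T k m l \<and> A = vty T k m)"
proof
 assume "(x, A) \<in> set (ctxT T)"
 then consider "x = 0" "A = Star" | m k where "m \<le> last_index T" "gl0 T m \<le> k" "k < summand T m"
   "(x, A) = (cvar T k m Tgt, vty T k m) \<or> (x, A) = (cvar T (Suc k) m Src, vty T (Suc k) m)"
  unfolding mem_ctxT_list by blast
 thus "\<exists>k m l. (m, l) \<in> sum_cells T k \<and> x = cvar T k m l \<and> A = vty T k m"
 proof cases
  case 1
  have "(0, if summand T 0 = 0 then Idn else Src) \<in> sum_cells T 0"
   by (auto simp: mem_sum_cells globe_hom_iff)
  thus ?thesis using 1 by (intro exI[of _ 0]) (auto split: if_splits)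
 next
  case 2
  have "(m, Tgt) \<in> sum_cells T k" using 2 by (simp add: mem_sum_cells globe_hom_iff)
  moreover have "(m, if Suc k = summand T m then Idn else Src) \<in> sum_cells T (Suc k)"
   using 2 by (simp add: mem_sum_cells globe_hom_iff)
  moreover have "cvar T (Suc k) m Idn = cvar T (Suc k) m Src" using cvar_Idn[of T m "Suc k"] 2 by simp
  ultimately have "(m, if Suc k = summand T m then Idn else Src) \<in> sum_cells T (Suc k) \<and>
   cvar T (Suc k) m Src = cvar T (Suc k) m (if Suc k = summand T m then Idn else Src)" "(m, Tgt) \<in> sum_cells T k" by auto
  thus ?thesis using 2(4) unfolding prod.inject by blast
 qed
qed (use cvar_in_ctxT[OF T] in auto)

lemma off_mono: "m \<le> m' \<Longrightarrow> off T m \<le> off T m'"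
 by (rule lift_Suc_mono_le[of "off T"]) auto

lemma cvar_less:
 assumes T: "is_table T" and c: "(m, l) \<in> sum_cells T k"
 shows "cvar T k m l < off T (Suc m)"
 using c
proof (induction m arbitrary: l)
 case 0 thus ?case by (auto simp: mem_sum_cells globe_hom_iff)
next
 case (Suc m)
 hence g: "glue T m < summand T m" "glue T m < summand T (Suc m)" "m \<le> last_index T"
  using is_tableD[OF T, of m] by (auto simp: mem_sum_cells)
 show ?case
 proof (cases "k < glue T m \<or> k = glue T m \<and> l = Src")
  case True
  hence "(m, if k < glue T m then l else Tgt) \<in> sum_cells T k"
   using g Suc.prems by (auto simp: mem_sum_cells globe_hom_iff)
  from Suc.IH[OF this] show ?thesis using True by (auto split: if_splits)
 next
  case False
  thus ?thesis using Suc.prems g by (auto simp: mem_sum_cells globe_hom_iff simp del: off.simps) (auto)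
 qed
qed

lemma cvar_ge:
 assumes "(Suc m, l) \<in> sum_cells T k" "\<not> k < glue T m" "\<not> (k = glue T m \<and> l = Src)" "is_table T"
 shows "off T (Suc m) \<le> cvar T k (Suc m) l"
 using assms is_tableD[of T m] by (auto simp: mem_sum_cells globe_hom_iff simp del: off.simps)

lemma cvar_Src_Tgt:
 assumes T: "is_table T" and "m \<le> last_index T" "k < summand T m"
 shows "cvar T k m Src < cvar T k m Tgt"
 using assms(2,3)
proof (induction m)
 case (Suc m)
 have g: "glue T m < summand T m" "glue T m < summand T (Suc m)" "m \<le> last_index T"
  using is_tableD[OF T, of m] Suc.prems by auto
 consider "k < glue T m" | "k = glue T m" | "k > glue T m" by linarith
 thus ?case
 proof cases
  case 1 thus ?thesis using Suc g by simp
 next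
  case 2
  have "cvar T k m Tgt < off T (Suc m)" using cvar_less[OF T, of m Tgt k] g 2 by (simp add: mem_sum_cells globe_hom_iff)
  thus ?thesis using 2 by (simp del: off.simps)
 next
  case 3
  hence "0 < 2 * (k - glue T m)" by simp
  hence "off T (Suc m) + 2 * (k - glue T m) - 1 < off T (Suc m) + 2 * (k - glue T m)" by linarith
  thus ?thesis using 3 by (simp del: off.simps)
 qed
qed simp

lemma sum_glueI:
 assumes T: "is_table T" and m: "m < last_index T"
 shows "k < glue T m \<Longrightarrow> l = Src \<or> l = Tgt \<Longrightarrow> ((m, l), (Suc m, l)) \<in> sum_glue T k"
  and "((m, Tgt), (Suc m, Src)) \<in> sum_glue T (glue T m)"
proof -
 assume "k < glue T m" "l = Src \<or> l = Tgt"
 thus "((m, l), (Suc m, l)) \<in> sum_glue T k"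
  unfolding sum_glue_def mem_Collect_eq using m
  by (intro exI[of _ m] exI[of _ l]) (auto simp: push_def globe_hom_iff)
next
 show "((m, Tgt), (Suc m, Src)) \<in> sum_glue T (glue T m)"
  unfolding sum_glue_def mem_Collect_eq using m is_tableD[OF T m]
  by (intro exI[of _ m] exI[of _ Idn]) (auto simp: push_def globe_hom_iff)
qed

lemma sum_rel_sym: "(p, q) \<in> sum_rel T k \<Longrightarrow> (q, p) \<in> sum_rel T k"
 unfolding sum_rel_def by (meson rtrancl_converseD rtrancl_converseI sym_Un_converse sym_rtrancl symD)

text \<open>New variables of a summand have numbers beyond those of all earlier summands. So equal
  numbers force the later cell to be shared with the preceding summand, and the gluings can be
  followed backwards one at a time.\<close>

lemma cvar_eq_rel_aux:
 assumes T: "is_table T"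
 shows "m \<le> m' \<Longrightarrow> (m, l) \<in> sum_cells T k \<Longrightarrow> (m', l') \<in> sum_cells T k \<Longrightarrow> cvar T k m l = cvar T k m' l' \<Longrightarrow>
  ((m, l), (m', l')) \<in> sum_rel T k"
proof (induction m' arbitrary: l')
 have same: "((m, l), (m, l')) \<in> sum_rel T k"
  if "(m, l) \<in> sum_cells T k" "(m, l') \<in> sum_cells T k" "cvar T k m l = cvar T k m l'" for l'
 proof -
  have "l = l'" using that cvar_Src_Tgt[OF T, of m k] by (auto simp: mem_sum_cells globe_hom_iff)
  thus ?thesis by (simp add: sum_rel_def)
 qed
 {
  case 0 thus ?case using same by auto
 next
  case (Suc m')
  show ?case
  proof (cases "m = Suc m'")
   case True thus ?thesis using same Suc.prems by auto
  next
   case False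
   hence mm: "m \<le> m'" using Suc.prems by simp
   have m': "m' < last_index T" using Suc.prems by (simp add: mem_sum_cells)
   note g = is_tableD[OF T m']
   show ?thesis
   proof (cases "k < glue T m' \<or> k = glue T m' \<and> l' = Src")
    case True
    let ?l = "if k < glue T m' then l' else Tgt"
    have c: "(m', ?l) \<in> sum_cells T k"
     using True g Suc.prems m' by (auto simp: mem_sum_cells globe_hom_iff)
    have "((m', ?l), (Suc m', l')) \<in> sum_glue T k"
     using sum_glueI[OF T m'] True Suc.prems g by (auto simp: mem_sum_cells globe_hom_iff)
    moreover have "((m, l), (m', ?l)) \<in> sum_rel T k"
     using Suc.IH[OF mm Suc.prems(2) c] Suc.prems(4) True by (auto split: if_splits)
    ultimately show ?thesis unfolding sum_rel_def by (meson UnI1 rtrancl.rtrancl_into_rtrancl)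
   next
    case False
    hence "off T (Suc m') \<le> cvar T k (Suc m') l'" using cvar_ge[OF Suc.prems(3)] T by auto
    moreover have "cvar T k m l < off T (Suc m')"
     using cvar_less[OF T Suc.prems(2)] off_mono[of "Suc m" "Suc m'" T] mm by simp
    ultimately show ?thesis using Suc.prems(4) by simp
   qed
  qed
 }
qed

lemma sum_glue_cvar:
 assumes T: "is_table T" and g: "((m, l), (m', l')) \<in> sum_glue T k"
 shows "(m, l) \<in> sum_cells T k \<and> (m', l') \<in> sum_cells T k \<and> cvar T k m l = cvar T k m' l'"
proof -
 from g obtain l0 where l0: "m' = Suc m" "m < last_index T" "l0 \<in> globe_hom k (glue T m)"
  "l = push Tgt (glue T m) (summand T m) l0" "l' = push Src (glue T m) (summand T (Suc m)) l0"
  by (auto simp: sum_glue_def)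
 thus ?thesis using is_tableD[OF T l0(2)] by (auto simp: push_def mem_sum_cells globe_hom_iff)
qed

text \<open>The inverse of the numbering: by \<open>sum_rel_class\<close> this is a full equivalence
  class, so variables are a complete invariant of glued cells.\<close>

definition cellof :: "table \<Rightarrow> nat \<Rightarrow> nat \<Rightarrow> (nat \<times> side) set" where
 "cellof T k x = {(m, l). (m, l) \<in> sum_cells T k \<and> cvar T k m l = x}"

lemma sum_rel_class:
 assumes T: "is_table T" and c: "(m, l) \<in> sum_cells T k"
 shows "sum_rel T k `` {(m, l)} = cellof T k (cvar T k m l)"
proof -
 have "(m', l') \<in> sum_cells T k \<and> cvar T k m' l' = cvar T k m l" if "((m, l), (m', l')) \<in> sum_rel T k" for m' l'
  using that unfolding sum_rel_def
 proof (induction rule: rtrancl_induct2)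
  case (step a b c d)
  thus ?case using sum_glue_cvar[OF T, of a b c d k] sum_glue_cvar[OF T, of c d a b k] by auto
 qed (use c in simp)
 moreover have "((m, l), (m', l')) \<in> sum_rel T k" if "(m', l') \<in> sum_cells T k" "cvar T k m' l' = cvar T k m l" for m' l'
 proof (cases "m \<le> m'")
  case True thus ?thesis using cvar_eq_rel_aux[OF T _ c that(1)] that(2) by simp
 next
  case False thus ?thesis using cvar_eq_rel_aux[OF T _ that(1) c] that(2) sum_rel_sym by simp
 qed
 ultimately show ?thesis by (auto simp: cellof_def)
qed

definition dvars :: "table \<Rightarrow> nat \<Rightarrow> nat set" where
 "dvars T k = {x. \<exists>A. (x, A) \<in> set (ctxT T) \<and> tdim A = k}"

lemma dvars_iff: "is_table T \<Longrightarrow> x \<in> dvars T k \<longleftrightarrow> (\<exists>m l. (m, l) \<in> sum_cells T k \<and> x = cvar T k m l)"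
proof -
 assume T: "is_table T"
 show ?thesis unfolding dvars_def mem_Collect_eq ctxT_mem[OF T] by (metis tdim_vty)
qed

lemma gsum_cells:
 assumes "is_table T"
 shows "cells (gsum T) k = cellof T k ` dvars T k"
proof -
 have "cells (gsum T) k = {sum_rel T k `` {(m, l)} | m l. (m, l) \<in> sum_cells T k}"
  by (auto simp: gsum_def quotient_def)
 also have "\<dots> = {cellof T k (cvar T k m l) | m l. (m, l) \<in> sum_cells T k}"
  by (intro Collect_cong iff_exI) (metis sum_rel_class[OF assms])
 also have "\<dots> = cellof T k ` {cvar T k m l | m l. (m, l) \<in> sum_cells T k}" by auto
 also have "{cvar T k m l | m l. (m, l) \<in> sum_cells T k} = dvars T k"
  unfolding set_eq_iff dvars_iff[OF assms] mem_Collect_eq by (intro allI arg_cong[where f = Ex] ext) (rule conj_commute)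
 finally show ?thesis .
qed

lemma cellof_ne: "is_table T \<Longrightarrow> x \<in> dvars T k \<Longrightarrow> cellof T k x \<noteq> {}"
 using dvars_iff[of T x k] unfolding cellof_def by blast

lemma cellof_inj: "is_table T \<Longrightarrow> x \<in> dvars T k \<Longrightarrow> y \<in> dvars T k \<Longrightarrow> cellof T k x = cellof T k y \<Longrightarrow> x = y"
 using cellof_ne unfolding cellof_def by blast

lemma ctxT_wf: "is_table T \<Longrightarrow> wf_ctx (ctxT T)" and ctxT_vt: "is_table T \<Longrightarrow> var_types (ctxT T)"
 using ctxT_ps ps_ctx_wf ps_ctx_var_types by blast+

lemma gsum_faces:
 assumes T: "is_table T" and x: "(x, Arrow (Var a) C (Var b)) \<in> set (ctxT T)" "tdim C = k"
 shows "gsrc (gsum T) k (cellof T (Suc k) x) = cellof T k a" "gtgt (gsum T) k (cellof T (Suc k) x) = cellof T k b"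
proof -
 let ?c = "cellof T (Suc k) x"
 have ne: "?c \<noteq> {}" using cellof_ne[OF T, of x "Suc k"] x by (force simp: dvars_def)
 have f: "cvar T k m Src = a \<and> cvar T k m Tgt = b \<and> (m, Src) \<in> sum_cells T k \<and> (m, Tgt) \<in> sum_cells T k"
  if "(m, l) \<in> ?c" for m l
 proof -
  have "(x, vty T (Suc k) m) \<in> set (ctxT T)" using cvar_in_ctxT[OF T, of m l "Suc k"] that by (auto simp: cellof_def simp del: vty.simps)
  hence "vty T (Suc k) m = Arrow (Var a) C (Var b)" using x ctx_fun ctxT_wf[OF T] by blast
  thus ?thesis using that by (auto simp: cellof_def mem_sum_cells globe_hom_iff)
 qed
 have im: "sum_rel T k `` ((\<lambda>(m, l). (m, e)) ` ?c) = (\<Union>(m, l)\<in>?c. sum_rel T k `` {(m, e)})" for e by auto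
 have "sum_rel T k `` {(m, Src)} = cellof T k a" if "(m, l) \<in> ?c" for m l
  using f[OF that] sum_rel_class[OF T, of m Src k] by simp
 hence "(\<Union>(m, l)\<in>?c. sum_rel T k `` {(m, Src)}) = (\<Union>p\<in>?c. cellof T k a)"
  by (intro SUP_cong) auto
 thus "gsrc (gsum T) k ?c = cellof T k a" using ne im[of Src] by (simp add: gsum_def)
 have "sum_rel T k `` {(m, Tgt)} = cellof T k b" if "(m, l) \<in> ?c" for m l
  using f[OF that] sum_rel_class[OF T, of m Tgt k] by simp
 hence "(\<Union>(m, l)\<in>?c. sum_rel T k `` {(m, Tgt)}) = (\<Union>p\<in>?c. cellof T k b)"
  by (intro SUP_cong) auto
 thus "gtgt (gsum T) k ?c = cellof T k b" using ne im[of Tgt] by (simp add: gsum_def)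
qed

lemma dvars_SucE:
 assumes "is_table T" "x \<in> dvars T (Suc k)"
 obtains a C b where "(x, Arrow (Var a) C (Var b)) \<in> set (ctxT T)" "tdim C = k" "a \<in> dvars T k" "b \<in> dvars T k"
  "(a, C) \<in> set (ctxT T)" "(b, C) \<in> set (ctxT T)"
proof -
 from assms(2) obtain A where A: "(x, A) \<in> set (ctxT T)" "tdim A = Suc k" by (auto simp: dvars_def)
 then obtain t C u where e: "A = Arrow t C u" by (cases A) auto
 from ctxT_vt[OF assms(1)] A(1)[unfolded e] obtain a b where "t = Var a" "u = Var b"
  "(a, C) \<in> set (ctxT T)" "(b, C) \<in> set (ctxT T)" by (rule var_typesE)
 thus thesis using that A e by (auto simp: dvars_def)
qed

lemma is_gset_gsum: "is_table T \<Longrightarrow> is_gset (gsum T)"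
 unfolding is_gset_def
proof (intro conjI allI ballI)
 assume T: "is_table T"
 note cl = gsum_cells[OF T] and fc = gsum_faces[OF T]
 fix n x assume "x \<in> cells (gsum T) (Suc n)"
 then obtain v where v: "x = cellof T (Suc n) v" "v \<in> dvars T (Suc n)" using cl by auto
 from T v(2) obtain a C b where "(v, Arrow (Var a) C (Var b)) \<in> set (ctxT T)" "tdim C = n" "a \<in> dvars T n" "b \<in> dvars T n"
  by (rule dvars_SucE)
 thus "gsrc (gsum T) n x \<in> cells (gsum T) n" "gtgt (gsum T) n x \<in> cells (gsum T) n" using fc cl v by auto
next
 assume T: "is_table T"
 note cl = gsum_cells[OF T] and fc = gsum_faces[OF T]
 fix n x assume "x \<in> cells (gsum T) (Suc (Suc n))"
 then obtain v where v: "x = cellof T (Suc (Suc n)) v" "v \<in> dvars T (Suc (Suc n))" using cl by auto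
 from T v(2) obtain a C b where a: "(v, Arrow (Var a) C (Var b)) \<in> set (ctxT T)" "tdim C = Suc n"
  "a \<in> dvars T (Suc n)" "(a, C) \<in> set (ctxT T)" "(b, C) \<in> set (ctxT T)" by (rule dvars_SucE)
 from T a(3) obtain a' C' b' where a': "(a, Arrow (Var a') C' (Var b')) \<in> set (ctxT T)" "tdim C' = n" by (rule dvars_SucE)
 hence "C = Arrow (Var a') C' (Var b')" using a ctx_fun ctxT_wf[OF T] by blast
 thus "gsrc (gsum T) n (gsrc (gsum T) (Suc n) x) = gsrc (gsum T) n (gtgt (gsum T) (Suc n) x)"
  "gtgt (gsum T) n (gsrc (gsum T) (Suc n) x) = gtgt (gsum T) n (gtgt (gsum T) (Suc n) x)"
  using fc a a' v by auto
qed

section \<open>Faces of terms and substitutions into globular sums\<close>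

lemma ctx_map_surj_eq:
 assumes "ps_ctx \<Gamma>" "canonical \<Gamma>" "ps_ctx \<Delta>" "canonical \<Delta>"
  and "\<And>f a C b. (f, Arrow (Var a) C (Var b)) \<in> set \<Gamma> \<Longrightarrow> \<exists>C'. (g f, Arrow (Var (g a)) C' (Var (g b))) \<in> set \<Delta>"
  and "\<And>x. (x, Star) \<in> set \<Gamma> \<Longrightarrow> (g x, Star) \<in> set \<Delta>"
  and "g ` vars_ctx \<Gamma> = vars_ctx \<Delta>"
 shows "\<Gamma> = \<Delta>" and "x \<in> vars_ctx \<Gamma> \<Longrightarrow> g x = x"
proof -
 have id: "length \<Gamma> = length \<Delta> \<and> (\<forall>i<length \<Gamma>. g i = i)"
  by (rule ps_map_surj_id[OF assms(1-5) assms(7)])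
 show gx: "g x = x" if "x \<in> vars_ctx \<Gamma>" for x using id that canonical_vars[OF assms(2)] by auto
 note wf = ps_ctx_wf[OF assms(3)] and vt = ps_ctx_var_types[OF assms(1)] ps_ctx_var_types[OF assms(3)]
 have sub: "(x, A) \<in> set \<Delta>" if "(x, A) \<in> set \<Gamma>" for x A using that
 proof (induction A arbitrary: x rule: tdim.induct)
  case 1 thus ?case using assms(6)[OF 1] gx[OF vars_ctxI[OF 1]] by simp
 next
  case (2 t C u)
  from vt(1) 2(2) obtain a b where ab: "t = Var a" "u = Var b" "(a, C) \<in> set \<Gamma>" "(b, C) \<in> set \<Gamma>" by (rule var_typesE)
  obtain C' where C': "(x, Arrow (Var a) C' (Var b)) \<in> set \<Delta>"
   using assms(5)[of x a C b] 2(2) ab gx[OF vars_ctxI[OF 2(2)]] gx[OF vars_ctxI[OF ab(3)]] gx[OF vars_ctxI[OF ab(4)]] by auto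
  hence "(a, C') \<in> set \<Delta>" using var_types_face[OF vt(2)] by blast
  hence "C' = C" using ctx_fun[OF wf] 2(1)[OF ab(3)] by blast
  thus ?case using C' ab by simp
 qed
 show "\<Gamma> = \<Delta>"
 proof (rule nth_equalityI)
  show "length \<Gamma> = length \<Delta>" using id by simp
  fix i assume i: "i < length \<Gamma>"
  hence "fst (\<Gamma> ! i) = i" "fst (\<Delta> ! i) = i" using assms(2,4) id
   unfolding canonical_def by (metis add_0 nth_map nth_upt)+
  moreover have "\<Gamma> ! i \<in> set \<Delta>" using sub i by (metis nth_mem surj_pair)
  moreover have "\<Delta> ! i \<in> set \<Delta>" using i id by simp
  ultimately show "\<Gamma> ! i = \<Delta> ! i" using ctx_fun[OF wf] by (metis prod.collapse)
 qed
qed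

text \<open>Equality of the sets of cells yields a bijection between the variables which respects
  faces. By rigidity it is the identity, and a table is determined by its context.\<close>

lemma gsum_inj:
 assumes T: "is_table T" "is_table T'" and eq: "gsum T = gsum T'"
 shows "T = T'"
proof -
 have ex: "\<exists>y. y \<in> dvars T' k \<and> cellof T k x = cellof T' k y" if "x \<in> dvars T k" for k x
  using that eq gsum_cells[OF T(1), of k] gsum_cells[OF T(2), of k] by (metis (no_types, lifting) imageE imageI)
 have ex': "\<exists>x. x \<in> dvars T k \<and> cellof T k x = cellof T' k y" if "y \<in> dvars T' k" for k y
  using that eq gsum_cells[OF T(1), of k] gsum_cells[OF T(2), of k] by (metis (no_types, lifting) imageE imageI)
 define g where "g x = (THE y. \<exists>k. x \<in> dvars T k \<and> y \<in> dvars T' k \<and> cellof T k x = cellof T' k y)" for x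
 have dd: "k = k'" if "x \<in> dvars T k" "x \<in> dvars T k'" for x k k'
  using that ctx_fun[OF ctxT_wf[OF T(1)]] by (auto simp: dvars_def)
 have g: "g x = y" if "x \<in> dvars T k" "y \<in> dvars T' k" "cellof T k x = cellof T' k y" for x y k
  unfolding g_def using that dd cellof_inj[OF T(2)] by (intro the_equality) metis+
 have g': "g x \<in> dvars T' k \<and> cellof T k x = cellof T' k (g x)" if "x \<in> dvars T k" for x k
  using ex[OF that] g[OF that] by metis
 have dv: "x \<in> vars_ctx (ctxT U) \<longleftrightarrow> (\<exists>k. x \<in> dvars U k)" for x U
  by (auto simp: dvars_def elim: vars_ctxE intro: vars_ctxI)
 have "ctxT T = ctxT T'"
 proof (rule ctx_map_surj_eq(1)[where g = g])
  fix f a C b assume f: "(f, Arrow (Var a) C (Var b)) \<in> set (ctxT T)"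
  hence ab: "(a, C) \<in> set (ctxT T)" "(b, C) \<in> set (ctxT T)" using var_types_face[OF ctxT_vt[OF T(1)]] by blast+
  let ?k = "tdim C"
  have d: "f \<in> dvars T (Suc ?k)" "a \<in> dvars T ?k" "b \<in> dvars T ?k" using f ab by (force simp: dvars_def)+
  from T(2) g'[OF d(1), THEN conjunct1] obtain a' C' b' where
   f': "(g f, Arrow (Var a') C' (Var b')) \<in> set (ctxT T')" "tdim C' = ?k" "a' \<in> dvars T' ?k" "b' \<in> dvars T' ?k"
   by (rule dvars_SucE)
  have "cellof T ?k a = cellof T' ?k a'" "cellof T ?k b = cellof T' ?k b'"
   using gsum_faces[OF T(1) f refl] gsum_faces[OF T(2) f'(1,2)] g'[OF d(1)] eq by metis+
  hence "g a = a'" "g b = b'" using g d f' by blast+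
  thus "\<exists>C'. (g f, Arrow (Var (g a)) C' (Var (g b))) \<in> set (ctxT T')" using f' by blast
 next
  fix x assume "(x, Star) \<in> set (ctxT T)"
  hence "x \<in> dvars T 0" by (force simp: dvars_def)
  from g'[OF this] obtain A where "(g x, A) \<in> set (ctxT T')" "tdim A = 0" by (auto simp: dvars_def)
  thus "(g x, Star) \<in> set (ctxT T')" by (cases A) auto
 next
  show "g ` vars_ctx (ctxT T) = vars_ctx (ctxT T')"
  proof (intro set_eqI iffI)
   fix y assume "y \<in> g ` vars_ctx (ctxT T)"
   then obtain x where "y = g x" "x \<in> vars_ctx (ctxT T)" by blast
   thus "y \<in> vars_ctx (ctxT T')" using g' dv[of x T] dv[of y T'] by blast
  next
   fix y assume "y \<in> vars_ctx (ctxT T')"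
   then obtain k where y: "y \<in> dvars T' k" using dv by blast
   from ex'[OF this] obtain x where x: "x \<in> dvars T k" "cellof T k x = cellof T' k y" by blast
   thus "y \<in> g ` vars_ctx (ctxT T)" using g[OF x(1) y x(2)] dv by blast
  qed
 qed (use ctxT_ps ctxT_canonical T in auto)
 thus ?thesis using ctxT_inj T by blast
qed

text \<open>\<open>bdf A k l\<close> is the \<open>k\<close>-dimensional source or target of a term of type \<open>A\<close>, and \<open>trunc A k\<close> is its
 type. The value of \<open>bdf\<close> at \<open>Star\<close> is irrelevant.\<close>

fun bdf :: "ty \<Rightarrow> nat \<Rightarrow> side \<Rightarrow> tm" where
 "bdf Star k l = Var 0"
| "bdf (Arrow a B b) k l = (if k = tdim B then (if l = Tgt then b else a) else bdf B k l)"

fun trunc :: "ty \<Rightarrow> nat \<Rightarrow> ty" where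
 "trunc Star k = Star"
| "trunc (Arrow a B b) k = (if k \<le> tdim B then trunc B k else Arrow a B b)"

lemma trunc_top [simp]: "tdim A \<le> k \<Longrightarrow> trunc A k = A"
 by (cases A) auto

lemma trunc_Suc: "k < tdim A \<Longrightarrow> trunc A (Suc k) = Arrow (bdf A k Src) (trunc A k) (bdf A k Tgt)"
 by (induction A rule: tdim.induct) (auto simp: less_Suc_eq)

lemma tdim_trunc: "k \<le> tdim A \<Longrightarrow> tdim (trunc A k) = k"
 by (induction A rule: tdim.induct) (auto simp: le_Suc_eq)

lemma trunc_0 [simp]: "trunc A 0 = Star"
 by (induction A rule: tdim.induct) auto

lemma bdf_trunc: "k < j \<Longrightarrow> j \<le> tdim A \<Longrightarrow> bdf (trunc A j) k l = bdf A k l"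
 by (induction A rule: tdim.induct) (auto simp: le_Suc_eq)

lemma wf_bdf: "wf_ty \<Gamma> A \<Longrightarrow> k < tdim A \<Longrightarrow> wf_tm \<Gamma> (bdf A k l) (trunc A k)"
 by (induction A rule: tdim.induct) (auto simp: wf_ty_Arrow)

lemma bdf_subst: "k < tdim A \<Longrightarrow> bdf (subst_ty \<gamma> A) k l = subst_tm \<gamma> (bdf A k l)"
 by (induction A rule: tdim.induct) auto

lemma bdf_vty: "k < i \<Longrightarrow> l \<noteq> Idn \<Longrightarrow> bdf (vty T i m) k l = Var (cvar T k m l)"
 by (induction i) (auto simp: less_Suc_eq intro: side.exhaust[of l])

lemma lev_bdf: "lev_ty n A \<Longrightarrow> lev_tm n (bdf A k l)"
 by (induction A rule: tdim.induct) auto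

definition face :: "tm \<Rightarrow> ty \<Rightarrow> nat \<Rightarrow> side \<Rightarrow> tm" where
 "face t A k l = (if l = Idn then t else bdf A k l)"

lemma wf_face:
 assumes "wf_tm \<Gamma> t A" "l \<in> globe_hom k (tdim A)"
 shows "wf_tm \<Gamma> (face t A k l) (trunc A k)"
 using assms wf_bdf[OF wf_tm_ty(3)[OF assms(1)]] by (auto simp: face_def globe_hom_iff)

lemma lev_vty: "lev_ty n (vty T k m)"
 by (induction k) auto

lemma lev_ctxT: "is_table T \<Longrightarrow> (x, B) \<in> set (ctxT T) \<Longrightarrow> lev_ty n B"
 by (subst (asm) ctxT_mem) (auto simp: lev_vty)

lemma lev_face:
 assumes "is_table T" "wf_tm (ctxT T) t A" "lev_tm n t"
 shows "lev_tm n (face t A k l)"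
 using lev_bdf[OF lev_tm_ty[OF assms(2,3)]] lev_ctxT[OF assms(1)] assms(3) by (simp add: face_def)

text \<open>The data of a substitution out of a globular sum. Only the faces in the dimension of the
  gluing are compared; the lower ones then agree too.\<close>

definition fits :: "ctx \<Rightarrow> table \<Rightarrow> (nat \<Rightarrow> tm) \<Rightarrow> (nat \<Rightarrow> ty) \<Rightarrow> bool" where
 "fits \<Delta> T t A \<longleftrightarrow> wf_ctx \<Delta> \<and> (\<forall>m\<le>last_index T. wf_tm \<Delta> (t m) (A m) \<and> tdim (A m) = summand T m) \<and>
   (\<forall>m<last_index T. bdf (A m) (glue T m) Tgt = bdf (A (Suc m)) (glue T m) Src)"

lemma fits_face:
 assumes T: "is_table T" and f: "fits \<Delta> T t A" and c: "(m, l) \<in> sum_cells T k" "(m', l') \<in> sum_cells T k"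
  and e: "cvar T k m l = cvar T k m' l'"
 shows "face (t m) (A m) k l = face (t m') (A m') k l'"
proof -
 have gl: "face (t m) (A m) k l = face (t m') (A m') k l'" if g: "((m, l), (m', l')) \<in> sum_glue T k" for m l m' l'
 proof -
  from g obtain l0 where l0: "m' = Suc m" "m < last_index T" "l0 \<in> globe_hom k (glue T m)"
   "l = push Tgt (glue T m) (summand T m) l0" "l' = push Src (glue T m) (summand T (Suc m)) l0"
   by (auto simp: sum_glue_def)
  note tb = is_tableD[OF T l0(2)]
  let ?g = "glue T m"
  have w: "wf_tm \<Delta> (t m) (A m)" "tdim (A m) = summand T m" "wf_tm \<Delta> (t m') (A m')" "tdim (A m') = summand T m'"
   "bdf (A m) ?g Tgt = bdf (A m') ?g Src" using f l0 by (auto simp: fits_def)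
  have "wf_tm \<Delta> (bdf (A m) ?g Tgt) (trunc (A m) ?g)" "wf_tm \<Delta> (bdf (A m') ?g Src) (trunc (A m') ?g)"
   using wf_bdf[OF wf_tm_ty(3)[OF w(1)], of ?g Tgt] wf_bdf[OF wf_tm_ty(3)[OF w(3)], of ?g Src] w(2,4) tb l0(1) by auto
  \<comment> \<open>Types are unique, so the common face has the same type on both sides, and this
    type records all lower faces.\<close>
  hence tr: "trunc (A m) ?g = trunc (A m') ?g" using wf_tm_unique w(5) by metis
  show ?thesis
  proof (cases "l0 = Idn")
   case True thus ?thesis using l0 w tb by (auto simp: face_def push_def globe_hom_iff)
  next
   case False
   hence "k < ?g" using l0 by (auto simp: globe_hom_iff)
   hence "bdf (A m) k l0 = bdf (A m') k l0"
    using bdf_trunc[of k ?g "A m" l0] bdf_trunc[of k ?g "A m'" l0] tr tb w l0(1) by simp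
   thus ?thesis using False l0 by (auto simp: face_def push_def)
  qed
 qed
 have "(m', l') \<in> cellof T k (cvar T k m l)" using c e by (simp add: cellof_def)
 hence "((m, l), (m', l')) \<in> sum_rel T k" using sum_rel_class[OF T c(1)] by blast
 thus ?thesis unfolding sum_rel_def
 proof (induction rule: rtrancl_induct2)
  case (step a b c d)
  thus ?case using gl[of a b c d] gl[of c d a b] by auto
 qed simp
qed

text \<open>Any cell with number \<open>x\<close> may be chosen: by \<open>fits_face\<close> all of
  them give the same face.\<close>

definition gfun :: "table \<Rightarrow> (nat \<Rightarrow> tm) \<Rightarrow> (nat \<Rightarrow> ty) \<Rightarrow> nat \<Rightarrow> tm" where
 "gfun T t A x = (case SOME (k, m, l). (m, l) \<in> sum_cells T k \<and> cvar T k m l = x of (k, m, l) \<Rightarrow> face (t m) (A m) k l)"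

definition gsub :: "table \<Rightarrow> (nat \<Rightarrow> tm) \<Rightarrow> (nat \<Rightarrow> ty) \<Rightarrow> sub" where
 "gsub T t A = map (\<lambda>(x, B). (x, gfun T t A x)) (ctxT T)"

lemma cvar_dim:
 assumes "is_table T" "(m, l) \<in> sum_cells T k" "(m', l') \<in> sum_cells T k'" "cvar T k m l = cvar T k' m' l'"
 shows "k = k'"
 using cvar_in_ctxT[OF assms(1,2)] cvar_in_ctxT[OF assms(1,3)] assms(4) ctx_fun[OF ctxT_wf[OF assms(1)]]
 by (metis tdim_vty)

lemma cvar_vars: "is_table T \<Longrightarrow> (m, l) \<in> sum_cells T k \<Longrightarrow> cvar T k m l \<in> vars_ctx (ctxT T)"
 using cvar_in_ctxT vars_ctxI by blast

lemma sv_gsub: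
 assumes T: "is_table T" and f: "fits \<Delta> T t A" and c: "(m, l) \<in> sum_cells T k"
 shows "sv (gsub T t A) (cvar T k m l) = face (t m) (A m) k l"
proof -
 obtain k' m' l' where e: "(SOME (k', m', l'). (m', l') \<in> sum_cells T k' \<and> cvar T k' m' l' = cvar T k m l) = (k', m', l')"
  using prod_cases3 by blast
 let ?P = "\<lambda>(k', m', l'). (m', l') \<in> sum_cells T k' \<and> cvar T k' m' l' = cvar T k m l"
 have "?P (k, m, l)" using c by simp
 hence "?P (SOME p. ?P p)" by (rule someI)
 hence "(m', l') \<in> sum_cells T k' \<and> cvar T k' m' l' = cvar T k m l" unfolding e by simp
 moreover from this have "k' = k" using cvar_dim[OF T c] by metis
 ultimately have "gfun T t A (cvar T k m l) = face (t m) (A m) k l"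
  unfolding gfun_def e using fits_face[OF T f, of m' l' k m l] c by simp
 thus ?thesis unfolding gsub_def using sv_map[OF cvar_vars[OF T c]] by metis
qed

text \<open>Substitution turns the type of a \<open>k\<close>-cell into the truncation at
  \<open>k\<close> of the type of the term on its summand, by induction on \<open>k\<close>.\<close>

lemma wf_gsub:
 assumes T: "is_table T" and f: "fits \<Delta> T t A"
 shows "wf_sub \<Delta> (gsub T t A) (ctxT T)"
proof -
 have ty: "subst_ty (gsub T t A) (vty T k m) = trunc (A m) k" if "m \<le> last_index T" "k \<le> summand T m" for k m
  using that(2)
 proof (induction k)
  case (Suc k)
  have "(m, e) \<in> sum_cells T k" if "e \<noteq> Idn" for e
   using Suc.prems \<open>m \<le> last_index T\<close> that by (cases e) (auto simp: mem_sum_cells globe_hom_iff)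
  hence "sv (gsub T t A) (cvar T k m Src) = bdf (A m) k Src" "sv (gsub T t A) (cvar T k m Tgt) = bdf (A m) k Tgt"
   using sv_gsub[OF T f] by (auto simp: face_def)
  moreover have "tdim (A m) = summand T m" using f that by (simp add: fits_def)
  ultimately show ?case using Suc trunc_Suc[of k "A m"] by simp
 qed simp
 show ?thesis unfolding gsub_def
 proof (rule wf_sub_mapI)
  show "wf_ctx \<Delta>" using f by (simp add: fits_def)
  show "wf_ctx (ctxT T)" using ctxT_wf[OF T] .
  fix x B assume "(x, B) \<in> set (ctxT T)"
  then obtain k m l where c: "(m, l) \<in> sum_cells T k" "x = cvar T k m l" "B = vty T k m" using ctxT_mem[OF T] by blast
  have m: "m \<le> last_index T" "l \<in> globe_hom k (summand T m)" using c by (auto simp: mem_sum_cells)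
  hence w: "wf_tm \<Delta> (t m) (A m)" "tdim (A m) = summand T m" using f by (auto simp: fits_def)
  have "k \<le> summand T m" using m by (auto simp: globe_hom_iff)
  hence "subst_ty (gsub T t A) B = trunc (A m) k" using ty m c by blast
  moreover have "gfun T t A x = face (t m) (A m) k l"
   using sv_gsub[OF T f c(1)] sv_map[OF cvar_vars[OF T c(1)], of "gfun T t A"] c(2) by (simp add: gsub_def)
  ultimately show "wf_tm \<Delta> (gfun T t A x) (subst_ty (map (\<lambda>(x, B). (x, gfun T t A x)) (ctxT T)) B)"
   using wf_face[OF w(1), of l k] m w by (simp add: gsub_def)
 qed
qed

section \<open>Substitutions out of a globular sum and their values on top cells\<close>

abbreviation top_var :: "table \<Rightarrow> nat \<Rightarrow> nat" where
 "top_var T m \<equiv> cvar T (summand T m) m Idn"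

lemma top_cell: "m \<le> last_index T \<Longrightarrow> (m, Idn) \<in> sum_cells T (summand T m)"
 by (simp add: mem_sum_cells globe_hom_iff)

lemma sub_top_wf:
 assumes "is_table T" "wf_sub \<Delta> \<gamma> (ctxT T)" "m \<le> last_index T"
 shows "wf_tm \<Delta> (sv \<gamma> (top_var T m)) (subst_ty \<gamma> (vty T (summand T m) m))"
 using wf_sub_sv[OF assms(2)] cvar_in_ctxT[OF assms(1) top_cell[OF assms(3)]] by blast

lemma sub_face:
 assumes T: "is_table T" and g: "wf_sub \<Delta> \<gamma> (ctxT T)" and c: "(m, l) \<in> sum_cells T k"
 shows "sv \<gamma> (cvar T k m l) = face (sv \<gamma> (top_var T m)) (subst_ty \<gamma> (vty T (summand T m) m)) k l"
 using c bdf_subst[of k "vty T (summand T m) m" \<gamma> l] bdf_vty[of k "summand T m" l T m]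
 by (auto simp: face_def mem_sum_cells globe_hom_iff)

text \<open>Every variable is a face of the top cell of some summand, and substitution commutes with
  faces.\<close>

lemma sub_ext:
 assumes T: "is_table T" and g: "wf_sub \<Delta> \<gamma> (ctxT T)" and d: "wf_sub \<Delta> \<delta> (ctxT T)"
  and e: "\<And>m. m \<le> last_index T \<Longrightarrow> sv \<gamma> (top_var T m) = sv \<delta> (top_var T m)"
 shows "\<gamma> = \<delta>"
proof (rule sub_eqI)
 show "map fst \<gamma> = map fst \<delta>" using wf_sub_dom g d by metis
 show "distinct (map fst \<gamma>)" using wf_sub_distinct g by blast
 fix x assume "x \<in> fst ` set \<gamma>"
 hence "x \<in> vars_ctx (ctxT T)" using wf_sub_dom_set[OF g] by simp
 then obtain k m l where c: "(m, l) \<in> sum_cells T k" "x = cvar T k m l" using ctxT_mem[OF T] by (auto elim!: vars_ctxE)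
 hence m: "m \<le> last_index T" by (simp add: mem_sum_cells)
 have "subst_ty \<gamma> (vty T (summand T m) m) = subst_ty \<delta> (vty T (summand T m) m)"
  using wf_tm_unique[OF sub_top_wf[OF T g m]] sub_top_wf[OF T d m] e[OF m] by simp
 thus "sv \<gamma> x = sv \<delta> x" using sub_face[OF T g c(1)] sub_face[OF T d c(1)] e[OF m] c(2) by simp
qed

lemma is_table_globe [simp]: "is_table (k, [])" and globe_simps [simp]: "last_index (k, []) = 0" "summand (k, []) 0 = k"
 by (auto simp: is_table_def last_index_def summand_def)

lemma fits_globe: "wf_tm \<Delta> t A \<Longrightarrow> tdim A = k \<Longrightarrow> fits \<Delta> (k, []) (\<lambda>_. t) (\<lambda>_. A)"
 by (auto simp: fits_def wf_ctx_of)

section \<open>Categories and functors\<close>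

declare split_paired_All [simp del] split_paired_Ex [simp del]

lemma homD: "f \<in> hom C X Y \<Longrightarrow> f \<in> Arr C \<and> Dom C f = X \<and> Cod C f = Y"
 by (simp add: hom_def)

lemma cat_comp: "category C \<Longrightarrow> f \<in> hom C X Y \<Longrightarrow> g \<in> hom C Y Z \<Longrightarrow> Comp C g f \<in> hom C X Z"
 by (auto simp: category_def hom_def)

lemma cat_assoc:
 "category C \<Longrightarrow> f \<in> hom C X Y \<Longrightarrow> g \<in> hom C Y Z \<Longrightarrow> h \<in> hom C Z W \<Longrightarrow>
  Comp C h (Comp C g f) = Comp C (Comp C h g) f"
 by (auto simp: category_def hom_def)

lemma cat_id: "category C \<Longrightarrow> X \<in> Obj C \<Longrightarrow> Id C X \<in> hom C X X"
 by (auto simp: category_def)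

lemma cat_id_comp: "category C \<Longrightarrow> f \<in> hom C X Y \<Longrightarrow> Comp C f (Id C X) = f \<and> Comp C (Id C Y) f = f"
 by (auto simp: category_def hom_def)

lemma cat_obj: "category C \<Longrightarrow> f \<in> hom C X Y \<Longrightarrow> X \<in> Obj C \<and> Y \<in> Obj C"
 by (auto simp: category_def hom_def)

lemma functor_hom: "is_functor C D F \<Longrightarrow> f \<in> hom C X Y \<Longrightarrow> snd F f \<in> hom D (fst F X) (fst F Y)"
 by (auto simp: is_functor_def hom_def)

lemma functor_comp:
 "is_functor C D F \<Longrightarrow> f \<in> hom C X Y \<Longrightarrow> g \<in> hom C Y Z \<Longrightarrow> snd F (Comp C g f) = Comp D (snd F g) (snd F f)"
 by (auto simp: is_functor_def hom_def)

lemma functor_id: "is_functor C D F \<Longrightarrow> X \<in> Obj C \<Longrightarrow> snd F (Id C X) = Id D (fst F X)"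
 by (auto simp: is_functor_def)

lemma functor_obj: "is_functor C D F \<Longrightarrow> X \<in> Obj C \<Longrightarrow> fst F X \<in> Obj D"
 by (auto simp: is_functor_def)

lemma functor_cats: "is_functor C D F \<Longrightarrow> category C \<and> category D"
 by (auto simp: is_functor_def)

lemma is_functor_comp: "is_functor C D F \<Longrightarrow> is_functor D E G \<Longrightarrow> is_functor C E (comp_functor G F)"
 by (auto simp: is_functor_def comp_functor_def hom_def)

lemma is_functor_id: "category C \<Longrightarrow> is_functor C C id_functor"
 by (auto simp: is_functor_def id_functor_def hom_def category_def)

lemma globular_sum_hom:
 assumes "is_globular_sum C G T X \<iota>"
 shows "X \<in> Obj C" "m \<le> last_index T \<Longrightarrow> \<iota> m \<in> hom C (fst G (summand T m)) X"
 using assms by (auto simp: is_globular_sum_def is_sum_cocone_def)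

text \<open>Composing the cocone of the sum with \<open>h\<close> gives a cocone through which both
  arrows factor, so the uniqueness in the universal property applies.\<close>

lemma globular_sum_ext:
 assumes s: "is_globular_sum C G T X \<iota>" and C: "category C" "is_functor Globe C G" "is_table T"
  and h: "h \<in> hom C X Y" "h' \<in> hom C X Y" "\<And>m. m \<le> last_index T \<Longrightarrow> Comp C h (\<iota> m) = Comp C h' (\<iota> m)"
 shows "h = h'"
proof -
 have glob: "snd G (globe_map e j i) \<in> hom C (fst G j) (fst G i)" if "j < i" "e = Src \<or> e = Tgt" for e j i
  using that by (intro functor_hom[OF C(2)]) (auto simp: hom_def Globe_def globe_map_def globe_hom_def)
 have io: "\<iota> m \<in> hom C (fst G (summand T m)) X" if "m \<le> last_index T" for m
  using s that by (auto simp: is_globular_sum_def is_sum_cocone_def)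
 have "is_sum_cocone C G T Y (\<lambda>m. Comp C h (\<iota> m))"
  unfolding is_sum_cocone_def
 proof (intro conjI allI impI)
  show "Y \<in> Obj C" using cat_obj[OF C(1) h(1)] by simp
  show "Comp C h (\<iota> m) \<in> hom C (fst G (summand T m)) Y" if "m \<le> last_index T" for m
   using cat_comp[OF C(1) io[OF that] h(1)] .
  fix m assume m: "m < last_index T"
  note tb = is_tableD[OF C(3) m]
  have "Comp C (\<iota> m) (snd G (globe_map Tgt (glue T m) (summand T m))) =
    Comp C (\<iota> (Suc m)) (snd G (globe_map Src (glue T m) (summand T (Suc m))))"
   using s m by (auto simp: is_globular_sum_def is_sum_cocone_def)
  thus "Comp C (Comp C h (\<iota> m)) (snd G (globe_map Tgt (glue T m) (summand T m))) =
    Comp C (Comp C h (\<iota> (Suc m))) (snd G (globe_map Src (glue T m) (summand T (Suc m))))"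
   using cat_assoc[OF C(1) glob io h(1)] tb m by (metis Suc_leI less_imp_le)
 qed
 hence "\<exists>!k. k \<in> hom C X Y \<and> (\<forall>m\<le>last_index T. Comp C k (\<iota> m) = Comp C h (\<iota> m))"
  using s by (auto simp: is_globular_sum_def)
 thus ?thesis using h by metis
qed

lemma sum_cocone_functor:
 assumes F: "is_functor C D F" and G: "is_functor Globe C G" and GH: "functor_eq Globe (comp_functor F G) H"
  and T: "is_table T" and c: "is_sum_cocone C G T X \<iota>"
 shows "is_sum_cocone D H T (fst F X) (\<lambda>m. snd F (\<iota> m))"
 unfolding is_sum_cocone_def
proof (intro conjI allI impI)
 have ob: "fst H i = fst F (fst G i)" for i using GH by (simp add: functor_eq_def comp_functor_def Globe_def)
 have gm: "globe_map e j i \<in> hom Globe j i" if "j < i" "e = Src \<or> e = Tgt" for e j i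
  using that by (auto simp: hom_def Globe_def globe_map_def globe_hom_def)
 hence ga: "snd H (globe_map e j i) = snd F (snd G (globe_map e j i))" if "j < i" "e = Src \<or> e = Tgt" for e j i
  using GH that homD[OF gm[OF that]] by (simp add: functor_eq_def comp_functor_def)
 show "fst F X \<in> Obj D" using functor_obj[OF F] c by (simp add: is_sum_cocone_def)
 have io: "\<iota> m \<in> hom C (fst G (summand T m)) X" if "m \<le> last_index T" for m
  using c that by (simp add: is_sum_cocone_def)
 show "snd F (\<iota> m) \<in> hom D (fst H (summand T m)) (fst F X)" if "m \<le> last_index T" for m
  using functor_hom[OF F io[OF that]] ob by simp
 fix m assume m: "m < last_index T"
 note tb = is_tableD[OF T m]
 have "Comp D (snd F (\<iota> m)) (snd H (globe_map Tgt (glue T m) (summand T m))) =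
  snd F (Comp C (\<iota> m) (snd G (globe_map Tgt (glue T m) (summand T m))))"
  using functor_comp[OF F functor_hom[OF G gm] io] ga tb m by simp
 also have "\<dots> = snd F (Comp C (\<iota> (Suc m)) (snd G (globe_map Src (glue T m) (summand T (Suc m)))))"
  using c m by (simp add: is_sum_cocone_def)
 also have "\<dots> = Comp D (snd F (\<iota> (Suc m))) (snd H (globe_map Src (glue T m) (summand T (Suc m))))"
  using functor_comp[OF F functor_hom[OF G gm] io] ga tb m by simp
 finally show "Comp D (snd F (\<iota> m)) (snd H (globe_map Tgt (glue T m) (summand T m))) =
  Comp D (snd F (\<iota> (Suc m))) (snd H (globe_map Src (glue T m) (summand T (Suc m))))" .
qed

text \<open>It suffices to check the preservation of globular sums for one sum of each shape, because any other
 one is isomorphic to it.\<close>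

lemma globular_sum_preserved:
 assumes F: "is_functor C D F" and G: "is_functor Globe C G" and GH: "functor_eq Globe (comp_functor F G) H"
  and H: "is_functor Globe D H" and T: "is_table T"
  and s0: "is_globular_sum C G T X0 \<iota>0" and s0': "is_globular_sum D H T (fst F X0) (\<lambda>m. snd F (\<iota>0 m))"
  and s: "is_globular_sum C G T X \<iota>"
 shows "is_globular_sum D H T (fst F X) (\<lambda>m. snd F (\<iota> m))"
proof -
 note C = functor_cats[OF F, THEN conjunct1] and D = functor_cats[OF F, THEN conjunct2]
 have ob: "fst H i = fst F (fst G i)" for i using GH by (simp add: functor_eq_def comp_functor_def Globe_def)
 have c0: "is_sum_cocone C G T X0 \<iota>0" and c: "is_sum_cocone C G T X \<iota>" using s0 s by (auto simp: is_globular_sum_def)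
 obtain u where u: "u \<in> hom C X0 X" "\<forall>m\<le>last_index T. Comp C u (\<iota>0 m) = \<iota> m"
  using s0 c unfolding is_globular_sum_def by blast
 obtain w where w: "w \<in> hom C X X0" "\<forall>m\<le>last_index T. Comp C w (\<iota> m) = \<iota>0 m"
  using s c0 unfolding is_globular_sum_def by blast
 have i0: "\<iota>0 m \<in> hom C (fst G (summand T m)) X0" and i1: "\<iota> m \<in> hom C (fst G (summand T m)) X"
  if "m \<le> last_index T" for m using globular_sum_hom s0 s that by metis+
 have uw: "Comp C u w = Id C X"
 proof (rule globular_sum_ext[OF s C G T])
  show "Comp C u w \<in> hom C X X" using cat_comp[OF C w(1) u(1)] .
  show "Id C X \<in> hom C X X" using cat_id[OF C] cat_obj[OF C u(1)] by simp
  show "Comp C (Comp C u w) (\<iota> m) = Comp C (Id C X) (\<iota> m)" if "m \<le> last_index T" for m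
   using that u w cat_assoc[OF C i1[OF that] w(1) u(1)] cat_id_comp[OF C i1[OF that]] by simp
 qed
 note Fu = functor_hom[OF F u(1)] and Fw = functor_hom[OF F w(1)]
 have Fi: "snd F (\<iota> m) \<in> hom D (fst H (summand T m)) (fst F X)" if "m \<le> last_index T" for m
  using functor_hom[OF F i1[OF that]] ob by simp
 have Fi0: "snd F (\<iota>0 m) \<in> hom D (fst H (summand T m)) (fst F X0)" if "m \<le> last_index T" for m
  using functor_hom[OF F i0[OF that]] ob by simp
 have Fuw: "Comp D (snd F u) (snd F w) = Id D (fst F X)"
  using functor_comp[OF F w(1) u(1)] uw functor_id[OF F] cat_obj[OF C u(1)] by simp
 show ?thesis unfolding is_globular_sum_def
 proof (intro conjI allI impI)
  show "is_sum_cocone D H T (fst F X) (\<lambda>m. snd F (\<iota> m))" using sum_cocone_functor[OF F G GH T c] .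
  fix Y \<kappa> assume k: "is_sum_cocone D H T Y \<kappa>"
  obtain h where h: "h \<in> hom D (fst F X0) Y" "\<forall>m\<le>last_index T. Comp D h (snd F (\<iota>0 m)) = \<kappa> m"
   using s0' k unfolding is_globular_sum_def by blast
  let ?h = "Comp D h (snd F w)"
  show "\<exists>!h. h \<in> hom D (fst F X) Y \<and> (\<forall>m\<le>last_index T. Comp D h (snd F (\<iota> m)) = \<kappa> m)"
  proof (rule ex1I[of _ ?h])
   have "Comp D ?h (snd F (\<iota> m)) = \<kappa> m" if m: "m \<le> last_index T" for m
   proof -
    have "Comp D ?h (snd F (\<iota> m)) = Comp D h (Comp D (snd F w) (snd F (\<iota> m)))"
     using cat_assoc[OF D Fi[OF m] Fw h(1)] by simp
    also have "Comp D (snd F w) (snd F (\<iota> m)) = snd F (\<iota>0 m)"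
     using functor_comp[OF F i1[OF m] w(1)] w(2) m by simp
    finally show ?thesis using h m by simp
   qed
   thus "?h \<in> hom D (fst F X) Y \<and> (\<forall>m\<le>last_index T. Comp D ?h (snd F (\<iota> m)) = \<kappa> m)"
    using cat_comp[OF D Fw h(1)] by blast
   fix h' assume h': "h' \<in> hom D (fst F X) Y \<and> (\<forall>m\<le>last_index T. Comp D h' (snd F (\<iota> m)) = \<kappa> m)"
   have "Comp D h' (snd F u) = h"
   proof (rule globular_sum_ext[OF s0' D H T])
    show "Comp D h' (snd F u) \<in> hom D (fst F X0) Y" using cat_comp[OF D Fu] h' by blast
    show "Comp D (Comp D h' (snd F u)) (snd F (\<iota>0 m)) = Comp D h (snd F (\<iota>0 m))" if m: "m \<le> last_index T" for m
    proof -
     have "Comp D (Comp D h' (snd F u)) (snd F (\<iota>0 m)) = Comp D h' (Comp D (snd F u) (snd F (\<iota>0 m)))"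
      using cat_assoc[OF D Fi0[OF m] Fu] h' by metis
     also have "Comp D (snd F u) (snd F (\<iota>0 m)) = snd F (\<iota> m)"
      using functor_comp[OF F i0[OF m] u(1)] u(2) m by simp
     finally show ?thesis using h h' m by simp
    qed
   qed (use h in simp)
   hence "?h = Comp D (Comp D h' (snd F u)) (snd F w)" by simp
   also have "\<dots> = Comp D h' (Comp D (snd F u) (snd F w))" using cat_assoc[OF D Fw Fu] h' by metis
   also have "\<dots> = h'" using Fuw cat_id_comp[OF D] h' by metis
   finally show "h' = ?h" by simp
  qed
 qed
qed

section \<open>The category of ps-contexts and substitutions of bounded level\<close>

text \<open>The opposite of the syntactic category on the ps-contexts, and its subcategories of substitutions of
 level at most \<open>n\<close>, are encoded in the types of \<open>Theta0\<close>, so that they can serve as test categories.\<close>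

definition enc :: "sub \<Rightarrow> nat \<Rightarrow> (nat \<times> side) set \<Rightarrow> (nat \<times> side) set" where
 "enc \<gamma> = (\<lambda>_ _. {(to_nat \<gamma>, Src)})"

definition dec :: "(nat \<Rightarrow> (nat \<times> side) set \<Rightarrow> (nat \<times> side) set) \<Rightarrow> sub" where
 "dec = inv enc"

lemma enc_inj: "inj enc"
 by (auto simp: inj_def enc_def fun_eq_iff)

lemma dec_enc [simp]: "dec (enc \<gamma>) = \<gamma>"
 unfolding dec_def by (rule inv_f_f[OF enc_inj])

definition tab :: "scheme \<Rightarrow> table" where
 "tab X = (THE T. is_table T \<and> gsum T = X)"

lemma tab_gsum [simp]: "is_table T \<Longrightarrow> tab (gsum T) = T"
 unfolding tab_def using gsum_inj by blast

definition ar :: "table \<Rightarrow> sub \<Rightarrow> table \<Rightarrow> scheme_arr" where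
 "ar T \<gamma> T' = (gsum T, enc \<gamma>, gsum T')"

text \<open>The direction is reversed: an arrow from \<open>T\<close> to \<open>T'\<close> is a
  substitution that is typed over the context of \<open>T'\<close> and instantiates the context of
  \<open>T\<close>.\<close>

definition wfs :: "table \<Rightarrow> sub \<Rightarrow> table \<Rightarrow> bool" where
 "wfs T \<gamma> T' \<longleftrightarrow> is_table T \<and> is_table T' \<and> wf_sub (ctxT T') \<gamma> (ctxT T)"

definition sComp :: "scheme_arr \<Rightarrow> scheme_arr \<Rightarrow> scheme_arr" where
 "sComp = (\<lambda>(Y', g, Z) (X, f, Y). (X, enc (comp_sub (dec f) (dec g)), Z))"

text \<open>Parametrized by a predicate on substitutions, so that the stages and their union are
  treated together.\<close>

definition Scat :: "(sub \<Rightarrow> bool) \<Rightarrow> (scheme, scheme_arr) cat" where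
 "Scat P = \<lparr>Obj = gsum ` {T. is_table T}, Arr = {ar T \<gamma> T' | T \<gamma> T'. wfs T \<gamma> T' \<and> P \<gamma>},
   Dom = (\<lambda>(X, f, Y). X), Cod = (\<lambda>(X, f, Y). Y), Id = (\<lambda>X. (X, enc (id_sub (ctxT (tab X))), X)),
   Comp = sComp\<rparr>"

lemma Scat_simps [simp]:
 "Obj (Scat P) = gsum ` {T. is_table T}" "Comp (Scat P) = sComp"
 "Dom (Scat P) (ar T \<gamma> T') = gsum T" "Cod (Scat P) (ar T \<gamma> T') = gsum T'"
 by (auto simp: Scat_def ar_def)

lemma Scat_Arr: "f \<in> Arr (Scat P) \<longleftrightarrow> (\<exists>T \<gamma> T'. f = ar T \<gamma> T' \<and> wfs T \<gamma> T' \<and> P \<gamma>)"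
 by (auto simp: Scat_def)

lemma Scat_Id: "is_table T \<Longrightarrow> Id (Scat P) (gsum T) = ar T (id_sub (ctxT T)) T"
 by (simp add: Scat_def ar_def)

lemma ar_inj: "ar T \<gamma> T' = ar U \<delta> U' \<Longrightarrow> wfs T \<gamma> T' \<Longrightarrow> wfs U \<delta> U' \<Longrightarrow> T = U \<and> \<gamma> = \<delta> \<and> T' = U'"
 using gsum_inj enc_inj by (auto simp: ar_def wfs_def inj_def)

lemma sComp_ar [simp]: "sComp (ar U' \<delta> V) (ar T \<gamma> U) = ar T (comp_sub \<gamma> \<delta>) V"
 by (simp add: sComp_def ar_def)

lemma Scat_hom:
 assumes "is_table T" "is_table T'"
 shows "f \<in> hom (Scat P) (gsum T) (gsum T') \<longleftrightarrow> (\<exists>\<gamma>. f = ar T \<gamma> T' \<and> wfs T \<gamma> T' \<and> P \<gamma>)"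
proof
 assume "f \<in> hom (Scat P) (gsum T) (gsum T')"
 then obtain U \<gamma> U' where u: "f = ar U \<gamma> U'" "wfs U \<gamma> U'" "P \<gamma>" "gsum U = gsum T" "gsum U' = gsum T'"
  by (auto simp: hom_def Scat_Arr)
 hence "U = T" "U' = T'" using gsum_inj assms by (auto simp: wfs_def)
 thus "\<exists>\<gamma>. f = ar T \<gamma> T' \<and> wfs T \<gamma> T' \<and> P \<gamma>" using u by blast
qed (auto simp: hom_def Scat_Arr)

lemma wfs_comp: "wfs T \<gamma> U \<Longrightarrow> wfs U \<delta> V \<Longrightarrow> wfs T (comp_sub \<gamma> \<delta>) V"
 using substitution(4) by (auto simp: wfs_def)

lemma wfs_id: "is_table T \<Longrightarrow> wfs T (id_sub (ctxT T)) T"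
 using wf_id_sub ctxT_wf by (auto simp: wfs_def)

lemma wfs_id_comp: "wfs T \<gamma> U \<Longrightarrow> comp_sub (id_sub (ctxT T)) \<gamma> = \<gamma>"
 using id_comp_sub wf_sub_distinct wf_sub_dom by (metis wfs_def)

lemma wfs_assoc: "wfs T \<gamma> U \<Longrightarrow> wfs U \<delta> V \<Longrightarrow> comp_sub (comp_sub \<gamma> \<delta>) \<theta> = comp_sub \<gamma> (comp_sub \<delta> \<theta>)"
 using wf_vars(4)[of "ctxT U" \<gamma> "ctxT T"] wf_sub_dom_set[of "ctxT V" \<delta> "ctxT U"]
 by (intro comp_sub_assoc) (auto simp: wfs_def)

lemma category_Scat:
 assumes "\<And>T. P (id_sub (ctxT T))" "\<And>\<gamma> \<delta>. P \<gamma> \<Longrightarrow> P \<delta> \<Longrightarrow> P (comp_sub \<gamma> \<delta>)"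
 shows "category (Scat P)"
 unfolding category_def
proof (intro conjI ballI impI)
 fix f assume "f \<in> Arr (Scat P)"
 then obtain T \<gamma> T' where f: "f = ar T \<gamma> T'" "wfs T \<gamma> T'" "P \<gamma>" by (auto simp: Scat_Arr)
 hence t: "is_table T" "is_table T'" by (auto simp: wfs_def)
 show "Dom (Scat P) f \<in> Obj (Scat P)" "Cod (Scat P) f \<in> Obj (Scat P)" using f t by auto
 show "Comp (Scat P) f (Id (Scat P) (Dom (Scat P) f)) = f" "Comp (Scat P) (Id (Scat P) (Cod (Scat P) f)) f = f"
  using f t by (auto simp: Scat_Id wfs_id_comp)
 fix g assume "g \<in> Arr (Scat P)" "Dom (Scat P) g = Cod (Scat P) f"
 then obtain U \<delta> V where g: "g = ar U \<delta> V" "wfs U \<delta> V" "P \<delta>" "gsum U = gsum T'" using f by (auto simp: Scat_Arr)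
 hence U: "U = T'" using gsum_inj f by (auto simp: wfs_def)
 thus "Comp (Scat P) g f \<in> hom (Scat P) (Dom (Scat P) f) (Cod (Scat P) g)"
 proof -
  have "wfs T (comp_sub \<gamma> \<delta>) V" "P (comp_sub \<gamma> \<delta>)" using f g U wfs_comp assms(2) by blast+
  hence "ar T (comp_sub \<gamma> \<delta>) V \<in> Arr (Scat P)" unfolding Scat_Arr by blast
  thus ?thesis using f g U by (simp add: hom_def)
 qed
 fix h assume "h \<in> Arr (Scat P)" "Dom (Scat P) h = Cod (Scat P) g"
 then obtain W \<theta> Z where h: "h = ar W \<theta> Z" by (auto simp: Scat_Arr)
 show "Comp (Scat P) h (Comp (Scat P) g f) = Comp (Scat P) (Comp (Scat P) h g) f"
  using f g h U wfs_assoc by auto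
next
 fix X assume "X \<in> Obj (Scat P)"
 then obtain T where T: "is_table T" "X = gsum T" by auto
 hence "ar T (id_sub (ctxT T)) T \<in> Arr (Scat P)" unfolding Scat_Arr using wfs_id assms(1) by blast
 thus "Id (Scat P) X \<in> hom (Scat P) X X" using T by (simp add: Scat_Id hom_def)
qed

abbreviation S :: "nat \<Rightarrow> (scheme, scheme_arr) cat" where
 "S n \<equiv> Scat (lev_sub n)"

abbreviation SS :: "(scheme, scheme_arr) cat" where
 "SS \<equiv> Scat (\<lambda>_. True)"

lemma category_S: "category (S n)"
 by (rule category_Scat) (auto intro: lev_id_sub lev_comp_sub)

lemma category_SS: "category SS"
 by (rule category_Scat) auto

subsection \<open>Arrows out of globes are terms\<close>

definition tyT :: "table \<Rightarrow> tm \<Rightarrow> ty" where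
 "tyT T t = (THE A. wf_tm (ctxT T) t A)"

definition tmd :: "table \<Rightarrow> nat \<Rightarrow> tm \<Rightarrow> bool" where
 "tmd T k t \<longleftrightarrow> is_table T \<and> wf_tm (ctxT T) t (tyT T t) \<and> tdim (tyT T t) = k"

lemma tyT_eq: "wf_tm (ctxT T) t A \<Longrightarrow> tyT T t = A"
 unfolding tyT_def using wf_tm_unique by blast

lemma tmdI: "is_table T \<Longrightarrow> wf_tm (ctxT T) t A \<Longrightarrow> tdim A = k \<Longrightarrow> tmd T k t"
 using tyT_eq by (auto simp: tmd_def)

definition tsub :: "table \<Rightarrow> nat \<Rightarrow> tm \<Rightarrow> sub" where
 "tsub T k t = gsub (k, []) (\<lambda>_. t) (\<lambda>_. tyT T t)"

text \<open>The analogue of the Yoneda lemma: arrows out of a globe correspond to terms by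
  evaluation at the top variable; see \<open>wfs_globe\<close> and \<open>arr_inj\<close>.\<close>

definition arr :: "table \<Rightarrow> nat \<Rightarrow> tm \<Rightarrow> scheme_arr" where
 "arr T k t = ar (k, []) (tsub T k t) T"

lemma tmd_fits: "tmd T k t \<Longrightarrow> fits (ctxT T) (k, []) (\<lambda>_. t) (\<lambda>_. tyT T t)"
 by (rule fits_globe) (auto simp: tmd_def)

lemma wfs_tsub: "tmd T k t \<Longrightarrow> wfs (k, []) (tsub T k t) T"
 using wf_gsub[OF is_table_globe tmd_fits, of T k t] by (auto simp: wfs_def tsub_def tmd_def)

lemma sv_tsub: "tmd T k t \<Longrightarrow> l \<in> globe_hom j k \<Longrightarrow> sv (tsub T k t) (cvar (k, []) j 0 l) = face t (tyT T t) j l"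
 unfolding tsub_def by (rule sv_gsub[OF is_table_globe tmd_fits]) (auto simp: mem_sum_cells)

lemma sv_tsub_top: "tmd T k t \<Longrightarrow> sv (tsub T k t) (top_var (k, []) 0) = t"
 using sv_tsub[of T k t Idn k] by (simp add: face_def globe_hom_iff)

lemma globe_sub_ext:
 assumes "wfs (k, []) \<gamma> T" "wfs (k, []) \<delta> T" "sv \<gamma> (top_var (k, []) 0) = sv \<delta> (top_var (k, []) 0)"
 shows "\<gamma> = \<delta>"
 using assms by (intro sub_ext[OF is_table_globe, where \<Delta> = "ctxT T"]) (auto simp: wfs_def)

lemma wfs_globe:
 assumes "wfs (k, []) \<gamma> T"
 obtains t where "tmd T k t" "\<gamma> = tsub T k t"
proof -
 let ?t = "sv \<gamma> (top_var (k, []) 0)"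
 have "wf_tm (ctxT T) ?t (subst_ty \<gamma> (vty (k, []) k 0))"
  using sub_top_wf[of "(k, [])" "ctxT T" \<gamma> 0] assms by (auto simp: wfs_def)
 hence t: "tmd T k ?t" using tmdI assms by (auto simp: wfs_def)
 moreover have "\<gamma> = tsub T k ?t" using globe_sub_ext[OF assms wfs_tsub[OF t]] sv_tsub_top[OF t] by simp
 ultimately show thesis using that by blast
qed

lemma lev_gsub:
 assumes T: "is_table T" "is_table U" and f: "fits (ctxT U) T t A" and l: "\<And>m. m \<le> last_index T \<Longrightarrow> lev_tm n (t m)"
 shows "lev_sub n (gsub T t A)"
 unfolding lev_sub_def
proof (intro ballI, clarify)
 fix x s assume x: "(x, s) \<in> set (gsub T t A)"
 note w = wf_gsub[OF T(1) f]
 have "sv (gsub T t A) x = s" using sv_in[OF wf_sub_distinct[OF w] x] .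
 moreover have "x \<in> vars_ctx (ctxT T)" using wf_sub_dom_set[OF w] x by force
 then obtain k m l where c: "(m, l) \<in> sum_cells T k" "x = cvar T k m l" using ctxT_mem[OF T(1)] by (auto elim!: vars_ctxE)
 moreover have "wf_tm (ctxT U) (t m) (A m)" "lev_tm n (t m)" using f c l by (auto simp: fits_def mem_sum_cells)
 ultimately show "lev_tm n s" using sv_gsub[OF T(1) f c(1)] lev_face[OF T(2), of "t m" "A m" n k l] by simp
qed

lemma lev_tsub: "tmd T k t \<Longrightarrow> lev_sub n (tsub T k t) \<longleftrightarrow> lev_tm n t"
proof
 assume t: "tmd T k t" "lev_sub n (tsub T k t)"
 show "lev_tm n t" using lev_sv[OF t(2), of "top_var (k, []) 0"] sv_tsub_top[OF t(1)] by simp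
next
 assume t: "tmd T k t" "lev_tm n t"
 show "lev_sub n (tsub T k t)" unfolding tsub_def
  using lev_gsub[OF is_table_globe _ tmd_fits[OF t(1)]] t by (auto simp: tmd_def)
qed

lemma arr_hom: "tmd T k t \<Longrightarrow> lev_tm n t \<Longrightarrow> arr T k t \<in> hom (S n) (gsum (k, [])) (gsum T)"
 using wfs_tsub[of T k t] lev_tsub[of T k t n] Scat_hom[OF is_table_globe, of T] by (auto simp: arr_def wfs_def)

lemma hom_globe:
 assumes "is_table T" "f \<in> hom (S n) (gsum (k, [])) (gsum T)"
 obtains t where "tmd T k t" "lev_tm n t" "f = arr T k t"
proof -
 from assms obtain \<gamma> where g: "f = ar (k, []) \<gamma> T" "wfs (k, []) \<gamma> T" "lev_sub n \<gamma>"
  using Scat_hom[OF is_table_globe assms(1)] by blast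
 from g(2) obtain t where "tmd T k t" "\<gamma> = tsub T k t" by (rule wfs_globe)
 thus thesis using that g lev_tsub by (auto simp: arr_def)
qed

lemma arr_inj: "tmd T k t \<Longrightarrow> tmd T' k' t' \<Longrightarrow> arr T k t = arr T' k' t' \<Longrightarrow> T = T' \<and> k = k' \<and> t = t'"
 using ar_inj[OF _ wfs_tsub wfs_tsub] sv_tsub_top unfolding arr_def by (metis prod.inject)

lemma tmd_subst: "wfs T \<gamma> U \<Longrightarrow> tmd T k t \<Longrightarrow> tmd U k (subst_tm \<gamma> t) \<and> tyT U (subst_tm \<gamma> t) = subst_ty \<gamma> (tyT T t)"
 using substitution(3)[of "ctxT T" t "tyT T t" "ctxT U" \<gamma>] tmdI tyT_eq by (auto simp: wfs_def tmd_def)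

lemma comp_arr:
 assumes "wfs T \<gamma> U" "tmd T k t"
 shows "sComp (ar T \<gamma> U) (arr T k t) = arr U k (subst_tm \<gamma> t)"
proof -
 have "comp_sub (tsub T k t) \<gamma> = tsub U k (subst_tm \<gamma> t)"
 proof (rule globe_sub_ext)
  show "wfs (k, []) (comp_sub (tsub T k t) \<gamma>) U" using wfs_comp[OF wfs_tsub[OF assms(2)] assms(1)] .
  show "wfs (k, []) (tsub U k (subst_tm \<gamma> t)) U" using wfs_tsub tmd_subst assms by blast
  have "top_var (k, []) 0 \<in> fst ` set (tsub T k t)"
   using wf_sub_dom_set wfs_tsub[OF assms(2)] cvar_vars[OF is_table_globe top_cell[of 0 "(k, [])"]] by (auto simp: wfs_def)
  thus "sv (comp_sub (tsub T k t) \<gamma>) (top_var (k, []) 0) = sv (tsub U k (subst_tm \<gamma> t)) (top_var (k, []) 0)"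
   using sv_comp_sub sv_tsub_top[OF assms(2)] sv_tsub_top[OF tmd_subst[OF assms, THEN conjunct1]] by metis
 qed
 thus ?thesis by (simp add: arr_def)
qed

definition gl :: "(scheme, scheme_arr) globes" where
 "gl = ((\<lambda>i. gsum (i, [])), (\<lambda>(j, l, i). arr (i, []) j (Var (cvar (i, []) j 0 l))))"

lemma gl_simps [simp]: "fst gl i = gsum (i, [])" "snd gl (j, l, i) = arr (i, []) j (Var (cvar (i, []) j 0 l))"
 by (auto simp: gl_def)

lemma tmd_Var:
 assumes "is_table T" "(m, l) \<in> sum_cells T k"
 shows "tmd T k (Var (cvar T k m l))" "tyT T (Var (cvar T k m l)) = vty T k m"
proof -
 have "wf_tm (ctxT T) (Var (cvar T k m l)) (vty T k m)"
  using cvar_in_ctxT[OF assms] ctxT_wf[OF assms(1)] by (simp add: wf_tm_Var)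
 thus "tmd T k (Var (cvar T k m l))" "tyT T (Var (cvar T k m l)) = vty T k m"
  using tmdI assms tyT_eq by auto
qed

lemma tmd_face: "tmd T i t \<Longrightarrow> l \<in> globe_hom j i \<Longrightarrow> tmd T j (face t (tyT T t) j l) \<and> tyT T (face t (tyT T t) j l) = trunc (tyT T t) j"
 using wf_face[of "ctxT T" t "tyT T t" l j] tmdI[of T "face t (tyT T t) j l"] tyT_eq tdim_trunc[of j "tyT T t"]
 by (auto simp: tmd_def globe_hom_iff)

lemma comp_gl:
 assumes t: "tmd T i t" and l: "l \<in> globe_hom j i"
 shows "sComp (arr T i t) (snd gl (j, l, i)) = arr T j (face t (tyT T t) j l)"
proof -
 have v: "tmd (i, []) j (Var (cvar (i, []) j 0 l))" using l by (intro tmd_Var) (auto simp: mem_sum_cells)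
 show ?thesis using comp_arr[OF wfs_tsub[OF t] v] sv_tsub[OF t l] by (simp add: arr_def del: cvar.simps)
qed

lemma category_Globe: "category Globe"
 by (auto simp: category_def Globe_def hom_def globe_hom_def split: if_splits)

lemma gl_functor: "is_functor Globe (S n) gl"
 unfolding is_functor_def
proof (intro conjI ballI impI)
 show "category Globe" by (rule category_Globe)
 show "category (S n)" by (rule category_S)
 fix i :: nat
 show "fst gl i \<in> Obj (S n)" by auto
 have v: "tmd (i, []) i (Var (top_var (i, []) 0))" using tmd_Var[OF is_table_globe top_cell[of 0 "(i, [])"]] by simp
 have "tsub (i, []) i (Var (top_var (i, []) 0)) = id_sub (ctxT (i, []))"
  using globe_sub_ext[OF wfs_tsub[OF v] wfs_id] sv_tsub_top[OF v] by simp
 thus "snd gl (Id Globe i) = Id (S n) (fst gl i)" by (simp add: Globe_def arr_def Scat_Id)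
next
 fix f assume "f \<in> Arr Globe"
 then obtain j l i where f: "f = (j, l, i)" "l \<in> globe_hom j i" by (auto simp: Globe_def)
 have v: "tmd (i, []) j (Var (cvar (i, []) j 0 l))" using f by (intro tmd_Var) (auto simp: mem_sum_cells)
 show "snd gl f \<in> hom (S n) (fst gl (Dom Globe f)) (fst gl (Cod Globe f))"
  using arr_hom[OF v] f by (simp add: Globe_def)
 fix g assume "g \<in> Arr Globe" "Dom Globe g = Cod Globe f"
 then obtain l' k where g: "g = (i, l', k)" "l' \<in> globe_hom i k" using f by (auto simp: Globe_def)
 have w: "tmd (k, []) i (Var (cvar (k, []) i 0 l'))" "tyT (k, []) (Var (cvar (k, []) i 0 l')) = vty (k, []) i 0"
  using tmd_Var[OF is_table_globe, of 0 l' k i] g by (auto simp: mem_sum_cells)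
 have "sComp (snd gl g) (snd gl f) = arr (k, []) j (face (Var (cvar (k, []) i 0 l')) (vty (k, []) i 0) j l)"
  using comp_gl[OF w(1) f(2)] w(2) f g by simp
 also have "face (Var (cvar (k, []) i 0 l')) (vty (k, []) i 0) j l = Var (cvar (k, []) j 0 (if l = Idn then l' else l))"
  using f(2) bdf_vty[of j i l "(k, [])" 0] by (auto simp: face_def globe_hom_iff)
 finally show "snd gl (Comp Globe g f) = Comp (S n) (snd gl g) (snd gl f)"
  using f g by (simp add: Globe_def)
qed

definition inj_sum :: "table \<Rightarrow> nat \<Rightarrow> scheme_arr" where
 "inj_sum T m = arr T (summand T m) (Var (top_var T m))"

lemma inj_sum_hom: "is_table T \<Longrightarrow> m \<le> last_index T \<Longrightarrow> inj_sum T m \<in> hom (S n) (fst gl (summand T m)) (gsum T)"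
 unfolding inj_sum_def using arr_hom tmd_Var(1) top_cell by simp

lemma inj_sum_face:
 assumes "is_table T" "(m, l) \<in> sum_cells T k"
 shows "sComp (inj_sum T m) (snd gl (k, l, summand T m)) = arr T k (Var (cvar T k m l))"
proof -
 have m: "m \<le> last_index T" "l \<in> globe_hom k (summand T m)" using assms by (auto simp: mem_sum_cells)
 note v = tmd_Var[OF assms(1) top_cell[OF m(1)]]
 show ?thesis unfolding inj_sum_def comp_gl[OF v(1) m(2)] v(2)
  using m(2) bdf_vty[of k "summand T m" l T m] by (auto simp: face_def globe_hom_iff)
qed

lemma comp_inj_sum: "wfs T \<gamma> U \<Longrightarrow> m \<le> last_index T \<Longrightarrow> sComp (ar T \<gamma> U) (inj_sum T m) = arr U (summand T m) (sv \<gamma> (top_var T m))"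
 unfolding inj_sum_def using comp_arr tmd_Var(1) top_cell by (simp add: wfs_def)

lemma globe_map_less: "j < i \<Longrightarrow> globe_map e j i = (j, e, i)"
 by (simp add: globe_map_def)

text \<open>A cocone is a family of terms whose faces agree along the gluings, and the arrow that it
  induces is \<open>gsub\<close>. Its level does not grow, since faces of terms of level
  \<open>n\<close> have level \<open>n\<close>.\<close>

lemma S_sum:
 assumes T: "is_table T"
 shows "is_globular_sum (S n) gl T (gsum T) (inj_sum T)"
 unfolding is_globular_sum_def
proof (intro conjI allI impI)
 have cell: "(m, l) \<in> sum_cells T k" if "m \<le> last_index T" "k < summand T m" "l = Src \<or> l = Tgt" for k m l
  using that by (auto simp: mem_sum_cells globe_hom_iff)
 show "is_sum_cocone (S n) gl T (gsum T) (inj_sum T)"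
  unfolding is_sum_cocone_def
 proof (intro conjI allI impI)
  show "gsum T \<in> Obj (S n)" using T by simp
  show "inj_sum T m \<in> hom (S n) (fst gl (summand T m)) (gsum T)" if "m \<le> last_index T" for m
   using inj_sum_hom[OF T that] .
  fix m assume m: "m < last_index T"
  note tb = is_tableD[OF T m]
  show "Comp (S n) (inj_sum T m) (snd gl (globe_map Tgt (glue T m) (summand T m))) =
   Comp (S n) (inj_sum T (Suc m)) (snd gl (globe_map Src (glue T m) (summand T (Suc m))))"
   using inj_sum_face[OF T cell, of m "glue T m" Tgt] inj_sum_face[OF T cell, of "Suc m" "glue T m" Src] tb m
   by (simp add: globe_map_less del: gl_simps)
 qed
 fix Y \<kappa> assume k: "is_sum_cocone (S n) gl T Y \<kappa>"
 then obtain U where U: "is_table U" "Y = gsum U" by (auto simp: is_sum_cocone_def)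
 have "\<forall>m. \<exists>t. m \<le> last_index T \<longrightarrow> tmd U (summand T m) t \<and> lev_tm n t \<and> \<kappa> m = arr U (summand T m) t"
 proof (intro allI)
  fix m
  show "\<exists>t. m \<le> last_index T \<longrightarrow> tmd U (summand T m) t \<and> lev_tm n t \<and> \<kappa> m = arr U (summand T m) t"
  proof (cases "m \<le> last_index T")
   case True
   hence "\<kappa> m \<in> hom (S n) (gsum (summand T m, [])) (gsum U)" using k U by (simp add: is_sum_cocone_def)
   from hom_globe[OF U(1) this] show ?thesis by blast
  qed simp
 qed
 then obtain t where t: "\<And>m. m \<le> last_index T \<Longrightarrow> tmd U (summand T m) (t m) \<and> lev_tm n (t m) \<and> \<kappa> m = arr U (summand T m) (t m)"
  by metis
 let ?A = "\<lambda>m. tyT U (t m)"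
 have f: "fits (ctxT U) T t ?A"
  unfolding fits_def
 proof (intro conjI allI impI)
  show "wf_ctx (ctxT U)" using ctxT_wf U by blast
  show "wf_tm (ctxT U) (t m) (?A m)" "tdim (?A m) = summand T m" if "m \<le> last_index T" for m
   using t[OF that] by (auto simp: tmd_def)
  fix m assume m: "m < last_index T"
  note tb = is_tableD[OF T m]
  have "sComp (\<kappa> m) (snd gl (globe_map Tgt (glue T m) (summand T m))) =
   sComp (\<kappa> (Suc m)) (snd gl (globe_map Src (glue T m) (summand T (Suc m))))"
   using k m by (simp add: is_sum_cocone_def)
  moreover have g: "Tgt \<in> globe_hom (glue T m) (summand T m)" "Src \<in> globe_hom (glue T m) (summand T (Suc m))"
   using tb by (auto simp: globe_hom_iff)
  ultimately have "arr U (glue T m) (face (t m) (?A m) (glue T m) Tgt) = arr U (glue T m) (face (t (Suc m)) (?A (Suc m)) (glue T m) Src)"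
   using comp_gl[of U "summand T m" "t m" Tgt] comp_gl[of U "summand T (Suc m)" "t (Suc m)" Src] t[of m] t[of "Suc m"] m tb
   by (simp add: globe_map_less del: gl_simps)
  hence "face (t m) (?A m) (glue T m) Tgt = face (t (Suc m)) (?A (Suc m)) (glue T m) Src"
   using arr_inj tmd_face[OF _ g(1)] tmd_face[OF _ g(2)] t[of m] t[of "Suc m"] m by (metis Suc_leI less_imp_le)
  thus "bdf (?A m) (glue T m) Tgt = bdf (?A (Suc m)) (glue T m) Src" by (simp add: face_def)
 qed
 let ?g = "gsub T t ?A"
 have w: "wfs T ?g U" using wf_gsub[OF T f] T U by (simp add: wfs_def)
 have top: "sv ?g (top_var T m) = t m" if "m \<le> last_index T" for m
  using sv_gsub[OF T f top_cell[OF that]] by (simp add: face_def)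
 show "\<exists>!h. h \<in> hom (S n) (gsum T) Y \<and> (\<forall>m\<le>last_index T. Comp (S n) h (inj_sum T m) = \<kappa> m)"
 proof (rule ex1I[of _ "ar T ?g U"])
  have "lev_sub n ?g" using lev_gsub[OF T U(1) f] t by blast
  thus "ar T ?g U \<in> hom (S n) (gsum T) Y \<and> (\<forall>m\<le>last_index T. Comp (S n) (ar T ?g U) (inj_sum T m) = \<kappa> m)"
   using w Scat_hom[OF T U(1)] U(2) comp_inj_sum[OF w] top t by auto
  fix h assume h: "h \<in> hom (S n) (gsum T) Y \<and> (\<forall>m\<le>last_index T. Comp (S n) h (inj_sum T m) = \<kappa> m)"
  then obtain \<delta> where d: "h = ar T \<delta> U" "wfs T \<delta> U" using Scat_hom[OF T U(1)] U(2) by blast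
  have "sv \<delta> (top_var T m) = sv ?g (top_var T m)" if m: "m \<le> last_index T" for m
  proof -
   have "arr U (summand T m) (sv \<delta> (top_var T m)) = arr U (summand T m) (t m)"
    using h d comp_inj_sum[OF d(2) m] t[OF m] m by simp
   moreover have "tmd U (summand T m) (sv \<delta> (top_var T m))"
    using tmd_subst[OF d(2) tmd_Var(1)[OF T top_cell[OF m]]] by simp
   ultimately show ?thesis using arr_inj t[OF m] top[OF m] by metis
  qed
  hence "\<delta> = ?g" using d w by (intro sub_ext[OF T, where \<Delta> = "ctxT U"]) (auto simp: wfs_def)
  thus "h = ar T ?g U" using d by simp
 qed
qed

lemma S_extension: "globular_extension (S n) gl"
 unfolding globular_extension_def using category_S gl_functor S_sum by blast

section \<open>Maps of globular sums are substitutions of variables\<close>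

text \<open>The middle part of the image type is left open: \<open>vmor_ty\<close> shows that it has
  to be the substituted type.\<close>

definition vmor :: "(nat \<Rightarrow> nat) \<Rightarrow> ctx \<Rightarrow> ctx \<Rightarrow> bool" where
 "vmor g \<Gamma> \<Delta> \<longleftrightarrow> (\<forall>x. (x, Star) \<in> set \<Gamma> \<longrightarrow> (g x, Star) \<in> set \<Delta>) \<and>
   (\<forall>f a C b. (f, Arrow (Var a) C (Var b)) \<in> set \<Gamma> \<longrightarrow>
    (\<exists>C'. (g f, Arrow (Var (g a)) C' (Var (g b))) \<in> set \<Delta>))"

definition vsub :: "(nat \<Rightarrow> nat) \<Rightarrow> ctx \<Rightarrow> sub" where
 "vsub g \<Gamma> = map (\<lambda>(x, A). (x, Var (g x))) \<Gamma>"

lemma sv_vsub: "x \<in> vars_ctx \<Gamma> \<Longrightarrow> sv (vsub g \<Gamma>) x = Var (g x)"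
 unfolding vsub_def by (rule sv_map)

lemma lev_vsub: "lev_sub n (vsub g \<Gamma>)"
 by (auto simp: lev_sub_def vsub_def)

lemma vmor_ty:
 assumes g: "vmor g \<Gamma> \<Delta>" and vt: "var_types \<Gamma>" "var_types \<Delta>" "wf_ctx \<Delta>" and x: "(x, A) \<in> set \<Gamma>"
 shows "(g x, subst_ty (vsub g \<Gamma>) A) \<in> set \<Delta>"
 using x
proof (induction A arbitrary: x rule: tdim.induct)
 case 1 thus ?case using g by (simp add: vmor_def)
next
 case (2 t C u)
 from vt(1) 2(2) obtain a b where ab: "t = Var a" "u = Var b" "(a, C) \<in> set \<Gamma>" "(b, C) \<in> set \<Gamma>" by (rule var_typesE)
 obtain C' where C': "(g x, Arrow (Var (g a)) C' (Var (g b))) \<in> set \<Delta>" using g 2(2) ab unfolding vmor_def by blast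
 hence "(g a, C') \<in> set \<Delta>" using var_types_face[OF vt(2)] by blast
 hence "C' = subst_ty (vsub g \<Gamma>) C" using ctx_fun[OF vt(3)] 2(1)[OF ab(3)] by blast
 thus ?case using C' ab sv_vsub[OF vars_ctxI[OF ab(3)]] sv_vsub[OF vars_ctxI[OF ab(4)]] by simp
qed

lemma vmor_wf:
 assumes "vmor g \<Gamma> \<Delta>" "var_types \<Gamma>" "wf_ctx \<Gamma>" "var_types \<Delta>" "wf_ctx \<Delta>"
 shows "wf_sub \<Delta> (vsub g \<Gamma>) \<Gamma>"
 unfolding vsub_def using vmor_ty[OF assms(1,2,4,5)] assms
 by (intro wf_sub_mapI) (auto simp: wf_tm_Var simp flip: vsub_def)

lemma vmor_vars: "vmor g \<Gamma> \<Delta> \<Longrightarrow> var_types \<Gamma> \<Longrightarrow> (x, A) \<in> set \<Gamma> \<Longrightarrow> \<exists>B. (g x, B) \<in> set \<Delta> \<and> tdim B = tdim A"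
 if "var_types \<Delta>" "wf_ctx \<Delta>"
 using vmor_ty[of g \<Gamma> \<Delta> x A] that tdim_subst by blast

text \<open>No coherence has level 0, so all values of the substitution are variables.\<close>

lemma vmor_of_sub:
 assumes w: "wf_sub \<Delta> \<gamma> \<Gamma>" and l: "lev_sub 0 \<gamma>" and vt: "var_types \<Gamma>"
 obtains g where "\<gamma> = vsub g \<Gamma>" "vmor g \<Gamma> \<Delta>"
proof -
 define g where "g x = (case sv \<gamma> x of Var y \<Rightarrow> y | _ \<Rightarrow> 0)" for x
 have var: "sv \<gamma> x = Var (g x)" for x
  using lev_sv[OF l, of x] by (cases "sv \<gamma> x") (auto simp: g_def)
 have "\<gamma> = vsub g \<Gamma>"
 proof (rule sub_eqI)
  show "map fst \<gamma> = map fst (vsub g \<Gamma>)" using wf_sub_dom[OF w] by (auto simp: vsub_def)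
  show "distinct (map fst \<gamma>)" using wf_sub_distinct[OF w] .
  show "sv \<gamma> x = sv (vsub g \<Gamma>) x" if "x \<in> fst ` set \<gamma>" for x
   using that wf_sub_dom_set[OF w] sv_vsub[of x \<Gamma> g] var by simp
 qed
 moreover have "vmor g \<Gamma> \<Delta>"
 proof -
  have "(g x, subst_ty \<gamma> A) \<in> set \<Delta>" if "(x, A) \<in> set \<Gamma>" for x A
   using wf_sub_sv[OF w that] var by (simp add: wf_tm_Var)
  from this[of _ Star] this[of _ "Arrow (Var _) _ (Var _)"] show ?thesis
   unfolding vmor_def by (simp add: var) blast
 qed
 ultimately show thesis using that by blast
qed

lemma vmor_surj_id:
 assumes "is_table U" "is_table T" "vmor h (ctxT U) (ctxT T)" "vars_ctx (ctxT T) \<subseteq> h ` vars_ctx (ctxT U)"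
 shows "U = T" "vsub h (ctxT U) = id_sub (ctxT U)"
proof -
 have "h ` vars_ctx (ctxT U) \<subseteq> vars_ctx (ctxT T)"
 proof
  fix y assume "y \<in> h ` vars_ctx (ctxT U)"
  then obtain x A where x: "y = h x" "(x, A) \<in> set (ctxT U)" by (auto elim: vars_ctxE)
  from vmor_vars[OF ctxT_vt[OF assms(2)] ctxT_wf[OF assms(2)] assms(3) ctxT_vt[OF assms(1)] x(2)]
  show "y \<in> vars_ctx (ctxT T)" using x(1) vars_ctxI by blast
 qed
 hence im: "h ` vars_ctx (ctxT U) = vars_ctx (ctxT T)" using assms(4) by blast
 have ar: "\<And>f a C b. (f, Arrow (Var a) C (Var b)) \<in> set (ctxT U) \<Longrightarrow> \<exists>C'. (h f, Arrow (Var (h a)) C' (Var (h b))) \<in> set (ctxT T)"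
  and st: "\<And>x. (x, Star) \<in> set (ctxT U) \<Longrightarrow> (h x, Star) \<in> set (ctxT T)" using assms(3) unfolding vmor_def by blast+
 note ps = ctxT_ps[OF assms(1)] ctxT_canonical[OF assms(1)] ctxT_ps[OF assms(2)] ctxT_canonical[OF assms(2)]
 have "ctxT U = ctxT T" by (rule ctx_map_surj_eq(1)[where g = h, OF ps ar st im])
 thus "U = T" by (rule ctxT_inj[OF assms(1,2)])
 have "h x = x" if "x \<in> vars_ctx (ctxT U)" for x by (rule ctx_map_surj_eq(2)[where g = h, OF ps ar st im that])
 thus "vsub h (ctxT U) = id_sub (ctxT U)" unfolding vsub_def id_sub_def by (auto dest: vars_ctxI)
qed

section \<open>The structure functor from \<open>Theta0\<close> to the stage of level 0\<close>

lemma Theta0_hom: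
 assumes "is_table T" "is_table T'"
 shows "F \<in> hom Theta0 (gsum T) (gsum T') \<longleftrightarrow> (\<exists>f\<in>gset_homs (gsum T) (gsum T'). F = (gsum T, f, gsum T'))"
 using is_gset_gsum[OF assms(1)] is_gset_gsum[OF assms(2)] assms
 by (auto simp: hom_def Theta0_def full_subcategory_def GSet_def)

lemma Theta0_Arr: "F \<in> Arr Theta0 \<Longrightarrow> \<exists>T T' f. is_table T \<and> is_table T' \<and> f \<in> gset_homs (gsum T) (gsum T') \<and> F = (gsum T, f, gsum T')"
 by (auto simp: Theta0_def full_subcategory_def GSet_def)

lemma Theta0_Obj: "X \<in> Obj Theta0 \<longleftrightarrow> (\<exists>T. is_table T \<and> X = gsum T)"
 using is_gset_gsum by (auto simp: Theta0_def full_subcategory_def GSet_def)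

lemma dvars_unique: "is_table T \<Longrightarrow> x \<in> dvars T k \<Longrightarrow> x \<in> dvars T k' \<Longrightarrow> k = k'"
 using ctx_fun[OF ctxT_wf] unfolding dvars_def by blast

lemma dvars_vars: "x \<in> vars_ctx (ctxT T) \<longleftrightarrow> (\<exists>k. x \<in> dvars T k)"
 by (auto simp: dvars_def elim: vars_ctxE intro: vars_ctxI)

definition jv :: "table \<Rightarrow> table \<Rightarrow> (nat \<Rightarrow> (nat \<times> side) set \<Rightarrow> (nat \<times> side) set) \<Rightarrow> nat \<Rightarrow> nat" where
 "jv T T' f x = (THE y. \<exists>k. x \<in> dvars T k \<and> y \<in> dvars T' k \<and> f k (cellof T k x) = cellof T' k y)"

lemma jv_eq:
 assumes "is_table T" "is_table T'" "x \<in> dvars T k" "y \<in> dvars T' k" "f k (cellof T k x) = cellof T' k y"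
 shows "jv T T' f x = y"
 unfolding jv_def
proof (rule the_equality)
 show "\<exists>k. x \<in> dvars T k \<and> y \<in> dvars T' k \<and> f k (cellof T k x) = cellof T' k y" using assms by blast
 fix z assume "\<exists>k. x \<in> dvars T k \<and> z \<in> dvars T' k \<and> f k (cellof T k x) = cellof T' k z"
 then obtain k' where k': "x \<in> dvars T k'" "z \<in> dvars T' k'" "f k' (cellof T k' x) = cellof T' k' z" by blast
 hence "k' = k" using dvars_unique assms(1,3) by blast
 thus "z = y" using cellof_inj[OF assms(2)] k' assms by metis
qed

lemma jv:
 assumes T: "is_table T" "is_table T'" and f: "f \<in> gset_homs (gsum T) (gsum T')" and x: "x \<in> dvars T k"
 shows "jv T T' f x \<in> dvars T' k \<and> f k (cellof T k x) = cellof T' k (jv T T' f x)"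
proof -
 have "cellof T k x \<in> cells (gsum T) k" using gsum_cells[OF T(1)] x by blast
 hence "f k (cellof T k x) \<in> cells (gsum T') k" using f by (auto simp: gset_homs_def PiE_def)
 then obtain y where "y \<in> dvars T' k" "f k (cellof T k x) = cellof T' k y" using gsum_cells[OF T(2)] by blast
 thus ?thesis using jv_eq[OF T x] by metis
qed

lemma jv_vmor:
 assumes T: "is_table T" "is_table T'" and f: "f \<in> gset_homs (gsum T) (gsum T')"
 shows "vmor (jv T T' f) (ctxT T) (ctxT T')"
 unfolding vmor_def
proof (intro conjI allI impI)
 fix x assume "(x, Star) \<in> set (ctxT T)"
 hence "x \<in> dvars T 0" unfolding dvars_def by force
 hence "jv T T' f x \<in> dvars T' 0" using jv[OF T f] by blast
 then obtain A where "(jv T T' f x, A) \<in> set (ctxT T')" "tdim A = 0" by (auto simp: dvars_def)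
 thus "(jv T T' f x, Star) \<in> set (ctxT T')" by (cases A) auto
next
 let ?g = "jv T T' f"
 fix x a C b assume x: "(x, Arrow (Var a) C (Var b)) \<in> set (ctxT T)"
 let ?k = "tdim C"
 have ab: "(a, C) \<in> set (ctxT T)" "(b, C) \<in> set (ctxT T)" using var_types_face[OF ctxT_vt[OF T(1)] x] by auto
 have d: "x \<in> dvars T (Suc ?k)" "a \<in> dvars T ?k" "b \<in> dvars T ?k" using x ab unfolding dvars_def by force+
 note jx = jv[OF T f d(1)] and ja = jv[OF T f d(2)] and jb = jv[OF T f d(3)]
 from T(2) jx[THEN conjunct1] obtain a' C' b' where
   x': "(?g x, Arrow (Var a') C' (Var b')) \<in> set (ctxT T')" "tdim C' = ?k" "a' \<in> dvars T' ?k" "b' \<in> dvars T' ?k"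
   by (rule dvars_SucE)
 have cx: "cellof T (Suc ?k) x \<in> cells (gsum T) (Suc ?k)" using gsum_cells[OF T(1)] d by blast
 hence "f ?k (gsrc (gsum T) ?k (cellof T (Suc ?k) x)) = gsrc (gsum T') ?k (f (Suc ?k) (cellof T (Suc ?k) x))"
   "f ?k (gtgt (gsum T) ?k (cellof T (Suc ?k) x)) = gtgt (gsum T') ?k (f (Suc ?k) (cellof T (Suc ?k) x))"
  using f by (auto simp: gset_homs_def)
 hence "f ?k (cellof T ?k a) = cellof T' ?k a'" "f ?k (cellof T ?k b) = cellof T' ?k b'"
  using gsum_faces[OF T(1) x refl] gsum_faces[OF T(2) x'(1,2)] jx by auto
 hence "?g a = a'" "?g b = b'" using jv_eq[OF T] d x' by blast+
 thus "\<exists>C'. (?g x, Arrow (Var (?g a)) C' (Var (?g b))) \<in> set (ctxT T')" using x' by blast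
qed

definition J :: "(scheme, scheme_arr, scheme, scheme_arr) func" where
 "J = (id, (\<lambda>(X, f, Y). ar (tab X) (vsub (jv (tab X) (tab Y) f) (ctxT (tab X))) (tab Y)))"

lemma J_simps [simp]: "fst J X = X"
 "is_table T \<Longrightarrow> is_table T' \<Longrightarrow> snd J (gsum T, f, gsum T') = ar T (vsub (jv T T' f) (ctxT T)) T'"
 by (auto simp: J_def)

lemma vmor_wfs: "is_table T \<Longrightarrow> is_table T' \<Longrightarrow> vmor g (ctxT T) (ctxT T') \<Longrightarrow> wfs T (vsub g (ctxT T)) T'"
 using vmor_wf ctxT_vt ctxT_wf by (simp add: wfs_def)

lemma vsub_eq: "vsub g \<Gamma> = vsub h \<Gamma> \<longleftrightarrow> (\<forall>x\<in>vars_ctx \<Gamma>. g x = h x)"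
 by (auto simp: vsub_def vars_ctx_def)

lemma J_hom: "is_table T \<Longrightarrow> is_table T' \<Longrightarrow> F \<in> hom Theta0 (gsum T) (gsum T') \<Longrightarrow> snd J F \<in> hom (S 0) (gsum T) (gsum T')"
proof -
 assume T: "is_table T" "is_table T'" and "F \<in> hom Theta0 (gsum T) (gsum T')"
 then obtain f where f: "f \<in> gset_homs (gsum T) (gsum T')" "F = (gsum T, f, gsum T')" using Theta0_hom[OF T] by blast
 hence "snd J F = ar T (vsub (jv T T' f) (ctxT T)) T'" using T by simp
 thus ?thesis unfolding Scat_hom[OF T] using vmor_wfs[OF T jv_vmor[OF T f(1)]] lev_vsub by blast
qed

lemma J_functor: "category Theta0 \<Longrightarrow> is_functor Theta0 (S 0) J"
 unfolding is_functor_def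
proof (intro conjI ballI impI)
 show "category (S 0)" by (rule category_S)
 fix X assume "X \<in> Obj Theta0"
 then obtain T where T: "is_table T" "X = gsum T" unfolding Theta0_Obj by blast
 thus "fst J X \<in> Obj (S 0)" by simp
 let ?i = "\<lambda>n. restrict id (cells (gsum T) n)"
 have "jv T T ?i x = x" if xv: "x \<in> vars_ctx (ctxT T)" for x
 proof -
  obtain k where k: "x \<in> dvars T k" using xv unfolding dvars_vars by blast
  hence "cellof T k x \<in> cells (gsum T) k" using gsum_cells[OF T(1)] by blast
  thus ?thesis using jv_eq[OF T(1) T(1) k k, of ?i] by simp
 qed
 hence "vsub (jv T T ?i) (ctxT T) = vsub id (ctxT T)" unfolding vsub_eq by simp
 thus "snd J (Id Theta0 X) = Id (S 0) (fst J X)"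
  using T by (simp add: Scat_Id Theta0_def full_subcategory_def GSet_def) (simp add: vsub_def id_sub_def)
next
 fix F assume "F \<in> Arr Theta0"
 then obtain T T' f where F: "is_table T" "is_table T'" "f \<in> gset_homs (gsum T) (gsum T')" "F = (gsum T, f, gsum T')"
  using Theta0_Arr by blast
 hence FH: "F \<in> hom Theta0 (gsum T) (gsum T')" using Theta0_hom by blast
 thus "snd J F \<in> hom (S 0) (fst J (Dom Theta0 F)) (fst J (Cod Theta0 F))" using J_hom[OF F(1,2)] by (auto simp: hom_def)
 fix F' assume F': "F' \<in> Arr Theta0" "Dom Theta0 F' = Cod Theta0 F"
 obtain U U' f' where u: "is_table U" "is_table U'" "f' \<in> gset_homs (gsum U) (gsum U')" "F' = (gsum U, f', gsum U')"
  using Theta0_Arr[OF F'(1)] by blast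
 hence "F' \<in> hom Theta0 (gsum U) (gsum U')" using Theta0_hom by blast
 hence "gsum U = gsum T'" using F'(2) FH by (auto simp: hom_def)
 hence U: "U = T'" using gsum_inj F(2) u(1) by blast
 let ?c = "\<lambda>n. compose (cells (gsum T) n) (f' n) (f n)"
 have "jv T U' ?c x = jv T' U' f' (jv T T' f x)" if xv: "x \<in> vars_ctx (ctxT T)" for x
 proof -
  obtain k where k: "x \<in> dvars T k" using xv unfolding dvars_vars by blast
  note j1 = jv[OF F(1,2,3) k]
  note j2 = jv[OF F(2) u(2) u(3)[unfolded U] j1[THEN conjunct1]]
  have "cellof T k x \<in> cells (gsum T) k" using gsum_cells[OF F(1)] k by blast
  hence "?c k (cellof T k x) = cellof U' k (jv T' U' f' (jv T T' f x))" using j1 j2 by (simp add: compose_def)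
  thus ?thesis using j2[THEN conjunct1] by (intro jv_eq[OF F(1) u(2) k])
 qed
 hence "vsub (jv T U' ?c) (ctxT T) = vsub (\<lambda>x. jv T' U' f' (jv T T' f x)) (ctxT T)" unfolding vsub_eq by blast
 also have "\<dots> = comp_sub (vsub (jv T T' f) (ctxT T)) (vsub (jv T' U' f') (ctxT T'))"
 proof -
  have "sv (vsub (jv T' U' f') (ctxT T')) (jv T T' f x) = Var (jv T' U' f' (jv T T' f x))" if xA: "(x, A) \<in> set (ctxT T)" for x A
  proof -
   obtain k where k: "x \<in> dvars T k" using vars_ctxI[OF xA] unfolding dvars_vars by blast
   have "jv T T' f x \<in> vars_ctx (ctxT T')" using jv[OF F(1,2,3) k] dvars_vars by blast
   thus ?thesis by (rule sv_vsub)
  qed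
  thus ?thesis by (auto simp: vsub_def[of _ "ctxT T"] comp_sub_def)
 qed
 finally show "snd J (Comp Theta0 F' F) = Comp (S 0) (snd J F') (snd J F)"
  using F u U by (simp add: Theta0_def full_subcategory_def GSet_def)
qed

lemma J_inj:
 assumes T: "is_table T" "is_table T'" and f: "f \<in> gset_homs (gsum T) (gsum T')" "f' \<in> gset_homs (gsum T) (gsum T')"
  and e: "\<forall>x\<in>vars_ctx (ctxT T). jv T T' f x = jv T T' f' x"
 shows "f = f'"
proof (intro ext)
 fix k c
 have pe: "f k \<in> cells (gsum T) k \<rightarrow>\<^sub>E cells (gsum T') k" "f' k \<in> cells (gsum T) k \<rightarrow>\<^sub>E cells (gsum T') k"
  using f by (auto simp: gset_homs_def)
 show "f k c = f' k c"
 proof (cases "c \<in> cells (gsum T) k")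
  case True
  then obtain x where "c = cellof T k x" "x \<in> dvars T k" using gsum_cells[OF T(1)] by blast
  moreover from this have "x \<in> vars_ctx (ctxT T)" unfolding dvars_vars by blast
  ultimately show ?thesis using jv[OF T f(1), of x k] jv[OF T f(2), of x k] e by simp
 next
  case False
  thus ?thesis using pe by (metis PiE_arb)
 qed
qed

lemma J_surj:
 assumes T: "is_table T" "is_table T'" and g: "vmor g (ctxT T) (ctxT T')"
 shows "\<exists>f\<in>gset_homs (gsum T) (gsum T'). \<forall>x\<in>vars_ctx (ctxT T). jv T T' f x = g x"
proof -
 define f where "f k = restrict (\<lambda>c. cellof T' k (g (THE x. x \<in> dvars T k \<and> c = cellof T k x))) (cells (gsum T) k)" for k
 have fx: "f k (cellof T k x) = cellof T' k (g x)" if x: "x \<in> dvars T k" for k x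
 proof -
  have "(THE y. y \<in> dvars T k \<and> cellof T k x = cellof T k y) = x"
  proof (rule the_equality)
   show "y = x" if "y \<in> dvars T k \<and> cellof T k x = cellof T k y" for y
    using cellof_inj[OF T(1) x, of y] that by simp
  qed (use x in simp)
  thus ?thesis unfolding f_def using gsum_cells[OF T(1), of k] x by simp
 qed
 have gd: "g x \<in> dvars T' k" if "x \<in> dvars T k" for x k
  using that vmor_vars[OF ctxT_vt[OF T(2)] ctxT_wf[OF T(2)] g ctxT_vt[OF T(1)]] unfolding dvars_def by blast
 have "f \<in> gset_homs (gsum T) (gsum T')"
  unfolding gset_homs_def
 proof (intro CollectI conjI allI ballI)
  fix k
  show "f k \<in> cells (gsum T) k \<rightarrow>\<^sub>E cells (gsum T') k"
  proof (rule PiE_I)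
   fix c assume "c \<in> cells (gsum T) k"
   then obtain x where "c = cellof T k x" "x \<in> dvars T k" using gsum_cells[OF T(1)] by blast
   thus "f k c \<in> cells (gsum T') k" using fx gd gsum_cells[OF T(2)] by simp
  qed (simp add: f_def)
  fix c assume "c \<in> cells (gsum T) (Suc k)"
  then obtain x where x: "c = cellof T (Suc k) x" "x \<in> dvars T (Suc k)" using gsum_cells[OF T(1)] by blast
  from T(1) x(2) obtain a C b where a: "(x, Arrow (Var a) C (Var b)) \<in> set (ctxT T)" "tdim C = k" "a \<in> dvars T k" "b \<in> dvars T k"
   by (rule dvars_SucE)
  obtain C' where C': "(g x, Arrow (Var (g a)) C' (Var (g b))) \<in> set (ctxT T')" using g a(1) unfolding vmor_def by blast
  have "(g a, C') \<in> set (ctxT T')" using var_types_face[OF ctxT_vt[OF T(2)] C'] by blast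
  moreover obtain D where "(g a, D) \<in> set (ctxT T')" "tdim D = k" using gd[OF a(3)] by (auto simp: dvars_def)
  ultimately have k: "tdim C' = k" using ctx_fun[OF ctxT_wf[OF T(2)]] by blast
  show "f k (gsrc (gsum T) k c) = gsrc (gsum T') k (f (Suc k) c)" "f k (gtgt (gsum T) k c) = gtgt (gsum T') k (f (Suc k) c)"
   using gsum_faces[OF T(1) a(1,2)] gsum_faces[OF T(2) C' k] fx[OF x(2)] fx[OF a(3)] fx[OF a(4)] x(1) by auto
 qed
 moreover have "jv T T' f x = g x" if "x \<in> vars_ctx (ctxT T)" for x
  using that jv_eq[OF T] gd fx unfolding dvars_vars by blast
 ultimately show ?thesis by blast
qed

text \<open>Maps of globular sums, maps of variables that respect faces, and substitutions of level
  0 are three descriptions of the same data.\<close>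

lemma J_bij:
 assumes T: "is_table T" "is_table T'"
 shows "bij_betw (snd J) (hom Theta0 (gsum T) (gsum T')) (hom (S 0) (gsum T) (gsum T'))"
 unfolding bij_betw_def
proof
 show "inj_on (snd J) (hom Theta0 (gsum T) (gsum T'))"
 proof (rule inj_onI)
  fix F F' assume F: "F \<in> hom Theta0 (gsum T) (gsum T')" "F' \<in> hom Theta0 (gsum T) (gsum T')" "snd J F = snd J F'"
  then obtain f f' where f: "f \<in> gset_homs (gsum T) (gsum T')" "F = (gsum T, f, gsum T')"
   "f' \<in> gset_homs (gsum T) (gsum T')" "F' = (gsum T, f', gsum T')" using Theta0_hom[OF T] by blast
  hence "ar T (vsub (jv T T' f) (ctxT T)) T' = ar T (vsub (jv T T' f') (ctxT T)) T'" using F(3) T by simp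
  hence "vsub (jv T T' f) (ctxT T) = vsub (jv T T' f') (ctxT T)"
   using ar_inj vmor_wfs[OF T jv_vmor[OF T f(1)]] vmor_wfs[OF T jv_vmor[OF T f(3)]] by blast
  hence "f = f'" using J_inj[OF T f(1,3)] unfolding vsub_eq by blast
  thus "F = F'" using f by simp
 qed
 show "snd J ` hom Theta0 (gsum T) (gsum T') = hom (S 0) (gsum T) (gsum T')"
 proof (intro equalityI subsetI)
  fix h assume "h \<in> snd J ` hom Theta0 (gsum T) (gsum T')"
  thus "h \<in> hom (S 0) (gsum T) (gsum T')" using J_hom[OF T] by blast
 next
  fix h assume "h \<in> hom (S 0) (gsum T) (gsum T')"
  then obtain \<gamma> where h: "h = ar T \<gamma> T'" "wf_sub (ctxT T') \<gamma> (ctxT T)" "lev_sub 0 \<gamma>" using Scat_hom[OF T] by (auto simp: wfs_def)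
  from h(2,3) ctxT_vt[OF T(1)] obtain g where g: "\<gamma> = vsub g (ctxT T)" "vmor g (ctxT T) (ctxT T')" by (rule vmor_of_sub)
  from J_surj[OF T g(2)] obtain f where f: "f \<in> gset_homs (gsum T) (gsum T')" "\<forall>x\<in>vars_ctx (ctxT T). jv T T' f x = g x" by blast
  hence "snd J (gsum T, f, gsum T') = h" using h g T vsub_eq[of "jv T T' f" "ctxT T" g] by simp
  thus "h \<in> snd J ` hom Theta0 (gsum T) (gsum T')" using Theta0_hom[OF T] f(1) by force
 qed
qed

lemma globular_arrow_J: "globular_arrow J g \<longleftrightarrow> g \<in> Arr (S 0)"
proof
 assume "globular_arrow J g"
 then obtain F where F: "F \<in> Arr Theta0" "g = snd J F" by (auto simp: globular_arrow_def)
 from Theta0_Arr[OF F(1)] show "g \<in> Arr (S 0)" using J_hom Theta0_hom F by (metis (no_types, lifting) homD)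
next
 assume "g \<in> Arr (S 0)"
 then obtain T \<gamma> T' where g: "g = ar T \<gamma> T'" "wfs T \<gamma> T'" "lev_sub 0 \<gamma>" by (auto simp: Scat_Arr)
 hence T: "is_table T" "is_table T'" by (auto simp: wfs_def)
 have "g \<in> hom (S 0) (gsum T) (gsum T')" using Scat_hom[OF T] g by blast
 thus "globular_arrow J g" using J_bij[OF T] unfolding globular_arrow_def bij_betw_def hom_def by blast
qed

lemma gsum_cellE:
 assumes "is_table T" "c \<in> cells (gsum T) k"
 obtains m l where "(m, l) \<in> sum_cells T k" "c = cellof T k (cvar T k m l)"
proof -
 from assms(2) obtain x where x: "c = cellof T k x" "x \<in> dvars T k" unfolding gsum_cells[OF assms(1)] by (rule imageE)
 from x(2) obtain m l where "(m, l) \<in> sum_cells T k" "x = cvar T k m l" unfolding dvars_iff[OF assms(1)] by (elim exE conjE)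
 thus thesis using that x(1) by simp
qed

text \<open>Reads off \<open>sum_map\<close> on variables as soon as its formula respects the
  gluings. It serves both for the globe maps and for the inclusions of boundaries.\<close>

lemma sum_map_J:
 assumes T: "is_table T" "is_table T'"
  and c: "\<And>m l k. (m, l) \<in> sum_cells T k \<Longrightarrow> (\<phi> m, push e (summand T m) (summand T' (\<phi> m)) l) \<in> sum_cells T' k"
  and g: "\<And>m l m' l' k. ((m, l), (m', l')) \<in> sum_glue T k \<Longrightarrow>
    cvar T' k (\<phi> m) (push e (summand T m) (summand T' (\<phi> m)) l) = cvar T' k (\<phi> m') (push e (summand T m') (summand T' (\<phi> m')) l')"
 shows "sum_map e \<phi> T T' \<in> hom Theta0 (gsum T) (gsum T')"
  and "\<exists>h. vmor h (ctxT T) (ctxT T') \<and> snd J (sum_map e \<phi> T T') = ar T (vsub h (ctxT T)) T' \<and>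
   (\<forall>k m l. (m, l) \<in> sum_cells T k \<longrightarrow> h (cvar T k m l) = cvar T' k (\<phi> m) (push e (summand T m) (summand T' (\<phi> m)) l))"
proof -
 define w where "w k m l = cvar T' k (\<phi> m) (push e (summand T m) (summand T' (\<phi> m)) l)" for k m l
 define f where "f k = restrict (\<lambda>c. sum_rel T' k ``
    ((\<lambda>(m, l). (\<phi> m, push e (summand T m) (summand T' (\<phi> m)) l)) ` c)) (cells (gsum T) k)" for k
 have sm: "sum_map e \<phi> T T' = (gsum T, f, gsum T')" unfolding sum_map_def f_def by simp
 have wd: "w k m l = w k m' l'" if "(m, l) \<in> sum_cells T k" "(m', l') \<in> sum_cells T k" "cvar T k m l = cvar T k m' l'" for k m l m' l'
 proof -
  have "(m', l') \<in> cellof T k (cvar T k m l)" using that by (simp add: cellof_def)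
  hence "((m, l), (m', l')) \<in> sum_rel T k" using sum_rel_class[OF T(1) that(1)] by blast
  thus ?thesis unfolding sum_rel_def
  proof (induction rule: rtrancl_induct2)
   case (step a b c d)
   thus ?case using g[of a b c d k] g[of c d a b k] unfolding w_def by auto
  qed simp
 qed
 have fx: "f k (cellof T k (cvar T k m l)) = cellof T' k (w k m l)" if ml: "(m, l) \<in> sum_cells T k" for k m l
 proof -
  let ?c = "cellof T k (cvar T k m l)"
  have "cvar T k m l \<in> dvars T k" using dvars_iff[OF T(1)] ml by blast
  hence cc: "?c \<in> cells (gsum T) k" "?c \<noteq> {}" unfolding gsum_cells[OF T(1)] using cellof_ne[OF T(1)] by (auto simp del: cvar.simps)
  have "f k ?c = (\<Union>(m', l')\<in>?c. sum_rel T' k `` {(\<phi> m', push e (summand T m') (summand T' (\<phi> m')) l')})"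
   unfolding f_def using cc(1) by (simp add: case_prod_beta') blast
  also have "\<dots> = (\<Union>p\<in>?c. cellof T' k (w k m l))"
  proof (rule SUP_cong)
   fix p assume p: "p \<in> ?c"
   obtain m' l' where p': "p = (m', l')" by (cases p)
   hence q: "(m', l') \<in> sum_cells T k" "cvar T k m' l' = cvar T k m l" using p by (auto simp: cellof_def)
   have "sum_rel T' k `` {(\<phi> m', push e (summand T m') (summand T' (\<phi> m')) l')} = cellof T' k (w k m' l')"
    unfolding w_def using sum_rel_class[OF T(2) c[OF q(1)]] .
   thus "(case p of (m', l') \<Rightarrow> sum_rel T' k `` {(\<phi> m', push e (summand T m') (summand T' (\<phi> m')) l')}) = cellof T' k (w k m l)"
    using wd[OF q(1) ml q(2)] p' by simp
  qed simp
  finally show ?thesis using cc(2) by simp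
 qed
 have wdv: "w k m l \<in> dvars T' k" if "(m, l) \<in> sum_cells T k" for k m l
  using c[OF that] dvars_iff[OF T(2)] unfolding w_def by blast
 have hom: "f \<in> gset_homs (gsum T) (gsum T')"
  unfolding gset_homs_def
 proof (intro CollectI conjI allI ballI)
  fix k
  show "f k \<in> cells (gsum T) k \<rightarrow>\<^sub>E cells (gsum T') k"
  proof (rule PiE_I)
   fix c assume "c \<in> cells (gsum T) k"
   with T(1) obtain m l where "(m, l) \<in> sum_cells T k" "c = cellof T k (cvar T k m l)" by (rule gsum_cellE)
   thus "f k c \<in> cells (gsum T') k" using fx wdv gsum_cells[OF T(2)] by simp
  qed (simp add: f_def)
  fix c assume "c \<in> cells (gsum T) (Suc k)"
  with T(1) obtain m l where ml: "(m, l) \<in> sum_cells T (Suc k)" "c = cellof T (Suc k) (cvar T (Suc k) m l)" by (rule gsum_cellE)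
  have s: "(m, e') \<in> sum_cells T k" if "e' \<noteq> Idn" for e'
   using ml(1) that by (cases e') (auto simp: mem_sum_cells globe_hom_iff)
  have we: "w k m e' = cvar T' k (\<phi> m) e'" if "e' \<noteq> Idn" for e' using that by (simp add: w_def push_def)
  have f1: "(cvar T (Suc k) m l, Arrow (Var (cvar T k m Src)) (vty T k m) (Var (cvar T k m Tgt))) \<in> set (ctxT T)"
   using cvar_in_ctxT[OF T(1) ml(1)] by simp
  have f2: "(w (Suc k) m l, Arrow (Var (w k m Src)) (vty T' k (\<phi> m)) (Var (w k m Tgt))) \<in> set (ctxT T')"
   using cvar_in_ctxT[OF T(2) c[OF ml(1)]] we by (simp add: w_def)
  show "f k (gsrc (gsum T) k c) = gsrc (gsum T') k (f (Suc k) c)" "f k (gtgt (gsum T) k c) = gtgt (gsum T') k (f (Suc k) c)"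
   using gsum_faces[OF T(1) f1] gsum_faces[OF T(2) f2] fx[OF ml(1)] fx[OF s] ml(2) by auto
 qed
 thus "sum_map e \<phi> T T' \<in> hom Theta0 (gsum T) (gsum T')" using Theta0_hom[OF T] sm by blast
 have "jv T T' f (cvar T k m l) = w k m l" if ml: "(m, l) \<in> sum_cells T k" for k m l
 proof (rule jv_eq[where k = k, OF T])
  show "cvar T k m l \<in> dvars T k" unfolding dvars_iff[OF T(1)] using ml by (intro exI conjI) auto
 qed (rule wdv[OF ml], rule fx[OF ml])
 thus "\<exists>h. vmor h (ctxT T) (ctxT T') \<and> snd J (sum_map e \<phi> T T') = ar T (vsub h (ctxT T)) T' \<and>
   (\<forall>k m l. (m, l) \<in> sum_cells T k \<longrightarrow> h (cvar T k m l) = cvar T' k (\<phi> m) (push e (summand T m) (summand T' (\<phi> m)) l))"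
  using jv_vmor[OF T hom] T sm unfolding w_def by (intro exI[of _ "jv T T' f"]) simp
qed

lemma J_globes: "functor_eq Globe (comp_functor J globes0) gl"
 unfolding functor_eq_def
proof (intro conjI ballI)
 fix i show "fst (comp_functor J globes0) i = fst gl i" by (simp add: comp_functor_def globes0_def)
next
 fix a assume "a \<in> Arr Globe"
 then obtain j l i where a: "a = (j, l, i)" "l \<in> globe_hom j i" by (auto simp: Globe_def)
 have p: "(0, push l j i l') \<in> sum_cells (i, []) k" if "l' \<in> globe_hom k j" for k l'
  using that a(2) by (auto simp: push_def mem_sum_cells globe_hom_iff)
 have 1: "\<And>m l' k. (m, l') \<in> sum_cells (j, []) k \<Longrightarrow> (m, push l (summand (j, []) m) (summand (i, []) m) l') \<in> sum_cells (i, []) k"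
  using p by (auto simp: mem_sum_cells)
 have 2: "((m, e), (m', e')) \<in> sum_glue (j, []) k \<Longrightarrow> P" for m e m' e' k P by (simp add: sum_glue_def)
 obtain h where h: "vmor h (ctxT (j, [])) (ctxT (i, []))"
  "snd J (sum_map l (\<lambda>m. m) (j, []) (i, [])) = ar (j, []) (vsub h (ctxT (j, []))) (i, [])"
  "\<And>k m l'. (m, l') \<in> sum_cells (j, []) k \<Longrightarrow> h (cvar (j, []) k m l') = cvar (i, []) k m (push l (summand (j, []) m) (summand (i, []) m) l')"
  using sum_map_J(2)[of "(j, [])" "(i, [])" "\<lambda>m. m" l] 1 2 by (metis is_table_globe)
 have v: "tmd (i, []) j (Var (cvar (i, []) j 0 l))" using a by (intro tmd_Var) (auto simp: mem_sum_cells)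
 have c: "(0, Idn) \<in> sum_cells (j, []) j" by (simp add: mem_sum_cells globe_hom_iff)
 have "push l j i Idn = l" using a(2) by (auto simp: push_def globe_hom_iff)
 hence "h (cvar (j, []) j 0 Idn) = cvar (i, []) j 0 l" using h(3)[OF c] by (simp del: cvar.simps)
 hence "vsub h (ctxT (j, [])) = tsub (i, []) j (Var (cvar (i, []) j 0 l))"
  using globe_sub_ext[OF vmor_wfs[OF _ _ h(1)] wfs_tsub[OF v]] sv_tsub_top[OF v] sv_vsub[OF cvar_vars[OF is_table_globe c], of h]
  by (simp del: cvar.simps)
 thus "snd (comp_functor J globes0) a = snd gl a"
  using a h(2) by (simp add: comp_functor_def globes0_def arr_def del: cvar.simps)
qed

section \<open>Boundaries of pasting schemes\<close>

lemma summand_le_dim: "m \<le> last_index T \<Longrightarrow> summand T m \<le> dim_table T"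
 unfolding dim_table_def by (rule Max_ge) auto

lemma dim_table_attained: "\<exists>m\<le>last_index T. summand T m = dim_table T"
proof -
 have "dim_table T \<in> summand T ` {..last_index T}" unfolding dim_table_def by (rule Max_in) auto
 thus ?thesis by auto
qed

lemma cdim_ctxT: "is_table T \<Longrightarrow> cdim (ctxT T) = dim_table T"
proof (rule antisym)
 assume T: "is_table T"
 obtain x A where x: "(x, A) \<in> set (ctxT T)" "tdim A = cdim (ctxT T)" using cdim_attained[OF ctxT_ne] by blast
 then obtain k m l where "(m, l) \<in> sum_cells T k" "A = vty T k m" using ctxT_mem[OF T] by metis
 thus "cdim (ctxT T) \<le> dim_table T" using x(2) summand_le_dim[of m T] by (auto simp: mem_sum_cells globe_hom_iff)
 obtain m where m: "m \<le> last_index T" "summand T m = dim_table T" using dim_table_attained by blast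
 show "dim_table T \<le> cdim (ctxT T)" using cdim_ge[OF cvar_in_ctxT[OF T top_cell[OF m(1)]]] m by simp
qed

lemma block_0 [simp]: "block T 0 = 0"
 by (simp add: block_def)

lemma block_Suc: "block T (Suc m) = block T m + (if glue T m < dim_table T - 1 then 1 else 0)"
proof -
 have "{m'. m' < Suc m \<and> glue T m' < dim_table T - 1} = {m'. m' < m \<and> glue T m' < dim_table T - 1} \<union>
  (if glue T m < dim_table T - 1 then {m} else {})" by (auto simp: less_Suc_eq)
 thus ?thesis unfolding block_def by (auto simp: card_insert_if)
qed

lemma block_filter:
 "m \<le> last_index T \<Longrightarrow> block T m = length (filter (\<lambda>(j, i). j < dim_table T - 1) (take m (snd T)))"
proof (induction m)
 case (Suc m)
 hence "take (Suc m) (snd T) = take m (snd T) @ [snd T ! m]" by (intro take_Suc_conv_app_nth) (simp add: last_index_def)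
 thus ?case using Suc block_Suc[of T m] by (simp add: glue_def case_prod_beta)
qed simp

lemma bd_last: "last_index (bd_table T) = block T (last_index T)"
 using block_filter[of "last_index T" T] by (simp add: bd_table_def Let_def last_index_def)

lemma bd_nth:
 assumes "m < last_index T" "glue T m < dim_table T - 1"
 shows "glue (bd_table T) (block T m) = glue T m"
  and "summand (bd_table T) (Suc (block T m)) = min (summand T (Suc m)) (dim_table T - 1)"
proof -
 let ?P = "\<lambda>(j, i). j < dim_table T - 1"
 have m: "m < length (snd T)" using assms by (simp add: last_index_def)
 have "filter ?P (snd T) = filter ?P (take m (snd T)) @ snd T ! m # filter ?P (drop (Suc m) (snd T))"
  using assms(2) by (subst id_take_nth_drop[OF m]) (simp add: glue_def case_prod_beta)
 hence "filter ?P (snd T) ! block T m = snd T ! m" "block T m < length (filter ?P (snd T))"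
  using block_filter[of m T] assms by auto
 thus "glue (bd_table T) (block T m) = glue T m"
  "summand (bd_table T) (Suc (block T m)) = min (summand T (Suc m)) (dim_table T - 1)"
  by (auto simp: bd_table_def Let_def glue_def summand_def case_prod_beta)
qed

lemma bd_first: "summand (bd_table T) 0 = min (summand T 0) (dim_table T - 1)"
 by (simp add: bd_table_def Let_def summand_def)

lemma block_mono: "m \<le> m' \<Longrightarrow> block T m \<le> block T m'"
 by (rule lift_Suc_mono_le[of "block T"]) (auto simp: block_Suc)

definition first_of :: "table \<Rightarrow> nat \<Rightarrow> nat" where
 "first_of T b = (LEAST m. m \<le> last_index T \<and> block T m = b)"

definition last_of :: "table \<Rightarrow> nat \<Rightarrow> nat" where
 "last_of T b = (GREATEST m. m \<le> last_index T \<and> block T m = b)"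

lemma block_surj: "b \<le> block T n \<Longrightarrow> \<exists>m\<le>n. block T m = b"
proof (induction n)
 case (Suc n)
 show ?case
 proof (cases "b \<le> block T n")
  case True thus ?thesis using Suc.IH le_SucI by blast
 next
  case False
  hence "b = block T (Suc n)" using Suc.prems by (auto simp: block_Suc split: if_splits)
  thus ?thesis by blast
 qed
qed simp

lemma first_of:
 assumes "b \<le> block T (last_index T)"
 shows "first_of T b \<le> last_index T" "block T (first_of T b) = b"
  "first_of T b = 0 \<or> glue T (first_of T b - 1) < dim_table T - 1"
  "\<And>m. m \<le> last_index T \<Longrightarrow> block T m = b \<Longrightarrow> first_of T b \<le> m"
proof -
 have ex: "\<exists>m. m \<le> last_index T \<and> block T m = b" using block_surj[OF assms] by blast
 show 1: "first_of T b \<le> last_index T" "block T (first_of T b) = b"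
  using LeastI_ex[OF ex] unfolding first_of_def by auto
 show 2: "\<And>m. m \<le> last_index T \<Longrightarrow> block T m = b \<Longrightarrow> first_of T b \<le> m"
  unfolding first_of_def by (simp add: Least_le)
 show "first_of T b = 0 \<or> glue T (first_of T b - 1) < dim_table T - 1"
 proof (rule ccontr)
  assume a: "\<not> (first_of T b = 0 \<or> glue T (first_of T b - 1) < dim_table T - 1)"
  then obtain m where m: "first_of T b = Suc m" by (cases "first_of T b") auto
  hence "block T m = b" using 1 a block_Suc[of T m] by auto
  thus False using 2[of m] m 1 by simp
 qed
qed

lemma last_of:
 assumes "b \<le> block T (last_index T)"
 shows "last_of T b \<le> last_index T" "block T (last_of T b) = b"
  "last_of T b = last_index T \<or> glue T (last_of T b) < dim_table T - 1"
  "\<And>m. m \<le> last_index T \<Longrightarrow> block T m = b \<Longrightarrow> m \<le> last_of T b"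
proof -
 have ex: "\<exists>m. m \<le> last_index T \<and> block T m = b" using block_surj[OF assms] by blast
 show 1: "last_of T b \<le> last_index T" "block T (last_of T b) = b"
  using GreatestI_ex_nat[OF ex, of "last_index T"] unfolding last_of_def by auto
 show 2: "\<And>m. m \<le> last_index T \<Longrightarrow> block T m = b \<Longrightarrow> m \<le> last_of T b"
  unfolding last_of_def by (rule Greatest_le_nat[of _ _ "last_index T"]) auto
 show "last_of T b = last_index T \<or> glue T (last_of T b) < dim_table T - 1"
 proof (rule ccontr)
  assume a: "\<not> (last_of T b = last_index T \<or> glue T (last_of T b) < dim_table T - 1)"
  hence "block T (Suc (last_of T b)) = b" using 1 block_Suc[of T "last_of T b"] by simp
  thus False using 2[of "Suc (last_of T b)"] a 1 by simp
 qed
qed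

text \<open>Inside a block all gluings happen in dimension \<open>dim_table T - 1\<close>, so a block with more than one
 globe consists of globes of maximal dimension.\<close>

lemma same_block:
 assumes T: "is_table T" and "m \<le> m'" "m' \<le> last_index T" "block T m = block T m'"
 shows "m \<le> i \<Longrightarrow> i < m' \<Longrightarrow> dim_table T - 1 \<le> glue T i"
  and "m < m' \<Longrightarrow> dim_table T \<le> Suc (dim_table T - 1) \<Longrightarrow> summand T m = dim_table T \<and> summand T m' = dim_table T"
  and "k < dim_table T - 1 \<Longrightarrow> l \<noteq> Idn \<Longrightarrow> cvar T k m' l = cvar T k m l"
proof -
 show 1: "dim_table T - 1 \<le> glue T i" if "m \<le> i" "i < m'" for i
 proof (rule ccontr)
  assume a: "\<not> dim_table T - 1 \<le> glue T i"
  hence "block T (Suc i) = Suc (block T i)" by (simp add: block_Suc)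
  moreover have "block T m \<le> block T i" "block T (Suc i) \<le> block T m'" using block_mono that by auto
  ultimately show False using assms(4) by simp
 qed
 show "summand T m = dim_table T \<and> summand T m' = dim_table T" if mm: "m < m'" "dim_table T \<le> Suc (dim_table T - 1)"
 proof -
  have "dim_table T - 1 < summand T m" using 1[of m] is_tableD[OF T, of m] that assms by simp
  moreover obtain i where "m' = Suc i" using mm by (cases m') auto
  hence "dim_table T - 1 < summand T m'" using 1[of i] is_tableD[OF T, of i] that assms by simp
  moreover have "summand T m \<le> dim_table T" "summand T m' \<le> dim_table T" using summand_le_dim assms by auto
  ultimately show ?thesis by linarith
 qed
 show "cvar T k m' l = cvar T k m l" if k: "k < dim_table T - 1" "l \<noteq> Idn"
  using assms(2,3) 1
 proof (induction m' rule: dec_induct)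
  case (step n)
  have "dim_table T - 1 \<le> glue T n" using step by simp
  hence "k < glue T n" using k by simp
  thus ?case using step by simp
 qed simp
qed

lemma bd_summand:
 assumes T: "is_table T" and b: "b \<le> last_index (bd_table T)"
 shows "summand (bd_table T) b = min (summand T (first_of T b)) (dim_table T - 1)"
proof -
 have b': "b \<le> block T (last_index T)" using b bd_last by simp
 note fo = first_of[OF b']
 show ?thesis
 proof (cases "first_of T b")
  case 0
  hence "b = 0" using fo(2) by simp
  thus ?thesis using 0 bd_first by simp
 next
  case (Suc m)
  hence g: "glue T m < dim_table T - 1" "m < last_index T" using fo by auto
  hence "Suc (block T m) = b" using fo(2) Suc block_Suc[of T m] by simp
  thus ?thesis using bd_nth(2)[OF g(2,1)] Suc by simp
 qed
qed

lemma first_last: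
 assumes T: "is_table T" and b: "b \<le> last_index (bd_table T)"
 shows "first_of T b \<le> last_of T b" "block T (first_of T b) = block T (last_of T b)"
  "min (summand T (last_of T b)) (dim_table T - 1) = min (summand T (first_of T b)) (dim_table T - 1)"
proof -
 have b': "b \<le> block T (last_index T)" using b bd_last by simp
 note fo = first_of[OF b'] and lo = last_of[OF b']
 show 1: "first_of T b \<le> last_of T b" "block T (first_of T b) = block T (last_of T b)" using fo lo by auto
 show "min (summand T (last_of T b)) (dim_table T - 1) = min (summand T (first_of T b)) (dim_table T - 1)"
  using same_block(2)[OF T 1(1) lo(1) 1(2)] 1(1) by (cases "first_of T b = last_of T b") auto
qed

lemma bd_glue:
 assumes T: "is_table T" and b: "b < last_index (bd_table T)"
 shows "last_of T b < last_index T" "first_of T (Suc b) = Suc (last_of T b)"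
  "glue (bd_table T) b = glue T (last_of T b)" "glue T (last_of T b) < dim_table T - 1"
proof -
 have b': "b \<le> block T (last_index T)" "Suc b \<le> block T (last_index T)" using b bd_last[of T] by auto
 note fo = first_of[OF b'(2)] and lo = last_of[OF b'(1)]
 have ne: "last_of T b \<noteq> last_index T" using lo(2) b bd_last[of T] by auto
 thus lt: "last_of T b < last_index T" using lo(1) by simp
 show g: "glue T (last_of T b) < dim_table T - 1" using lo(3) ne by simp
 show "glue (bd_table T) b = glue T (last_of T b)" using bd_nth(1)[OF lt g] lo(2) by simp
 have "block T (Suc (last_of T b)) = Suc b" using block_Suc[of T "last_of T b"] g lo(2) by simp
 hence "first_of T (Suc b) \<le> Suc (last_of T b)" using fo(4) lt by simp
 moreover have "\<not> first_of T (Suc b) \<le> last_of T b" using block_mono[of "first_of T (Suc b)" "last_of T b" T] fo(2) lo(2) by auto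
 ultimately show "first_of T (Suc b) = Suc (last_of T b)" by simp
qed

lemma is_table_bd:
 assumes T: "is_table T"
 shows "is_table (bd_table T)"
 unfolding is_table_def
proof (intro allI impI)
 fix b assume b: "b < last_index (bd_table T)"
 note g = bd_glue[OF T b] and tb = is_tableD[OF T bd_glue(1)[OF T b]]
 show "glue (bd_table T) b < summand (bd_table T) b \<and> glue (bd_table T) b < summand (bd_table T) (Suc b)"
  using g tb bd_summand[OF T, of b] bd_summand[OF T, of "Suc b"] first_last(3)[OF T, of b] b
  by (metis Suc_leI less_imp_le min_less_iff_conj)
qed

text \<open>The globe of a block through which the boundary inclusion of a merged globe goes: the
  first one for the source, the last one for the target.\<close>

definition end_of :: "table \<Rightarrow> side \<Rightarrow> nat \<Rightarrow> nat" where
 "end_of T e b = (if e = Src then first_of T b else last_of T b)"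

abbreviation bd_side :: "table \<Rightarrow> side \<Rightarrow> nat \<Rightarrow> side \<Rightarrow> side" where
 "bd_side T e b l \<equiv> push e (summand (bd_table T) b) (summand T (end_of T e b)) l"

abbreviation bd_var :: "table \<Rightarrow> side \<Rightarrow> nat \<Rightarrow> nat \<Rightarrow> side \<Rightarrow> nat" where
 "bd_var T e k b l \<equiv> cvar T k (end_of T e b) (bd_side T e b l)"

lemma end_of:
 assumes T: "is_table T" and b: "b \<le> last_index (bd_table T)"
 shows "end_of T e b \<le> last_index T" "block T (end_of T e b) = b"
  "summand (bd_table T) b = min (summand T (end_of T e b)) (dim_table T - 1)"
 using first_of[of b T] last_of[of b T] bd_summand[OF T b] first_last(3)[OF T b] b bd_last[of T] by (auto simp: end_of_def)

lemma bd_cell: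
 assumes T: "is_table T" and e: "e \<noteq> Idn" and c: "(b, l) \<in> sum_cells (bd_table T) k"
 shows "(end_of T e b, bd_side T e b l) \<in> sum_cells T k"
proof -
 have b: "b \<le> last_index (bd_table T)" "l \<in> globe_hom k (summand (bd_table T) b)" using c by (auto simp: mem_sum_cells)
 show ?thesis using b end_of[OF T b(1), of e] e by (auto simp: mem_sum_cells globe_hom_iff push_def; cases e; auto)
qed

lemma same_block_eq:
 assumes T: "is_table T" and m: "m \<le> last_index T" "m' \<le> last_index T" "block T m = block T m'"
 shows "m \<noteq> m' \<Longrightarrow> 0 < dim_table T \<Longrightarrow> summand T m = dim_table T \<and> summand T m' = dim_table T"
  and "k < dim_table T - 1 \<Longrightarrow> l \<noteq> Idn \<Longrightarrow> cvar T k m l = cvar T k m' l"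
proof -
 show "summand T m = dim_table T \<and> summand T m' = dim_table T" if "m \<noteq> m'" "0 < dim_table T"
  using same_block(2)[OF T _ m(2,3)] same_block(2)[OF T _ m(1) m(3)[symmetric]] that by (cases m m' rule: linorder_cases) auto
 show "cvar T k m l = cvar T k m' l" if "k < dim_table T - 1" "l \<noteq> Idn"
  using same_block(3)[OF T _ m(2,3) that] same_block(3)[OF T _ m(1) m(3)[symmetric] that] by (metis linear)
qed

lemma bd_glue_compat:
 assumes T: "is_table T" and g: "((b, l), (b', l')) \<in> sum_glue (bd_table T) k"
 shows "bd_var T e k b l = bd_var T e k b' l'"
proof -
 from g obtain l0 where l0: "b' = Suc b" "b < last_index (bd_table T)" "l0 \<in> globe_hom k (glue (bd_table T) b)"
  "l = push Tgt (glue (bd_table T) b) (summand (bd_table T) b) l0" "l' = push Src (glue (bd_table T) b) (summand (bd_table T) (Suc b)) l0"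
  by (auto simp: sum_glue_def)
 note bg = bd_glue[OF T l0(2)] and tb = is_tableD[OF is_table_bd[OF T] l0(2)]
 let ?j = "glue T (last_of T b)"
 have ll: "l = (if l0 = Idn then Tgt else l0)" "l' = (if l0 = Idn then Src else l0)" using l0 tb by (auto simp: push_def)
 have pl: "push d i i' l = l" "push d i i' l' = l'" for d i i' using ll by (auto simp: push_def)
 have k: "k \<le> ?j" "l0 = Idn \<Longrightarrow> k = ?j" "l0 \<noteq> Idn \<Longrightarrow> k < ?j" using l0(3) bg(3) by (auto simp: globe_hom_iff)
 have kd: "k < dim_table T - 1" using k bg(4) by simp
 have b1: "b \<le> last_index (bd_table T)" "Suc b \<le> last_index (bd_table T)" using l0 by auto
 \<comment> \<open>In dimensions below \<open>dim_table T - 1\<close> all globes of a block have the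
   same faces, so the ends of a block can be exchanged freely.\<close>
 have ends: "cvar T k (end_of T e c) r = cvar T k (end_of T d c) r" if "c \<le> last_index (bd_table T)" "r \<noteq> Idn" for c d r
  by (rule same_block_eq(2)[OF T]) (use end_of[OF T that(1)] kd that(2) in auto)
 have "cvar T k (last_of T b) l = cvar T k (Suc (last_of T b)) l'" using k ll by auto
 hence "cvar T k (end_of T Tgt b) l = cvar T k (end_of T Src (Suc b)) l'" using bg(2) by (simp add: end_of_def)
 thus ?thesis unfolding pl l0(1) using ends[OF b1(1), of l Tgt] ends[OF b1(2), of l' Src] ll by (simp split: if_splits del: cvar.simps)
qed

text \<open>Every \<open>off T m\<close> is odd, so among the variables that a summand introduces
  the targets have odd and all others even numbers. This separates sources from targets in
  \<open>bd_image\<close>.\<close>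

lemma cvar_parity:
 assumes "is_table T" "(m, l) \<in> sum_cells T k" "gl0 T m < k \<or> m = 0 \<or> (k = gl0 T m \<and> l = Tgt)"
 shows "odd (cvar T k m l) \<longleftrightarrow> l = Tgt" "l \<noteq> Tgt \<Longrightarrow> k = 0 \<and> m = 0 \<or> off T m \<le> cvar T k m l" "l = Tgt \<Longrightarrow> off T m \<le> cvar T k m l"
proof -
 have o: "odd (off T m)" for m by (induction m) auto
 show "odd (cvar T k m l) \<longleftrightarrow> l = Tgt" "l \<noteq> Tgt \<Longrightarrow> k = 0 \<and> m = 0 \<or> off T m \<le> cvar T k m l" "l = Tgt \<Longrightarrow> off T m \<le> cvar T k m l"
  using assms o[of m] by (cases m; auto simp del: off.simps(2) simp: Suc_le_eq; presburger?)+
qed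

lemma cvar_new_inj:
 assumes T: "is_table T" and c: "(m, l) \<in> sum_cells T k" "(m', l') \<in> sum_cells T k"
  and n: "gl0 T m < k \<or> m = 0 \<or> (k = gl0 T m \<and> l = Tgt)" "gl0 T m' < k \<or> m' = 0 \<or> (k = gl0 T m' \<and> l' = Tgt)"
  and e: "cvar T k m l = cvar T k m' l'"
 shows "m = m'"
proof -
 have aux: "\<not> m < m'" if c: "(m, l) \<in> sum_cells T k" "(m', l') \<in> sum_cells T k"
  and n: "gl0 T m' < k \<or> m' = 0 \<or> (k = gl0 T m' \<and> l' = Tgt)" and e: "cvar T k m l = cvar T k m' l'" for m l m' l'
 proof
  assume lt: "m < m'"
  hence "off T m' \<le> cvar T k m' l'" using cvar_parity(2,3)[OF T c(2) n] by (cases "l' = Tgt") auto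
  moreover have "cvar T k m l < off T m'" using cvar_less[OF T c(1)] off_mono[of "Suc m" m' T] lt by simp
  ultimately show False using e by simp
 qed
 show ?thesis using aux[OF c n(2) e] aux[OF c(2,1) n(1) e[symmetric]] by simp
qed

text \<open>The boundary of a pasting scheme agrees with that of its ps-context. The critical
  dimension is \<open>n\<close>, where the gluings inside a block identify the target of each globe
  with the source of the next one: only the source of the first globe is not also a target, and only
  the target of the last one is not also a source.\<close>

lemma bd_image:
 assumes T: "is_table T" and n: "dim_table T = Suc n" and e: "e = Src \<or> e = Tgt"
 shows "{bd_var T e k b l | k b l. (b, l) \<in> sum_cells (bd_table T) k} = vars_ctx ((if e = Src then src_ctx else tgt_ctx) (ctxT T))"
  (is "?L = vars_ctx ?D")
proof -
 have cd: "cdim (ctxT T) = Suc n" using cdim_ctxT[OF T] n by simp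
 have gln: "glue T m \<le> n" if "m < last_index T" for m
  using is_tableD[OF T that] summand_le_dim[of m T] n that by simp
 have gl0n: "gl0 T m \<le> n" if "m \<le> last_index T" for m using gln[of "m - 1"] that by (cases m) auto
 \<comment> \<open>The opposite side: in dimension \<open>n\<close>, the \<open>e'\<close>-faces of
   the top cells are what the boundary removes.\<close>
 define e' where "e' = (if e = Src then Tgt else Src)"
 have e': "e' = Src \<or> e' = Tgt" "e' \<noteq> e" using e by (auto simp: e'_def)
 have top: "(f, B) \<in> set (ctxT T) \<and> tdim B = Suc n \<longleftrightarrow>
  (\<exists>m\<le>last_index T. summand T m = Suc n \<and> f = cvar T (Suc n) m Idn \<and> B = vty T (Suc n) m)" for f B
 proof
  assume "(f, B) \<in> set (ctxT T) \<and> tdim B = Suc n"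
  then obtain m l where c: "(m, l) \<in> sum_cells T (Suc n)" "f = cvar T (Suc n) m l" "B = vty T (Suc n) m"
   unfolding ctxT_mem[OF T] by (elim exE conjE) simp
  hence "m \<le> last_index T" "summand T m = Suc n" "l = Idn"
   using summand_le_dim[of m T] n by (auto simp: mem_sum_cells globe_hom_iff)
  thus "\<exists>m\<le>last_index T. summand T m = Suc n \<and> f = cvar T (Suc n) m Idn \<and> B = vty T (Suc n) m" using c by blast
 next
  assume "\<exists>m\<le>last_index T. summand T m = Suc n \<and> f = cvar T (Suc n) m Idn \<and> B = vty T (Suc n) m"
  then obtain m where m: "m \<le> last_index T" "summand T m = Suc n" "f = cvar T (Suc n) m Idn" "B = vty T (Suc n) m" by blast
  thus "(f, B) \<in> set (ctxT T) \<and> tdim B = Suc n" using cvar_in_ctxT[OF T top_cell[OF m(1)]] by (simp del: cvar.simps vty.simps)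
 qed
 let ?Q = "\<lambda>x. \<exists>m\<le>last_index T. summand T m = Suc n \<and> x = cvar T n m e'"
 have faces: "(\<exists>f t B. (f, Arrow t B (Var x)) \<in> set (ctxT T) \<and> tdim B = n) \<longleftrightarrow> (\<exists>m\<le>last_index T. summand T m = Suc n \<and> x = cvar T n m Tgt)"
  "(\<exists>f B u. (f, Arrow (Var x) B u) \<in> set (ctxT T) \<and> tdim B = n) \<longleftrightarrow> (\<exists>m\<le>last_index T. summand T m = Suc n \<and> x = cvar T n m Src)" for x
  using top[of _ "Arrow _ _ _"] by (simp_all del: cvar.simps)
 have vs: "x \<in> vars_ctx ?D \<longleftrightarrow> (\<exists>k m l. (m, l) \<in> sum_cells T k \<and> x = cvar T k m l \<and> k \<noteq> Suc n \<and> \<not> (k = n \<and> ?Q x))" for x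
 proof -
  have "(x, A) \<in> set ?D \<longleftrightarrow> (x, A) \<in> set (ctxT T) \<and> tdim A \<noteq> Suc n \<and> \<not> (tdim A = n \<and> ?Q x)" for A
  proof (cases "e = Src")
   case True thus ?thesis using mem_src_ctx[OF ctxT_ne cd, of x A, unfolded faces] by (simp only: e'_def if_True simp_thms)
  next
   case False thus ?thesis using mem_tgt_ctx[OF ctxT_ne cd, of x A, unfolded faces] by (simp only: e'_def if_False simp_thms)
  qed
  hence 1: "x \<in> vars_ctx ?D \<longleftrightarrow> (\<exists>A. (x, A) \<in> set (ctxT T) \<and> tdim A \<noteq> Suc n \<and> \<not> (tdim A = n \<and> ?Q x))"
   by (metis vars_ctxE vars_ctxI)
  show ?thesis
  proof
   assume "x \<in> vars_ctx ?D"
   then obtain A where A: "(x, A) \<in> set (ctxT T)" "tdim A \<noteq> Suc n" "\<not> (tdim A = n \<and> ?Q x)" unfolding 1 by (elim exE conjE)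
   from A(1) obtain k m l where c: "(m, l) \<in> sum_cells T k" "x = cvar T k m l" "A = vty T k m" unfolding ctxT_mem[OF T] by (elim exE conjE)
   have "k \<noteq> Suc n" "\<not> (k = n \<and> ?Q x)" using A(2,3) unfolding c(3) tdim_vty .
   thus "\<exists>k m l. (m, l) \<in> sum_cells T k \<and> x = cvar T k m l \<and> k \<noteq> Suc n \<and> \<not> (k = n \<and> ?Q x)" using c(1,2) by (intro exI conjI)
  next
   assume "\<exists>k m l. (m, l) \<in> sum_cells T k \<and> x = cvar T k m l \<and> k \<noteq> Suc n \<and> \<not> (k = n \<and> ?Q x)"
   then obtain k m l where c: "(m, l) \<in> sum_cells T k" "x = cvar T k m l" "k \<noteq> Suc n" "\<not> (k = n \<and> ?Q x)" by (elim exE conjE)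
   have "(x, vty T k m) \<in> set (ctxT T)" using cvar_in_ctxT[OF T c(1)] c(2) by simp
   thus "x \<in> vars_ctx ?D" unfolding 1 using c(3,4) by (intro exI[of _ "vty T k m"]) simp
  qed
 qed
 have Tgt_new: "gl0 T m < n \<or> m = 0 \<or> (n = gl0 T m \<and> Tgt = Tgt)" if "m \<le> last_index T" for m
  using gl0n[OF that] by auto
 let ?bd = "bd_table T"
 have sb: "summand ?bd b = min (summand T (end_of T e b)) n" if "b \<le> last_index ?bd" for b
  using end_of(3)[OF T that] n by simp
 have bl: "b \<le> block T (last_index T)" if "b \<le> last_index ?bd" for b using bd_last[of T] that by simp
 show ?thesis
 proof (intro set_eqI iffI)
  fix x assume "x \<in> ?L"
  then obtain k b l where c: "(b, l) \<in> sum_cells ?bd k" and x: "x = bd_var T e k b l" by blast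
  let ?m = "end_of T e b" let ?l = "bd_side T e b l"
  have b: "b \<le> last_index ?bd" "l \<in> globe_hom k (summand ?bd b)" using c by (auto simp: mem_sum_cells)
  note s = sb[OF b(1)] and eo = end_of[OF T b(1), of e] and bb = bl[OF b(1)]
  have cT: "(?m, ?l) \<in> sum_cells T k" using bd_cell[OF T _ c] e by auto
  have kn: "k \<le> n" using b s by (auto simp: globe_hom_iff)
  have "\<not> (k = n \<and> ?Q x)"
  proof (intro notI, elim conjE exE)
   fix m assume k: "k = n" and m: "m \<le> last_index T" "summand T m = Suc n" "x = cvar T n m e'"
   have l: "l = Idn" using b s k by (auto simp: globe_hom_iff)
   have sm: "summand T ?m = n \<and> ?l = Idn \<or> summand T ?m = Suc n \<and> ?l = e"
    using cT l k summand_le_dim[OF eo(1)] n s by (auto simp: push_def mem_sum_cells globe_hom_iff)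
   have cm: "(m, e') \<in> sum_cells T n" using m e' by (auto simp: mem_sum_cells globe_hom_iff)
   show False
   proof (cases "e = Src")
    case True
    have "gl0 T ?m < n \<or> ?m = 0" using first_of(3)[OF bb] n True by (cases ?m) (auto simp: end_of_def)
    hence "even x" using cvar_parity(1)[OF T cT[unfolded k]] sm True x k by auto
    moreover have "odd x" using cvar_parity(1)[OF T cm] m Tgt_new[OF m(1)] True by (auto simp: e'_def)
    ultimately show False by blast
   next
    case False
    hence E: "e = Tgt" "e' = Src" "?m = last_of T b" using e by (auto simp: e'_def end_of_def)
    have nwm: "gl0 T ?m < n \<or> ?m = 0 \<or> (n = gl0 T ?m \<and> ?l = Tgt)" using sm gl0n[OF eo(1)] gl0_less[OF T eo(1)] E by auto
    show False
    proof (cases "gl0 T m < n \<or> m = 0")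
     case True
     hence "?m = m" using cvar_new_inj[OF T cT[unfolded k] cm nwm] x m(3) k by auto
     hence "?l = Tgt" using sm m(2) E by auto
     hence "odd x" using cvar_parity(1)[OF T cT[unfolded k] nwm] x k by simp
     moreover have "even x" using cvar_parity(1)[OF T cm] True m(3) E by auto
     ultimately show False by blast
    next
     case False
     \<comment> \<open>Here the source of the \<open>m\<close>-th globe is the target of its
       predecessor \<open>m0\<close>. If this were the chosen variable, then \<open>m0\<close> would
       end the block and yet be glued to \<open>m\<close> in dimension \<open>n\<close>.\<close>
     then obtain m0 where m0: "m = Suc m0" "glue T m0 = n" using gl0n[OF m(1)] by (cases m) auto
     hence x0: "x = cvar T n m0 Tgt" using m(3) E by simp
     have m0': "m0 < last_index T" using m m0 by simp
     have "n < summand T m0" using is_tableD[OF T m0'] m0 by simp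
     hence c0: "(m0, Tgt) \<in> sum_cells T n" using m0' by (simp add: mem_sum_cells globe_hom_iff)
     have "?m = m0" using cvar_new_inj[OF T cT[unfolded k] c0 nwm Tgt_new] x x0 k m0' by simp
     thus False using last_of(3)[OF bb] m0 m0' n E by simp
    qed
   qed
  qed
  thus "x \<in> vars_ctx ?D" unfolding vs using cT kn x by (metis Suc_n_not_le_n)
 next
  fix x assume "x \<in> vars_ctx ?D"
  then obtain k m l where c: "(m, l) \<in> sum_cells T k" and x: "x = cvar T k m l" and kn: "k \<noteq> Suc n"
   and nt: "\<And>m. k = n \<Longrightarrow> m \<le> last_index T \<Longrightarrow> summand T m = Suc n \<Longrightarrow> x \<noteq> cvar T n m e'" unfolding vs by metis
  have m: "m \<le> last_index T" "l \<in> globe_hom k (summand T m)" using c by (auto simp: mem_sum_cells)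
  have sm: "summand T m \<le> Suc n" using summand_le_dim[OF m(1)] n by simp
  have kle: "k \<le> n" using m sm kn by (auto simp: globe_hom_iff)
  let ?b = "block T m" let ?m = "end_of T e ?b"
  have b: "?b \<le> last_index ?bd" using bd_last block_mono[OF m(1)] by metis
  note s = sb[OF b] and eo = end_of[OF T b, of e] and bb = bl[OF b]
  have str: "?m \<noteq> m \<Longrightarrow> summand T ?m = Suc n \<and> summand T m = Suc n" using same_block_eq(1)[OF T eo(1) m(1) eo(2)] n by simp
  have ex: "(?b, l') \<in> sum_cells ?bd k \<Longrightarrow> bd_var T e k ?b l' = x \<Longrightarrow> x \<in> ?L" for l' by blast
  consider "k < n" "l \<noteq> Idn" | "k < n" "l = Idn" | "k = n" using kle by linarith
  thus "x \<in> ?L"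
  proof cases
   case 1
   have "k < summand T ?m" using m 1 str by (cases "?m = m") (auto simp: globe_hom_iff)
   hence "(?b, l) \<in> sum_cells ?bd k" using b s 1 m by (auto simp: mem_sum_cells globe_hom_iff)
   moreover have "cvar T k ?m l = cvar T k m l" using same_block_eq(2)[OF T eo(1) m(1) eo(2)] 1 n by simp
   ultimately show ?thesis using ex[of l] x 1 by (auto simp: push_def)
  next
   case 2
   hence "summand T m = k" using m by (simp add: globe_hom_iff)
   hence q: "?m = m" using str 2 by (cases "?m = m") auto
   hence "(?b, Idn) \<in> sum_cells ?bd k" "summand ?bd ?b = summand T ?m" using b s 2 \<open>summand T m = k\<close> by (auto simp: mem_sum_cells globe_hom_iff)
   thus ?thesis using ex[of Idn] x 2 q by (simp add: push_def)
  next
   case 3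
   have nl: "l \<noteq> e'" using nt[OF 3 m(1)] x 3 m sm e' by (auto simp: globe_hom_iff)
   \<comment> \<open>Otherwise a neighbouring globe of the same block is glued on in dimension
     \<open>n\<close>, and \<open>x\<close> is the \<open>e'\<close>-face of that neighbour, so it
     would have been removed.\<close>
   have q: "?m = m"
   proof (rule ccontr)
    assume ne: "?m \<noteq> m"
    have le: "l = e" using nl m str[OF ne] 3 e by (cases l) (auto simp: globe_hom_iff e'_def)
    show False
    proof (cases "e = Src")
     case True
     hence lt: "?m < m" using first_of(4)[OF bb m(1)] ne by (simp add: end_of_def)
     then obtain m0 where m0: "m = Suc m0" by (cases m) auto
     have "n \<le> glue T m0" using same_block(1)[OF T less_imp_le[OF lt] m(1) eo(2), of m0] lt m0 n by simp
     hence g: "glue T m0 = n" using gln[of m0] m m0 by simp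
     hence "x = cvar T n m0 e'" using x m0 le 3 True by (simp add: e'_def)
     moreover have "summand T m0 = Suc n" using is_tableD[OF T, of m0] m m0 g summand_le_dim[of m0 T] n by simp
     ultimately show False using nt[OF 3, of m0] m m0 by simp
    next
     case False
     hence lt: "m < ?m" using last_of(4)[OF bb m(1)] ne by (simp add: end_of_def)
     hence mL: "m < last_index T" using eo(1) by simp
     have "n \<le> glue T m" using same_block(1)[OF T less_imp_le[OF lt] eo(1) eo(2)[symmetric], of m] lt n by simp
     hence g: "glue T m = n" using gln[OF mL] by simp
     hence "x = cvar T n (Suc m) e'" using x le 3 False e by (auto simp: e'_def)
     moreover have "summand T (Suc m) = Suc n" using is_tableD[OF T mL] g summand_le_dim[of "Suc m" T] n mL by simp
     ultimately show False using nt[OF 3, of "Suc m"] mL by simp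
    qed
   qed
   have "(?b, Idn) \<in> sum_cells ?bd k" using b s 3 q m by (auto simp: mem_sum_cells globe_hom_iff)
   moreover have "bd_side T e ?b Idn = l" using nl m 3 s q e by (cases l) (auto simp: push_def globe_hom_iff e'_def)
   ultimately show ?thesis using ex[of Idn] x q by simp
  qed
 qed
qed

lemma vars_image:
 assumes "is_table U" "\<forall>k m l. (m, l) \<in> sum_cells U k \<longrightarrow> h (cvar U k m l) = w k m l"
 shows "h ` vars_ctx (ctxT U) = {w k m l | k m l. (m, l) \<in> sum_cells U k}"
proof (intro set_eqI iffI)
 fix y assume "y \<in> h ` vars_ctx (ctxT U)"
 then obtain x A where x: "y = h x" "(x, A) \<in> set (ctxT U)" by (auto elim: vars_ctxE)
 then obtain k m l where c: "(m, l) \<in> sum_cells U k" "x = cvar U k m l" unfolding ctxT_mem[OF assms(1)] by (elim exE conjE)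
 hence "y = w k m l" using x(1) assms(2) by simp
 thus "y \<in> {w k m l | k m l. (m, l) \<in> sum_cells U k}" using c(1) by blast
next
 fix y assume "y \<in> {w k m l | k m l. (m, l) \<in> sum_cells U k}"
 then obtain k m l where c: "y = w k m l" "(m, l) \<in> sum_cells U k" by blast
 hence "y = h (cvar U k m l)" using assms(2) by simp
 thus "y \<in> h ` vars_ctx (ctxT U)" using cvar_vars[OF assms(1) c(2)] by blast
qed

lemma bd_sum_map:
 "bd_src T = sum_map Src (end_of T Src) (bd_table T) T" "bd_tgt T = sum_map Tgt (end_of T Tgt) (bd_table T) T"
 by (simp_all add: bd_src_def bd_tgt_def first_of_def last_of_def end_of_def[abs_def])

lemma bd_hom:
 assumes T: "is_table T"
 shows "bd_src T \<in> hom Theta0 (gsum (bd_table T)) (gsum T)" "bd_tgt T \<in> hom Theta0 (gsum (bd_table T)) (gsum T)"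
 unfolding bd_sum_map by (rule sum_map_J(1)[OF is_table_bd[OF T] T bd_cell[OF T] bd_glue_compat[OF T]]; simp)+

lemma J_bd:
 assumes T: "is_table T" and n: "0 < dim_table T"
 shows "\<exists>h. vmor h (ctxT (bd_table T)) (ctxT T) \<and> snd J (bd_src T) = ar (bd_table T) (vsub h (ctxT (bd_table T))) T \<and>
   h ` vars_ctx (ctxT (bd_table T)) = vars_ctx (src_ctx (ctxT T))"
  and "\<exists>h. vmor h (ctxT (bd_table T)) (ctxT T) \<and> snd J (bd_tgt T) = ar (bd_table T) (vsub h (ctxT (bd_table T))) T \<and>
   h ` vars_ctx (ctxT (bd_table T)) = vars_ctx (tgt_ctx (ctxT T))"
proof -
 obtain n' where n': "dim_table T = Suc n'" using n by (cases "dim_table T") auto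
 note B = is_table_bd[OF T]
 have "\<exists>h. vmor h (ctxT (bd_table T)) (ctxT T) \<and>
  snd J (sum_map e (end_of T e) (bd_table T) T) = ar (bd_table T) (vsub h (ctxT (bd_table T))) T \<and>
  h ` vars_ctx (ctxT (bd_table T)) = vars_ctx ((if e = Src then src_ctx else tgt_ctx) (ctxT T))" if e: "e = Src \<or> e = Tgt" for e
 proof -
  have "e \<noteq> Idn" using e by auto
  from sum_map_J(2)[OF B T bd_cell[OF T this] bd_glue_compat[OF T]] obtain h where
   h: "vmor h (ctxT (bd_table T)) (ctxT T)" "snd J (sum_map e (end_of T e) (bd_table T) T) = ar (bd_table T) (vsub h (ctxT (bd_table T))) T"
   "\<forall>k m l. (m, l) \<in> sum_cells (bd_table T) k \<longrightarrow> h (cvar (bd_table T) k m l) = bd_var T e k m l" by blast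
  show ?thesis using h(1,2) vars_image[OF B h(3)] bd_image[OF T n' e] by auto
 qed
 from this[of Src] this[of Tgt] show
  "\<exists>h. vmor h (ctxT (bd_table T)) (ctxT T) \<and> snd J (bd_src T) = ar (bd_table T) (vsub h (ctxT (bd_table T))) T \<and>
   h ` vars_ctx (ctxT (bd_table T)) = vars_ctx (src_ctx (ctxT T))"
  "\<exists>h. vmor h (ctxT (bd_table T)) (ctxT T) \<and> snd J (bd_tgt T) = ar (bd_table T) (vsub h (ctxT (bd_table T))) T \<and>
   h ` vars_ctx (ctxT (bd_table T)) = vars_ctx (tgt_ctx (ctxT T))"
  unfolding bd_sum_map by simp_all
qed

section \<open>Algebraic arrows and admissible pairs\<close>

fun rntm :: "(nat \<Rightarrow> nat) \<Rightarrow> tm \<Rightarrow> tm" where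
 "rntm \<rho> (Var x) = Var (\<rho> x)"
| "rntm \<rho> t = t"

fun rnty :: "(nat \<Rightarrow> nat) \<Rightarrow> ty \<Rightarrow> ty" where
 "rnty \<rho> Star = Star"
| "rnty \<rho> (Arrow t A u) = Arrow (rntm \<rho> t) (rnty \<rho> A) (rntm \<rho> u)"

lemma ps_at_rename:
 assumes "ps_at \<Gamma> x A" "inj_on \<rho> (vars_ctx \<Gamma>)"
 shows "ps_at (map (\<lambda>(x, A). (\<rho> x, rnty \<rho> A)) \<Gamma>) (\<rho> x) (rnty \<rho> A)"
 using assms
proof (induction rule: ps_at.induct)
 case (ps_point x) thus ?case by (auto intro: ps_at.ps_point)
next
 case (ps_drop \<Gamma> f x A y) thus ?case using ps_at.ps_drop by simp
next
 case (ps_extend \<Gamma> x A y f)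
 let ?r = "map (\<lambda>(x, A). (\<rho> x, rnty \<rho> A))"
 have inj: "inj_on \<rho> (insert y (insert f (vars_ctx \<Gamma>)))" using ps_extend.prems by (simp add: vars_ctx_def)
 hence "inj_on \<rho> (vars_ctx \<Gamma>)" by (rule inj_on_subset) auto
 hence "ps_at (?r \<Gamma>) (\<rho> x) (rnty \<rho> A)" by (rule ps_extend.IH)
 moreover have "vars_ctx (?r \<Gamma>) = \<rho> ` vars_ctx \<Gamma>" by (force simp: vars_ctx_def)
 moreover have "\<rho> y \<notin> \<rho> ` vars_ctx \<Gamma>" "\<rho> f \<notin> \<rho> ` vars_ctx \<Gamma>" "\<rho> f \<noteq> \<rho> y"
  using inj ps_extend.hyps unfolding inj_on_def by blast+
 ultimately show ?case using ps_at.ps_extend[of "?r \<Gamma>" "\<rho> x" "rnty \<rho> A" "\<rho> y" "\<rho> f"] by simp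
qed

text \<open>A sub-ps-context keeps the names of the variables of the ambient one. Renaming each
  variable to its position yields a canonical ps-context, hence a table, and \<open>g\<close> undoes
  the renaming.\<close>

lemma ps_canonicalize:
 assumes ps: "ps_ctx \<Gamma>"
 shows "\<exists>V g. is_table V \<and> vmor g (ctxT V) \<Gamma> \<and> g ` vars_ctx (ctxT V) = vars_ctx \<Gamma>"
proof -
 obtain x where x: "ps_at \<Gamma> x Star" using ps by (auto simp: ps_ctx_def)
 note wf = ps_ctx_wf[OF ps] and vt = ps_ctx_var_types[OF ps]
 define g where "g i = fst (\<Gamma> ! i)" for i
 have inj: "inj_on g {..<length \<Gamma>}"
  using wf_ctx_distinct[OF wf] unfolding distinct_map inj_on_def g_def
  by (metis (no_types, lifting) distinct_conv_nth lessThan_iff length_map nth_map wf_ctx_distinct[OF wf])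
 define \<rho> where "\<rho> = inv_into {..<length \<Gamma>} g"
 have rg: "\<rho> (g i) = i" if "i < length \<Gamma>" for i unfolding \<rho>_def using inv_into_f_f[OF inj] that by simp
 have gim: "g ` {..<length \<Gamma>} = vars_ctx \<Gamma>" unfolding g_def vars_ctx_def by (force simp: in_set_conv_nth)
 have gr: "g (\<rho> y) = y" if "y \<in> vars_ctx \<Gamma>" for y unfolding \<rho>_def using f_inv_into_f that gim by metis
 have injr: "inj_on \<rho> (vars_ctx \<Gamma>)" using gr by (metis inj_onI)
 let ?G = "map (\<lambda>(x, A). (\<rho> x, rnty \<rho> A)) \<Gamma>"
 have "map fst ?G = [0..<length ?G]"
 proof (rule nth_equalityI)
  fix i assume i: "i < length (map fst ?G)"
  hence "map fst ?G ! i = \<rho> (g i)" by (simp add: g_def case_prod_beta)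
  thus "map fst ?G ! i = [0..<length ?G] ! i" using rg i by simp
 qed simp
 hence cn: "canonical ?G" by (simp add: canonical_def)
 have "ps_ctx ?G" using ps_at_rename[OF x injr] by (auto simp: ps_ctx_def)
 then obtain V where V: "is_table V" "?G = ctxT V" using ctxT_surj cn by blast
 have mem: "\<exists>x A. (x, A) \<in> set \<Gamma> \<and> y = \<rho> x \<and> B = rnty \<rho> A" if "(y, B) \<in> set (ctxT V)" for y B
  using that unfolding V(2)[symmetric] by auto
 have "vmor g (ctxT V) \<Gamma>"
  unfolding vmor_def
 proof (intro conjI allI impI)
  fix y assume "(y, Star) \<in> set (ctxT V)"
  then obtain x A where "(x, A) \<in> set \<Gamma>" "y = \<rho> x" "Star = rnty \<rho> A" using mem by blast
  thus "(g y, Star) \<in> set \<Gamma>" using gr vars_ctxI by (cases A) auto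
 next
  fix f a C b assume "(f, Arrow (Var a) C (Var b)) \<in> set (ctxT V)"
  then obtain x A where x: "(x, A) \<in> set \<Gamma>" "f = \<rho> x" "Arrow (Var a) C (Var b) = rnty \<rho> A" using mem by blast
  then obtain t D u where A: "A = Arrow t D u" by (cases A) auto
  obtain a' b' where ab: "t = Var a'" "u = Var b'" "(a', D) \<in> set \<Gamma>" "(b', D) \<in> set \<Gamma>"
   using vt x(1)[unfolded A] by (rule var_typesE)
  hence "g f = x" "g a = a'" "g b = b'" using x A gr vars_ctxI by auto
  thus "\<exists>C'. (g f, Arrow (Var (g a)) C' (Var (g b))) \<in> set \<Gamma>" using x(1) A ab by auto
 qed
 moreover have "vars_ctx (ctxT V) = {..<length \<Gamma>}" using canonical_vars[OF cn] V(2) by (metis length_map)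
 ultimately show ?thesis using V(1) gim by metis
qed

section \<open>Terms over the image of a map of ps-contexts\<close>

definition im_ctx :: "(nat \<Rightarrow> nat) \<Rightarrow> table \<Rightarrow> table \<Rightarrow> ctx" where
 "im_ctx h B T = filter (\<lambda>p. fst p \<in> h ` vars_ctx (ctxT B)) (ctxT T)"

context
 fixes h B T
 assumes B: "is_table B" and T: "is_table T" and h: "vmor h (ctxT B) (ctxT T)"
begin

lemma im_vars: "vars_ctx (im_ctx h B T) = h ` vars_ctx (ctxT B)"
proof -
 have "h ` vars_ctx (ctxT B) \<subseteq> vars_ctx (ctxT T)"
  using vmor_vars[OF ctxT_vt[OF T] ctxT_wf[OF T] h ctxT_vt[OF B]] by (auto elim!: vars_ctxE) (metis vars_ctxI)
 thus ?thesis by (force simp: im_ctx_def vars_ctx_def)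
qed

lemma h_ty: "(x, A) \<in> set (ctxT B) \<Longrightarrow> (h x, subst_ty (vsub h (ctxT B)) A) \<in> set (ctxT T)"
 by (rule vmor_ty[OF h ctxT_vt[OF B] ctxT_vt[OF T] ctxT_wf[OF T]])

lemma subst_vsub_vars:
 assumes "U \<subseteq> vars_ctx (ctxT B)"
 shows "(\<Union>x\<in>U. vars_tm (sv (vsub h (ctxT B)) x)) = h ` U"
proof -
 have "vars_tm (sv (vsub h (ctxT B)) x) = {h x}" if "x \<in> U" for x using sv_vsub[of x "ctxT B" h] assms that by auto
 thus ?thesis by blast
qed

lemma im_mem: "(y, D) \<in> set (im_ctx h B T) \<longleftrightarrow> (\<exists>x A. (x, A) \<in> set (ctxT B) \<and> y = h x \<and> D = subst_ty (vsub h (ctxT B)) A)"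
proof
 assume "(y, D) \<in> set (im_ctx h B T)"
 then obtain x A where x: "(x, A) \<in> set (ctxT B)" "y = h x" "(y, D) \<in> set (ctxT T)" by (auto simp: im_ctx_def elim: vars_ctxE)
 thus "\<exists>x A. (x, A) \<in> set (ctxT B) \<and> y = h x \<and> D = subst_ty (vsub h (ctxT B)) A"
  using h_ty[OF x(1)] ctx_fun[OF ctxT_wf[OF T]] by blast
next
 assume "\<exists>x A. (x, A) \<in> set (ctxT B) \<and> y = h x \<and> D = subst_ty (vsub h (ctxT B)) A"
 thus "(y, D) \<in> set (im_ctx h B T)" using h_ty vars_ctxI by (auto simp: im_ctx_def)
qed

lemma im_closed: "(y, D) \<in> set (im_ctx h B T) \<Longrightarrow> vars_ty D \<subseteq> h ` vars_ctx (ctxT B)"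
proof -
 assume "(y, D) \<in> set (im_ctx h B T)"
 then obtain x A where x: "(x, A) \<in> set (ctxT B)" "D = subst_ty (vsub h (ctxT B)) A" using im_mem by blast
 have "vars_ty A \<subseteq> vars_ctx (ctxT B)" using var_types_vars[OF ctxT_vt[OF B] x(1)] by blast
 thus ?thesis using subst_vsub_vars x(2) by (auto simp: vars_subst)
qed

lemma im_wf: "wf_ctx (im_ctx h B T)"
 unfolding im_ctx_def
proof (rule wf_ctx_filter[OF ctxT_wf[OF T]])
 fix x A y assume "(x, A) \<in> set (ctxT T)" "x \<in> h ` vars_ctx (ctxT B)" "y \<in> vars_ty A"
 thus "y \<in> h ` vars_ctx (ctxT B)" using im_closed[of x A] by (auto simp: im_ctx_def)
qed

lemma im_vmor: "vmor h (ctxT B) (im_ctx h B T)"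
 unfolding vmor_def
proof (intro conjI allI impI)
 fix x assume "(x, Star) \<in> set (ctxT B)"
 thus "(h x, Star) \<in> set (im_ctx h B T)" unfolding im_mem by (metis subst_ty.simps(1))
next
 fix f a C b assume f: "(f, Arrow (Var a) C (Var b)) \<in> set (ctxT B)"
 hence "(a, C) \<in> set (ctxT B)" "(b, C) \<in> set (ctxT B)" using var_types_face[OF ctxT_vt[OF B]] by blast+
 hence "subst_ty (vsub h (ctxT B)) (Arrow (Var a) C (Var b)) = Arrow (Var (h a)) (subst_ty (vsub h (ctxT B)) C) (Var (h b))"
  using sv_vsub vars_ctxI by simp
 thus "\<exists>C'. (h f, Arrow (Var (h a)) C' (Var (h b))) \<in> set (im_ctx h B T)" using f unfolding im_mem by metis
qed

lemma im_vt: "var_types (im_ctx h B T)"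
 unfolding var_types_def
proof (intro ballI, clarify)
 fix y D assume y: "(y, D) \<in> set (im_ctx h B T)" "\<nexists>a C b. D = Arrow (Var a) C (Var b) \<and> (a, C) \<in> set (im_ctx h B T) \<and> (b, C) \<in> set (im_ctx h B T)"
 then obtain x A where x: "(x, A) \<in> set (ctxT B)" "y = h x" "D = subst_ty (vsub h (ctxT B)) A" using im_mem by blast
 show "D = Star"
 proof (cases A)
  case (Arrow t C u)
  obtain a b where ab: "t = Var a" "u = Var b" "(a, C) \<in> set (ctxT B)" "(b, C) \<in> set (ctxT B)"
   using ctxT_vt[OF B] x(1)[unfolded Arrow] by (rule var_typesE)
  hence "D = Arrow (Var (h a)) (subst_ty (vsub h (ctxT B)) C) (Var (h b))" using x(3) Arrow sv_vsub vars_ctxI by simp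
  moreover have "(h a, subst_ty (vsub h (ctxT B)) C) \<in> set (im_ctx h B T)" "(h b, subst_ty (vsub h (ctxT B)) C) \<in> set (im_ctx h B T)"
   using ab im_mem by blast+
  ultimately show ?thesis using y(2) by blast
 qed (use x in simp)
qed

text \<open>Maps of ps-contexts are increasing. So the image of \<open>h\<close> is a copy of
  \<open>ctxT B\<close>, and terms over it can be pulled back.\<close>

lemma h_inj: "inj_on h (vars_ctx (ctxT B))"
proof -
 have less: "h i < h j" if "i < j" "j < length (ctxT B)" for i j
 proof (rule ps_map_less[OF ctxT_ps[OF B] ctxT_canonical[OF B] ctxT_ps[OF T] ctxT_canonical[OF T] _ _ that])
  show "h v \<in> vars_ctx (ctxT T)" if "(v, A) \<in> set (ctxT B)" for v A using h_ty[OF that] vars_ctxI by blast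
  show "\<exists>C'. (h f, Arrow (Var (h a)) C' (Var (h b))) \<in> set (ctxT T)" if "(f, Arrow (Var a) C (Var b)) \<in> set (ctxT B)" for f a C b
   using h that unfolding vmor_def by blast
 qed
 show ?thesis
 proof (rule inj_onI)
  fix x y assume "x \<in> vars_ctx (ctxT B)" "y \<in> vars_ctx (ctxT B)" "h x = h y"
  thus "x = y" using less[of x y] less[of y x] canonical_vars[OF ctxT_canonical[OF B]] by (metis lessThan_iff less_irrefl linorder_neqE_nat)
 qed
qed

definition "hinv = inv_into (vars_ctx (ctxT B)) h"

lemma hinv: "x \<in> vars_ctx (ctxT B) \<Longrightarrow> hinv (h x) = x" "y \<in> h ` vars_ctx (ctxT B) \<Longrightarrow> h (hinv y) = y"
 unfolding hinv_def using inv_into_f_f[OF h_inj] f_inv_into_f by metis+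

lemma hinv_vmor: "vmor hinv (im_ctx h B T) (ctxT B)"
 unfolding vmor_def
proof (intro conjI allI impI)
 fix y assume "(y, Star) \<in> set (im_ctx h B T)"
 then obtain x A where x: "(x, A) \<in> set (ctxT B)" "y = h x" "Star = subst_ty (vsub h (ctxT B)) A" using im_mem by blast
 hence "A = Star" by (cases A) auto
 thus "(hinv y, Star) \<in> set (ctxT B)" using x hinv(1)[OF vars_ctxI[OF x(1)]] by simp
next
 fix f a C b assume "(f, Arrow (Var a) C (Var b)) \<in> set (im_ctx h B T)"
 then obtain x A where x: "(x, A) \<in> set (ctxT B)" "f = h x" "Arrow (Var a) C (Var b) = subst_ty (vsub h (ctxT B)) A" using im_mem by blast
 then obtain t D u where A: "A = Arrow t D u" by (cases A) auto
 obtain a' b' where ab: "t = Var a'" "u = Var b'" "(a', D) \<in> set (ctxT B)" "(b', D) \<in> set (ctxT B)"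
   using ctxT_vt[OF B] x(1)[unfolded A] by (rule var_typesE)
 hence "a = h a'" "b = h b'" using x(3) A sv_vsub vars_ctxI by auto
 hence "hinv f = x" "hinv a = a'" "hinv b = b'" using x ab hinv(1) vars_ctxI by auto
 thus "\<exists>C'. (hinv f, Arrow (Var (hinv a)) C' (Var (hinv b))) \<in> set (ctxT B)" using x(1) A ab by auto
qed

lemma im_push:
 assumes "wf_tm (ctxT B) t A"
 shows "wf_tm (im_ctx h B T) (subst_tm (vsub h (ctxT B)) t) (subst_ty (vsub h (ctxT B)) A)"
  and "vars_typed (subst_tm (vsub h (ctxT B)) t) (subst_ty (vsub h (ctxT B)) A) = h ` vars_typed t A"
proof -
 show "wf_tm (im_ctx h B T) (subst_tm (vsub h (ctxT B)) t) (subst_ty (vsub h (ctxT B)) A)"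
  using substitution(3)[OF assms vmor_wf[OF im_vmor ctxT_vt[OF B] ctxT_wf[OF B] im_vt im_wf]] .
 have "vars_typed t A \<subseteq> vars_ctx (ctxT B)"
  using wf_vars(3)[OF assms] wf_vars(2)[OF wf_tm_ty(3)[OF assms]] by (auto simp: vars_typed_def)
 thus "vars_typed (subst_tm (vsub h (ctxT B)) t) (subst_ty (vsub h (ctxT B)) A) = h ` vars_typed t A"
  unfolding vars_typed_subst by (rule subst_vsub_vars)
qed

text \<open>The preimage is obtained by substituting along the inverse renaming \<open>hinv\<close>.
  As this has level 0, no level is lost on the way.\<close>

lemma im_pull:
 assumes t: "wf_tm (im_ctx h B T) t A"
 shows "\<exists>t' A'. wf_tm (ctxT B) t' A' \<and> tdim A' = tdim A \<and> t = subst_tm (vsub h (ctxT B)) t' \<and>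
   A = subst_ty (vsub h (ctxT B)) A' \<and> (\<forall>n. lev_tm n t \<longrightarrow> lev_tm n t') \<and>
   (vars_typed t A = h ` vars_ctx (ctxT B) \<longrightarrow> vars_typed t' A' = vars_ctx (ctxT B))"
proof -
 let ?D = "im_ctx h B T"
 let ?i = "vsub hinv ?D"
 let ?h = "vsub h (ctxT B)"
 have w: "wf_sub (ctxT B) ?i ?D" using vmor_wf[OF hinv_vmor im_vt im_wf ctxT_vt[OF B] ctxT_wf[OF B]] .
 have t': "wf_tm (ctxT B) (subst_tm ?i t) (subst_ty ?i A)" using substitution(3)[OF t w] .
 have id: "sv (comp_sub ?i ?h) y = sv (id_sub ?D) y" if y: "y \<in> vars_ctx ?D" for y
 proof -
  have "y \<in> fst ` set ?i" using wf_sub_dom_set[OF w] y by simp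
  hence "sv (comp_sub ?i ?h) y = subst_tm ?h (Var (hinv y))" using sv_comp_sub[of y ?i ?h] sv_vsub[OF y] by simp
  moreover have "hinv y \<in> vars_ctx (ctxT B)" using y im_vars hinv(1) by auto
  ultimately show ?thesis using sv_vsub[of "hinv y" "ctxT B" h] hinv(2) y im_vars by simp
 qed
 have vt: "vars_tm t \<subseteq> vars_ctx ?D" "vars_ty A \<subseteq> vars_ctx ?D" using wf_vars(3)[OF t] wf_vars(2)[OF wf_tm_ty(3)[OF t]] by auto
 have 1: "subst_tm ?h (subst_tm ?i t) = t"
  using subst_comp_wf(2)[OF w t] subst_cong(2)[of t "comp_sub ?i ?h" "id_sub ?D"] id vt by auto
 have 2: "subst_ty ?h (subst_ty ?i A) = A"
  using subst_comp_wf(1)[OF w wf_tm_ty(3)[OF t]] subst_cong(1)[of A "comp_sub ?i ?h" "id_sub ?D"] id vt by auto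
 have 3: "vars_typed (subst_tm ?i t) (subst_ty ?i A) = vars_ctx (ctxT B)" if e: "vars_typed t A = h ` vars_ctx (ctxT B)"
 proof -
  have "vars_typed t A = h ` vars_typed (subst_tm ?i t) (subst_ty ?i A)" using im_push(2)[OF t'] 1 2 by simp
  moreover have "vars_typed (subst_tm ?i t) (subst_ty ?i A) \<subseteq> vars_ctx (ctxT B)"
   using wf_vars(3)[OF t'] wf_vars(2)[OF wf_tm_ty(3)[OF t']] by (auto simp: vars_typed_def)
  ultimately show ?thesis using e inj_on_image_eq_iff[OF h_inj] by blast
 qed
 have 4: "\<forall>n. lev_tm n t \<longrightarrow> lev_tm n (subst_tm ?i t)" using lev_subst(2)[OF lev_vsub] by blast
 show ?thesis
  by (rule exI[of _ "subst_tm ?i t"], rule exI[of _ "subst_ty ?i A"]) (use t' 1 2 3 4 in auto)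
qed

end

lemma filter_vars:
 assumes "wf_ctx \<Gamma>"
 shows "filter P \<Gamma> = filter (\<lambda>p. fst p \<in> vars_ctx (filter P \<Gamma>)) \<Gamma>"
proof (rule filter_cong[OF refl])
 fix p assume p: "p \<in> set \<Gamma>"
 show "P p = (fst p \<in> vars_ctx (filter P \<Gamma>))"
 proof
  assume "fst p \<in> vars_ctx (filter P \<Gamma>)"
  then obtain A where "(fst p, A) \<in> set \<Gamma>" "P (fst p, A)" by (auto simp: vars_ctx_def)
  thus "P p" using ctx_fun[OF assms, of "fst p" A "snd p"] p by simp
 qed (use p in \<open>auto simp: vars_ctx_def\<close>)
qed

section \<open>Algebraic arrows and terms of full support\<close>

definition full :: "table \<Rightarrow> tm \<Rightarrow> bool" where
 "full T t \<longleftrightarrow> vars_typed t (tyT T t) = vars_ctx (ctxT T)"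

lemma tmd_vars: "tmd T k t \<Longrightarrow> vars_typed t (tyT T t) \<subseteq> vars_ctx (ctxT T)"
 using wf_vars(3)[of "ctxT T" t "tyT T t"] wf_vars(2)[OF wf_tm_ty(3), of "ctxT T" t "tyT T t"]
 by (auto simp: vars_typed_def tmd_def)

text \<open>If a variable is missing, \<open>proper_support\<close> provides a proper sub-ps-context
  through whose inclusion the arrow factors, and this inclusion is no identity. Conversely, a
  globular arrow through which a term of full support factors is surjective on variables, hence an
  identity by rigidity.\<close>

lemma algebraic_iff_full:
 assumes t: "tmd T k t" "lev_tm n t"
 shows "algebraic_arrow (S n) J (arr T k t) \<longleftrightarrow> full T t"
proof
 have T: "is_table T" and wt: "wf_tm (ctxT T) t (tyT T t)" "tdim (tyT T t) = k" using t by (auto simp: tmd_def)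
 note hom = homD[OF arr_hom[OF t]]
 assume alg: "algebraic_arrow (S n) J (arr T k t)"
 show "full T t"
 proof (rule ccontr)
  assume "\<not> full T t"
  then obtain U where U: "vars_typed t (tyT T t) \<subseteq> U" "\<not> vars_ctx (ctxT T) \<subseteq> U" "ps_ctx (filter (\<lambda>p. fst p \<in> U) (ctxT T))"
   using proper_support[OF ctxT_ps[OF T] ctxT_canonical[OF T] wt(1)] unfolding full_def by blast
  let ?G = "filter (\<lambda>p. fst p \<in> U) (ctxT T)"
  obtain V g where V: "is_table V" "vmor g (ctxT V) ?G" "g ` vars_ctx (ctxT V) = vars_ctx ?G" using ps_canonicalize[OF U(3)] by blast
  have g: "vmor g (ctxT V) (ctxT T)" using V(2) unfolding vmor_def by fastforce
  have im: "im_ctx g V T = ?G" unfolding im_ctx_def V(3) using filter_vars[OF ctxT_wf[OF T], of "\<lambda>p. fst p \<in> U"] by simp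
  have "wf_tm (im_ctx g V T) t (tyT T t)"
   using U(1) by (intro strengthening(3)[OF wt(1) im_wf[OF V(1) T g]]) (auto simp: im vars_typed_def)
  from im_pull[OF V(1) T g this] t(2) obtain t' A' where t': "wf_tm (ctxT V) t' A'" "tdim A' = tdim (tyT T t)"
   "t = subst_tm (vsub g (ctxT V)) t'" "lev_tm n t'" by blast
  have tm': "tmd V k t'" using tmdI[OF V(1) t'(1)] t'(2) wt by simp
  have w: "wfs V (vsub g (ctxT V)) T" using vmor_wfs[OF V(1) T g] .
  have "arr T k t = sComp (ar V (vsub g (ctxT V)) T) (arr V k t')" using comp_arr[OF w tm'] t'(3) by simp
  moreover have ga: "ar V (vsub g (ctxT V)) T \<in> Arr (S 0)" unfolding Scat_Arr using w lev_vsub by blast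
  moreover have "arr V k t' \<in> Arr (S n)" "Cod (S n) (arr V k t') = gsum V" using homD[OF arr_hom[OF tm' t'(4)]] by auto
  ultimately have "ar V (vsub g (ctxT V)) T = Id (S n) (Cod (S n) (arr T k t))"
   using alg unfolding algebraic_arrow_def globular_arrow_J by auto
  hence "ar V (vsub g (ctxT V)) T = ar T (id_sub (ctxT T)) T" using hom Scat_Id[OF T] by simp
  hence "V = T" "vsub g (ctxT V) = id_sub (ctxT T)" using ar_inj[OF _ w wfs_id[OF T]] by blast+
  hence "vsub g (ctxT T) = vsub id (ctxT T)" by (simp add: vsub_def id_sub_def)
  hence "\<forall>x\<in>vars_ctx (ctxT T). g x = x" unfolding vsub_eq by simp
  hence "vars_ctx (ctxT T) = vars_ctx ?G" using V(3) \<open>V = T\<close> by force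
  thus False using U(2) by (auto simp: vars_ctx_def)
 qed
next
 assume f: "full T t"
 have T: "is_table T" and wt: "wf_tm (ctxT T) t (tyT T t)" "tdim (tyT T t) = k" using t by (auto simp: tmd_def)
 note hom = homD[OF arr_hom[OF t]]
 show "algebraic_arrow (S n) J (arr T k t)"
  unfolding algebraic_arrow_def
 proof (intro conjI allI impI, use hom in blast, elim conjE)
  fix g f' assume g: "globular_arrow J g" "f' \<in> Arr (S n)" "Dom (S n) g = Cod (S n) f'" "arr T k t = Comp (S n) g f'"
  obtain U \<gamma> T' where u: "g = ar U \<gamma> T'" "wfs U \<gamma> T'" "lev_sub 0 \<gamma>" using g(1) unfolding globular_arrow_J Scat_Arr by blast
  obtain V \<delta> U' where v: "f' = ar V \<delta> U'" "wfs V \<delta> U'" using g(2) unfolding Scat_Arr by blast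
  have "U' = U" using g(3) u v gsum_inj by (auto simp: wfs_def)
  note v = v[unfolded this]
  have "ar (k, []) (tsub T k t) T = ar V (comp_sub \<delta> \<gamma>) T'" using g(4) u v by (simp add: arr_def)
  hence e: "V = (k, [])" "T' = T" using ar_inj[OF _ wfs_tsub[OF t(1)] wfs_comp[OF v(2) u(2)]] by blast+
  from v(2)[unfolded e(1)] obtain t' where t': "tmd U k t'" "\<delta> = tsub U k t'" by (rule wfs_globe)
  have "arr T k t = arr T k (subst_tm \<gamma> t')" using comp_arr[OF u(2)[unfolded e] t'(1)] g(4) u v t' e by (simp add: arr_def)
  hence tt: "t = subst_tm \<gamma> t'" using arr_inj[OF t(1) tmd_subst[OF u(2)[unfolded e] t'(1), THEN conjunct1]] by blast
  have tU: "is_table U" "wf_sub (ctxT T) \<gamma> (ctxT U)" using u(2) e by (auto simp: wfs_def)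
  from tU(2) u(3) ctxT_vt[OF tU(1)] obtain h where h: "\<gamma> = vsub h (ctxT U)" "vmor h (ctxT U) (ctxT T)" by (rule vmor_of_sub)
  have wt': "wf_tm (ctxT U) t' (tyT U t')" using t'(1) by (simp add: tmd_def)
  have "vars_ctx (ctxT T) = h ` vars_typed t' (tyT U t')"
   using f im_push(2)[OF tU(1) T h(2) wt'] tmd_subst[OF u(2)[unfolded e] t'(1)] tt h(1) by (simp add: full_def)
  also have "\<dots> \<subseteq> h ` vars_ctx (ctxT U)" using tmd_vars[OF t'(1)] by blast
  finally have "vars_ctx (ctxT T) \<subseteq> h ` vars_ctx (ctxT U)" .
  from vmor_surj_id[OF tU(1) T h(2) this] show "g = Id (S n) (Cod (S n) (arr T k t))"
   using u(1) h(1) e(2) hom Scat_Id[OF T] by simp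
 qed
qed

text \<open>The two faces of codimension one, together with their own type, make up the type of a
  term; in dimension 0 there is only the type \<open>Star\<close>.\<close>

lemma parallel_iff:
 assumes t: "tmd T i t" "tmd T i u" "lev_tm n t" "lev_tm n u"
 shows "parallel_arrows (S n) gl i (gsum T) (arr T i t) (arr T i u) \<longleftrightarrow> tyT T t = tyT T u"
proof -
 let ?A = "tyT T t" and ?B = "tyT T u"
 have wt: "wf_tm (ctxT T) t ?A" "tdim ?A = i" "wf_tm (ctxT T) u ?B" "tdim ?B = i" using t by (auto simp: tmd_def)
 have h: "arr T i t \<in> hom (S n) (fst gl i) (gsum T)" "arr T i u \<in> hom (S n) (fst gl i) (gsum T)" using arr_hom t by auto
 have cmp: "Comp (S n) (arr T i s) (snd gl (globe_map e i' i)) = arr T i' (bdf (tyT T s) i' e) \<and> tmd T i' (bdf (tyT T s) i' e)"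
  if "i = Suc i'" "e = Src \<or> e = Tgt" "tmd T i s" for i' e s
 proof -
  have e: "e \<in> globe_hom i' i" using that by (auto simp: globe_hom_iff)
  have "face s (tyT T s) i' e = bdf (tyT T s) i' e" using that(2) by (auto simp: face_def)
  thus ?thesis using comp_gl[OF that(3) e] tmd_face[OF that(3) e] that(1) by (simp add: globe_map_less del: gl_simps)
 qed
 show ?thesis
 proof
  assume p: "parallel_arrows (S n) gl i (gsum T) (arr T i t) (arr T i u)"
  show "?A = ?B"
  proof (cases i)
   case 0
   hence "?A = Star" "?B = Star" using wt by (cases ?A; cases ?B; auto)+
   thus ?thesis by simp
  next
   case (Suc i')
   have "arr T i' (bdf ?A i' e) = arr T i' (bdf ?B i' e)" if "e = Src \<or> e = Tgt" for e
   proof -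
    have "Comp (S n) (arr T i t) (snd gl (globe_map e i' i)) = Comp (S n) (arr T i u) (snd gl (globe_map e i' i))"
     using p Suc that unfolding parallel_arrows_def by blast
    thus ?thesis using cmp[OF Suc that t(1)] cmp[OF Suc that t(2)] by simp
   qed
   hence e: "bdf ?A i' e = bdf ?B i' e" if "e = Src \<or> e = Tgt" for e
    using cmp[OF Suc that t(1)] cmp[OF Suc that t(2)] arr_inj[of T i' "bdf ?A i' e" T i' "bdf ?B i' e"] that by simp
   have "wf_tm (ctxT T) (bdf ?A i' Src) (trunc ?A i')" "wf_tm (ctxT T) (bdf ?B i' Src) (trunc ?B i')"
    using wf_bdf[OF wf_tm_ty(3)[OF wt(1)]] wf_bdf[OF wf_tm_ty(3)[OF wt(3)]] wt Suc by auto
   hence "trunc ?A i' = trunc ?B i'" using e[of Src] wf_tm_unique by simp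
   thus ?thesis using trunc_Suc[of i' ?A] trunc_Suc[of i' ?B] e[of Src] e[of Tgt] wt Suc trunc_top[of ?A i] trunc_top[of ?B i] by simp
  qed
 next
  assume e: "?A = ?B"
  show "parallel_arrows (S n) gl i (gsum T) (arr T i t) (arr T i u)"
   unfolding parallel_arrows_def
  proof (intro conjI allI impI ballI)
   fix i' e' assume "i = Suc i'" "e' \<in> {Src, Tgt}"
   thus "Comp (S n) (arr T i t) (snd gl (globe_map e' i' i)) = Comp (S n) (arr T i u) (snd gl (globe_map e' i' i))"
    using cmp[of i' e' t] cmp[of i' e' u] t e by auto
  qed (use h in auto)
 qed
qed

text \<open>The typing and support conditions under which one of the rules \<open>tm_coh\<close> and
  \<open>tm_op\<close> forms a coherence from \<open>t\<close> to \<open>u\<close> over the context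
  of \<open>T\<close>.\<close>

definition adm :: "table \<Rightarrow> nat \<Rightarrow> tm \<Rightarrow> tm \<Rightarrow> bool" where
 "adm T i t u \<longleftrightarrow> tmd T i t \<and> tmd T i u \<and> tyT T t = tyT T u \<and>
   (full T t \<and> full T u \<or>
   0 < dim_table T \<and> wf_tm (src_ctx (ctxT T)) t (tyT T t) \<and> wf_tm (tgt_ctx (ctxT T)) u (tyT T t) \<and>
   vars_typed t (tyT T t) = vars_ctx (src_ctx (ctxT T)) \<and> vars_typed u (tyT T t) = vars_ctx (tgt_ctx (ctxT T)))"

lemma admD: "adm T i t u \<Longrightarrow> tmd T i t \<and> tmd T i u \<and> tyT T t = tyT T u \<and> is_table T"
 unfolding adm_def tmd_def by blast

lemma src_ctx_filter: "wf_ctx \<Gamma> \<Longrightarrow> src_ctx \<Gamma> = filter (\<lambda>p. fst p \<in> vars_ctx (src_ctx \<Gamma>)) \<Gamma>"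
 and tgt_ctx_filter: "wf_ctx \<Gamma> \<Longrightarrow> tgt_ctx \<Gamma> = filter (\<lambda>p. fst p \<in> vars_ctx (tgt_ctx \<Gamma>)) \<Gamma>"
proof -
 assume w: "wf_ctx \<Gamma>"
 have "\<exists>P. (if c then \<Gamma> else filter Q \<Gamma>) = filter P \<Gamma>" for c Q
  by (rule exI[of _ "\<lambda>p. c \<or> Q p"]) auto
 hence "\<exists>P. src_ctx \<Gamma> = filter P \<Gamma>" "\<exists>P. tgt_ctx \<Gamma> = filter P \<Gamma>"
  unfolding src_ctx_def tgt_ctx_def Let_def by blast+
 thus "src_ctx \<Gamma> = filter (\<lambda>p. fst p \<in> vars_ctx (src_ctx \<Gamma>)) \<Gamma>" "tgt_ctx \<Gamma> = filter (\<lambda>p. fst p \<in> vars_ctx (tgt_ctx \<Gamma>)) \<Gamma>"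
  using filter_vars[OF w] by metis+
qed

text \<open>An algebraic factor through the inclusion \<open>h\<close> is a term over
  \<open>B\<close> of full support, and those terms are the terms over the image whose support is
  the whole image. Stated for arbitrary \<open>h\<close>, it covers both boundaries.\<close>

lemma bd_factor:
 assumes T: "is_table T" and B: "is_table B" and h: "vmor h (ctxT B) (ctxT T)" and D: "\<Delta> = im_ctx h B T"
  and t: "tmd T i t" "lev_tm n t"
 shows "(\<exists>f'\<in>hom (S n) (gsum (i, [])) (gsum B). algebraic_arrow (S n) J f' \<and> arr T i t = Comp (S n) (ar B (vsub h (ctxT B)) T) f') \<longleftrightarrow>
  wf_tm \<Delta> t (tyT T t) \<and> vars_typed t (tyT T t) = vars_ctx \<Delta>"
proof
 note w = vmor_wfs[OF B T h]
 assume "\<exists>f'\<in>hom (S n) (gsum (i, [])) (gsum B). algebraic_arrow (S n) J f' \<and> arr T i t = Comp (S n) (ar B (vsub h (ctxT B)) T) f'"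
 then obtain f' where f': "f' \<in> hom (S n) (gsum (i, [])) (gsum B)" "algebraic_arrow (S n) J f'" "arr T i t = sComp (ar B (vsub h (ctxT B)) T) f'" by auto
 from B f'(1) obtain t' where t': "tmd B i t'" "lev_tm n t'" "f' = arr B i t'" by (rule hom_globe)
 have ft: "full B t'" using algebraic_iff_full[OF t'(1,2)] f'(2) t'(3) by simp
 note sb = tmd_subst[OF w t'(1)]
 have "t = subst_tm (vsub h (ctxT B)) t'" using f'(3) t'(3) comp_arr[OF w t'(1)] arr_inj[OF t(1) sb[THEN conjunct1]] by simp
 moreover have wt: "wf_tm (ctxT B) t' (tyT B t')" using t'(1) by (simp add: tmd_def)
 ultimately show "wf_tm \<Delta> t (tyT T t) \<and> vars_typed t (tyT T t) = vars_ctx \<Delta>"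
  using im_push[OF B T h wt] sb ft D im_vars[OF B T h] by (simp add: full_def)
next
 note w = vmor_wfs[OF B T h]
 assume a: "wf_tm \<Delta> t (tyT T t) \<and> vars_typed t (tyT T t) = vars_ctx \<Delta>"
 hence "wf_tm (im_ctx h B T) t (tyT T t)" "vars_typed t (tyT T t) = h ` vars_ctx (ctxT B)" using D im_vars[OF B T h] by auto
 from im_pull[OF B T h this(1)] this(2) t(2) obtain t' A' where t': "wf_tm (ctxT B) t' A'" "tdim A' = tdim (tyT T t)"
   "t = subst_tm (vsub h (ctxT B)) t'" "lev_tm n t'" "vars_typed t' A' = vars_ctx (ctxT B)" by blast
 have tm': "tmd B i t'" "tyT B t' = A'" using tmdI[OF B t'(1)] tyT_eq[OF t'(1)] t'(2) t(1) by (auto simp: tmd_def)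
 have "algebraic_arrow (S n) J (arr B i t')" using algebraic_iff_full[OF tm'(1) t'(4)] t'(5) tm'(2) by (simp add: full_def)
 moreover have "arr T i t = Comp (S n) (ar B (vsub h (ctxT B)) T) (arr B i t')" using comp_arr[OF w tm'(1)] t'(3) by simp
 ultimately show "\<exists>f'\<in>hom (S n) (gsum (i, [])) (gsum B). algebraic_arrow (S n) J f' \<and> arr T i t = Comp (S n) (ar B (vsub h (ctxT B)) T) f'"
  using arr_hom[OF tm'(1) t'(4)] by blast
qed

lemma admissible_iff:
 "(i, f, g) \<in> admissible_pairs (S n) gl J \<longleftrightarrow>
   (\<exists>T t u. adm T i t u \<and> lev_tm n t \<and> lev_tm n u \<and> f = arr T i t \<and> g = arr T i u)"
proof -
 have key: "(algebraic_arrow (S n) J (arr T i t) \<and> algebraic_arrow (S n) J (arr T i u) \<or>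
   dim_table T > 0 \<and>
   (\<exists>f'\<in>hom (S n) (fst gl i) (fst J (gsum (bd_table T))).
    \<exists>g'\<in>hom (S n) (fst gl i) (fst J (gsum (bd_table T))).
     algebraic_arrow (S n) J f' \<and> algebraic_arrow (S n) J g' \<and>
     arr T i t = Comp (S n) (snd J (bd_src T)) f' \<and> arr T i u = Comp (S n) (snd J (bd_tgt T)) g'))
   \<and> tyT T t = tyT T u \<longleftrightarrow> adm T i t u" if t: "tmd T i t" "tmd T i u" "lev_tm n t" "lev_tm n u" for T t u
 proof -
  have T: "is_table T" using t by (simp add: tmd_def)
  note B = is_table_bd[OF T]
  have 1: "(\<exists>f'\<in>hom (S n) (gsum (i, [])) (gsum (bd_table T)). algebraic_arrow (S n) J f' \<and> arr T i t = Comp (S n) (snd J (bd_src T)) f') \<longleftrightarrow>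
   wf_tm (src_ctx (ctxT T)) t (tyT T t) \<and> vars_typed t (tyT T t) = vars_ctx (src_ctx (ctxT T))" if d: "dim_table T > 0"
  proof -
   obtain h where h: "vmor h (ctxT (bd_table T)) (ctxT T)" "snd J (bd_src T) = ar (bd_table T) (vsub h (ctxT (bd_table T))) T"
    "h ` vars_ctx (ctxT (bd_table T)) = vars_ctx (src_ctx (ctxT T))" using J_bd(1)[OF T d] by blast
   have "src_ctx (ctxT T) = im_ctx h (bd_table T) T" unfolding im_ctx_def h(3) by (rule src_ctx_filter[OF ctxT_wf[OF T]])
   from bd_factor[OF T B h(1) this t(1,3)] show ?thesis unfolding h(2) .
  qed
  have 2: "(\<exists>f'\<in>hom (S n) (gsum (i, [])) (gsum (bd_table T)). algebraic_arrow (S n) J f' \<and> arr T i u = Comp (S n) (snd J (bd_tgt T)) f') \<longleftrightarrow>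
   wf_tm (tgt_ctx (ctxT T)) u (tyT T u) \<and> vars_typed u (tyT T u) = vars_ctx (tgt_ctx (ctxT T))" if d: "dim_table T > 0"
  proof -
   obtain h where h: "vmor h (ctxT (bd_table T)) (ctxT T)" "snd J (bd_tgt T) = ar (bd_table T) (vsub h (ctxT (bd_table T))) T"
    "h ` vars_ctx (ctxT (bd_table T)) = vars_ctx (tgt_ctx (ctxT T))" using J_bd(2)[OF T d] by blast
   have "tgt_ctx (ctxT T) = im_ctx h (bd_table T) T" unfolding im_ctx_def h(3) by (rule tgt_ctx_filter[OF ctxT_wf[OF T]])
   from bd_factor[OF T B h(1) this t(2,4)] show ?thesis unfolding h(2) .
  qed
  show ?thesis unfolding adm_def algebraic_iff_full[OF t(1,3)] algebraic_iff_full[OF t(2,4)] gl_simps J_simps(1)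
   using 1 2 t by metis
 qed
 show ?thesis
 proof
  assume "(i, f, g) \<in> admissible_pairs (S n) gl J"
  then obtain T where T: "is_table T" "parallel_arrows (S n) gl i (gsum T) f g"
   and c: "algebraic_arrow (S n) J f \<and> algebraic_arrow (S n) J g \<or>
   dim_table T > 0 \<and>
   (\<exists>f'\<in>hom (S n) (fst gl i) (fst J (gsum (bd_table T))).
    \<exists>g'\<in>hom (S n) (fst gl i) (fst J (gsum (bd_table T))).
     algebraic_arrow (S n) J f' \<and> algebraic_arrow (S n) J g' \<and>
     f = Comp (S n) (snd J (bd_src T)) f' \<and> g = Comp (S n) (snd J (bd_tgt T)) g')"
   unfolding admissible_pairs_def by auto
  have fg: "f \<in> hom (S n) (gsum (i, [])) (gsum T)" "g \<in> hom (S n) (gsum (i, [])) (gsum T)" using T(2) unfolding parallel_arrows_def by auto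
  from T(1) fg(1) obtain t where t: "tmd T i t" "lev_tm n t" "f = arr T i t" by (rule hom_globe)
  from T(1) fg(2) obtain u where u: "tmd T i u" "lev_tm n u" "g = arr T i u" by (rule hom_globe)
  have "tyT T t = tyT T u" using parallel_iff[OF t(1) u(1) t(2) u(2)] T(2) t(3) u(3) by simp
  hence "adm T i t u" using c t(3) u(3) key[OF t(1) u(1) t(2) u(2)] by simp
  thus "\<exists>T t u. adm T i t u \<and> lev_tm n t \<and> lev_tm n u \<and> f = arr T i t \<and> g = arr T i u" using t u by blast
 next
  assume "\<exists>T t u. adm T i t u \<and> lev_tm n t \<and> lev_tm n u \<and> f = arr T i t \<and> g = arr T i u"
  then obtain T t u where a: "adm T i t u" "lev_tm n t" "lev_tm n u" "f = arr T i t" "g = arr T i u" by blast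
  hence tm: "tmd T i t" "tmd T i u" "tyT T t = tyT T u" "is_table T" using admD by blast+
  have "parallel_arrows (S n) gl i (gsum T) f g" using parallel_iff[OF tm(1,2) a(2,3)] tm(3) a by simp
  thus "(i, f, g) \<in> admissible_pairs (S n) gl J"
   unfolding admissible_pairs_def using key[OF tm(1,2) a(2,3)] a tm(4) by auto
 qed
qed

text \<open>The generic coherence, with the identity as substitution; all others are its instances.
  An admissible pair determines the constructor, since the source boundary is proper in positive
  dimension.\<close>

definition cohT :: "table \<Rightarrow> tm \<Rightarrow> tm \<Rightarrow> tm" where
 "cohT T t u = (if full T t \<and> full T u then Coh else CohOp) (ctxT T) (Arrow t (tyT T t) u) (id_sub (ctxT T))"

text \<open>The boundary contains no variables of maximal dimension. Hence the conditions of
  \<open>tm_op\<close> and \<open>tm_coh\<close> exclude each other, and a pair has a single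
  coherence.\<close>

lemma src_ctx_proper:
 assumes "is_table T" "0 < dim_table T"
 shows "vars_ctx (src_ctx (ctxT T)) \<noteq> vars_ctx (ctxT T)"
proof
 assume e: "vars_ctx (src_ctx (ctxT T)) = vars_ctx (ctxT T)"
 obtain n where n: "cdim (ctxT T) = Suc n" using cdim_ctxT[OF assms(1)] assms(2) gr0_implies_Suc by metis
 obtain x A where x: "(x, A) \<in> set (ctxT T)" "tdim A = Suc n" using cdim_attained[OF ctxT_ne] n by metis
 then obtain B where "(x, B) \<in> set (src_ctx (ctxT T))" using e vars_ctxI by (metis vars_ctxE)
 hence "(x, B) \<in> set (ctxT T)" "tdim B \<noteq> Suc n" using mem_src_ctx[OF ctxT_ne n] by auto
 thus False using x ctx_fun[OF ctxT_wf[OF assms(1)]] by blast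
qed

lemma wf_cohT:
 assumes "adm T i t u"
 shows "wf_tm (ctxT T) (cohT T t u) (Arrow t (tyT T t) u)" "tmd T (Suc i) (cohT T t u)" "tyT T (cohT T t u) = Arrow t (tyT T t) u"
proof -
 have tm: "tmd T i t" "tmd T i u" "tyT T t = tyT T u" "is_table T" using admD[OF assms] by blast+
 note ps = ctxT_ps[OF tm(4)] ctxT_canonical[OF tm(4)] and id = wf_id_sub[OF ctxT_wf[OF tm(4)]]
 show w: "wf_tm (ctxT T) (cohT T t u) (Arrow t (tyT T t) u)"
 proof (cases "full T t \<and> full T u")
  case True
  hence "wf_tm (ctxT T) (Coh (ctxT T) (Arrow t (tyT T t) u) (id_sub (ctxT T))) (Arrow (subst_tm (id_sub (ctxT T)) t) (subst_ty (id_sub (ctxT T)) (tyT T t)) (subst_tm (id_sub (ctxT T)) u))"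
   using tm by (intro tm_coh ps id) (auto simp: tmd_def full_def)
  thus ?thesis using True by (simp add: cohT_def)
 next
  case False
  hence o: "0 < dim_table T" "wf_tm (src_ctx (ctxT T)) t (tyT T t)" "wf_tm (tgt_ctx (ctxT T)) u (tyT T t)"
   "vars_typed t (tyT T t) = vars_ctx (src_ctx (ctxT T))" "vars_typed u (tyT T t) = vars_ctx (tgt_ctx (ctxT T))"
   using assms by (auto simp: adm_def)
  have "dim_ctx (ctxT T) \<noteq> 0" using dim_ctx_cdim[OF ctxT_ne] cdim_ctxT[OF tm(4)] o(1) by simp
  from wf_ctx_wf_ty_wf_tm_wf_sub.tm_op[OF ps this o(2,3) id o(4,5)]
  show ?thesis unfolding cohT_def if_not_P[OF False] by simp
 qed
 show "tmd T (Suc i) (cohT T t u)" "tyT T (cohT T t u) = Arrow t (tyT T t) u"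
  using tmdI[OF tm(4) w] tyT_eq[OF w] tm(1) by (auto simp: tmd_def)
qed

lemma subst_cohT: "wfs T \<gamma> U \<Longrightarrow> subst_tm \<gamma> (cohT T t u) = (if full T t \<and> full T u then Coh else CohOp) (ctxT T) (Arrow t (tyT T t) u) \<gamma>"
 using wfs_id_comp[of T \<gamma> U] by (simp add: cohT_def comp_sub_def)

lemma coh_cases:
 assumes "wf_tm (ctxT U) t C" "is_table U" "t = Coh \<Gamma> A \<gamma> \<or> t = CohOp \<Gamma> A \<gamma>"
 obtains T i a u where "adm T i a u" "wfs T \<gamma> U" "\<Gamma> = ctxT T" "A = Arrow a (tyT T a) u"
  "t = subst_tm \<gamma> (cohT T a u)" "t = (if full T a \<and> full T u then Coh else CohOp) \<Gamma> A \<gamma>"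
proof -
 have "\<exists>T i a u. adm T i a u \<and> wfs T \<gamma> U \<and> \<Gamma> = ctxT T \<and> A = Arrow a (tyT T a) u \<and>
  t = (if full T a \<and> full T u then Coh else CohOp) \<Gamma> A \<gamma>"
  using assms(1)
 proof (cases rule: wf_tm.cases)
  case (tm_var x) thus ?thesis using assms(3) by auto
 next
  case (tm_op \<Gamma>' a B u \<gamma>')
  hence e: "\<Gamma>' = \<Gamma>" "A = Arrow a B u" "\<gamma>' = \<gamma>" "t = CohOp \<Gamma> A \<gamma>" using assms(3) by auto
  obtain T where T: "is_table T" "\<Gamma> = ctxT T" using ctxT_surj tm_op e by blast
  note op = tm_op[unfolded e(1,3) T(2)]
  have w: "wf_tm (ctxT T) a B" "wf_tm (ctxT T) u B" using wf_coh_body op by blast+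
  have ty: "tyT T a = B" "tyT T u = B" using tyT_eq w by auto
  have d: "0 < dim_table T" using op dim_ctx_cdim[OF ctxT_ne] cdim_ctxT[OF T(1)] by simp
  have "adm T (tdim B) a u" unfolding adm_def ty using tmdI[OF T(1) w(1)] tmdI[OF T(1) w(2)] d op by auto
  moreover have "\<not> full T a" using src_ctx_proper[OF T(1) d] op by (simp add: full_def ty)
  moreover have "wfs T \<gamma> U" using T assms(2) op by (simp add: wfs_def)
  ultimately show ?thesis using T e ty by auto
 next
  case (tm_coh \<Gamma>' a B u \<gamma>')
  hence e: "\<Gamma>' = \<Gamma>" "A = Arrow a B u" "\<gamma>' = \<gamma>" "t = Coh \<Gamma> A \<gamma>" using assms(3) by auto
  obtain T where T: "is_table T" "\<Gamma> = ctxT T" using ctxT_surj tm_coh e by blast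
  note co = tm_coh[unfolded e(1,3) T(2)]
  have ty: "tyT T a = B" "tyT T u = B" using tyT_eq co by auto
  have fl: "full T a" "full T u" using co by (auto simp: full_def ty)
  have "adm T (tdim B) a u" unfolding adm_def using tmdI[OF T(1)] co fl ty by auto
  moreover have "wfs T \<gamma> U" using T assms(2) co by (simp add: wfs_def)
  ultimately show ?thesis using T e ty fl by auto
 qed
 then obtain T i a u where h: "adm T i a u" "wfs T \<gamma> U" "\<Gamma> = ctxT T" "A = Arrow a (tyT T a) u"
  "t = (if full T a \<and> full T u then Coh else CohOp) \<Gamma> A \<gamma>" by blast
 moreover have "t = subst_tm \<gamma> (cohT T a u)" using subst_cohT[OF h(2)] h by simp
 ultimately show thesis using that by blast
qed

text \<open>The level of the body is decided by its ends alone, because the type of a term has no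
  greater level than the term.\<close>

lemma lev_cohT:
 assumes "adm T i t u"
 shows "lev_tm (Suc n) (cohT T t u) \<longleftrightarrow> lev_tm n t \<and> lev_tm n u" "\<not> lev_tm 0 (cohT T t u)"
proof -
 have "tmd T i t" using assms by (simp add: adm_def)
 hence "lev_tm n t \<Longrightarrow> lev_ty n (tyT T t)" using lev_tm_ty[of "ctxT T" t "tyT T t" n] lev_ctxT[of T] by (auto simp: tmd_def)
 thus "lev_tm (Suc n) (cohT T t u) \<longleftrightarrow> lev_tm n t \<and> lev_tm n u" "\<not> lev_tm 0 (cohT T t u)"
  using lev_id_sub[of "Suc n" "ctxT T"] by (auto simp: cohT_def lev_sub_def)
qed

section \<open>The universal property of the stages\<close>

lemma comp_functor_simps [simp]:
 "fst (comp_functor G F) X = fst G (fst F X)" "snd (comp_functor G F) f = snd G (snd F f)"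
 by (auto simp: comp_functor_def)

lemma id_functor_simps [simp]: "fst id_functor X = X" "snd id_functor f = f"
 by (auto simp: id_functor_def)

lemma Scat_inclusion:
 assumes C: "category (Scat P)" "category (Scat Q)" and PQ: "\<And>\<gamma>. P \<gamma> \<Longrightarrow> Q \<gamma>" and F: "is_functor C (Scat P) F"
 shows "is_functor C (Scat Q) F"
proof -
 have "is_functor (Scat P) (Scat Q) id_functor" unfolding is_functor_def
 proof (intro conjI ballI impI C)
  fix X assume "X \<in> Obj (Scat P)"
  thus "fst id_functor X \<in> Obj (Scat Q)" "snd id_functor (Id (Scat P) X) = Id (Scat Q) (fst id_functor X)"
   by (auto simp: Scat_Id)
 next
  fix f assume "f \<in> Arr (Scat P)"
  then obtain T \<gamma> U where f: "f = ar T \<gamma> U" "wfs T \<gamma> U" "P \<gamma>" unfolding Scat_Arr by blast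
  hence "f \<in> Arr (Scat Q)" unfolding Scat_Arr using PQ by blast
  thus "snd id_functor f \<in> hom (Scat Q) (fst id_functor (Dom (Scat P) f)) (fst id_functor (Cod (Scat P) f))"
   using f by (simp add: hom_def)
 qed simp
 from is_functor_comp[OF F this] show ?thesis by (simp add: comp_functor_def id_functor_def)
qed

definition new_pairs :: "nat \<Rightarrow> (nat \<times> scheme_arr \<times> scheme_arr) set" where
 "new_pairs n = admissible_pairs (S n) gl J - (\<Union>m<n. admissible_pairs (S m) gl J)"

lemma adm_stage_iff:
 assumes a: "adm T i t u"
 shows "(i, arr T i t, arr T i u) \<in> admissible_pairs (S n) gl J \<longleftrightarrow> lev_tm n t \<and> lev_tm n u"
proof
 assume "(i, arr T i t, arr T i u) \<in> admissible_pairs (S n) gl J"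
 then obtain T' t' u' where h: "adm T' i t' u'" "lev_tm n t'" "lev_tm n u'" "arr T i t = arr T' i t'" "arr T i u = arr T' i u'"
  unfolding admissible_iff by blast
 have "t = t'" "u = u'" using arr_inj admD[OF a] admD[OF h(1)] h(4,5) by blast+
 thus "lev_tm n t \<and> lev_tm n u" using h by simp
qed (use a in \<open>auto simp: admissible_iff\<close>)

text \<open>Levels are monotone, so among the earlier stages only the last one counts, and a pair
  occurs there exactly if its coherence is already present at level \<open>n\<close>.\<close>

lemma new_pairs_iff:
 assumes a: "adm T i t u"
 shows "(i, arr T i t, arr T i u) \<in> new_pairs n \<longleftrightarrow> lev_tm n t \<and> lev_tm n u \<and> \<not> lev_tm n (cohT T t u)"
proof (cases n)
 case 0 thus ?thesis using adm_stage_iff[OF a] lev_cohT(2)[OF a] by (simp add: new_pairs_def)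
next
 case (Suc p)
 have "(\<exists>m<Suc p. lev_tm m t \<and> lev_tm m u) \<longleftrightarrow> lev_tm p t \<and> lev_tm p u"
  using lev_mono(2) by (meson lessI less_Suc_eq_le)
 thus ?thesis using adm_stage_iff[OF a] lev_cohT(1)[OF a] Suc by (auto simp: new_pairs_def)
qed

lemma new_pairsE:
 assumes "(i, f, g) \<in> new_pairs n"
 obtains T t u where "adm T i t u" "lev_tm n t" "lev_tm n u" "f = arr T i t" "g = arr T i u"
proof -
 have "(i, f, g) \<in> admissible_pairs (S n) gl J" using assms by (simp add: new_pairs_def)
 thus thesis unfolding admissible_iff by (elim exE conjE) (rule that)
qed

definition coh_lift :: "nat \<times> scheme_arr \<times> scheme_arr \<Rightarrow> scheme_arr" where
 "coh_lift e = (case e of (i, f, g) \<Rightarrow>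
   THE h. \<exists>T t u. adm T i t u \<and> f = arr T i t \<and> g = arr T i u \<and> h = arr T (Suc i) (cohT T t u))"

lemma coh_lift:
 assumes a: "adm T i t u"
 shows "coh_lift (i, arr T i t, arr T i u) = arr T (Suc i) (cohT T t u)"
proof -
 have "h = arr T (Suc i) (cohT T t u)"
  if h: "adm T' i t' u'" "arr T i t = arr T' i t'" "arr T i u = arr T' i u'" "h = arr T' (Suc i) (cohT T' t' u')" for h T' t' u'
 proof -
  have "T = T'" "t = t'" "u = u'" using arr_inj admD[OF a] admD[OF h(1)] h(2,3) by blast+
  thus ?thesis using h by simp
 qed
 thus ?thesis unfolding coh_lift_def prod.case using a by (intro the_equality) blast+
qed

text \<open>Terms are freely generated from variables by instances of generic coherences. The bodies
  \<open>a\<close> and \<open>u\<close> are not part of the recursion; they belong to a lower level.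
  The hypothesis covers all cells of \<open>T\<close> and not only the top ones.\<close>

lemma coh_induct [consumes 1, case_names Var Coh]:
 assumes t: "tmd U k t"
  and v: "\<And>k m l. (m, l) \<in> sum_cells U k \<Longrightarrow> P k (Var (cvar U k m l))"
  and c: "\<And>T i a u \<gamma>. adm T i a u \<Longrightarrow> wfs T \<gamma> U \<Longrightarrow>
   (\<And>k m l. (m, l) \<in> sum_cells T k \<Longrightarrow> P k (sv \<gamma> (cvar T k m l))) \<Longrightarrow> P (Suc i) (subst_tm \<gamma> (cohT T a u))"
 shows "P k t"
 using t
proof (induction t arbitrary: k rule: tm_cases_induct)
 case (Var x)
 hence w: "is_table U" "(x, tyT U (Var x)) \<in> set (ctxT U)" "tdim (tyT U (Var x)) = k" by (auto simp: tmd_def wf_tm_Var)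
 then obtain k' m l where h: "(m, l) \<in> sum_cells U k'" "x = cvar U k' m l" using ctxT_mem[OF w(1)] by blast
 have "tmd U k' (Var x)" using tmd_Var(1)[OF w(1) h(1)] h(2) by simp
 hence "k' = k" using Var by (simp add: tmd_def)
 thus ?case using v[OF h(1)] h(2) by simp
next
 case (Coh c \<Gamma> A \<gamma>)
 have w: "wf_tm (ctxT U) (c \<Gamma> A \<gamma>) (tyT U (c \<Gamma> A \<gamma>))" "is_table U" "c \<Gamma> A \<gamma> = Coh \<Gamma> A \<gamma> \<or> c \<Gamma> A \<gamma> = CohOp \<Gamma> A \<gamma>"
  using Coh by (auto simp: tmd_def)
 obtain T i a u where h: "adm T i a u" "wfs T \<gamma> U" "c \<Gamma> A \<gamma> = subst_tm \<gamma> (cohT T a u)" by (rule coh_cases[OF w])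
 have "P j (sv \<gamma> (cvar T j m l))" if m: "(m, l) \<in> sum_cells T j" for j m l
 proof (rule Coh(2))
  have T: "is_table T" using h(2) by (simp add: wfs_def)
  show "tmd U j (sv \<gamma> (cvar T j m l))" using tmd_subst[OF h(2) tmd_Var(1)[OF T m]] by simp
  show "(cvar T j m l, sv \<gamma> (cvar T j m l)) \<in> set \<gamma>"
   using wf_sub_in[of "ctxT U" \<gamma> "ctxT T"] h(2) cvar_vars[OF T m] by (simp add: wfs_def)
 qed
 hence "P (Suc i) (c \<Gamma> A \<gamma>)" using c[OF h(1,2)] h(3) by simp
 moreover have "tmd U (Suc i) (c \<Gamma> A \<gamma>)" using tmd_subst[OF h(2) wf_cohT(2)[OF h(1)]] h(3) by simp
 hence "k = Suc i" using Coh(3) by (simp add: tmd_def)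
 ultimately show ?case by simp
qed

lemma lev_subst_cohT:
 assumes "adm T i a u" "wfs T \<gamma> U"
 shows "lev_tm n (subst_tm \<gamma> (cohT T a u)) \<longleftrightarrow> lev_tm n (cohT T a u) \<and> lev_sub n \<gamma>"
 unfolding subst_cohT[OF assms(2)] using lev_id_sub[of n "ctxT T"] by (auto simp: cohT_def lev_sub_def)

section \<open>Interpretation of terms in a test category\<close>

locale stage_model =
 fixes n :: nat and D :: "(scheme, scheme_arr) cat" and H :: "(scheme, scheme_arr) globes"
  and F :: "(scheme, scheme_arr, scheme, scheme_arr) func" and M :: "nat \<times> scheme_arr \<times> scheme_arr \<Rightarrow> scheme_arr"
 assumes De: "globular_extension D H" and Fg: "globular_functor (S n) gl D H F"
  and lift: "(i, f, g) \<in> new_pairs n \<Longrightarrow> is_lift D H i (snd F f) (snd F g) (M (i, f, g))"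
begin

lemma catD: "category D" and HD: "is_functor Globe D H" and FD: "is_functor (S n) D F"
 using De Fg by (auto simp: globular_extension_def globular_functor_def)

lemma F_sum: "is_table T \<Longrightarrow> is_globular_sum D H T (fst F (gsum T)) (\<lambda>m. snd F (inj_sum T m))"
 using Fg S_sum unfolding globular_functor_def by blast

lemma F_gl: "fst F (gsum (i, [])) = fst H i" "l \<in> globe_hom j i \<Longrightarrow> snd F (snd gl (j, l, i)) = snd H (j, l, i)"
 using Fg by (auto simp: globular_functor_def functor_eq_def comp_functor_def Globe_def simp del: gl_simps(2))

lemma H_hom: "l \<in> globe_hom j i \<Longrightarrow> snd H (j, l, i) \<in> hom D (fst H j) (fst H i)"
 by (rule functor_hom[OF HD]) (simp add: hom_def Globe_def)

lemma F_arr_hom: "tmd T k t \<Longrightarrow> lev_tm n t \<Longrightarrow> snd F (arr T k t) \<in> hom D (fst H k) (fst F (gsum T))"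
 using functor_hom[OF FD arr_hom] F_gl(1) by metis

lemma F_arr_face:
 assumes "tmd T k t" "lev_tm n t" "l \<in> globe_hom j k"
 shows "Comp D (snd F (arr T k t)) (snd H (j, l, k)) = snd F (arr T j (face t (tyT T t) j l))"
proof -
 have "snd gl (j, l, k) \<in> hom (S n) (gsum (j, [])) (gsum (k, []))"
  using functor_hom[OF gl_functor, of "(j, l, k)" j k n] assms(3) by (simp add: hom_def Globe_def del: gl_simps(2))
 from functor_comp[OF FD this arr_hom[OF assms(1,2)]]
 show ?thesis using comp_gl[OF assms(1,3)] F_gl(2)[OF assms(3)] by (simp del: gl_simps(2))
qed

text \<open>The interpretation of a generic coherence: the prescribed lift if its pair is new, and
  otherwise the value of \<open>F\<close>, where the coherence already exists.\<close>

definition gen :: "table \<Rightarrow> tm \<Rightarrow> tm \<Rightarrow> scheme_arr" where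
 "gen T a u = (let i = tdim (tyT T a); e = (i, arr T i a, arr T i u) in
   if e \<in> new_pairs n then M e else snd F (arr T (Suc i) (cohT T a u)))"

lemma gen:
 assumes a: "adm T i a u" "lev_tm n a" "lev_tm n u"
 shows "gen T a u \<in> hom D (fst H (Suc i)) (fst F (gsum T))"
  "Comp D (gen T a u) (snd H (i, Src, Suc i)) = snd F (arr T i a)"
  "Comp D (gen T a u) (snd H (i, Tgt, Suc i)) = snd F (arr T i u)"
  "lev_tm n (cohT T a u) \<Longrightarrow> gen T a u = snd F (arr T (Suc i) (cohT T a u))"
  "(i, arr T i a, arr T i u) \<in> new_pairs n \<Longrightarrow> gen T a u = M (i, arr T i a, arr T i u)"
proof -
 have tm: "tmd T i a" "tmd T i u" "tyT T a = tyT T u" "is_table T" using admD[OF a(1)] by blast+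
 have i: "tdim (tyT T a) = i" using tm by (simp add: tmd_def)
 note N = new_pairs_iff[OF a(1), of n]
 show F: "gen T a u = snd F (arr T (Suc i) (cohT T a u))" if "lev_tm n (cohT T a u)"
  using that N by (simp add: gen_def i)
 show M: "gen T a u = M (i, arr T i a, arr T i u)" if "(i, arr T i a, arr T i u) \<in> new_pairs n"
  using that by (simp add: gen_def i)
 note w = wf_cohT[OF a(1)]
 have "gen T a u \<in> hom D (fst H (Suc i)) (fst F (gsum T)) \<and> Comp D (gen T a u) (snd H (i, Src, Suc i)) = snd F (arr T i a) \<and>
  Comp D (gen T a u) (snd H (i, Tgt, Suc i)) = snd F (arr T i u)"
 proof (cases "lev_tm n (cohT T a u)")
  case True
  have "face (cohT T a u) (Arrow a (tyT T a) u) i Src = a" "face (cohT T a u) (Arrow a (tyT T a) u) i Tgt = u"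
   by (auto simp: face_def i)
  thus ?thesis using F[OF True] F_arr_hom[OF w(2) True] F_arr_face[OF w(2) True, of Src i] F_arr_face[OF w(2) True, of Tgt i]
   by (simp add: w(3) globe_hom_iff)
 next
  case False
  hence e: "(i, arr T i a, arr T i u) \<in> new_pairs n" using N a by simp
  have "Cod D (snd F (arr T i a)) = fst F (gsum T)" using F_arr_hom[OF tm(1) a(2)] by (simp add: hom_def)
  thus ?thesis using lift[OF e] M[OF e] by (simp add: is_lift_def globe_map_def)
 qed
 thus "gen T a u \<in> hom D (fst H (Suc i)) (fst F (gsum T))"
  "Comp D (gen T a u) (snd H (i, Src, Suc i)) = snd F (arr T i a)"
  "Comp D (gen T a u) (snd H (i, Tgt, Suc i)) = snd F (arr T i u)" by auto
qed

text \<open>The arrow out of a globular sum with given components. The components are passed as an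
  association list with the shape of a substitution, which keeps the recursion of \<open>sem\<close>
  structural.\<close>

definition cop :: "table \<Rightarrow> table \<Rightarrow> (nat \<times> scheme_arr) list \<Rightarrow> scheme_arr" where
 "cop T U \<rho> = (THE h. h \<in> hom D (fst F (gsum T)) (fst F (gsum U)) \<and>
   (\<forall>m\<le>last_index T. Comp D h (snd F (inj_sum T m)) = the (map_of \<rho> (top_var T m))))"

text \<open>Defined on raw terms, so the table is recovered from the context by a definite
  description. The body of a coherence is not interpreted recursively but enters through
  \<open>gen\<close>.\<close>

fun sem :: "table \<Rightarrow> tm \<Rightarrow> scheme_arr" where
 "sem U (Var x) = snd F (arr U (tdim (tyT U (Var x))) (Var x))"
| "sem U (CohOp \<Gamma> A \<gamma>) = (let T = (THE T. is_table T \<and> ctxT T = \<Gamma>) in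
   Comp D (cop T U (map (\<lambda>(x, t). (x, sem U t)) \<gamma>)) (case A of Arrow a B u \<Rightarrow> gen T a u))"
| "sem U (Coh \<Gamma> A \<gamma>) = (let T = (THE T. is_table T \<and> ctxT T = \<Gamma>) in
   Comp D (cop T U (map (\<lambda>(x, t). (x, sem U t)) \<gamma>)) (case A of Arrow a B u \<Rightarrow> gen T a u))"

definition sub_sem :: "table \<Rightarrow> sub \<Rightarrow> table \<Rightarrow> scheme_arr" where
 "sub_sem T \<gamma> U = cop T U (map (\<lambda>(x, t). (x, sem U t)) \<gamma>)"

lemma sem_cohT:
 assumes "adm T i a u" "wfs T \<gamma> U"
 shows "sem U (subst_tm \<gamma> (cohT T a u)) = Comp D (sub_sem T \<gamma> U) (gen T a u)"
proof -
 have "(THE T'. is_table T' \<and> ctxT T' = ctxT T) = T" using assms(2) ctxT_inj[of _ T] by (intro the_equality) (simp_all add: wfs_def)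
 thus ?thesis unfolding subst_cohT[OF assms(2)] by (simp add: sub_sem_def)
qed

lemma sub_sem_char:
 assumes g: "wfs T \<gamma> U" and h: "h \<in> hom D (fst F (gsum T)) (fst F (gsum U))"
  and e: "\<And>m. m \<le> last_index T \<Longrightarrow> Comp D h (snd F (inj_sum T m)) = sem U (sv \<gamma> (top_var T m))"
 shows "sub_sem T \<gamma> U = h"
proof -
 have T: "is_table T" using g by (simp add: wfs_def)
 have v: "the (map_of (map (\<lambda>(x, t). (x, sem U t)) \<gamma>) (top_var T m)) = sem U (sv \<gamma> (top_var T m))" if "m \<le> last_index T" for m
 proof -
  have "(top_var T m, sv \<gamma> (top_var T m)) \<in> set \<gamma>"
   using wf_sub_in[of "ctxT U" \<gamma> "ctxT T"] g cvar_vars[OF T top_cell[OF that]] by (simp add: wfs_def)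
  moreover have "distinct (map fst \<gamma>)" using wf_sub_distinct g by (auto simp: wfs_def)
  ultimately show ?thesis by (simp add: map_of_map)
 qed
 show ?thesis unfolding sub_sem_def cop_def
 proof (rule the_equality, intro conjI allI impI)
  show "Comp D h (snd F (inj_sum T m)) = the (map_of (map (\<lambda>(x, t). (x, sem U t)) \<gamma>) (top_var T m))" if "m \<le> last_index T" for m
   unfolding v[OF that] using e[OF that] .
  fix h' assume h': "h' \<in> hom D (fst F (gsum T)) (fst F (gsum U)) \<and>
   (\<forall>m\<le>last_index T. Comp D h' (snd F (inj_sum T m)) = the (map_of (map (\<lambda>(x, t). (x, sem U t)) \<gamma>) (top_var T m)))"
  show "h' = h"
  proof (rule globular_sum_ext[OF F_sum[OF T] catD HD T _ h])
   show "Comp D h' (snd F (inj_sum T m)) = Comp D h (snd F (inj_sum T m))" if "m \<le> last_index T" for m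
    using h' that v[OF that] e[OF that] by metis
  qed (use h' in blast)
 qed (rule h)
qed

text \<open>Compatibility with faces. Only compatible families induce an arrow out of a globular
  sum, so without this property the value of \<open>sub_sem\<close> is not under control.\<close>

definition good :: "table \<Rightarrow> nat \<Rightarrow> tm \<Rightarrow> bool" where
 "good U k t \<longleftrightarrow> sem U t \<in> hom D (fst H k) (fst F (gsum U)) \<and>
   (\<forall>j l. l \<in> globe_hom j k \<longrightarrow> Comp D (sem U t) (snd H (j, l, k)) = sem U (face t (tyT U t) j l))"

definition good_sub :: "table \<Rightarrow> sub \<Rightarrow> table \<Rightarrow> bool" where
 "good_sub T \<gamma> U \<longleftrightarrow> (\<forall>m\<le>last_index T. good U (summand T m) (sv \<gamma> (top_var T m)))"

lemma F_inj_sum_face: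
 assumes T: "is_table T" and c: "(m, l) \<in> sum_cells T k"
 shows "snd F (arr T k (Var (cvar T k m l))) = Comp D (snd F (inj_sum T m)) (snd H (k, l, summand T m))"
proof -
 have m: "m \<le> last_index T" "l \<in> globe_hom k (summand T m)" using c by (auto simp: mem_sum_cells)
 note v = tmd_Var[OF T top_cell[OF m(1)]]
 have "sComp (arr T (summand T m) (Var (top_var T m))) (snd gl (k, l, summand T m)) = arr T k (Var (cvar T k m l))"
  using inj_sum_face[OF T c] unfolding inj_sum_def .
 thus ?thesis using F_arr_face[OF v(1) _ m(2)] comp_gl[OF v(1) m(2)]
  by (simp add: inj_sum_def del: cvar.simps gl_simps)
qed

lemma sub_sem_exists:
 assumes g: "wfs T \<gamma> U" and gd: "good_sub T \<gamma> U"
 shows "sub_sem T \<gamma> U \<in> hom D (fst F (gsum T)) (fst F (gsum U))"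
  "m \<le> last_index T \<Longrightarrow> Comp D (sub_sem T \<gamma> U) (snd F (inj_sum T m)) = sem U (sv \<gamma> (top_var T m))"
  "(j, l) \<in> sum_cells T k \<Longrightarrow> Comp D (sub_sem T \<gamma> U) (snd F (arr T k (Var (cvar T k j l)))) = sem U (sv \<gamma> (cvar T k j l))"
proof -
 have T: "is_table T" "is_table U" "wf_sub (ctxT U) \<gamma> (ctxT T)" using g by (auto simp: wfs_def)
 have fc: "Comp D (sem U (sv \<gamma> (top_var T m))) (snd H (k, l, summand T m)) = sem U (sv \<gamma> (cvar T k m l))"
  if c: "(m, l) \<in> sum_cells T k" for m k l
 proof -
  have m: "m \<le> last_index T" "l \<in> globe_hom k (summand T m)" using c by (auto simp: mem_sum_cells)
  have "tyT U (sv \<gamma> (top_var T m)) = subst_ty \<gamma> (vty T (summand T m) m)"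
   using tyT_eq sub_top_wf[OF T(1,3) m(1)] by simp
  thus ?thesis using gd m sub_face[OF T(1,3) c] by (simp add: good_sub_def good_def del: cvar.simps)
 qed
 have "is_sum_cocone D H T (fst F (gsum U)) (\<lambda>m. sem U (sv \<gamma> (top_var T m)))"
  unfolding is_sum_cocone_def
 proof (intro conjI allI impI)
  show "fst F (gsum U) \<in> Obj D" using functor_obj[OF FD] T(2) by simp
  show "sem U (sv \<gamma> (top_var T m)) \<in> hom D (fst H (summand T m)) (fst F (gsum U))" if "m \<le> last_index T" for m
   using gd that by (simp add: good_sub_def good_def)
  fix m assume m: "m < last_index T"
  note tb = is_tableD[OF T(1) m]
  have c: "(m, Tgt) \<in> sum_cells T (glue T m)" "(Suc m, Src) \<in> sum_cells T (glue T m)"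
   using m tb by (auto simp: mem_sum_cells globe_hom_iff)
  have "cvar T (glue T m) m Tgt = cvar T (glue T m) (Suc m) Src" by simp
  thus "Comp D (sem U (sv \<gamma> (top_var T m))) (snd H (globe_map Tgt (glue T m) (summand T m))) =
    Comp D (sem U (sv \<gamma> (top_var T (Suc m)))) (snd H (globe_map Src (glue T m) (summand T (Suc m))))"
   using fc[OF c(1)] fc[OF c(2)] tb by (simp add: globe_map_less del: cvar.simps)
 qed
 then obtain h where h: "h \<in> hom D (fst F (gsum T)) (fst F (gsum U))" "\<forall>m\<le>last_index T. Comp D h (snd F (inj_sum T m)) = sem U (sv \<gamma> (top_var T m))"
  using F_sum[OF T(1)] unfolding is_globular_sum_def by blast
 have e: "sub_sem T \<gamma> U = h" using sub_sem_char[OF g h(1)] h(2) by simp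
 show "sub_sem T \<gamma> U \<in> hom D (fst F (gsum T)) (fst F (gsum U))"
  "m \<le> last_index T \<Longrightarrow> Comp D (sub_sem T \<gamma> U) (snd F (inj_sum T m)) = sem U (sv \<gamma> (top_var T m))" using h e by auto
 show "Comp D (sub_sem T \<gamma> U) (snd F (arr T k (Var (cvar T k j l)))) = sem U (sv \<gamma> (cvar T k j l))" if c: "(j, l) \<in> sum_cells T k"
 proof -
  have j: "j \<le> last_index T" "l \<in> globe_hom k (summand T j)" using c by (auto simp: mem_sum_cells)
  have "snd F (inj_sum T j) \<in> hom D (fst H (summand T j)) (fst F (gsum T))" using globular_sum_hom(2)[OF F_sum[OF T(1)]] j by simp
  from cat_assoc[OF catD H_hom[OF j(2)] this h(1)] show ?thesis
   unfolding e F_inj_sum_face[OF T(1) c] using h(2) j fc[OF c] by (simp del: cvar.simps)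
 qed
qed

lemma F_sub:
 assumes g: "wfs T \<gamma> U" "lev_sub n \<gamma>" "m \<le> last_index T"
 shows "snd F (ar T \<gamma> U) \<in> hom D (fst F (gsum T)) (fst F (gsum U))"
  "Comp D (snd F (ar T \<gamma> U)) (snd F (inj_sum T m)) = snd F (arr U (summand T m) (sv \<gamma> (top_var T m)))"
proof -
 have T: "is_table T" "is_table U" using g by (auto simp: wfs_def)
 have a: "ar T \<gamma> U \<in> hom (S n) (gsum T) (gsum U)" using Scat_hom[OF T] g by blast
 show "snd F (ar T \<gamma> U) \<in> hom D (fst F (gsum T)) (fst F (gsum U))" using functor_hom[OF FD a] .
 show "Comp D (snd F (ar T \<gamma> U)) (snd F (inj_sum T m)) = snd F (arr U (summand T m) (sv \<gamma> (top_var T m)))"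
  using functor_comp[OF FD inj_sum_hom[OF T(1) g(3)] a] comp_inj_sum[OF g(1,3)] by simp
qed

lemma sem_Var: "is_table U \<Longrightarrow> (m, l) \<in> sum_cells U k \<Longrightarrow> sem U (Var (cvar U k m l)) = snd F (arr U k (Var (cvar U k m l)))"
 using tmd_Var(1)[of U m l k] by (simp add: tmd_def del: cvar.simps)

text \<open>A coherence of level \<open>n\<close> is an instance of a generic coherence of level
  \<open>n\<close>, on which \<open>gen\<close> is the value of \<open>F\<close>; the rest is
  functoriality of \<open>F\<close>.\<close>

lemma sem_F:
 assumes "tmd U k t" "lev_tm n t"
 shows "sem U t = snd F (arr U k t)"
 using assms
proof (induction rule: coh_induct)
 case (Var k m l)
 thus ?case using sem_Var assms(1) by (simp add: tmd_def del: cvar.simps)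
next
 case (Coh T i a u \<gamma>)
 note lv = Coh(4)[unfolded lev_subst_cohT[OF Coh(1,2)]]
 then obtain p where p: "n = Suc p" using lev_cohT(2)[OF Coh(1)] by (metis not0_implies_Suc)
 have au: "lev_tm n a" "lev_tm n u" using lv lev_cohT(1)[OF Coh(1), of p] p lev_mono(2)[of p] by auto
 have T: "is_table T" "is_table U" using Coh(2) by (auto simp: wfs_def)
 have "sub_sem T \<gamma> U = snd F (ar T \<gamma> U)"
 proof (rule sub_sem_char[OF Coh(2)])
  show "snd F (ar T \<gamma> U) \<in> hom D (fst F (gsum T)) (fst F (gsum U))" using F_sub(1)[OF Coh(2)] lv by blast
  show "Comp D (snd F (ar T \<gamma> U)) (snd F (inj_sum T m)) = sem U (sv \<gamma> (top_var T m))" if "m \<le> last_index T" for m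
   using F_sub(2)[OF Coh(2) _ that] lv Coh(3)[OF top_cell[OF that]] lev_sv by simp
 qed
 moreover have a: "ar T \<gamma> U \<in> hom (S n) (gsum T) (gsum U)" using Scat_hom[OF T] Coh(2) lv by blast
 ultimately show ?case
  using sem_cohT[OF Coh(1,2)] gen(4)[OF Coh(1) au] lv functor_comp[OF FD arr_hom[OF wf_cohT(2)[OF Coh(1)]] a]
   comp_arr[OF Coh(2) wf_cohT(2)[OF Coh(1)]] by simp
qed

lemma good_F:
 assumes "tmd U k t" "lev_tm n t"
 shows "good U k t"
 unfolding good_def
proof (intro conjI allI impI)
 show "sem U t \<in> hom D (fst H k) (fst F (gsum U))" using F_arr_hom sem_F assms by simp
 fix j l assume l: "l \<in> globe_hom j k"
 have "tmd U j (face t (tyT U t) j l)" "lev_tm n (face t (tyT U t) j l)"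
  using tmd_face[OF assms(1) l] lev_face[of U t] assms by (auto simp: tmd_def)
 thus "Comp D (sem U t) (snd H (j, l, k)) = sem U (face t (tyT U t) j l)"
  using F_arr_face[OF assms l] sem_F assms by simp
qed

text \<open>The level \<open>q\<close> is a parameter because the lemma is used twice: with
  \<open>n\<close>, where compatibility with faces is already known, in the proof of compatibility
  for \<open>Suc n\<close>; and then with \<open>Suc n\<close> for the functoriality of the
  extension.\<close>

lemma subst_sem:
 assumes Q: "\<And>k t. tmd T k t \<Longrightarrow> lev_tm q t \<Longrightarrow> good T k t" and q: "q \<le> Suc n"
  and g: "wfs T \<gamma> U" and gd: "good_sub T \<gamma> U"
  and b: "tmd T k b" "lev_tm q b"
 shows "sem U (subst_tm \<gamma> b) = Comp D (sub_sem T \<gamma> U) (sem T b)"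
 using b
proof (induction rule: coh_induct)
 case (Var k m l)
 thus ?case using sub_sem_exists(3)[OF g gd Var(1)] sem_Var[OF _ Var(1)] g by (simp add: wfs_def del: cvar.simps)
next
 case (Coh V i a u \<delta>)
 note lv = Coh(4)[unfolded lev_subst_cohT[OF Coh(1,2)]]
 have V: "is_table V" using Coh(2) by (simp add: wfs_def)
 have "lev_tm (Suc n) (cohT V a u)" using lv lev_mono(2) q by blast
 hence au: "lev_tm n a" "lev_tm n u" using lev_cohT(1)[OF Coh(1)] by auto
 have gdd: "good_sub V \<delta> T" unfolding good_sub_def
  using Q tmd_subst[OF Coh(2) tmd_Var(1)[OF V top_cell]] lv lev_sv by simp
 note d = sub_sem_exists[OF Coh(2) gdd] and s = sub_sem_exists[OF g gd]
 have w: "wfs V (comp_sub \<delta> \<gamma>) U" using wfs_comp[OF Coh(2) g] .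
 have "sub_sem V (comp_sub \<delta> \<gamma>) U = Comp D (sub_sem T \<gamma> U) (sub_sem V \<delta> T)"
 proof (rule sub_sem_char[OF w])
  show "Comp D (sub_sem T \<gamma> U) (sub_sem V \<delta> T) \<in> hom D (fst F (gsum V)) (fst F (gsum U))" using cat_comp[OF catD d(1) s(1)] .
  fix m assume m: "m \<le> last_index V"
  have i: "snd F (inj_sum V m) \<in> hom D (fst H (summand V m)) (fst F (gsum V))" using globular_sum_hom(2)[OF F_sum[OF V]] m by simp
  have "top_var V m \<in> fst ` set \<delta>" using wf_sub_dom_set Coh(2) cvar_vars[OF V top_cell[OF m]] by (auto simp: wfs_def)
  hence "sv (comp_sub \<delta> \<gamma>) (top_var V m) = subst_tm \<gamma> (sv \<delta> (top_var V m))" by (rule sv_comp_sub)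
  thus "Comp D (Comp D (sub_sem T \<gamma> U) (sub_sem V \<delta> T)) (snd F (inj_sum V m)) = sem U (sv (comp_sub \<delta> \<gamma>) (top_var V m))"
   using cat_assoc[OF catD i d(1) s(1)] d(2)[OF m] Coh(3)[OF top_cell[OF m]] lv lev_sv by simp
 qed
 moreover have "subst_tm \<gamma> (subst_tm \<delta> (cohT V a u)) = subst_tm (comp_sub \<delta> \<gamma>) (cohT V a u)"
  unfolding subst_cohT[OF w] subst_cohT[OF Coh(2)] by (simp add: comp_sub_def)
 ultimately show ?case
  using sem_cohT[OF Coh(1) w] sem_cohT[OF Coh(1,2)] cat_assoc[OF catD gen(1)[OF Coh(1) au] d(1) s(1)] by simp
qed

text \<open>The ends of the generic coherence have level \<open>n\<close>, where the interpretation
  is \<open>F\<close>, so \<open>subst_sem\<close> at level \<open>n\<close> computes their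
  instances. The faces of a coherence then come from the faces of \<open>gen\<close>.\<close>

lemma good_Suc:
 assumes "tmd U k t" "lev_tm (Suc n) t"
 shows "good U k t"
 using assms
proof (induction rule: coh_induct)
 case (Var k m l)
 have "is_table U" using assms(1) by (simp add: tmd_def)
 thus ?case using good_F[OF tmd_Var(1)[OF _ Var(1)]] by simp
next
 case (Coh T i a u \<gamma>)
 note lv = Coh(4)[unfolded lev_subst_cohT[OF Coh(1,2)]]
 hence au: "lev_tm n a" "lev_tm n u" using lev_cohT(1)[OF Coh(1)] by auto
 have tm: "tmd T i a" "tmd T i u" "tyT T a = tyT T u" "is_table T" using admD[OF Coh(1)] by blast+
 have gd: "good_sub T \<gamma> U" unfolding good_sub_def using Coh(3)[OF top_cell] lv lev_sv by blast
 note s = sub_sem_exists[OF Coh(2) gd] and gn = gen[OF Coh(1) au]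
 have sb: "Comp D (sub_sem T \<gamma> U) (snd F (arr T j b)) = sem U (subst_tm \<gamma> b)" if "tmd T j b" "lev_tm n b" for j b
  using subst_sem[where q = n, OF good_F _ Coh(2) gd that] sem_F[OF that] by simp
 let ?c = "subst_tm \<gamma> (cohT T a u)"
 have sc: "sem U ?c = Comp D (sub_sem T \<gamma> U) (gen T a u)" using sem_cohT[OF Coh(1,2)] .
 have ty: "tyT U ?c = subst_ty \<gamma> (Arrow a (tyT T a) u)" using tmd_subst[OF Coh(2) wf_cohT(2)[OF Coh(1)]] wf_cohT(3)[OF Coh(1)] by simp
 have di: "tdim (tyT T a) = i" using tm(1) by (simp add: tmd_def)
 have hm: "sem U ?c \<in> hom D (fst H (Suc i)) (fst F (gsum U))" unfolding sc using cat_comp[OF catD gn(1) s(1)] .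
 show ?case unfolding good_def
 proof (intro conjI allI impI)
  show "sem U ?c \<in> hom D (fst H (Suc i)) (fst F (gsum U))" by (rule hm)
  fix j l assume l: "l \<in> globe_hom j (Suc i)"
  show "Comp D (sem U ?c) (snd H (j, l, Suc i)) = sem U (face ?c (tyT U ?c) j l)"
  proof (cases "l = Idn")
   case True
   hence "j = Suc i" using l by (auto simp: globe_hom_iff)
   moreover have "snd H (Suc i, Idn, Suc i) = Id D (fst H (Suc i))" using functor_id[OF HD, of "Suc i"] by (simp add: Globe_def)
   ultimately show ?thesis using True cat_id_comp[OF catD hm] by (simp add: face_def)
  next
   case False
   hence j: "j < Suc i" "l = Src \<or> l = Tgt" using l by (cases l; auto simp: globe_hom_iff)+
   \<comment> \<open>A proper face of a coherence is a face of one of its ends. In dimension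
     \<open>i\<close> the end is prescribed by \<open>l\<close>; below this dimension both ends have
     the same faces, and the source is taken.\<close>
   define e b where "e = (if j = i then l else Src)" and "b = (if e = Src then a else u)"
   define r where "r = (if j = i then Idn else l)"
   have eb: "e \<in> globe_hom i (Suc i)" "r \<in> globe_hom j i" "tmd T i b" "lev_tm n b" "tyT T b = tyT T a"
    "Comp D (gen T a u) (snd H (i, e, Suc i)) = snd F (arr T i b)"
    using j tm au gn(2,3) by (auto simp: e_def b_def r_def globe_hom_iff)
   have "snd H (j, l, Suc i) = Comp D (snd H (i, e, Suc i)) (snd H (j, r, i))"
   proof -
    have "(j, r, i) \<in> hom Globe j i" "(i, e, Suc i) \<in> hom Globe i (Suc i)" using eb by (auto simp: hom_def Globe_def)
    moreover have "Comp Globe (i, e, Suc i) (j, r, i) = (j, l, Suc i)" using j by (auto simp: Globe_def e_def r_def)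
    ultimately show ?thesis using functor_comp[OF HD] by metis
   qed
   hence "Comp D (sem U ?c) (snd H (j, l, Suc i)) = Comp D (Comp D (sem U ?c) (snd H (i, e, Suc i))) (snd H (j, r, i))"
    using cat_assoc[OF catD H_hom[OF eb(2)] H_hom[OF eb(1)] hm] by simp
   also have "Comp D (sem U ?c) (snd H (i, e, Suc i)) = Comp D (sub_sem T \<gamma> U) (snd F (arr T i b))"
    unfolding sc using cat_assoc[OF catD H_hom[OF eb(1)] gn(1) s(1)] eb(6) by simp
   also have "Comp D \<dots> (snd H (j, r, i)) = Comp D (sub_sem T \<gamma> U) (Comp D (snd F (arr T i b)) (snd H (j, r, i)))"
    using cat_assoc[OF catD H_hom[OF eb(2)] F_arr_hom[OF eb(3,4)] s(1)] by simp
   also have "\<dots> = Comp D (sub_sem T \<gamma> U) (snd F (arr T j (face b (tyT T a) j r)))" using F_arr_face[OF eb(3,4,2)] eb(5) by simp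
   also have "\<dots> = sem U (subst_tm \<gamma> (face b (tyT T a) j r))"
   proof (rule sb)
    show "tmd T j (face b (tyT T a) j r)" using tmd_face[OF eb(3,2)] eb(5) by simp
    show "lev_tm n (face b (tyT T a) j r)" using lev_face[of T b] eb(3,4,5) by (simp add: tmd_def)
   qed
   also have "subst_tm \<gamma> (face b (tyT T a) j r) = face ?c (tyT U ?c) j l"
    unfolding ty using j bdf_subst[of j "tyT T a" \<gamma> l] di by (auto simp: face_def r_def b_def e_def)
   finally show ?thesis .
  qed
 qed
qed

definition ext :: "(scheme, scheme_arr, scheme, scheme_arr) func" where
 "ext = (fst F, (\<lambda>f. case f of (X, e, Y) \<Rightarrow> sub_sem (tab X) (dec e) (tab Y)))"

lemma ext_ar: "wfs T \<gamma> U \<Longrightarrow> snd ext (ar T \<gamma> U) = sub_sem T \<gamma> U"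
 by (simp add: ext_def ar_def wfs_def)

lemma good_subI:
 assumes "wfs T \<gamma> U" "lev_sub (Suc n) \<gamma>"
 shows "good_sub T \<gamma> U"
 unfolding good_sub_def
proof (intro allI impI good_Suc)
 have T: "is_table T" using assms by (simp add: wfs_def)
 show "tmd U (summand T m) (sv \<gamma> (top_var T m))" if "m \<le> last_index T" for m
  using tmd_subst[OF assms(1) tmd_Var(1)[OF T top_cell[OF that]]] by simp
qed (use assms lev_sv in blast)

lemma ext_F:
 assumes "wfs T \<gamma> U" "lev_sub n \<gamma>"
 shows "sub_sem T \<gamma> U = snd F (ar T \<gamma> U)"
proof (rule sub_sem_char[OF assms(1)])
 show "snd F (ar T \<gamma> U) \<in> hom D (fst F (gsum T)) (fst F (gsum U))" using F_sub(1)[OF assms] by blast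
 fix m assume m: "m \<le> last_index T"
 have T: "is_table T" using assms by (simp add: wfs_def)
 have "tmd U (summand T m) (sv \<gamma> (top_var T m))" using tmd_subst[OF assms(1) tmd_Var(1)[OF T top_cell[OF m]]] by simp
 thus "Comp D (snd F (ar T \<gamma> U)) (snd F (inj_sum T m)) = sem U (sv \<gamma> (top_var T m))"
  using F_sub(2)[OF assms m] sem_F lev_sv[OF assms(2)] by simp
qed

lemma ext_functor: "is_functor (S (Suc n)) D ext"
 unfolding is_functor_def
proof (intro conjI ballI impI)
 show "category (S (Suc n))" "category D" by (rule category_S catD)+
next
 fix X assume "X \<in> Obj (S (Suc n))"
 then obtain T where T: "is_table T" "X = gsum T" by auto
 show "fst ext X \<in> Obj D" using functor_obj[OF FD, of X] T by (simp add: ext_def)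
 show "snd ext (Id (S (Suc n)) X) = Id D (fst ext X)"
  using ext_ar[OF wfs_id[OF T(1)]] ext_F[OF wfs_id[OF T(1)] lev_id_sub] functor_id[OF FD, of X] T by (simp add: Scat_Id ext_def)
next
 fix f assume "f \<in> Arr (S (Suc n))"
 then obtain T \<gamma> U where f: "f = ar T \<gamma> U" "wfs T \<gamma> U" "lev_sub (Suc n) \<gamma>" unfolding Scat_Arr by blast
 note s = sub_sem_exists[OF f(2) good_subI[OF f(2,3)]]
 show "snd ext f \<in> hom D (fst ext (Dom (S (Suc n)) f)) (fst ext (Cod (S (Suc n)) f))"
  using s(1) ext_ar[OF f(2)] f(1) by (simp add: ext_def)
 fix g assume g: "g \<in> Arr (S (Suc n))" "Dom (S (Suc n)) g = Cod (S (Suc n)) f"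
 then obtain U' \<delta> V where g': "g = ar U' \<delta> V" "wfs U' \<delta> V" "lev_sub (Suc n) \<delta>" unfolding Scat_Arr by blast
 have T: "is_table T" "is_table U" "is_table U'" using f g' by (auto simp: wfs_def)
 have "U' = U" using g(2) f g' gsum_inj T by simp
 note g' = g'[unfolded this]
 note r = sub_sem_exists[OF g'(2) good_subI[OF g'(2,3)]]
 have w: "wfs T (comp_sub \<gamma> \<delta>) V" using wfs_comp f g' by blast
 have "sub_sem T (comp_sub \<gamma> \<delta>) V = Comp D (sub_sem U \<delta> V) (sub_sem T \<gamma> U)"
 proof (rule sub_sem_char[OF w])
  show "Comp D (sub_sem U \<delta> V) (sub_sem T \<gamma> U) \<in> hom D (fst F (gsum T)) (fst F (gsum V))" using cat_comp[OF catD s(1) r(1)] .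
  fix m assume m: "m \<le> last_index T"
  have i: "snd F (inj_sum T m) \<in> hom D (fst H (summand T m)) (fst F (gsum T))" using globular_sum_hom(2)[OF F_sum[OF T(1)]] m by simp
  have "top_var T m \<in> fst ` set \<gamma>" using wf_sub_dom_set f(2) cvar_vars[OF T(1) top_cell[OF m]] by (auto simp: wfs_def)
  hence e: "sv (comp_sub \<gamma> \<delta>) (top_var T m) = subst_tm \<delta> (sv \<gamma> (top_var T m))" by (rule sv_comp_sub)
  have tm: "tmd U (summand T m) (sv \<gamma> (top_var T m))" using tmd_subst[OF f(2) tmd_Var(1)[OF T(1) top_cell[OF m]]] by simp
  have "sem V (subst_tm \<delta> (sv \<gamma> (top_var T m))) = Comp D (sub_sem U \<delta> V) (sem U (sv \<gamma> (top_var T m)))"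
   using subst_sem[where q = "Suc n", OF good_Suc _ g'(2) good_subI[OF g'(2,3)] tm lev_sv[OF f(3)]] by simp
  thus "Comp D (Comp D (sub_sem U \<delta> V) (sub_sem T \<gamma> U)) (snd F (inj_sum T m)) = sem V (sv (comp_sub \<gamma> \<delta>) (top_var T m))"
   unfolding e using cat_assoc[OF catD i s(1) r(1)] s(2)[OF m] by simp
 qed
 thus "snd ext (Comp (S (Suc n)) g f) = Comp D (snd ext g) (snd ext f)"
  using ext_ar[OF w] ext_ar[OF f(2)] ext_ar[OF g'(2)] f g' by simp
qed

lemma ext_restrict: "functor_eq (S n) (comp_functor ext id_functor) F"
proof -
 have "snd ext f = snd F f" if "f \<in> Arr (S n)" for f
 proof -
  from that obtain T \<gamma> U where f: "f = ar T \<gamma> U" "wfs T \<gamma> U" "lev_sub n \<gamma>" unfolding Scat_Arr by blast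
  thus ?thesis using ext_ar[OF f(2)] ext_F[OF f(2,3)] by simp
 qed
 thus ?thesis by (auto simp: functor_eq_def comp_functor_def id_functor_def ext_def simp del: prod.case)
qed

lemma restrict_gl:
 assumes "functor_eq (S n) (comp_functor K id_functor) F"
 shows "functor_eq Globe (comp_functor K gl) H"
proof -
 have "fst K (gsum (i, [])) = fst H i" for i using assms F_gl(1)[of i] by (simp add: functor_eq_def comp_functor_def id_functor_def)
 moreover have "snd K (snd gl (j, l, i)) = snd H (j, l, i)" if l: "l \<in> globe_hom j i" for j l i
 proof -
  have "snd gl (j, l, i) \<in> Arr (S n)"
   using functor_hom[OF gl_functor, of "(j, l, i)" j i n] l by (simp add: hom_def Globe_def del: gl_simps(2))
  thus ?thesis using assms F_gl(2)[OF l] by (simp add: functor_eq_def comp_functor_def id_functor_def del: gl_simps(2))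
 qed
 ultimately show ?thesis by (auto simp: functor_eq_def comp_functor_def Globe_def simp del: gl_simps(2))
qed

lemma inj_sum_Arr: "is_table T \<Longrightarrow> m \<le> last_index T \<Longrightarrow> inj_sum T m \<in> Arr (S n)"
 using inj_sum_hom by (auto simp: hom_def)

lemma ext_globular: "globular_functor (S (Suc n)) gl D H ext"
 unfolding globular_functor_def
proof (intro conjI allI impI ext_functor)
 show gH: "functor_eq Globe (comp_functor ext gl) H" using restrict_gl[OF ext_restrict] .
 fix T X \<iota> assume T: "is_table T" and s: "is_globular_sum (S (Suc n)) gl T X \<iota>"
 have "snd ext (inj_sum T m) = snd F (inj_sum T m)" if "m \<le> last_index T" for m
  using ext_restrict inj_sum_Arr[OF T that] by (simp add: functor_eq_def comp_functor_def id_functor_def)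
 hence "is_globular_sum D H T (fst ext (gsum T)) (\<lambda>m. snd ext (inj_sum T m))"
  using F_sum[OF T] by (simp add: is_globular_sum_def is_sum_cocone_def ext_def cong: conj_cong)
 from globular_sum_preserved[OF ext_functor gl_functor gH HD T S_sum[OF T] this s]
 show "is_globular_sum D H T (fst ext X) (\<lambda>m. snd ext (\<iota> m))" .
qed

lemma ext_lift:
 assumes "(i, f, g) \<in> new_pairs n"
 shows "snd ext (coh_lift (i, f, g)) = M (i, f, g)"
proof -
 from assms obtain T t u where h: "adm T i t u" "lev_tm n t" "lev_tm n u" "f = arr T i t" "g = arr T i u" by (rule new_pairsE)
 let ?c = "cohT T t u"
 have T: "is_table T" using admD h(1) by blast
 note w = wf_cohT(2)[OF h(1)]
 have lc: "lev_tm (Suc n) ?c" using lev_cohT(1)[OF h(1)] h by simp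
 have gc: "good T (Suc i) ?c" using good_Suc[OF w lc] .
 have "sub_sem (Suc i, []) (tsub T (Suc i) ?c) T = sem T ?c"
 proof (rule sub_sem_char[OF wfs_tsub[OF w]])
  show hm: "sem T ?c \<in> hom D (fst F (gsum (Suc i, []))) (fst F (gsum T))" using gc F_gl(1) by (simp add: good_def)
  fix m assume "m \<le> last_index (Suc i, [])"
  hence m: "m = 0" by (simp add: last_index_def)
  have "inj_sum (Suc i, []) 0 = snd gl (Suc i, Idn, Suc i)" by (simp add: inj_sum_def summand_def)
  hence "snd F (inj_sum (Suc i, []) 0) = snd H (Suc i, Idn, Suc i)" using F_gl(2)[of Idn "Suc i" "Suc i"] by (simp add: globe_hom_iff del: gl_simps)
  also have "\<dots> = Id D (fst H (Suc i))" using functor_id[OF HD, of "Suc i"] by (simp add: Globe_def)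
  finally show "Comp D (sem T ?c) (snd F (inj_sum (Suc i, []) m)) = sem T (sv (tsub T (Suc i) ?c) (top_var (Suc i, []) m))"
   using m sv_tsub_top[OF w] cat_id_comp[OF catD hm] F_gl(1) by (simp del: cvar.simps)
 qed
 also have "sem T ?c = M (i, f, g)"
 proof -
  have "subst_tm (id_sub (ctxT T)) ?c = ?c" using subst_cohT[OF wfs_id[OF T], of t u] by (simp add: cohT_def)
  hence "sem T ?c = Comp D (sub_sem T (id_sub (ctxT T)) T) (gen T t u)" using sem_cohT[OF h(1) wfs_id[OF T]] by simp
  also have "sub_sem T (id_sub (ctxT T)) T = Id D (fst F (gsum T))"
   using ext_F[OF wfs_id[OF T] lev_id_sub] functor_id[OF FD, of "gsum T"] T by (simp add: Scat_Id)
  also have "Comp D \<dots> (gen T t u) = gen T t u" using cat_id_comp[OF catD gen(1)[OF h(1-3)]] by simp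
  also have "\<dots> = M (i, f, g)" using gen(5)[OF h(1-3)] assms h(4,5) by simp
  finally show ?thesis .
 qed
 finally show ?thesis using coh_lift[OF h(1)] h(4,5) ext_ar[OF wfs_tsub[OF w]] by (simp add: arr_def)
qed

text \<open>A functor is determined by its values on arrows out of globes, because arrows out of a
  sum are determined by their components. These arrows are terms, generated by variables, where
  \<open>F\<close> decides, and by generic coherences, where \<open>F\<close> or \<open>M\<close>
  does.\<close>

lemma ext_unique:
 assumes K: "globular_functor (S (Suc n)) gl D H K" and KF: "functor_eq (S n) (comp_functor K id_functor) F"
  and KM: "\<And>e. e \<in> new_pairs n \<Longrightarrow> snd K (coh_lift e) = M e"
 shows "functor_eq (S (Suc n)) K ext"
proof -
 have Kf: "is_functor (S (Suc n)) D K" using K by (simp add: globular_functor_def)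
 have Ko: "fst K (gsum T) = fst F (gsum T)" if "is_table T" for T
  using KF that by (simp add: functor_eq_def comp_functor_def id_functor_def)
 have Ka: "snd K f = snd F f" if "f \<in> Arr (S n)" for f
  using KF that by (simp add: functor_eq_def comp_functor_def id_functor_def)
 have Ks: "snd K (ar T \<gamma> U) = sub_sem T \<gamma> U" if g: "wfs T \<gamma> U" "lev_sub (Suc n) \<gamma>"
  and e: "\<And>m. m \<le> last_index T \<Longrightarrow> snd K (arr U (summand T m) (sv \<gamma> (top_var T m))) = sem U (sv \<gamma> (top_var T m))" for T \<gamma> U
 proof (rule sub_sem_char[symmetric, OF g(1)])
  have T: "is_table T" "is_table U" using g by (auto simp: wfs_def)
  have a: "ar T \<gamma> U \<in> hom (S (Suc n)) (gsum T) (gsum U)" using Scat_hom[OF T] g by blast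
  show "snd K (ar T \<gamma> U) \<in> hom D (fst F (gsum T)) (fst F (gsum U))" using functor_hom[OF Kf a] Ko T by simp
  fix m assume m: "m \<le> last_index T"
  show "Comp D (snd K (ar T \<gamma> U)) (snd F (inj_sum T m)) = sem U (sv \<gamma> (top_var T m))"
   using functor_comp[OF Kf inj_sum_hom[OF T(1) m] a] comp_inj_sum[OF g(1) m] e[OF m] Ka[OF inj_sum_Arr[OF T(1) m]] by simp
 qed
 have Kt: "snd K (arr U k t) = sem U t" if "tmd U k t" "lev_tm (Suc n) t" for U k t
  using that
 proof (induction rule: coh_induct)
  case (Var k m l)
  have U: "is_table U" using that by (simp add: tmd_def)
  have "arr U k (Var (cvar U k m l)) \<in> Arr (S n)" using arr_hom[OF tmd_Var(1)[OF U Var(1)]] by (simp add: hom_def)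
  thus ?case using Ka sem_Var[OF U Var(1)] by simp
 next
  case (Coh T i a u \<gamma>)
  note lv = Coh(4)[unfolded lev_subst_cohT[OF Coh(1,2)]]
  hence au: "lev_tm n a" "lev_tm n u" using lev_cohT(1)[OF Coh(1)] by auto
  have T: "is_table T" "is_table U" using Coh(2) by (auto simp: wfs_def)
  let ?c = "cohT T a u"
  note w = wf_cohT(2)[OF Coh(1)]
  have s: "snd K (ar T \<gamma> U) = sub_sem T \<gamma> U"
   using Ks[OF Coh(2)] Coh(3)[OF top_cell] lv lev_sv by blast
  have "snd K (arr T (Suc i) ?c) = gen T a u"
  proof (cases "lev_tm n ?c")
   case True
   hence "arr T (Suc i) ?c \<in> Arr (S n)" using arr_hom[OF w] by (simp add: hom_def)
   thus ?thesis using Ka gen(4)[OF Coh(1) au True] by simp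
  next
   case False
   hence "(i, arr T i a, arr T i u) \<in> new_pairs n" using new_pairs_iff[OF Coh(1)] au by simp
   thus ?thesis using KM coh_lift[OF Coh(1)] gen(5)[OF Coh(1) au] by metis
  qed
  moreover have a: "ar T \<gamma> U \<in> hom (S (Suc n)) (gsum T) (gsum U)" using Scat_hom[OF T] Coh(2) lv by blast
  ultimately show ?case using functor_comp[OF Kf arr_hom[OF w] a] lv s sem_cohT[OF Coh(1,2)] comp_arr[OF Coh(2) w] by simp
 qed
 have "snd K f = snd ext f" if "f \<in> Arr (S (Suc n))" for f
 proof -
  from that obtain T \<gamma> U where f: "f = ar T \<gamma> U" "wfs T \<gamma> U" "lev_sub (Suc n) \<gamma>" unfolding Scat_Arr by blast
  have T: "is_table T" using f by (simp add: wfs_def)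
  have "tmd U (summand T m) (sv \<gamma> (top_var T m))" if "m \<le> last_index T" for m
   using tmd_subst[OF f(2) tmd_Var(1)[OF T top_cell[OF that]]] by simp
  hence "snd K (ar T \<gamma> U) = sub_sem T \<gamma> U" using Ks[OF f(2,3)] Kt lev_sv[OF f(3)] by blast
  thus ?thesis using ext_ar[OF f(2)] f(1) by simp
 qed
 thus ?thesis using Ko by (auto simp: functor_eq_def ext_def simp del: prod.case)
qed

end

lemma S_universal: "universal_extension (S n) gl (new_pairs n) (S (Suc n)) gl id_functor coh_lift"
 unfolding universal_extension_def
proof (intro conjI allI impI)
 show "globular_extension (S (Suc n)) gl" by (rule S_extension)
 show "globular_functor (S n) gl (S (Suc n)) gl id_functor"
  unfolding globular_functor_def
 proof (intro conjI allI impI)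
  show i: "is_functor (S n) (S (Suc n)) id_functor"
   by (rule Scat_inclusion[OF category_S category_S _ is_functor_id[OF category_S]]) (simp add: lev_sub_mono)
  show g: "functor_eq Globe (comp_functor id_functor gl) gl" by (simp add: functor_eq_def comp_functor_def id_functor_def)
  fix T X \<iota> assume T: "is_table T" and s: "is_globular_sum (S n) gl T X \<iota>"
  let ?I = "id_functor :: (scheme, scheme_arr, scheme, scheme_arr) func"
  have "is_globular_sum (S (Suc n)) gl T (fst ?I (gsum T)) (\<lambda>m. snd ?I (inj_sum T m))"
   using S_sum[OF T, of "Suc n"] by (simp add: id_functor_def)
  from globular_sum_preserved[OF i gl_functor g gl_functor T S_sum[OF T] this s]
  show "is_globular_sum (S (Suc n)) gl T (fst ?I X) (\<lambda>m. snd ?I (\<iota> m))" .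
 qed
 show "\<forall>(i, f, g)\<in>new_pairs n. is_lift (S (Suc n)) gl i (snd id_functor f) (snd id_functor g) (coh_lift (i, f, g))"
 proof (intro ballI, clarify)
  fix i f g assume "(i, f, g) \<in> new_pairs n"
  then obtain T t u where h: "adm T i t u" "lev_tm n t" "lev_tm n u" "f = arr T i t" "g = arr T i u" by (rule new_pairsE)
  note w = wf_cohT[OF h(1)]
  have i: "tdim (tyT T t) = i" using admD[OF h(1)] by (simp add: tmd_def)
  have l: "lev_tm (Suc n) (cohT T t u)" using lev_cohT(1)[OF h(1)] h by simp
  have "Cod (S (Suc n)) (arr T i t) = gsum T" by (simp add: arr_def)
  thus "is_lift (S (Suc n)) gl i (snd id_functor f) (snd id_functor g) (coh_lift (i, f, g))"
   using comp_gl[OF w(2), of Src i] comp_gl[OF w(2), of Tgt i] arr_hom[OF w(2) l] h(4,5) coh_lift[OF h(1)]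
   by (simp add: is_lift_def id_functor_def globe_map_less w(3) face_def i globe_hom_iff del: gl_simps(2))
 qed
next
 fix D :: "(scheme, scheme_arr) cat" and H F and M :: "nat \<times> scheme_arr \<times> scheme_arr \<Rightarrow> scheme_arr"
 assume a: "globular_extension D H \<and> globular_functor (S n) gl D H F \<and>
  (\<forall>(i, f, g)\<in>new_pairs n. is_lift D H i (snd F f) (snd F g) (M (i, f, g)))"
 interpret stage_model n D H F M using a by unfold_locales auto
 show "\<exists>K. globular_functor (S (Suc n)) gl D H K \<and> functor_eq (S n) (comp_functor K id_functor) F \<and>
   (\<forall>e\<in>new_pairs n. snd K (coh_lift e) = M e) \<and>
   (\<forall>K'. globular_functor (S (Suc n)) gl D H K' \<and> functor_eq (S n) (comp_functor K' id_functor) F \<and>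
    (\<forall>e\<in>new_pairs n. snd K' (coh_lift e) = M e) \<longrightarrow> functor_eq (S (Suc n)) K' K)"
 proof (rule exI[of _ ext], intro conjI allI impI)
  show "globular_functor (S (Suc n)) gl D H ext" "functor_eq (S n) (comp_functor ext id_functor) F" by (rule ext_globular ext_restrict)+
  show "\<forall>e\<in>new_pairs n. snd ext (coh_lift e) = M e" using ext_lift by (metis prod_cases3)
  fix K' assume "globular_functor (S (Suc n)) gl D H K' \<and> functor_eq (S n) (comp_functor K' id_functor) F \<and>
   (\<forall>e\<in>new_pairs n. snd K' (coh_lift e) = M e)"
  thus "functor_eq (S (Suc n)) K' ext" using ext_unique by blast
 qed
qed

section \<open>Isomorphisms of categories\<close>

text \<open>Two mutually inverse functors. Functors are total maps whose values matter only inside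
  the category, so the inverse laws are stated with \<open>functor_eq\<close>.\<close>

definition iso_pair :: "('o, 'a) cat \<Rightarrow> ('p, 'b) cat \<Rightarrow> ('o, 'a, 'p, 'b) func \<Rightarrow> ('p, 'b, 'o, 'a) func \<Rightarrow> bool" where
 "iso_pair C D F F' \<longleftrightarrow> is_functor C D F \<and> is_functor D C F' \<and>
   functor_eq C (comp_functor F' F) id_functor \<and> functor_eq D (comp_functor F F') id_functor"

lemma functor_eqD: "functor_eq C F G \<Longrightarrow> X \<in> Obj C \<Longrightarrow> fst F X = fst G X" "functor_eq C F G \<Longrightarrow> f \<in> Arr C \<Longrightarrow> snd F f = snd G f"
 by (auto simp: functor_eq_def)

lemma functor_arr: "is_functor C D F \<Longrightarrow> f \<in> Arr C \<Longrightarrow> snd F f \<in> Arr D"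
 by (auto simp: is_functor_def hom_def)

lemma functor_dom_cod:
 "is_functor C D F \<Longrightarrow> f \<in> Arr C \<Longrightarrow> Dom D (snd F f) = fst F (Dom C f) \<and> Cod D (snd F f) = fst F (Cod C f)"
 by (auto simp: is_functor_def hom_def)

lemma iso_pairD:
 assumes "iso_pair C D F F'"
 shows "is_functor C D F" "is_functor D C F'" "X \<in> Obj C \<Longrightarrow> fst F' (fst F X) = X" "f \<in> Arr C \<Longrightarrow> snd F' (snd F f) = f"
  "Y \<in> Obj D \<Longrightarrow> fst F (fst F' Y) = Y" "g \<in> Arr D \<Longrightarrow> snd F (snd F' g) = g"
 using assms by (auto simp: iso_pair_def functor_eq_def)

lemma iso_pair_sym: "iso_pair C D F F' \<Longrightarrow> iso_pair D C F' F"
 by (auto simp: iso_pair_def)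

lemma iso_pair_cancel:
 assumes i: "iso_pair C D I I'" and G: "is_functor B C G" and e: "functor_eq B (comp_functor I G) H"
 shows "functor_eq B (comp_functor I' H) G"
 unfolding functor_eq_def comp_functor_simps
proof (intro conjI ballI)
 note ip = iso_pairD[OF i]
 show "fst I' (fst H X) = fst G X" if "X \<in> Obj B" for X using functor_eqD(1)[OF e that] ip(3)[OF functor_obj[OF G that]] by simp
 show "snd I' (snd H f) = snd G f" if "f \<in> Arr B" for f using functor_eqD(2)[OF e that] ip(4)[OF functor_arr[OF G that]] by simp
qed

lemma iso_pair_comp:
 assumes "iso_pair C D F F'" "iso_pair D E K K'"
 shows "iso_pair C E (comp_functor K F) (comp_functor F' K')"
proof -
 note a = iso_pairD[OF assms(1)] and b = iso_pairD[OF assms(2)]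
 show ?thesis unfolding iso_pair_def
 proof (intro conjI is_functor_comp[OF a(1) b(1)] is_functor_comp[OF b(2) a(2)])
  show "functor_eq C (comp_functor (comp_functor F' K') (comp_functor K F)) id_functor"
   using a(3,4) b(3,4) functor_obj[OF a(1)] functor_arr[OF a(1)] by (simp add: functor_eq_def)
  show "functor_eq E (comp_functor (comp_functor K F) (comp_functor F' K')) id_functor"
   using a(5,6) b(5,6) functor_obj[OF b(2)] functor_arr[OF b(2)] by (simp add: functor_eq_def)
 qed
qed

lemma category_opposite: "category C \<Longrightarrow> category (opposite C)"
 by (auto simp: category_def opposite_def hom_def)

lemma functor_opposite: "is_functor C D F \<Longrightarrow> is_functor (opposite C) (opposite D) F"
 using category_opposite[of C] category_opposite[of D] by (auto simp: is_functor_def) (auto simp: opposite_def hom_def)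

lemma iso_pair_opposite: "iso_pair C D F F' \<Longrightarrow> iso_pair (opposite C) (opposite D) F F'"
 using functor_opposite[of C D F] functor_opposite[of D C F'] by (auto simp: iso_pair_def functor_eq_def opposite_def)

lemma naturally_isomorphic_id:
 assumes C: "category C" and e: "functor_eq C F id_functor"
 shows "naturally_isomorphic C C F id_functor"
 unfolding naturally_isomorphic_def
proof (intro exI[of _ "Id C"] conjI ballI)
 fix X assume X: "X \<in> Obj C"
 note i = cat_id[OF C X]
 show "Id C X \<in> hom C (fst F X) (fst id_functor X)" using i functor_eqD(1)[OF e X] by simp
 show "is_iso C (Id C X)" unfolding is_iso_def using cat_id_comp[OF C i] i homD[OF i] by auto
next
 fix f assume f: "f \<in> Arr C"
 hence h: "f \<in> hom C (Dom C f) (Cod C f)" by (simp add: hom_def)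
 show "Comp C (Id C (Cod C f)) (snd F f) = Comp C (snd id_functor f) (Id C (Dom C f))"
  using cat_id_comp[OF C h] functor_eqD(2)[OF e f] by simp
qed

lemma iso_pair_equivalent:
 assumes "iso_pair C D F F'"
 shows "equivalent_categories C D"
proof -
 have C: "category C" "category D" using functor_cats[OF iso_pairD(1)[OF assms]] by auto
 have e: "functor_eq C (comp_functor F' F) id_functor" "functor_eq D (comp_functor F F') id_functor"
  using assms unfolding iso_pair_def by blast+
 show ?thesis unfolding equivalent_categories_def
 proof (intro conjI exI)
  show "naturally_isomorphic C C (comp_functor F' F) id_functor" by (rule naturally_isomorphic_id[OF C(1) e(1)])
  show "naturally_isomorphic D D (comp_functor F F') id_functor" by (rule naturally_isomorphic_id[OF C(2) e(2)])
 qed (rule C iso_pairD[OF assms])+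
qed

lemma iso_pairI:
 assumes F: "is_functor C D F" and o: "bij_betw (fst F) (Obj C) (Obj D)" and a: "bij_betw (snd F) (Arr C) (Arr D)"
 shows "iso_pair C D F (inv_into (Obj C) (fst F), inv_into (Arr C) (snd F))"
proof -
 let ?o = "inv_into (Obj C) (fst F)" and ?a = "inv_into (Arr C) (snd F)"
 have C: "category C" "category D" using functor_cats[OF F] by auto
 have o1: "?o (fst F X) = X" if "X \<in> Obj C" for X using o that by (simp add: bij_betw_def)
 have a1: "?a (snd F f) = f" if "f \<in> Arr C" for f using a that by (simp add: bij_betw_def)
 have o2: "fst F (?o Y) = Y" "?o Y \<in> Obj C" if "Y \<in> Obj D" for Y
  using o that by (auto simp: bij_betw_def f_inv_into_f inv_into_into)
 have a2: "snd F (?a g) = g" "?a g \<in> Arr C" if "g \<in> Arr D" for g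
  using a that by (auto simp: bij_betw_def f_inv_into_f inv_into_into)
 have dc: "Dom C (?a g) = ?o (Dom D g)" "Cod C (?a g) = ?o (Cod D g)" if g: "g \<in> Arr D" for g
 proof -
  have "?a g \<in> hom C (Dom C (?a g)) (Cod C (?a g))" using a2[OF g] by (simp add: hom_def)
  hence "Dom C (?a g) \<in> Obj C" "Cod C (?a g) \<in> Obj C" using cat_obj[OF C(1)] by blast+
  thus "Dom C (?a g) = ?o (Dom D g)" "Cod C (?a g) = ?o (Cod D g)"
   using functor_dom_cod[OF F a2(2)[OF g]] a2(1)[OF g] o1 by metis+
 qed
 have "is_functor D C (?o, ?a)" unfolding is_functor_def fst_conv snd_conv
 proof (intro conjI ballI impI C)
  fix Y assume Y: "Y \<in> Obj D"
  show "?o Y \<in> Obj C" using o2 Y by blast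
  have "snd F (Id C (?o Y)) = Id D Y" using functor_id[OF F o2(2)[OF Y]] o2(1)[OF Y] by simp
  thus "?a (Id D Y) = Id C (?o Y)" using a1 cat_id[OF C(1) o2(2)[OF Y]] homD by metis
 next
  fix f assume f: "f \<in> Arr D"
  show "?a f \<in> hom C (?o (Dom D f)) (?o (Cod D f))" using a2[OF f] dc[OF f] by (simp add: hom_def)
  fix g assume g: "g \<in> Arr D" "Dom D g = Cod D f"
  have h: "?a f \<in> hom C (?o (Dom D f)) (?o (Cod D f))" "?a g \<in> hom C (?o (Cod D f)) (?o (Cod D g))"
   using a2[OF f] dc[OF f] a2[OF g(1)] dc[OF g(1)] g(2) by (auto simp: hom_def)
  have "snd F (Comp C (?a g) (?a f)) = Comp D g f" using functor_comp[OF F h] a2(1)[OF f] a2(1)[OF g(1)] by simp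
  thus "?a (Comp D g f) = Comp C (?a g) (?a f)" using a1 cat_comp[OF C(1) h] homD by metis
 qed
 thus ?thesis unfolding iso_pair_def using F o1 a1 o2 a2 by (auto simp: functor_eq_def)
qed

lemma functor_cong: "is_functor C D F \<Longrightarrow> functor_eq C F F' \<Longrightarrow> is_functor C D F'"
proof -
 assume F: "is_functor C D F" and e: "functor_eq C F F'"
 note C = functor_cats[OF F, THEN conjunct1]
 show ?thesis unfolding is_functor_def
 proof (intro conjI ballI impI)
  show "category C" "category D" using functor_cats[OF F] by auto
  fix X assume X: "X \<in> Obj C"
  thus "fst F' X \<in> Obj D" "snd F' (Id C X) = Id D (fst F' X)"
   using functor_obj[OF F X] functor_id[OF F X] functor_eqD[OF e] homD[OF cat_id[OF C X]] by metis+
 next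
  fix f assume f: "f \<in> Arr C"
  hence h: "f \<in> hom C (Dom C f) (Cod C f)" by (simp add: hom_def)
  show "snd F' f \<in> hom D (fst F' (Dom C f)) (fst F' (Cod C f))"
   using functor_hom[OF F h] functor_eqD[OF e] cat_obj[OF C h] f by metis
  fix g assume g: "g \<in> Arr C" "Dom C g = Cod C f"
  hence h': "g \<in> hom C (Cod C f) (Cod C g)" by (simp add: hom_def)
  show "snd F' (Comp C g f) = Comp D (snd F' g) (snd F' f)"
   using functor_comp[OF F h h'] functor_eqD(2)[OF e] f g homD[OF cat_comp[OF C h h']] by metis
 qed
qed

lemma iso_sum:
 assumes i: "iso_pair C D F F'" and G: "is_functor Globe C G" and H: "is_functor Globe D H"
  and GH: "functor_eq Globe (comp_functor F G) H" and T: "is_table T" and s: "is_globular_sum C G T X \<iota>"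
 shows "is_globular_sum D H T (fst F X) (\<lambda>m. snd F (\<iota> m))"
 unfolding is_globular_sum_def
proof (intro conjI allI impI)
 note I = iso_pairD[OF i]
 have C: "category C" "category D" using functor_cats[OF I(1)] by auto
 have HG: "functor_eq Globe (comp_functor F' H) G"
  using iso_pair_cancel[OF i G GH] .
 have c: "is_sum_cocone C G T X \<iota>" using s by (simp add: is_globular_sum_def)
 show "is_sum_cocone D H T (fst F X) (\<lambda>m. snd F (\<iota> m))" using sum_cocone_functor[OF I(1) G GH T c] .
 fix Y \<kappa> assume k: "is_sum_cocone D H T Y \<kappa>"
 have Y: "Y \<in> Obj D" using k by (simp add: is_sum_cocone_def)
 have X: "X \<in> Obj C" using globular_sum_hom(1)[OF s] .
 have kA: "\<kappa> m \<in> Arr D" if "m \<le> last_index T" for m using k that by (simp add: is_sum_cocone_def hom_def)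
 have "is_sum_cocone C G T (fst F' Y) (\<lambda>m. snd F' (\<kappa> m))" using sum_cocone_functor[OF I(2) H HG T k] .
 then obtain h where h: "h \<in> hom C X (fst F' Y)" "\<forall>m\<le>last_index T. Comp C h (\<iota> m) = snd F' (\<kappa> m)"
  using s unfolding is_globular_sum_def by blast
 show "\<exists>!h. h \<in> hom D (fst F X) Y \<and> (\<forall>m\<le>last_index T. Comp D h (snd F (\<iota> m)) = \<kappa> m)"
 proof (rule ex1I[of _ "snd F h"], intro conjI allI impI)
  show "snd F h \<in> hom D (fst F X) Y" using functor_hom[OF I(1) h(1)] I(5)[OF Y] by simp
  show "Comp D (snd F h) (snd F (\<iota> m)) = \<kappa> m" if m: "m \<le> last_index T" for m
   using functor_comp[OF I(1) globular_sum_hom(2)[OF s m] h(1)] h(2) m I(6)[OF kA[OF m]] by simp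
  fix h' assume h': "h' \<in> hom D (fst F X) Y \<and> (\<forall>m\<le>last_index T. Comp D h' (snd F (\<iota> m)) = \<kappa> m)"
  have "snd F' h' = h"
  proof (rule globular_sum_ext[OF s C(1) G T])
   show a: "snd F' h' \<in> hom C X (fst F' Y)" using functor_hom[OF I(2), of h'] h' I(3)[OF X] by metis
   fix m assume m: "m \<le> last_index T"
   have i: "snd F (\<iota> m) \<in> hom D (fst F (fst G (summand T m))) (fst F X)" using functor_hom[OF I(1) globular_sum_hom(2)[OF s m]] .
   have "Comp C (snd F' h') (snd F' (snd F (\<iota> m))) = snd F' (\<kappa> m)" using functor_comp[OF I(2) i] h' m by metis
   thus "Comp C (snd F' h') (\<iota> m) = Comp C h (\<iota> m)" using h(2) m I(4) homD[OF globular_sum_hom(2)[OF s m]] by simp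
  qed (rule h(1))
  thus "h' = snd F h" using I(6)[of h'] h' by (auto simp: hom_def)
 qed
qed

lemma iso_globular:
 assumes "iso_pair C D F F'" "is_functor Globe C G" "is_functor Globe D H" "functor_eq Globe (comp_functor F G) H"
 shows "globular_functor C G D H F"
 unfolding globular_functor_def using iso_sum[OF assms] assms(4) iso_pairD(1)[OF assms(1)] by blast

lemma globular_functor_comp:
 assumes F: "globular_functor C G D H F" and K: "globular_functor D H E N K"
 shows "globular_functor C G E N (comp_functor K F)"
 unfolding globular_functor_def
proof (intro conjI allI impI)
 show "is_functor C E (comp_functor K F)" using is_functor_comp F K unfolding globular_functor_def by blast
 have "functor_eq Globe (comp_functor F G) H" "functor_eq Globe (comp_functor K H) N" using F K unfolding globular_functor_def by blast+
 thus "functor_eq Globe (comp_functor (comp_functor K F) G) N" by (simp add: functor_eq_def)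
 fix T X \<iota> assume "is_table T" "is_globular_sum C G T X \<iota>"
 hence "is_globular_sum E N T (fst K (fst F X)) (\<lambda>m. snd K (snd F (\<iota> m)))" using F K unfolding globular_functor_def by blast
 thus "is_globular_sum E N T (fst (comp_functor K F) X) (\<lambda>m. snd (comp_functor K F) (\<iota> m))" by simp
qed

lemma globular_functor_id: "globular_extension C G \<Longrightarrow> globular_functor C G C G id_functor"
 by (auto simp: globular_functor_def globular_extension_def functor_eq_def is_functor_id)

section \<open>Uniqueness of universal extensions\<close>

definition map_pair :: "('o, 'a, 'p, 'b) func \<Rightarrow> nat \<times> 'a \<times> 'a \<Rightarrow> nat \<times> 'b \<times> 'b" where
 "map_pair F = (\<lambda>(i, f, g). (i, snd F f, snd F g))"

definition arr_pairs :: "('o, 'a) cat \<Rightarrow> (nat \<times> 'a \<times> 'a) set" where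
 "arr_pairs C = {(i, f, g). f \<in> Arr C \<and> g \<in> Arr C}"

lemma map_pair_simp [simp]: "map_pair F (i, f, g) = (i, snd F f, snd F g)"
 by (simp add: map_pair_def)

lemma map_pair_arr: "is_functor C D F \<Longrightarrow> e \<in> arr_pairs C \<Longrightarrow> map_pair F e \<in> arr_pairs D"
 by (auto simp: arr_pairs_def functor_arr)

lemma map_pair_inverse: "iso_pair C D F F' \<Longrightarrow> e \<in> arr_pairs C \<Longrightarrow> map_pair F' (map_pair F e) = e"
 by (auto simp: arr_pairs_def iso_pairD)

lemma universal_extensionD:
 fixes C D :: "('o, 'a) cat"
 assumes U: "universal_extension C G E C1 G1 P L" and D: "globular_extension D H" "globular_functor C G D H F"
  and M: "\<And>i f g. (i, f, g) \<in> E \<Longrightarrow> is_lift D H i (snd F f) (snd F g) (M (i, f, g))"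
 obtains K where "globular_functor C1 G1 D H K" "functor_eq C (comp_functor K P) F" "\<forall>e\<in>E. snd K (L e) = M e"
  "\<And>K'. globular_functor C1 G1 D H K' \<Longrightarrow> functor_eq C (comp_functor K' P) F \<Longrightarrow> \<forall>e\<in>E. snd K' (L e) = M e \<Longrightarrow> functor_eq C1 K' K"
proof -
 have "\<forall>(i, f, g)\<in>E. is_lift D H i (snd F f) (snd F g) (M (i, f, g))" using M by blast
 with U D have "\<exists>K. globular_functor C1 G1 D H K \<and> functor_eq C (comp_functor K P) F \<and> (\<forall>e\<in>E. snd K (L e) = M e) \<and>
  (\<forall>K'. globular_functor C1 G1 D H K' \<and> functor_eq C (comp_functor K' P) F \<and> (\<forall>e\<in>E. snd K' (L e) = M e) \<longrightarrow> functor_eq C1 K' K)"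
  unfolding universal_extension_def by simp
 thus thesis using that by blast
qed

lemma universal_extension_map:
 fixes C C' :: "('o, 'a) cat"
 assumes U: "universal_extension C G E C1 G1 P L" and U': "universal_extension C' G' E' C1' G1' P' L'"
  and I: "globular_functor C G C' G' I" and E: "map_pair I ` E \<subseteq> E'"
 shows "\<exists>K. globular_functor C1 G1 C1' G1' K \<and> functor_eq C (comp_functor K P) (comp_functor P' I) \<and>
  (\<forall>e\<in>E. snd K (L e) = L' (map_pair I e))"
proof -
 have e: "globular_extension C1' G1'" using U' by (simp add: universal_extension_def)
 have "globular_functor C' G' C1' G1' P'" using U' by (simp add: universal_extension_def)
 hence g: "globular_functor C G C1' G1' (comp_functor P' I)" by (rule globular_functor_comp[OF I])
 have l: "\<forall>(i, f, g)\<in>E'. is_lift C1' G1' i (snd P' f) (snd P' g) (L' (i, f, g))" using U' by (simp add: universal_extension_def)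
 show ?thesis
 proof (rule universal_extensionD[OF U e g])
  fix i f g assume "(i, f, g) \<in> E"
  hence "map_pair I (i, f, g) \<in> E'" using E by blast
  thus "is_lift C1' G1' i (snd (comp_functor P' I) f) (snd (comp_functor P' I) g) (L' (map_pair I (i, f, g)))"
   using l by auto
 qed blast
qed

lemma universal_extension_endo:
 assumes U: "universal_extension C G E C1 G1 P L" and K: "globular_functor C1 G1 C1 G1 K"
  and KP: "functor_eq C (comp_functor K P) P" and KL: "\<And>e. e \<in> E \<Longrightarrow> snd K (L e) = L e"
 shows "functor_eq C1 K id_functor"
proof -
 have u: "globular_extension C1 G1" "globular_functor C G C1 G1 P" "\<forall>(i, f, g)\<in>E. is_lift C1 G1 i (snd P f) (snd P g) (L (i, f, g))"
  using U by (auto simp: universal_extension_def)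
 obtain K0 where K0: "\<And>K'. globular_functor C1 G1 C1 G1 K' \<Longrightarrow> functor_eq C (comp_functor K' P) P \<Longrightarrow> \<forall>e\<in>E. snd K' (L e) = L e \<Longrightarrow> functor_eq C1 K' K0"
  by (rule universal_extensionD[OF U u(1,2), where M = L]) (use u(3) in auto)
 have "functor_eq C1 K K0" using K0 K KP KL by blast
 moreover have "functor_eq C1 id_functor K0" using globular_functor_id[OF u(1)] by (intro K0) (simp_all add: functor_eq_def)
 ultimately show ?thesis by (simp add: functor_eq_def)
qed

text \<open>The usual comparison of two universal objects. Each extension serves as a test category
  for the other one, so both sides have to live in the same types; this is the purpose of encoding
  the stages in the types of \<open>Theta0\<close>.\<close>

lemma universal_extension_iso:
 fixes C C' :: "('o, 'a) cat"
 assumes U: "universal_extension C G E C1 G1 P L" and U': "universal_extension C' G' E' C1' G1' P' L'"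
  and i: "iso_pair C C' I I'" and I: "globular_functor C G C' G' I" "globular_functor C' G' C G I'"
  and E: "map_pair I ` E = E'" "E \<subseteq> arr_pairs C"
 shows "\<exists>K K'. iso_pair C1 C1' K K' \<and> globular_functor C1 G1 C1' G1' K \<and> globular_functor C1' G1' C1 G1 K' \<and>
  functor_eq C (comp_functor K P) (comp_functor P' I)"
proof -
 have E': "map_pair I' ` E' = E" using E map_pair_inverse[OF i] by (auto simp: image_image subset_iff intro!: rev_image_eqI)
 have inv: "map_pair I' (map_pair I e) = e" if "e \<in> E" for e using E(2) map_pair_inverse[OF i] that by blast
 have inv': "map_pair I (map_pair I' e) = e" if "e \<in> E'" for e using that E(1) inv by auto
 note ip = iso_pairD[OF i]
 obtain K where K: "globular_functor C1 G1 C1' G1' K" "functor_eq C (comp_functor K P) (comp_functor P' I)"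
  "\<forall>e\<in>E. snd K (L e) = L' (map_pair I e)" using universal_extension_map[OF U U' I(1)] E by blast
 obtain K' where K': "globular_functor C1' G1' C1 G1 K'" "functor_eq C' (comp_functor K' P') (comp_functor P I')"
  "\<forall>e\<in>E'. snd K' (L' e) = L (map_pair I' e)" using universal_extension_map[OF U' U I(2)] E' by blast
 have "functor_eq C1 (comp_functor K' K) id_functor"
 proof (rule universal_extension_endo[OF U globular_functor_comp[OF K(1) K'(1)]])
  show "functor_eq C (comp_functor (comp_functor K' K) P) P"
   using K(2) K'(2) functor_obj[OF ip(1)] functor_arr[OF ip(1)] ip(3,4) by (simp add: functor_eq_def)
  show "snd (comp_functor K' K) (L e) = L e" if "e \<in> E" for e
   using K(3) K'(3) E(1) that inv[OF that] by (simp, metis imageI)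
 qed
 moreover have "functor_eq C1' (comp_functor K K') id_functor"
 proof (rule universal_extension_endo[OF U' globular_functor_comp[OF K'(1) K(1)]])
  show "functor_eq C' (comp_functor (comp_functor K K') P') P'"
   using K(2) K'(2) functor_obj[OF ip(2)] functor_arr[OF ip(2)] ip(5,6) by (simp add: functor_eq_def)
  show "snd (comp_functor K K') (L' e) = L' e" if "e \<in> E'" for e
   using K(3) K'(3) E' that inv'[OF that] by (simp, metis imageI)
 qed
 ultimately have "iso_pair C1 C1' K K'" using K(1) K'(1) unfolding iso_pair_def globular_functor_def by blast
 thus ?thesis using K K' by blast
qed

section \<open>Transport of admissible pairs\<close>

lemma admissible_pairs_arr: "admissible_pairs C G J0 \<subseteq> arr_pairs C"
 by (auto simp: admissible_pairs_def arr_pairs_def parallel_arrows_def hom_def)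

lemma algebraic_transport:
 assumes i: "iso_pair C D I I'" and J0: "is_functor Theta0 C J0" and JJ: "functor_eq Theta0 (comp_functor I J0) J1"
  and f: "algebraic_arrow C J0 f"
 shows "algebraic_arrow D J1 (snd I f)"
 unfolding algebraic_arrow_def
proof (intro conjI allI impI)
 note ip = iso_pairD[OF i]
 have C: "category C" using functor_cats[OF ip(1)] by auto
 have fA: "f \<in> Arr C" using f by (simp add: algebraic_arrow_def)
 show "snd I f \<in> Arr D" using functor_arr[OF ip(1) fA] .
 fix g f' assume h: "globular_arrow J1 g \<and> f' \<in> Arr D \<and> Dom D g = Cod D f' \<and> snd I f = Comp D g f'"
 then obtain x where x: "x \<in> Arr Theta0" "g = snd J1 x" by (auto simp: globular_arrow_def)
 hence g: "g = snd I (snd J0 x)" using functor_eqD(2)[OF JJ x(1)] by simp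
 have gA: "snd J0 x \<in> Arr C" using functor_arr[OF J0 x(1)] .
 have gD: "g \<in> Arr D" using functor_arr[OF ip(1) gA] g by simp
 have g': "snd I' g = snd J0 x" using ip(4)[OF gA] g by simp
 have hf: "f' \<in> hom D (Dom D f') (Cod D f')" "g \<in> hom D (Cod D f') (Cod D g)" using h gD by (auto simp: hom_def)
 have "f = Comp C (snd J0 x) (snd I' f')" using functor_comp[OF ip(2) hf] h ip(4)[OF fA] g' by metis
 moreover have "snd I' f' \<in> Arr C" using functor_arr[OF ip(2)] h by blast
 moreover have "Dom C (snd J0 x) = Cod C (snd I' f')"
  using homD[OF functor_hom[OF ip(2) hf(1)]] homD[OF functor_hom[OF ip(2) hf(2)]] g' by simp
 moreover have "globular_arrow J0 (snd J0 x)" using x(1) by (simp add: globular_arrow_def)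
 ultimately have "snd J0 x = Id C (Cod C f)" using f unfolding algebraic_arrow_def by blast
 moreover have "Cod C f \<in> Obj C" using C fA by (simp add: category_def)
 ultimately show "g = Id D (Cod D (snd I f))" using g functor_id[OF ip(1)] functor_dom_cod[OF ip(1) fA] by simp
qed

lemma admissible_transport_subset:
 assumes i: "iso_pair C D I I'" and G: "is_functor Globe C G" and GH: "functor_eq Globe (comp_functor I G) H"
  and J0: "is_functor Theta0 C J0" and JJ: "functor_eq Theta0 (comp_functor I J0) J1"
 shows "map_pair I ` admissible_pairs C G J0 \<subseteq> admissible_pairs D H J1"
proof
 note F = iso_pairD(1)[OF i]
 fix e assume "e \<in> map_pair I ` admissible_pairs C G J0"
 then obtain i f g T where e: "e = (i, snd I f, snd I g)" and T: "is_table T" and p: "parallel_arrows C G i (fst J0 (gsum T)) f g"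
  and d: "algebraic_arrow C J0 f \<and> algebraic_arrow C J0 g \<or> dim_table T > 0 \<and>
   (\<exists>f'\<in>hom C (fst G i) (fst J0 (gsum (bd_table T))). \<exists>g'\<in>hom C (fst G i) (fst J0 (gsum (bd_table T))).
     algebraic_arrow C J0 f' \<and> algebraic_arrow C J0 g' \<and>
     f = Comp C (snd J0 (bd_src T)) f' \<and> g = Comp C (snd J0 (bd_tgt T)) g')"
 proof -
  obtain x where x: "x \<in> admissible_pairs C G J0" "e = map_pair I x" using \<open>e \<in> _\<close> by blast
  obtain i f g where "x = (i, f, g)" by (cases x)
  thus thesis using x that unfolding admissible_pairs_def by simp blast
 qed
 have Ho: "fst H k = fst I (fst G k)" for k using GH by (simp add: functor_eq_def Globe_def)
 have Jo: "fst J1 (gsum U) = fst I (fst J0 (gsum U))" if "is_table U" for U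
 proof -
  have "gsum U \<in> Obj Theta0" using that unfolding Theta0_Obj by blast
  thus ?thesis using functor_eqD(1)[OF JJ] by simp
 qed
 have hm: "snd I h \<in> hom D (fst H i) (fst J1 (gsum U))" if "h \<in> hom C (fst G i) (fst J0 (gsum U))" "is_table U" for h U
  using functor_hom[OF F that(1)] Ho Jo[OF that(2)] by simp
 note alg = algebraic_transport[OF \<open>iso_pair C D I I'\<close> J0 JJ]
 have fg: "f \<in> hom C (fst G i) (fst J0 (gsum T))" "g \<in> hom C (fst G i) (fst J0 (gsum T))" using p by (auto simp: parallel_arrows_def)
 have "parallel_arrows D H i (fst J1 (gsum T)) (snd I f) (snd I g)"
  unfolding parallel_arrows_def
 proof (intro conjI allI impI ballI hm[OF fg(1) T] hm[OF fg(2) T])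
  fix i' s assume s: "i = Suc i'" "s \<in> {Src, Tgt}"
  have m: "globe_map s i' i \<in> hom Globe i' i" using s by (auto simp: hom_def Globe_def globe_map_def globe_hom_def)
  have H: "snd H (globe_map s i' i) = snd I (snd G (globe_map s i' i))" using GH homD[OF m] by (simp add: functor_eq_def)
  have "Comp C f (snd G (globe_map s i' i)) = Comp C g (snd G (globe_map s i' i))" using p s unfolding parallel_arrows_def by blast
  thus "Comp D (snd I f) (snd H (globe_map s i' i)) = Comp D (snd I g) (snd H (globe_map s i' i))"
   unfolding H using functor_comp[OF F functor_hom[OF G m] fg(1)] functor_comp[OF F functor_hom[OF G m] fg(2)] by simp
 qed
 moreover have "\<exists>f'\<in>hom D (fst H i) (fst J1 (gsum (bd_table T))). \<exists>g'\<in>hom D (fst H i) (fst J1 (gsum (bd_table T))).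
     algebraic_arrow D J1 f' \<and> algebraic_arrow D J1 g' \<and>
     snd I f = Comp D (snd J1 (bd_src T)) f' \<and> snd I g = Comp D (snd J1 (bd_tgt T)) g'"
  if h: "f' \<in> hom C (fst G i) (fst J0 (gsum (bd_table T)))" "g' \<in> hom C (fst G i) (fst J0 (gsum (bd_table T)))"
   "algebraic_arrow C J0 f'" "algebraic_arrow C J0 g'"
   "f = Comp C (snd J0 (bd_src T)) f'" "g = Comp C (snd J0 (bd_tgt T)) g'" for f' g'
 proof (rule bexI[of _ "snd I f'"], rule bexI[of _ "snd I g'"], intro conjI)
  note b = bd_hom[OF T]
  show "snd I f' \<in> hom D (fst H i) (fst J1 (gsum (bd_table T)))" "snd I g' \<in> hom D (fst H i) (fst J1 (gsum (bd_table T)))"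
   using hm h(1,2) is_table_bd[OF T] by blast+
  show "algebraic_arrow D J1 (snd I f')" "algebraic_arrow D J1 (snd I g')" using alg h by blast+
  show "snd I f = Comp D (snd J1 (bd_src T)) (snd I f')" "snd I g = Comp D (snd J1 (bd_tgt T)) (snd I g')"
   using functor_comp[OF F h(1) functor_hom[OF J0 b(1)]] functor_comp[OF F h(2) functor_hom[OF J0 b(2)]] h(5,6)
    functor_eqD(2)[OF JJ] homD[OF b(1)] homD[OF b(2)] by auto
 qed
 ultimately show "e \<in> admissible_pairs D H J1" unfolding admissible_pairs_def e using T d alg by blast
qed

text \<open>Only one inclusion has to be computed; the other one is the same statement for the
  inverse isomorphism.\<close>

lemma admissible_transport:
 assumes i: "iso_pair C D I I'" and G: "is_functor Globe C G" and GH: "functor_eq Globe (comp_functor I G) H"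
  and J0: "is_functor Theta0 C J0" and JJ: "functor_eq Theta0 (comp_functor I J0) J1"
 shows "map_pair I ` admissible_pairs C G J0 = admissible_pairs D H J1"
proof
 note ip = iso_pairD[OF i]
 show "map_pair I ` admissible_pairs C G J0 \<subseteq> admissible_pairs D H J1" using admissible_transport_subset[OF assms] .
 have H: "is_functor Globe D H" using functor_cong[OF is_functor_comp[OF G ip(1)] GH] .
 have J1: "is_functor Theta0 D J1" using functor_cong[OF is_functor_comp[OF J0 ip(1)] JJ] .
 have "functor_eq Globe (comp_functor I' H) G" "functor_eq Theta0 (comp_functor I' J1) J0"
  using iso_pair_cancel[OF i] G GH J0 JJ by blast+
 hence s: "map_pair I' ` admissible_pairs D H J1 \<subseteq> admissible_pairs C G J0"
  using admissible_transport_subset[OF iso_pair_sym[OF i] H _ J1] by blast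
 show "admissible_pairs D H J1 \<subseteq> map_pair I ` admissible_pairs C G J0"
 proof
  fix e assume e: "e \<in> admissible_pairs D H J1"
  hence "map_pair I (map_pair I' e) = e" using map_pair_inverse[OF iso_pair_sym[OF i]] admissible_pairs_arr by blast
  thus "e \<in> map_pair I ` admissible_pairs C G J0" using s e by (metis imageI subsetD)
 qed
qed

text \<open>That \<open>Theta0\<close> is a category is assumed here; in a tower of universal
  extensions it comes with the functor out of the first stage.\<close>

lemma J_iso:
 assumes "category Theta0"
 shows "\<exists>J'. iso_pair Theta0 (S 0) J J'"
proof -
 note F = J_functor[OF assms]
 have "bij_betw (fst J) (Obj Theta0) (Obj (S 0))" by (auto simp: bij_betw_def inj_on_def Theta0_Obj)
 moreover have "bij_betw (snd J) (Arr Theta0) (Arr (S 0))" unfolding bij_betw_def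
 proof
  show "inj_on (snd J) (Arr Theta0)"
  proof (rule inj_onI)
   fix f g assume h: "f \<in> Arr Theta0" "g \<in> Arr Theta0" "snd J f = snd J g"
   obtain T T' where T: "is_table T" "is_table T'" "f \<in> hom Theta0 (gsum T) (gsum T')"
    using Theta0_Arr[OF h(1)] Theta0_hom by blast
   have "Dom Theta0 g = Dom Theta0 f" "Cod Theta0 g = Cod Theta0 f"
    using functor_dom_cod[OF F h(1)] functor_dom_cod[OF F h(2)] h(3) by auto
   hence "g \<in> hom Theta0 (gsum T) (gsum T')" using T(3) h(2) by (simp add: hom_def)
   thus "f = g" using J_bij[OF T(1,2)] T(3) h(3) by (auto simp: bij_betw_def inj_on_def)
  qed
  show "snd J ` Arr Theta0 = Arr (S 0)" using globular_arrow_J unfolding globular_arrow_def by blast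
 qed
 ultimately show ?thesis using iso_pairI[OF F] by blast
qed

lemma globes0_Arr:
 assumes "f \<in> Arr Globe"
 shows "snd globes0 f \<in> Arr Theta0"
proof -
 obtain j l i where f: "f = (j, l, i)" "l \<in> globe_hom j i" using assms by (auto simp: Globe_def)
 have "sum_map l (\<lambda>m. m) (j, []) (i, []) \<in> hom Theta0 (gsum (j, [])) (gsum (i, []))"
 proof (rule sum_map_J(1)[OF is_table_globe is_table_globe])
  show "(m, push l (summand (j, []) m) (summand (i, []) m) l') \<in> sum_cells (i, []) k" if "(m, l') \<in> sum_cells (j, []) k" for m l' k
   using that f(2) by (auto simp: push_def mem_sum_cells globe_hom_iff)
 qed (simp add: sum_glue_def)
 thus ?thesis using f by (simp add: globes0_def hom_def)
qed

text \<open>Functoriality is carried over from \<open>gl\<close> along the inverse of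
  \<open>J\<close>, which avoids computing composites of the maps \<open>sum_map\<close>.\<close>

lemma globes0_functor:
 assumes "category Theta0"
 shows "is_functor Globe Theta0 globes0"
proof -
 from J_iso[OF assms] obtain J' where i: "iso_pair Theta0 (S 0) J J'" by blast
 note ip = iso_pairD[OF i]
 have "functor_eq Globe (comp_functor J' gl) globes0" unfolding functor_eq_def comp_functor_simps
 proof (intro conjI ballI)
  fix k assume k: "k \<in> Obj Globe"
  have "fst globes0 k \<in> Obj Theta0" unfolding Theta0_Obj globes0_def fst_conv using is_table_globe by blast
  thus "fst J' (fst gl k) = fst globes0 k" using functor_eqD(1)[OF J_globes k] ip(3) by simp
 next
  fix f assume f: "f \<in> Arr Globe"
  hence "snd globes0 f \<in> Arr Theta0" using globes0_Arr by blast
  thus "snd J' (snd gl f) = snd globes0 f" using functor_eqD(2)[OF J_globes f] ip(4) by (metis comp_functor_simps(2))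
 qed
 thus ?thesis using functor_cong[OF is_functor_comp[OF gl_functor ip(2)]] by blast
qed

section \<open>The coherator and the syntactic category\<close>

lemma S_arr_mono: "f \<in> Arr (S m) \<Longrightarrow> m \<le> n \<Longrightarrow> f \<in> Arr (S n)"
 unfolding Scat_Arr using lev_sub_mono by blast

lemma SS_arr: "f \<in> Arr SS \<Longrightarrow> \<exists>n. f \<in> Arr (S n)"
 unfolding Scat_Arr using lev_sub_ex by blast

locale coherator_tower =
 fixes \<Theta> :: "nat \<Rightarrow> (scheme, scheme_arr) cat" and G P L
 assumes T0: "\<Theta> 0 = Theta0" "G 0 = globes0"
  and U: "universal_extension (\<Theta> n) (G n) (new_admissible_pairs \<Theta> G P n) (\<Theta> (Suc n)) (G (Suc n)) (P n) (L n)"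
begin

lemma P_functor: "is_functor (\<Theta> n) (\<Theta> (Suc n)) (P n)"
 using U[of n] by (simp add: universal_extension_def globular_functor_def)

lemma cat_Theta: "category (\<Theta> n)"
 using functor_cats[OF P_functor] by blast

lemma G_functor: "is_functor Globe (\<Theta> n) (G n)"
proof (cases n)
 case 0 thus ?thesis using globes0_functor cat_Theta[of 0] T0 by simp
next
 case (Suc m) thus ?thesis using U[of m] by (simp add: universal_extension_def globular_extension_def)
qed

lemma tower_functor: "is_functor (\<Theta> m) (\<Theta> (m + k)) (tower_map P m k)"
proof (induction k)
 case 0 thus ?case using is_functor_id[OF cat_Theta] by simp
next
 case (Suc k) thus ?case using is_functor_comp[OF Suc P_functor] by simp
qed

lemma tower_functor': "m \<le> n \<Longrightarrow> is_functor (\<Theta> m) (\<Theta> n) (tower_map P m (n - m))"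
 using tower_functor[of m "n - m"] by simp

text \<open>The last clause keeps track of the pairs of the earlier stages, which must not receive a second lift.\<close>

definition stage_iso :: "nat \<Rightarrow> (scheme, scheme_arr, scheme, scheme_arr) func \<times> (scheme, scheme_arr, scheme, scheme_arr) func \<Rightarrow> bool" where
 "stage_iso n p \<longleftrightarrow> iso_pair (\<Theta> n) (S n) (fst p) (snd p) \<and>
   globular_functor (\<Theta> n) (G n) (S n) gl (fst p) \<and> globular_functor (S n) gl (\<Theta> n) (G n) (snd p) \<and>
   functor_eq Theta0 (comp_functor (fst p) (tower_map P 0 n)) J \<and>
   (\<forall>m<n. map_pair (comp_functor (fst p) (tower_map P m (n - m))) ` admissible_stage \<Theta> G P m = admissible_pairs (S m) gl J)"

lemma stage_iso_0: "\<exists>p. stage_iso 0 p"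
proof -
 have c: "category Theta0" using cat_Theta[of 0] T0 by simp
 from J_iso[OF c] obtain J' where i: "iso_pair Theta0 (S 0) J J'" by blast
 note g = globes0_functor[OF c]
 have "globular_functor Theta0 globes0 (S 0) gl J" using iso_globular[OF i g gl_functor J_globes] .
 moreover have "globular_functor (S 0) gl Theta0 globes0 J'"
  using iso_globular[OF iso_pair_sym[OF i] gl_functor g iso_pair_cancel[OF i g J_globes]] .
 ultimately have "stage_iso 0 (J, J')" using i T0 by (simp add: stage_iso_def functor_eq_def)
 thus ?thesis by blast
qed

lemma stage_iso_admissible:
 assumes "stage_iso n p"
 shows "map_pair (fst p) ` admissible_stage \<Theta> G P n = admissible_pairs (S n) gl J"
 unfolding admissible_stage_def
proof (rule admissible_transport[where I' = "snd p"])
 show "is_functor Theta0 (\<Theta> n) (tower_map P 0 n)" using tower_functor[of 0 n] T0 by simp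
 show "functor_eq Globe (comp_functor (fst p) (G n)) gl" using assms by (simp add: stage_iso_def globular_functor_def)
qed (use assms G_functor in \<open>simp_all add: stage_iso_def\<close>)

lemma stage_arr: "admissible_stage \<Theta> G P n \<subseteq> arr_pairs (\<Theta> n)"
 unfolding admissible_stage_def by (rule admissible_pairs_arr)

text \<open>An isomorphism is injective on pairs of arrows, so it commutes with the removal of the
  pairs that come from earlier stages.\<close>

lemma stage_iso_new:
 assumes p: "stage_iso n p"
 shows "map_pair (fst p) ` new_admissible_pairs \<Theta> G P n = new_pairs n"
proof -
 let ?I = "fst p"
 have i: "iso_pair (\<Theta> n) (S n) ?I (snd p)" using p by (simp add: stage_iso_def)
 have inj: "inj_on (map_pair ?I) (arr_pairs (\<Theta> n))" by (rule inj_on_inverseI) (rule map_pair_inverse[OF i])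
 define B where "B = (\<Union>m<n. map_pair (tower_map P m (n - m)) ` admissible_stage \<Theta> G P m)"
 have B: "B \<subseteq> arr_pairs (\<Theta> n)"
 proof
  fix e assume "e \<in> B"
  then obtain m e' where m: "m < n" "e' \<in> admissible_stage \<Theta> G P m" "e = map_pair (tower_map P m (n - m)) e'"
   unfolding B_def by blast
  thus "e \<in> arr_pairs (\<Theta> n)" using map_pair_arr[OF tower_functor'] stage_arr by (meson less_imp_le subsetD)
 qed
 have "map_pair ?I ` map_pair (tower_map P m (n - m)) ` admissible_stage \<Theta> G P m = admissible_pairs (S m) gl J" if "m < n" for m
 proof -
  have "map_pair ?I (map_pair K e) = map_pair (comp_functor ?I K) e" for K :: "(scheme, scheme_arr, scheme, scheme_arr) func" and e by (cases e) simp
  hence "map_pair ?I ` map_pair K ` A = map_pair (comp_functor ?I K) ` A" for K :: "(scheme, scheme_arr, scheme, scheme_arr) func" and A by (simp add: image_image)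
  thus ?thesis using p that by (simp add: stage_iso_def)
 qed
 hence "map_pair ?I ` B = (\<Union>m<n. admissible_pairs (S m) gl J)" unfolding B_def image_UN by simp
 moreover have "new_admissible_pairs \<Theta> G P n = admissible_stage \<Theta> G P n - B"
  by (simp add: new_admissible_pairs_def B_def map_pair_def)
 moreover have "admissible_stage \<Theta> G P n - B \<subseteq> arr_pairs (\<Theta> n)" using stage_arr[of n] by blast
 ultimately show ?thesis
  using inj_on_image_set_diff[OF inj _ B] stage_iso_admissible[OF p] by (simp add: new_pairs_def)
qed

lemma stage_iso_Suc:
 assumes p: "stage_iso n p"
 shows "\<exists>q. stage_iso (Suc n) q \<and> functor_eq (\<Theta> n) (comp_functor (fst q) (P n)) (fst p)"
proof -
 have i: "iso_pair (\<Theta> n) (S n) (fst p) (snd p)" "globular_functor (\<Theta> n) (G n) (S n) gl (fst p)"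
  "globular_functor (S n) gl (\<Theta> n) (G n) (snd p)" using p by (simp_all add: stage_iso_def)
 have "new_admissible_pairs \<Theta> G P n \<subseteq> arr_pairs (\<Theta> n)" using stage_arr[of n] by (auto simp: new_admissible_pairs_def)
 from universal_extension_iso[OF U S_universal i stage_iso_new[OF p] this]
 obtain K K' where K: "iso_pair (\<Theta> (Suc n)) (S (Suc n)) K K'" "globular_functor (\<Theta> (Suc n)) (G (Suc n)) (S (Suc n)) gl K"
  "globular_functor (S (Suc n)) gl (\<Theta> (Suc n)) (G (Suc n)) K'"
  "functor_eq (\<Theta> n) (comp_functor K (P n)) (comp_functor id_functor (fst p))" by blast
 have KP: "functor_eq (\<Theta> n) (comp_functor K (P n)) (fst p)" using K(4) by (simp add: functor_eq_def)
 have tw: "functor_eq (\<Theta> m) (comp_functor K (tower_map P m (Suc n - m))) (comp_functor (fst p) (tower_map P m (n - m)))" if "m \<le> n" for m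
  using functor_obj[OF tower_functor'[OF that]] functor_arr[OF tower_functor'[OF that]] KP that
  by (simp add: functor_eq_def Suc_diff_le)
 have "functor_eq Theta0 (comp_functor K (tower_map P 0 (Suc n))) J"
 proof -
  have "functor_eq Theta0 (comp_functor (fst p) (tower_map P 0 n)) J" using p by (simp add: stage_iso_def)
  thus ?thesis using tw[of 0] T0 by (simp add: functor_eq_def)
 qed
 moreover have "map_pair (comp_functor K (tower_map P m (Suc n - m))) ` admissible_stage \<Theta> G P m = admissible_pairs (S m) gl J"
  if m: "m < Suc n" for m
 proof -
  have "map_pair (comp_functor K (tower_map P m (Suc n - m))) e = map_pair (comp_functor (fst p) (tower_map P m (n - m))) e"
   if "e \<in> admissible_stage \<Theta> G P m" for e
  proof -
   obtain i f g where e: "e = (i, f, g)" by (cases e)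
   hence "f \<in> Arr (\<Theta> m)" "g \<in> Arr (\<Theta> m)" using stage_arr[of m] that by (auto simp: arr_pairs_def)
   thus ?thesis using functor_eqD(2)[OF tw[of m]] m e by (simp del: comp_functor_simps)
  qed
  hence "map_pair (comp_functor K (tower_map P m (Suc n - m))) ` admissible_stage \<Theta> G P m =
   map_pair (comp_functor (fst p) (tower_map P m (n - m))) ` admissible_stage \<Theta> G P m" by (rule image_cong[OF refl])
  also have "\<dots> = admissible_pairs (S m) gl J"
  proof (cases "m = n")
   case True
   have "comp_functor (fst p) id_functor = fst p" by (simp add: comp_functor_def id_functor_def)
   thus ?thesis using True stage_iso_admissible[OF p] by simp
  next
   case False thus ?thesis using p m by (simp add: stage_iso_def)
  qed
  finally show ?thesis .
 qed
 ultimately have "stage_iso (Suc n) (K, K')" unfolding stage_iso_def fst_conv snd_conv using K(1-3) by blast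
 thus ?thesis using KP by (metis fst_conv)
qed

text \<open>Each isomorphism must extend the previous one along the tower, hence a dependent
  choice.\<close>

lemma stage_isos:
 "\<exists>I I'. (\<forall>n. iso_pair (\<Theta> n) (S n) (I n) (I' n)) \<and> (\<forall>n. functor_eq (\<Theta> n) (comp_functor (I (Suc n)) (P n)) (I n))"
proof -
 obtain p where p: "\<And>n. stage_iso n (p n)" "\<And>n. functor_eq (\<Theta> n) (comp_functor (fst (p (Suc n))) (P n)) (fst (p n))"
  using dependent_nat_choice[of stage_iso "\<lambda>n p q. functor_eq (\<Theta> n) (comp_functor (fst q) (P n)) (fst p)"] stage_iso_0 stage_iso_Suc by blast
 have "iso_pair (\<Theta> n) (S n) (fst (p n)) (snd (p n))" for n using p(1)[of n] by (simp add: stage_iso_def)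
 thus ?thesis using p(2) by (intro exI[of _ "\<lambda>n. fst (p n)"] exI[of _ "\<lambda>n. snd (p n)"]) simp
qed

text \<open>The isomorphisms of the stages form a cocone over \<open>SS\<close>, which induces
  \<open>K\<close>. Every substitution has a finite level, so the inverse can be assembled from the
  inverses at the stages. One composite is the identity level by level, the other one by the
  uniqueness in the colimit.\<close>

lemma colimit_iso:
 assumes c: "is_sequential_colimit \<Theta> P \<Theta>inf \<Phi>"
 shows "\<exists>K K'. iso_pair \<Theta>inf SS K K'"
proof -
 obtain I I' where I: "\<And>n. iso_pair (\<Theta> n) (S n) (I n) (I' n)" "\<And>n. functor_eq (\<Theta> n) (comp_functor (I (Suc n)) (P n)) (I n)"
  using stage_isos by blast
 note ip = iso_pairD[OF I(1)]
 have co: "is_sequential_cocone \<Theta> P \<Theta>inf \<Phi>" using c by (simp add: is_sequential_colimit_def)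
 have Ph: "is_functor (\<Theta> n) \<Theta>inf (\<Phi> n)" "functor_eq (\<Theta> n) (comp_functor (\<Phi> (Suc n)) (P n)) (\<Phi> n)" for n
  using co by (auto simp: is_sequential_cocone_def)
 have cI: "category \<Theta>inf" using functor_cats[OF Ph(1)] by blast
 have "is_functor (\<Theta> n) SS (I n)" for n by (rule Scat_inclusion[OF category_S category_SS _ ip(1)]) simp
 hence "is_sequential_cocone \<Theta> P SS I" using I(2) by (simp add: is_sequential_cocone_def)
 then obtain K where K: "is_functor \<Theta>inf SS K" "\<And>n. functor_eq (\<Theta> n) (comp_functor K (\<Phi> n)) (I n)"
  using c unfolding is_sequential_colimit_def by blast
 define Q where "Q n = comp_functor (\<Phi> n) (I' n)" for n
 have Qf: "is_functor (S n) \<Theta>inf (Q n)" for n unfolding Q_def by (rule is_functor_comp[OF ip(2) Ph(1)])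
 have Qo: "fst (Q (Suc n)) X = fst (Q n) X" if X: "X \<in> Obj SS" for n X
 proof -
  have X': "fst (I' n) X \<in> Obj (\<Theta> n)" using functor_obj[OF ip(2)] X by simp
  have "fst (I (Suc n)) (fst (P n) (fst (I' n) X)) = X" using functor_eqD(1)[OF I(2) X'] ip(5)[of X n] X by simp
  hence "fst (I' (Suc n)) X = fst (P n) (fst (I' n) X)" using ip(3)[OF functor_obj[OF P_functor X']] by simp
  thus ?thesis using functor_eqD(1)[OF Ph(2) X'] by (simp add: Q_def)
 qed
 have Qa: "snd (Q (Suc n)) f = snd (Q n) f" if f: "f \<in> Arr (S n)" for n f
 proof -
  have f': "snd (I' n) f \<in> Arr (\<Theta> n)" using functor_arr[OF ip(2) f] .
  have "snd (I (Suc n)) (snd (P n) (snd (I' n) f)) = f" using functor_eqD(2)[OF I(2) f'] ip(6)[OF f] by simp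
  hence "snd (I' (Suc n)) f = snd (P n) (snd (I' n) f)" using ip(4)[OF functor_arr[OF P_functor f']] by simp
  thus ?thesis using functor_eqD(2)[OF Ph(2) f'] by (simp add: Q_def)
 qed
 have Qo0: "fst (Q n) X = fst (Q 0) X" if "X \<in> Obj SS" for n X using Qo[OF that] by (induction n) simp_all
 have Qam: "snd (Q n) f = snd (Q m) f" if f: "f \<in> Arr (S m)" "m \<le> n" for m n f
  using f(2)
 proof (induction rule: dec_induct)
  case (step k) thus ?case using Qa[OF S_arr_mono[OF f(1) step(1)]] by simp
 qed simp
 \<comment> \<open>The least level is just a choice: by \<open>Qam\<close> every level at which
   \<open>f\<close> exists gives the same value.\<close>
 define K' where "K' = (fst (Q 0), \<lambda>f. snd (Q (LEAST n. f \<in> Arr (S n))) f)"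
 have Ka: "snd K' f = snd (Q n) f" if "f \<in> Arr (S n)" for n f
 proof -
  have "f \<in> Arr (S (LEAST n. f \<in> Arr (S n)))" using that by (rule LeastI)
  moreover have "(LEAST n. f \<in> Arr (S n)) \<le> n" using that by (rule Least_le)
  ultimately have "snd (Q n) f = snd (Q (LEAST n. f \<in> Arr (S n))) f" by (rule Qam)
  thus ?thesis unfolding K'_def snd_conv by (rule sym)
 qed
 have Ko: "fst K' X = fst (Q n) X" if "X \<in> Obj SS" for n X unfolding K'_def fst_conv by (rule Qo0[OF that, symmetric])
 have K'f: "is_functor SS \<Theta>inf K'" unfolding is_functor_def
 proof (intro conjI ballI impI category_SS cI)
  fix X assume X: "X \<in> Obj SS"
  show "fst K' X \<in> Obj \<Theta>inf" using functor_obj[OF Qf] Ko[OF X, of 0] X by simp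
  have "Id SS X = Id (S 0) X" using X by (auto simp: Scat_Id)
  moreover have "Id (S 0) X \<in> Arr (S 0)" using cat_id[OF category_S, of X 0] X by (simp add: hom_def)
  ultimately show "snd K' (Id SS X) = Id \<Theta>inf (fst K' X)" using Ka[of "Id (S 0) X" 0] Ko[OF X, of 0] functor_id[OF Qf, of X 0] X by simp
 next
  fix f assume f: "f \<in> Arr SS"
  then obtain a where a: "f \<in> Arr (S a)" using SS_arr by blast
  have dom: "Dom (S n) = Dom SS" "Cod (S n) = Cod SS" for n by (auto simp: Scat_def)
  have ob: "Dom SS h \<in> Obj SS" "Cod SS h \<in> Obj SS" if "h \<in> Arr SS" for h using category_SS that by (simp_all add: category_def del: Scat_simps)
  show "snd K' f \<in> hom \<Theta>inf (fst K' (Dom SS f)) (fst K' (Cod SS f))"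
   using functor_hom[OF Qf, of f a "Dom SS f" "Cod SS f"] Ka[OF a] Ko[OF ob(1)[OF f]] Ko[OF ob(2)[OF f]] a dom by (simp add: hom_def)
  fix g assume g: "g \<in> Arr SS" "Dom SS g = Cod SS f"
  then obtain b where b: "g \<in> Arr (S b)" using SS_arr by blast
  let ?n = "max a b"
  have fg: "f \<in> hom (S ?n) (Dom SS f) (Cod SS f)" "g \<in> hom (S ?n) (Cod SS f) (Cod SS g)"
   using S_arr_mono[OF a, of ?n] S_arr_mono[OF b, of ?n] g(2) dom by (auto simp: hom_def)
  have "Comp SS g f \<in> Arr (S ?n)" using cat_comp[OF category_S fg] by (simp add: hom_def)
  thus "snd K' (Comp SS g f) = Comp \<Theta>inf (snd K' g) (snd K' f)"
   using Ka[of _ ?n] functor_comp[OF Qf fg] fg by (simp add: hom_def)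
 qed
 have "functor_eq SS (comp_functor K K') id_functor" unfolding functor_eq_def comp_functor_simps id_functor_simps
 proof (intro conjI ballI)
  fix X assume X: "X \<in> Obj SS"
  have "fst (I' 0) X \<in> Obj (\<Theta> 0)" using functor_obj[OF ip(2), of X 0] X by simp
  thus "fst K (fst K' X) = X" using functor_eqD(1)[OF K(2)[of 0]] Ko[OF X, of 0] ip(5)[of X 0] X by (simp add: Q_def)
 next
  fix f assume "f \<in> Arr SS"
  then obtain a where a: "f \<in> Arr (S a)" using SS_arr by blast
  have "snd (I' a) f \<in> Arr (\<Theta> a)" using functor_arr[OF ip(2) a] .
  thus "snd K (snd K' f) = f" using functor_eqD(2)[OF K(2)[of a]] Ka[OF a] ip(6)[OF a] by (simp add: Q_def)
 qed
 moreover have "functor_eq \<Theta>inf (comp_functor K' K) id_functor"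
 proof -
  have "functor_eq (\<Theta> n) (comp_functor (comp_functor K' K) (\<Phi> n)) (\<Phi> n)" for n
   unfolding functor_eq_def comp_functor_simps
  proof (intro conjI ballI)
   fix X assume X: "X \<in> Obj (\<Theta> n)"
   have "fst (I n) X \<in> Obj SS" using functor_obj[OF ip(1) X] by simp
   thus "fst K' (fst K (fst (\<Phi> n) X)) = fst (\<Phi> n) X" using functor_eqD(1)[OF K(2) X] Ko[of _ n] ip(3)[OF X] by (simp add: Q_def)
  next
   fix f assume f: "f \<in> Arr (\<Theta> n)"
   show "snd K' (snd K (snd (\<Phi> n) f)) = snd (\<Phi> n) f"
    using functor_eqD(2)[OF K(2) f] Ka[OF functor_arr[OF ip(1) f]] ip(4)[OF f] by (simp add: Q_def)
  qed
  moreover have "functor_eq (\<Theta> n) (comp_functor id_functor (\<Phi> n)) (\<Phi> n)" for n by (simp add: functor_eq_def)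
  moreover obtain K0 where K0: "\<And>K'. is_functor \<Theta>inf \<Theta>inf K' \<Longrightarrow> (\<forall>n. functor_eq (\<Theta> n) (comp_functor K' (\<Phi> n)) (\<Phi> n)) \<Longrightarrow> functor_eq \<Theta>inf K' K0"
   using c co unfolding is_sequential_colimit_def by blast
  ultimately have "functor_eq \<Theta>inf (comp_functor K' K) K0" "functor_eq \<Theta>inf id_functor K0"
   using is_functor_comp[OF K(1) K'f] is_functor_id[OF cI] by blast+
  thus ?thesis by (simp add: functor_eq_def)
 qed
 ultimately show ?thesis using K(1) K'f unfolding iso_pair_def by blast
qed

end

section \<open>The syntactic category and its ps-contexts\<close>

lemma category_Syn: "category Syn"
 unfolding category_def
proof (intro conjI ballI impI)
 fix f assume "f \<in> Arr Syn"
 then obtain \<Delta> \<gamma> \<Gamma> where f: "f = (\<Delta>, \<gamma>, \<Gamma>)" "wf_ctx \<Delta>" "canonical \<Delta>" "wf_ctx \<Gamma>" "canonical \<Gamma>" "wf_sub \<Delta> \<gamma> \<Gamma>"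
  by (auto simp: Syn_def)
 show "Dom Syn f \<in> Obj Syn" "Cod Syn f \<in> Obj Syn" using f by (auto simp: Syn_def)
 show "Comp Syn f (Id Syn (Dom Syn f)) = f" using f by (simp add: Syn_def)
 show "Comp Syn (Id Syn (Cod Syn f)) f = f"
  using f id_comp_sub[OF wf_sub_distinct[OF f(6)] wf_sub_dom[OF f(6)]] by (simp add: Syn_def)
 fix g assume "g \<in> Arr Syn" "Dom Syn g = Cod Syn f"
 then obtain \<delta> \<Xi> where g: "g = (\<Gamma>, \<delta>, \<Xi>)" "wf_ctx \<Xi>" "canonical \<Xi>" "wf_sub \<Gamma> \<delta> \<Xi>" using f by (auto simp: Syn_def)
 show "Comp Syn g f \<in> hom Syn (Dom Syn f) (Cod Syn g)" using f g substitution(4)[OF g(4) f(6)] by (simp add: Syn_def hom_def)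
 fix h assume "h \<in> Arr Syn" "Dom Syn h = Cod Syn g"
 then obtain \<theta> \<Omega> where h: "h = (\<Xi>, \<theta>, \<Omega>)" "wf_sub \<Xi> \<theta> \<Omega>" using g by (auto simp: Syn_def)
 have "comp_sub (comp_sub \<theta> \<delta>) \<gamma> = comp_sub \<theta> (comp_sub \<delta> \<gamma>)"
  using wf_vars(4)[OF h(2)] wf_sub_dom_set[OF g(4)] by (intro comp_sub_assoc) auto
 thus "Comp Syn h (Comp Syn g f) = Comp Syn (Comp Syn h g) f" using f g h by (simp add: Syn_def)
next
 fix X assume "X \<in> Obj Syn"
 thus "Id Syn X \<in> hom Syn X X" using wf_id_sub by (simp add: Syn_def hom_def)
qed

lemma category_full_subcategory: "category C \<Longrightarrow> category (full_subcategory C A)"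
 by (auto simp: category_def full_subcategory_def hom_def)

text \<open>Undoes the encoding in the types of \<open>Theta0\<close>. Source and target are
  exchanged because an arrow from \<open>T\<close> to \<open>U\<close> is a substitution over the
  context of \<open>U\<close>.\<close>

definition syn_func :: "(scheme, scheme_arr, ctx, ctx \<times> sub \<times> ctx) func" where
 "syn_func = (\<lambda>X. ctxT (tab X), \<lambda>(X, e, Y). (ctxT (tab Y), dec e, ctxT (tab X)))"

lemma syn_func_simps [simp]: "is_table T \<Longrightarrow> fst syn_func (gsum T) = ctxT T" "wfs T \<gamma> U \<Longrightarrow> snd syn_func (ar T \<gamma> U) = (ctxT U, \<gamma>, ctxT T)"
 by (auto simp: syn_func_def ar_def wfs_def)

lemma Syn_ps_Obj: "X \<in> Obj Syn_ps \<longleftrightarrow> (\<exists>T. is_table T \<and> X = ctxT T)"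
proof
 assume "X \<in> Obj Syn_ps"
 hence "ps_ctx X" "canonical X" by (auto simp: Syn_ps_def Syn_def full_subcategory_def)
 thus "\<exists>T. is_table T \<and> X = ctxT T" by (rule ctxT_surj)
next
 assume "\<exists>T. is_table T \<and> X = ctxT T"
 then obtain T where T: "is_table T" "X = ctxT T" by blast
 thus "X \<in> Obj Syn_ps" using ctxT_wf[OF T(1)] ctxT_ps[OF T(1)] ctxT_canonical[OF T(1)]
  by (simp add: Syn_ps_def Syn_def full_subcategory_def)
qed

lemma Syn_ps_Arr: "f \<in> Arr Syn_ps \<longleftrightarrow> (\<exists>T \<gamma> U. wfs T \<gamma> U \<and> f = (ctxT U, \<gamma>, ctxT T))"
proof
 assume "f \<in> Arr Syn_ps"
 then obtain \<Delta> \<gamma> \<Gamma> where f: "f = (\<Delta>, \<gamma>, \<Gamma>)" "canonical \<Delta>" "canonical \<Gamma>" "ps_ctx \<Delta>" "ps_ctx \<Gamma>" "wf_sub \<Delta> \<gamma> \<Gamma>"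
  by (auto simp: Syn_ps_def Syn_def full_subcategory_def)
 then obtain T U where "is_table T" "\<Gamma> = ctxT T" "is_table U" "\<Delta> = ctxT U" using ctxT_surj by blast
 hence "wfs T \<gamma> U" "f = (ctxT U, \<gamma>, ctxT T)" using f by (auto simp: wfs_def)
 thus "\<exists>T \<gamma> U. wfs T \<gamma> U \<and> f = (ctxT U, \<gamma>, ctxT T)" by blast
next
 assume "\<exists>T \<gamma> U. wfs T \<gamma> U \<and> f = (ctxT U, \<gamma>, ctxT T)"
 then obtain T \<gamma> U where f: "wfs T \<gamma> U" "f = (ctxT U, \<gamma>, ctxT T)" by blast
 hence T: "is_table T" "is_table U" "wf_sub (ctxT U) \<gamma> (ctxT T)" by (auto simp: wfs_def)
 thus "f \<in> Arr Syn_ps"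
  using ctxT_wf[OF T(1)] ctxT_ps[OF T(1)] ctxT_canonical[OF T(1)] ctxT_wf[OF T(2)] ctxT_ps[OF T(2)] ctxT_canonical[OF T(2)] f(2)
  by (simp add: Syn_ps_def Syn_def full_subcategory_def)
qed

lemma opposite_simps [simp]: "Obj (opposite C) = Obj C" "Arr (opposite C) = Arr C" "Dom (opposite C) = Cod C"
 "Cod (opposite C) = Dom C" "Id (opposite C) = Id C" "Comp (opposite C) g f = Comp C f g"
 by (auto simp: opposite_def)

lemma SS_Arr: "f \<in> Arr SS \<longleftrightarrow> (\<exists>T \<gamma> U. f = ar T \<gamma> U \<and> wfs T \<gamma> U)"
 by (simp add: Scat_Arr)

lemma Syn_ps_simps: "Dom Syn_ps (\<Delta>, \<gamma>, \<Gamma>) = \<Delta>" "Cod Syn_ps (\<Delta>, \<gamma>, \<Gamma>) = \<Gamma>" "Id Syn_ps \<Gamma> = (\<Gamma>, id_sub \<Gamma>, \<Gamma>)"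
 "Comp Syn_ps (\<Delta>, \<gamma>, \<Gamma>) (\<Xi>, \<delta>, \<Delta>') = (\<Xi>, comp_sub \<gamma> \<delta>, \<Gamma>)"
 by (auto simp: Syn_ps_def Syn_def full_subcategory_def)

lemma syn_functor: "is_functor (opposite SS) Syn_ps syn_func"
 unfolding is_functor_def opposite_simps
proof (intro conjI ballI impI)
 show "category (opposite SS)" by (rule category_opposite[OF category_SS])
 show "category Syn_ps" unfolding Syn_ps_def by (rule category_full_subcategory[OF category_Syn])
 fix X assume "X \<in> Obj SS"
 then obtain T where T: "is_table T" "X = gsum T" by auto
 show "fst syn_func X \<in> Obj Syn_ps" unfolding Syn_ps_Obj using T by auto
 show "snd syn_func (Id SS X) = Id Syn_ps (fst syn_func X)" using T wfs_id[OF T(1)] by (simp add: Scat_Id Syn_ps_simps)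
next
 fix f assume "f \<in> Arr SS"
 then obtain T \<gamma> U where f: "f = ar T \<gamma> U" "wfs T \<gamma> U" unfolding SS_Arr by blast
 have T: "is_table T" "is_table U" using f by (auto simp: wfs_def)
 have "(ctxT U, \<gamma>, ctxT T) \<in> Arr Syn_ps" unfolding Syn_ps_Arr using f by blast
 thus "snd syn_func f \<in> hom Syn_ps (fst syn_func (Cod SS f)) (fst syn_func (Dom SS f))"
  using f T by (simp add: hom_def Syn_ps_simps)
 fix g assume g: "g \<in> Arr SS" "Cod SS g = Dom SS f"
 then obtain V \<delta> V' where g': "g = ar V \<delta> V'" "wfs V \<delta> V'" unfolding SS_Arr by blast
 have "V' = T" using g f g' gsum_inj by (simp add: wfs_def)
 note g' = g'[unfolded this]
 show "snd syn_func (Comp SS f g) = Comp Syn_ps (snd syn_func g) (snd syn_func f)"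
  using f g' wfs_comp[OF g'(2) f(2)] by (simp add: Syn_ps_simps)
qed

lemma syn_iso: "\<exists>K. iso_pair (opposite SS) Syn_ps syn_func K"
proof -
 have "bij_betw (fst syn_func) (Obj SS) (Obj Syn_ps)" unfolding bij_betw_def
 proof
  show "inj_on (fst syn_func) (Obj SS)" by (auto simp: inj_on_def dest: ctxT_inj)
  show "fst syn_func ` Obj SS = Obj Syn_ps"
  proof (intro set_eqI)
   fix X show "X \<in> fst syn_func ` Obj SS \<longleftrightarrow> X \<in> Obj Syn_ps"
    unfolding Syn_ps_Obj Scat_simps image_image by (auto simp: image_iff)
  qed
 qed
 moreover have "bij_betw (snd syn_func) (Arr SS) (Arr Syn_ps)" unfolding bij_betw_def
 proof
  show "inj_on (snd syn_func) (Arr SS)"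
  proof (rule inj_onI)
   fix f g assume "f \<in> Arr SS" "g \<in> Arr SS" and e: "snd syn_func f = snd syn_func g"
   then obtain T \<gamma> U T' \<gamma>' U' where h: "f = ar T \<gamma> U" "wfs T \<gamma> U" "g = ar T' \<gamma>' U'" "wfs T' \<gamma>' U'" unfolding SS_Arr by blast
   hence "ctxT T = ctxT T'" "ctxT U = ctxT U'" "\<gamma> = \<gamma>'" using e by auto
   moreover from this have "T = T'" "U = U'" using ctxT_inj h(2,4) unfolding wfs_def by blast+
   ultimately show "f = g" using h by simp
  qed
  show "snd syn_func ` Arr SS = Arr Syn_ps"
  proof (intro set_eqI iffI)
   fix f assume "f \<in> snd syn_func ` Arr SS"
   then obtain x where x: "x \<in> Arr SS" "f = snd syn_func x" by blast
   then obtain T \<gamma> U where "f = snd syn_func (ar T \<gamma> U)" "wfs T \<gamma> U" unfolding SS_Arr by blast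
   thus "f \<in> Arr Syn_ps" unfolding Syn_ps_Arr by (metis syn_func_simps(2))
  next
   fix f assume "f \<in> Arr Syn_ps"
   then obtain T \<gamma> U where f: "wfs T \<gamma> U" "f = (ctxT U, \<gamma>, ctxT T)" unfolding Syn_ps_Arr by blast
   hence "f = snd syn_func (ar T \<gamma> U)" "ar T \<gamma> U \<in> Arr SS" unfolding SS_Arr by auto
   thus "f \<in> snd syn_func ` Arr SS" by blast
  qed
 qed
 ultimately show ?thesis using iso_pairI[OF syn_functor] by auto
qed

theorem theorem5p13:
 fixes \<Theta>inf :: "(scheme, scheme_arr) cat"
 assumes "batanin_leinster_coherator \<Theta>inf"
 shows "equivalent_categories Syn_ps (opposite \<Theta>inf)"
proof -
 from assms obtain \<Theta> G P L \<Phi> where h: "\<Theta> 0 = Theta0" "G 0 = globes0"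
  "\<And>n. universal_extension (\<Theta> n) (G n) (new_admissible_pairs \<Theta> G P n) (\<Theta> (Suc n)) (G (Suc n)) (P n) (L n)"
  "is_sequential_colimit \<Theta> P \<Theta>inf \<Phi>"
  unfolding batanin_leinster_coherator_def by (elim exE conjE) blast
 interpret coherator_tower \<Theta> G P L by unfold_locales (rule h)+
 obtain K K' where "iso_pair \<Theta>inf SS K K'" using colimit_iso[OF h(4)] by blast
 hence "iso_pair (opposite \<Theta>inf) (opposite SS) K K'" by (rule iso_pair_opposite)
 moreover obtain W where "iso_pair (opposite SS) Syn_ps syn_func W" using syn_iso by blast
 ultimately have "iso_pair Syn_ps (opposite \<Theta>inf) (comp_functor K' W) (comp_functor syn_func K)"
  using iso_pair_sym iso_pair_comp by blast
 thus ?thesis by (rule iso_pair_equivalent)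
qed

end
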